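(* Let $I\subset\mathbb{R}$ be an interval closed and bounded on the left, with left end point $t_0$, and let $\mathbf{f}\in L^\infty(I;H)$. If $\rho$ is a Vishik-Fursikov measure over $I$, then the family of projections $\{\rho_t\}_{t\in I}$, $\rho_t=\Pi_t\rho$, is a statistical solution of the Navier-Stokes equations over $I$ with initial data $\rho_{t_0}$.
   Context: Spaces. Fix $\nu>0$ and one of two cases. Periodic case: $\Omega=\prod_{i=1}^3(0,L_i)$, $L_i>0$, and $\mathcal{V}$ is the set of restrictions to $\Omega$ of fields $\mathbf{w}\in C^\infty(\mathbb{R}^3)^3$ that are divergence-free, periodic with period $L_i$ in each direction $x_i$, and satisfy $\int_\Omega\mathbf{w}\,d\mathbf{x}=0$. No-slip case: $\Omega\subset\mathbb{R}^3$ is a bounded domain with smooth boundary (at least of class $C^2$) and $\mathcal{V}$ is the set of divergence-free fields in $C_c^\infty(\Omega)^3$. $H$ (resp. $V$) is the completion of $\mathcal{V}$ in the $L^2(\Omega)^3$ (resp. $H^1(\Omega)^3$) norm. Write $(\mathbf{u},\mathbf{v})_{L^2}=\int_\Omega\mathbf{u}\cdot\mathbf{v}\,d\mathbf{x}$, $|\mathbf{u}|_{L^2}$ for its norm, $((\mathbf{u},\mathbf{v}))_{H^1}=\int_\Omega\sum_{i=1}^3\partial_{x_i}\mathbf{u}\cdot\partial_{x_i}\mathbf{v}\,d\mathbf{x}$ and $\|\mathbf{u}\|_{H^1}$ for its norm. $H$ is identified with its dual, so $V\subset H\subset V'$, with duality product $\langle\cdot,\cdot\rangle_{V',V}$. Define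 $A:V\to V'$ by $\langle A\mathbf{u},\mathbf{v}\rangle_{V',V}=((\mathbf{u},\mathbf{v}))_{H^1}$, $b(\mathbf{u},\mathbf{v},\mathbf{w})=\int_\Omega(\mathbf{u}\cdot\nabla)\mathbf{v}\cdot\mathbf{w}\,d\mathbf{x}$, and $B:V\times V\to V'$ by $\langle B(\mathbf{u},\mathbf{v}),\mathbf{w}\rangle_{V',V}=b(\mathbf{u},\mathbf{v},\mathbf{w})$. For an interval $I\subset\mathbb{R}$, the subscript "loc" on spaces over $I$ refers to compact subintervals of $I$. $H_{\mathrm{w}}$ is $H$ with its weak topology. $\mathcal{C}_{\mathrm{loc}}(I,H_{\mathrm{w}})$ is the space of weakly continuous functions $I\to H$ with the topology of uniform weak convergence on compact subintervals of $I$. $\Pi_t\mathbf{u}=\mathbf{u}(t)$ for $t\in I$, and $\Pi_t\rho$ denotes the push-forward measure $\Pi_t\rho(E)=\rho(\Pi_t^{-1}E)$ on $H$ (Borel sets of $H$ and $H_{\mathrm{w}}$ coincide). Weak solution (always meaning Leray-Hopf weak solution) on an interval $I$, for a given $\mathbf{f}\in L^\infty(I;H)$: a function $\mathbf{u}:I\to H$ such that (i) $\mathbf{u}\in L^\infty_{\mathrm{loc}}(I;H)\cap L^2_{\mathrm{loc}}(I;V)$; (ii) $\partial_t\mathbf{u}\in L^{4/3}_{\mathrm{loc}}(I;V')$; (iii) $\mathbf{u}\in\mathcal{C}_{\mathrm{loc}}(I,H_{\mathrm{w}})$; (iv) $\frac{d\mathbf{u}}{dt}+\nu A\mathbf{u}+B(\mathbf{u},\mathbf{u})=\mathbf{f}$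 in the distribution sense on $I$ with values in $V'$; (v) for almost all $t'\in I$ and all $t\in I$ with $t>t'$, $\frac12|\mathbf{u}(t)|_{L^2}^2+\nu\int_{t'}^t\|\mathbf{u}(s)\|_{H^1}^2ds\le\frac12|\mathbf{u}(t')|_{L^2}^2+\int_{t'}^t(\mathbf{f}(s),\mathbf{u}(s))_{L^2}ds$; (vi) if $I$ is closed and bounded on the left with left end point $t_0$, then $\mathbf{u}(t)\to\mathbf{u}(t_0)$ strongly in $H$ as $t\to t_0^+$. $\mathcal{U}_I^\sharp$ is the set of $\mathbf{u}\in\mathcal{C}_{\mathrm{loc}}(I,H_{\mathrm{w}})$ which are weak solutions on the interior $I^\circ$ of $I$. A measure is carried by a measurable set if the complement of that set has measure zero. Vishik-Fursikov measure over $I$: a Borel probability measure $\rho$ on $\mathcal{C}_{\mathrm{loc}}(I,H_{\mathrm{w}})$ such that (i) $\rho$ is carried by $\mathcal{U}_I^\sharp$; (ii) $t\mapsto\int_{\mathcal{U}_I^\sharp}|\mathbf{u}(t)|_{L^2}^2\,d\rho(\mathbf{u})$ belongs to $L^\infty_{\mathrm{loc}}(I)$; (iii) if $I$ is closed and bounded on the left with left end point $t_0$, then for every nonnegative, nondecreasing, continuously differentiable $\psi:[0,\infty)\to\mathbb{R}$ with bounded derivative, $\lim_{t\to t_0^+}\int_{\mathcal{U}_I^\sharp}\psi(|\mathbf{u}(t)|_{L^2}^2)\,d\rho(\mathbf{u})=\int_{\mathcal{U}_I^\sharp}\psi(|\mathbf{u}(t_0)|_{L^2}^2)\,d\rho(\mathbf{u})<\infty$.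 Cylindrical test function: $\Phi:H\to\mathbb{R}$ of the form $\Phi(\mathbf{u})=\phi((\mathbf{u},\mathbf{v}_1)_{L^2},\dots,(\mathbf{u},\mathbf{v}_k)_{L^2})$ with $k\in\mathbb{N}$, $\phi\in C^1(\mathbb{R}^k)$ real-valued with compact support and $\mathbf{v}_1,\dots,\mathbf{v}_k\in V$; its Fréchet derivative is $\Phi'(\mathbf{u})=\sum_{j=1}^k\partial_j\phi((\mathbf{u},\mathbf{v}_1)_{L^2},\dots,(\mathbf{u},\mathbf{v}_k)_{L^2})\mathbf{v}_j$. Statistical solution over $I$: a family $\{\mu_t\}_{t\in I}$ of Borel probability measures on $H$ such that (i) $t\mapsto\int_H\Phi\,d\mu_t$ is measurable on $I$ for every bounded continuous $\Phi:H\to\mathbb{R}$; (ii) $t\mapsto\int_H|\mathbf{u}|_{L^2}^2d\mu_t(\mathbf{u})$ belongs to $L^\infty_{\mathrm{loc}}(I)$; (iii) $t\mapsto\int_H\|\mathbf{u}\|_{H^1}^2d\mu_t(\mathbf{u})$ belongs to $L^1_{\mathrm{loc}}(I)$ (with $\|\mathbf{u}\|_{H^1}=\infty$ for $\mathbf{u}\notin V$); (iv) for every cylindrical test function $\Phi$ and all $t',t\in I$, $\int_H\Phi\,d\mu_t=\int_H\Phi\,d\mu_{t'}+\int_{t'}^t\int_H\langle\mathbf{F}(s,\mathbf{u}),\Phi'(\mathbf{u})\rangle_{V',V}\,d\mu_s(\mathbf{u})\,ds$, where $\mathbf{F}(s,\mathbf{u})=\mathbf{f}(s)-\nu A\mathbf{u}-B(\mathbf{u},\mathbf{u})$;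 (v) there is $I'\subset I$ of full measure in $I$ such that for every nonnegative, nondecreasing, continuously differentiable $\psi:[0,\infty)\to\mathbb{R}$ with bounded derivative, all $t'\in I'$ and all $t\in I$ with $t\ge t'$, $\frac12\int_H\psi(|\mathbf{u}|_{L^2}^2)d\mu_t+\nu\int_{t'}^t\int_H\psi'(|\mathbf{u}|_{L^2}^2)\|\mathbf{u}\|_{H^1}^2d\mu_s\,ds\le\frac12\int_H\psi(|\mathbf{u}|_{L^2}^2)d\mu_{t'}+\int_{t'}^t\int_H\psi'(|\mathbf{u}|_{L^2}^2)(\mathbf{f}(s),\mathbf{u})_{L^2}d\mu_s\,ds$; (vi) if $I$ is closed and bounded on the left with left end point $t_0$, then $t\mapsto\int_H\psi(|\mathbf{u}|_{L^2}^2)d\mu_t(\mathbf{u})$ is continuous at $t_0$ from the right for every $\psi$ as in (v). *)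

theory Defs
  imports "HOL-Analysis.Analysis" "HOL-Probability.Probability_Measure"
begin

section \<open>The Hilbert space of square-integrable vector fields\<close>

definition sq_integrable :: "(real^3 \<Rightarrow> real^3) \<Rightarrow> bool" where
  "sq_integrable f \<longleftrightarrow> f \<in> borel_measurable lebesgue \<and> integrable lebesgue (\<lambda>x. (norm (f x))\<^sup>2)"

lemma sq_integrable_zero: "sq_integrable (\<lambda>x. 0)"
  by (simp add: sq_integrable_def)

lemma sq_integrable_scaleR: "sq_integrable f \<Longrightarrow> sq_integrable (\<lambda>x. c *\<^sub>R f x)"
  by (auto simp: sq_integrable_def power_mult_distrib)

lemma sq_integrable_add:
  assumes "sq_integrable f" "sq_integrable g"
  shows "sq_integrable (\<lambda>x. f x + g x)"
proof -
  have [measurable]: "f \<in> borel_measurable lebesgue" "g \<in> borel_measurable lebesgue"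
    using assms by (auto simp: sq_integrable_def)
  have "integrable lebesgue (\<lambda>x. 2 * (norm (f x))\<^sup>2 + 2 * (norm (g x))\<^sup>2)"
    using assms by (auto simp: sq_integrable_def)
  moreover have "(norm (f x + g x))\<^sup>2 \<le> 2 * (norm (f x))\<^sup>2 + 2 * (norm (g x))\<^sup>2" for x
  proof -
    have "(norm (f x + g x))\<^sup>2 \<le> (norm (f x) + norm (g x))\<^sup>2"
      by (intro power_mono norm_triangle_ineq) auto
    also have "\<dots> \<le> 2 * (norm (f x))\<^sup>2 + 2 * (norm (g x))\<^sup>2"
      using sum_squares_bound[of "norm (f x)" "norm (g x)"] by (simp add: power2_sum)
    finally show ?thesis .
  qed
  ultimately have "integrable lebesgue (\<lambda>x. (norm (f x + g x))\<^sup>2)"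
    by (intro Bochner_Integration.integrable_bound[where g = "\<lambda>x. (norm (f x + g x))\<^sup>2"
          and f = "\<lambda>x. 2 * (norm (f x))\<^sup>2 + 2 * (norm (g x))\<^sup>2",
          OF _ _ always_eventually]) simp_all
  then show ?thesis by (simp add: sq_integrable_def)
qed

lemma sq_integrable_inner:
  assumes "sq_integrable f" "sq_integrable g"
  shows "integrable lebesgue (\<lambda>x. f x \<bullet> g x)"
proof -
  have [measurable]: "f \<in> borel_measurable lebesgue" "g \<in> borel_measurable lebesgue"
    using assms by (auto simp: sq_integrable_def)
  have "integrable lebesgue (\<lambda>x. (norm (f x))\<^sup>2 + (norm (g x))\<^sup>2)"
    using assms by (auto simp: sq_integrable_def)
  moreover have "norm (f x \<bullet> g x) \<le> norm ((norm (f x))\<^sup>2 + (norm (g x))\<^sup>2)" for x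
  proof -
    have "\<bar>f x \<bullet> g x\<bar> \<le> norm (f x) * norm (g x)" by (rule Cauchy_Schwarz_ineq2)
    also have "\<dots> \<le> (norm (f x))\<^sup>2 + (norm (g x))\<^sup>2"
      using sum_squares_bound[of "norm (f x)" "norm (g x)"]
        mult_nonneg_nonneg[OF norm_ge_zero[of "f x"] norm_ge_zero[of "g x"]] by linarith
    finally show ?thesis by simp
  qed
  ultimately show ?thesis
    by (intro Bochner_Integration.integrable_bound[where g = "\<lambda>x. f x \<bullet> g x"
          and f = "\<lambda>x. (norm (f x))\<^sup>2 + (norm (g x))\<^sup>2",
          OF _ _ always_eventually]) simp_all
qed

text \<open>\<open>L\<^sup>2(\<real>\<^sup>3)\<^sup>3\<close>; fields on a set \<open>\<Omega>\<close> are represented by their extension by zero, which embeds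
  \<open>L\<^sup>2(\<Omega>)\<^sup>3\<close> isometrically.\<close>

quotient_type l2_field = "real^3 \<Rightarrow> real^3" / partial:
  "\<lambda>f g. sq_integrable f \<and> sq_integrable g \<and> (AE x in lebesgue. f x = g x)"
proof (rule part_equivpI)
  show "\<exists>f. sq_integrable f \<and> sq_integrable f \<and> (AE x in lebesgue. f x = f x)"
    using sq_integrable_zero by auto
  show "symp (\<lambda>f g. sq_integrable f \<and> sq_integrable g \<and> (AE x in lebesgue. f x = g x))"
    by (auto intro!: sympI simp: eq_commute)
  show "transp (\<lambda>f g. sq_integrable f \<and> sq_integrable g \<and> (AE x in lebesgue. f x = g x))"
    by (rule transpI) auto
qed

instantiation l2_field :: real_inner
begin

lift_definition zero_l2_field :: l2_field is "\<lambda>x. 0"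
  by (simp add: sq_integrable_zero)

lift_definition plus_l2_field :: "l2_field \<Rightarrow> l2_field \<Rightarrow> l2_field" is "\<lambda>f g x. f x + g x"
  by (auto intro: sq_integrable_add)

lift_definition scaleR_l2_field :: "real \<Rightarrow> l2_field \<Rightarrow> l2_field" is "\<lambda>c f x. c *\<^sub>R f x"
  by (auto intro: sq_integrable_scaleR)

definition uminus_l2_field :: "l2_field \<Rightarrow> l2_field" where
  "uminus_l2_field u = (-1) *\<^sub>R u"

definition minus_l2_field :: "l2_field \<Rightarrow> l2_field \<Rightarrow> l2_field" where
  "minus_l2_field u v = u + - v"

lift_definition inner_l2_field :: "l2_field \<Rightarrow> l2_field \<Rightarrow> real" is
  "\<lambda>f g. \<integral>x. f x \<bullet> g x \<partial>lebesgue"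
proof (elim conjE)
  fix f f' g g' :: "real^3 \<Rightarrow> real^3"
  assume ae: "AE x in lebesgue. f x = f' x" "AE x in lebesgue. g x = g' x"
    and sq: "sq_integrable f" "sq_integrable f'" "sq_integrable g" "sq_integrable g'"
  show "(\<integral>x. f x \<bullet> g x \<partial>lebesgue) = (\<integral>x. f' x \<bullet> g' x \<partial>lebesgue)"
  proof (rule integral_cong_AE)
    show "AE x in lebesgue. f x \<bullet> g x = f' x \<bullet> g' x" using ae by eventually_elim simp
  qed (use sq in \<open>auto intro: borel_measurable_integrable sq_integrable_inner\<close>)
qed

definition norm_l2_field :: "l2_field \<Rightarrow> real" where
  "norm_l2_field u = sqrt (u \<bullet> u)"

definition sgn_l2_field :: "l2_field \<Rightarrow> l2_field" where
  "sgn_l2_field u = inverse (norm u) *\<^sub>R u"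

definition dist_l2_field :: "l2_field \<Rightarrow> l2_field \<Rightarrow> real" where
  "dist_l2_field u v = norm (u - v)"

definition uniformity_l2_field :: "(l2_field \<times> l2_field) filter" where
  "uniformity_l2_field = (INF e\<in>{0 <..}. principal {(x, y). dist x y < e})"

definition open_l2_field :: "l2_field set \<Rightarrow> bool" where
  "open_l2_field U \<longleftrightarrow> (\<forall>x\<in>U. eventually (\<lambda>(x', y). x' = x \<longrightarrow> y \<in> U) uniformity)"

instance
proof
  fix u v w :: l2_field and a b :: real
  note sq = sq_integrable_zero sq_integrable_add sq_integrable_scaleR
  show "u + v + w = u + (v + w)"
    by transfer (simp add: sq add.assoc)
  show "u + v = v + u"
    by transfer (simp add: sq add.commute)
  show "0 + u = u"
    by transfer (simp add: sq)
  show "- u + u = 0"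
    unfolding uminus_l2_field_def by transfer (simp add: sq sq_integrable_scaleR[of _ "-1", simplified])
  show "u - v = u + - v" by (fact minus_l2_field_def)
  show "a *\<^sub>R (u + v) = a *\<^sub>R u + a *\<^sub>R v"
    by transfer (simp add: sq scaleR_add_right)
  show "(a + b) *\<^sub>R u = a *\<^sub>R u + b *\<^sub>R u"
    by transfer (simp add: sq scaleR_add_left)
  show "a *\<^sub>R b *\<^sub>R u = (a * b) *\<^sub>R u"
    by transfer (simp add: sq)
  show "1 *\<^sub>R u = u"
    by transfer (simp add: sq)
  show "dist u v = norm (u - v)" by (fact dist_l2_field_def)
  show "sgn u = inverse (norm u) *\<^sub>R u" by (fact sgn_l2_field_def)
  show "u \<bullet> v = v \<bullet> u" by transfer (simp add: inner_commute)
  show "(u + v) \<bullet> w = u \<bullet> w + v \<bullet> w"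
    by transfer (simp add: inner_add_left sq_integrable_inner)
  show "(a *\<^sub>R u) \<bullet> v = a * (u \<bullet> v)"
    by transfer simp
  show "0 \<le> u \<bullet> u" by transfer (auto intro: integral_nonneg_AE)
  show "norm u = sqrt (u \<bullet> u)" by (fact norm_l2_field_def)
  show "u \<bullet> u = 0 \<longleftrightarrow> u = 0"
  proof transfer
    fix f :: "real^3 \<Rightarrow> real^3"
    assume "sq_integrable f \<and> sq_integrable f \<and> (AE x in lebesgue. f x = f x)"
    then have f: "sq_integrable f" by simp
    have "(\<integral>x. f x \<bullet> f x \<partial>lebesgue) = 0 \<longleftrightarrow> (AE x in lebesgue. f x \<bullet> f x = 0)"
      by (rule integral_nonneg_eq_0_iff_AE) (use f in \<open>auto intro: sq_integrable_inner\<close>)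
    then show "(\<integral>x. f x \<bullet> f x \<partial>lebesgue) = 0 \<longleftrightarrow>
        sq_integrable f \<and> sq_integrable (\<lambda>x. 0) \<and> (AE x in lebesgue. f x = 0)"
      using f sq_integrable_zero by simp
  qed
qed (rule uniformity_l2_field_def open_l2_field_def)+

end

definition l2_class :: "(real^3) set \<Rightarrow> (real^3 \<Rightarrow> real^3) \<Rightarrow> l2_field" where
  "l2_class \<Omega> w = abs_l2_field (\<lambda>x. indicator \<Omega> x *\<^sub>R w x)"

definition l2_on :: "(real^3) set \<Rightarrow> l2_field set" where
  "l2_on \<Omega> = {u. AE x in lebesgue. x \<notin> \<Omega> \<longrightarrow> rep_l2_field u x = 0}"

section \<open>Domains and test fields\<close>

primrec C_k :: "nat \<Rightarrow> ('a::real_normed_vector \<Rightarrow> 'b::real_normed_vector) \<Rightarrow> bool" where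
  "C_k 0 f \<longleftrightarrow> continuous_on UNIV f"
| "C_k (Suc n) f \<longleftrightarrow> (\<exists>f'. (\<forall>x. (f has_derivative f' x) (at x)) \<and> (\<forall>v. C_k n (\<lambda>x. f' x v)))"

definition smooth :: "('a::real_normed_vector \<Rightarrow> 'b::real_normed_vector) \<Rightarrow> bool" where
  "smooth f \<longleftrightarrow> (\<forall>n. C_k n f)"

text \<open>\<open>C\<^sub>c\<^sup>\<infinity>(U)\<close>, with functions extended by zero to the whole space.\<close>

definition test_functions ::
    "'a::real_normed_vector set \<Rightarrow> ('a \<Rightarrow> 'b::real_normed_vector) set" where
  "test_functions U =
     {\<theta>. smooth \<theta> \<and> compact (closure {x. \<theta> x \<noteq> 0}) \<and> closure {x. \<theta> x \<noteq> 0} \<subseteq> U}"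

definition partial_deriv :: "3 \<Rightarrow> (real^3 \<Rightarrow> real^3) \<Rightarrow> real^3 \<Rightarrow> real^3" where
  "partial_deriv i w x = frechet_derivative w (at x) (axis i 1)"

definition divergence_free :: "(real^3 \<Rightarrow> real^3) \<Rightarrow> bool" where
  "divergence_free w \<longleftrightarrow> (\<forall>x. (\<Sum>i\<in>UNIV. partial_deriv i w x $ i) = 0)"

text \<open>Near each boundary point, \<open>\<Omega>\<close> is the part above the graph of a \<open>C\<^sup>2\<close> function, in rotated
  coordinates.\<close>

definition C2_boundary :: "(real^3) set \<Rightarrow> bool" where
  "C2_boundary \<Omega> \<longleftrightarrow> (\<forall>p\<in>frontier \<Omega>. \<exists>r>0. \<exists>T :: real^3 \<Rightarrow> real^3. \<exists>\<gamma> :: real \<times> real \<Rightarrow> real.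
     orthogonal_transformation T \<and> C_k 2 \<gamma> \<and>
     \<Omega> \<inter> ball p r = {x \<in> ball p r. \<gamma> (T x $ 1, T x $ 2) < T x $ 3})"

datatype flow_domain = Periodic "real^3" | No_Slip "(real^3) set"

fun admissible :: "flow_domain \<Rightarrow> bool" where
  "admissible (Periodic L) \<longleftrightarrow> (\<forall>i. 0 < L $ i)"
| "admissible (No_Slip \<Omega>) \<longleftrightarrow>
     \<Omega> \<noteq> {} \<and> open \<Omega> \<and> connected \<Omega> \<and> bounded \<Omega> \<and> C2_boundary \<Omega>"

fun region :: "flow_domain \<Rightarrow> (real^3) set" where
  "region (Periodic L) = box 0 L"
| "region (No_Slip \<Omega>) = \<Omega>"

text \<open>The space \<open>\<V>\<close>; the restriction to \<open>\<Omega>\<close> is performed by \<^const>\<open>l2_class\<close>.\<close>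

fun test_fields :: "flow_domain \<Rightarrow> (real^3 \<Rightarrow> real^3) set" where
  "test_fields (Periodic L) =
     {w. smooth w \<and> divergence_free w \<and> (\<forall>i x. w (x + (L $ i) *\<^sub>R axis i 1) = w x) \<and>
         (LINT x:box 0 L|lebesgue. w x) = 0}"
| "test_fields (No_Slip \<Omega>) = {w \<in> test_functions \<Omega>. divergence_free w}"

section \<open>The spaces \<open>H\<close>, \<open>V\<close> and \<open>V'\<close>\<close>

definition H_space :: "flow_domain \<Rightarrow> l2_field set" where
  "H_space D = closure (l2_class (region D) ` test_fields D)"

definition has_weak_partial :: "flow_domain \<Rightarrow> 3 \<Rightarrow> l2_field \<Rightarrow> l2_field \<Rightarrow> bool" where
  "has_weak_partial D i u g \<longleftrightarrow> g \<in> l2_on (region D) \<and>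
     (\<forall>\<phi>\<in>test_functions (region D).
        u \<bullet> l2_class (region D) (partial_deriv i \<phi>) = - (g \<bullet> l2_class (region D) \<phi>))"

definition weak_partial :: "flow_domain \<Rightarrow> 3 \<Rightarrow> l2_field \<Rightarrow> l2_field" where
  "weak_partial D i u = (THE g. has_weak_partial D i u g)"

definition H1_space :: "flow_domain \<Rightarrow> l2_field set" where
  "H1_space D = {u \<in> l2_on (region D). \<forall>i. \<exists>g. has_weak_partial D i u g}"

definition H1_inner :: "flow_domain \<Rightarrow> l2_field \<Rightarrow> l2_field \<Rightarrow> real" where
  "H1_inner D u v = (\<Sum>i\<in>UNIV. weak_partial D i u \<bullet> weak_partial D i v)"

definition H1_norm :: "flow_domain \<Rightarrow> l2_field \<Rightarrow> real" where
  "H1_norm D u = sqrt (H1_inner D u u)"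

text \<open>Completion of \<open>\<V>\<close> in the full norm of \<open>H\<^sup>1(\<Omega>)\<^sup>3\<close>, i.e. its closure there.\<close>

definition V_space :: "flow_domain \<Rightarrow> l2_field set" where
  "V_space D = {u \<in> H1_space D. \<forall>\<epsilon>>0. \<exists>w\<in>test_fields D.
     (norm (u - l2_class (region D) w))\<^sup>2 + (H1_norm D (u - l2_class (region D) w))\<^sup>2 < \<epsilon>\<^sup>2}"

text \<open>Functionals on \<open>V\<close>, undefined off \<open>V\<close>; the duality product is application.\<close>

definition V_dual :: "flow_domain \<Rightarrow> (l2_field \<Rightarrow> real) set" where
  "V_dual D = {g \<in> extensional (V_space D).
     (\<forall>u\<in>V_space D. \<forall>v\<in>V_space D. g (u + v) = g u + g v) \<and>
     (\<forall>c. \<forall>v\<in>V_space D. g (c *\<^sub>R v) = c * g v) \<and>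
     (\<exists>C. \<forall>v\<in>V_space D. \<bar>g v\<bar> \<le> C * H1_norm D v)}"

definition dual_norm :: "flow_domain \<Rightarrow> (l2_field \<Rightarrow> real) \<Rightarrow> real" where
  "dual_norm D g = (SUP v\<in>{v \<in> V_space D. H1_norm D v \<le> 1}. \<bar>g v\<bar>)"

definition metric_topology :: "'a set \<Rightarrow> ('a \<Rightarrow> 'a \<Rightarrow> real) \<Rightarrow> 'a topology" where
  "metric_topology X d = topology_generated_by {{y \<in> X. d x y < r} | x r. x \<in> X \<and> 0 < r}"

definition borel_of :: "'a topology \<Rightarrow> 'a measure" where
  "borel_of X = sigma (topspace X) {U. openin X U}"

definition H_borel :: "flow_domain \<Rightarrow> l2_field measure" where
  "H_borel D = restrict_space borel (H_space D)"

definition V_borel :: "flow_domain \<Rightarrow> l2_field measure" where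
  "V_borel D = borel_of (metric_topology (V_space D) (\<lambda>u v. H1_norm D (u - v)))"

definition V_dual_borel :: "flow_domain \<Rightarrow> (l2_field \<Rightarrow> real) measure" where
  "V_dual_borel D = borel_of (metric_topology (V_dual D) (\<lambda>g h. dual_norm D (\<lambda>v. g v - h v)))"

definition H_weak :: "flow_domain \<Rightarrow> l2_field topology" where
  "H_weak D = topology_generated_by {{u \<in> H_space D. u \<bullet> w \<in> U} | w U. w \<in> H_space D \<and> open U}"

section \<open>Lebesgue--Bochner spaces over an interval\<close>

text \<open>Functions with values in a space with Borel structure \<open>M\<close> and norm \<open>N\<close>. The spaces used below
  are separable, so strong measurability is Borel measurability; members are only required to
  agree almost everywhere with a function taking all its values in the space.\<close>

definition L_inf :: "real set \<Rightarrow> 'a measure \<Rightarrow> ('a \<Rightarrow> real) \<Rightarrow> (real \<Rightarrow> 'a) set" where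
  "L_inf I M N = {u. \<exists>v \<in> lebesgue_on I \<rightarrow>\<^sub>M M. (AE t in lebesgue_on I. u t = v t) \<and>
     (\<exists>C. AE t in lebesgue_on I. N (v t) \<le> C)}"

definition L_inf_loc :: "real set \<Rightarrow> 'a measure \<Rightarrow> ('a \<Rightarrow> real) \<Rightarrow> (real \<Rightarrow> 'a) set" where
  "L_inf_loc I M N = {u. \<exists>v \<in> lebesgue_on I \<rightarrow>\<^sub>M M. (AE t in lebesgue_on I. u t = v t) \<and>
     (\<forall>a b. {a..b} \<subseteq> I \<longrightarrow> (\<exists>C. AE t in lebesgue_on {a..b}. N (v t) \<le> C))}"

definition L_p_loc :: "real \<Rightarrow> real set \<Rightarrow> 'a measure \<Rightarrow> ('a \<Rightarrow> real) \<Rightarrow> (real \<Rightarrow> 'a) set" where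
  "L_p_loc p I M N = {u. \<exists>v \<in> lebesgue_on I \<rightarrow>\<^sub>M M. (AE t in lebesgue_on I. u t = v t) \<and>
     (\<forall>a b. {a..b} \<subseteq> I \<longrightarrow> (\<integral>\<^sup>+t\<in>{a..b}. ennreal (N (v t) powr p) \<partial>lebesgue) < \<infinity>)}"

text \<open>Membership of a function with values in \<open>[0,\<infinity>]\<close> in the scalar spaces \<open>L\<^sup>\<infinity>\<^sub>l\<^sub>o\<^sub>c(I)\<close>, \<open>L\<^sup>1\<^sub>l\<^sub>o\<^sub>c(I)\<close>.\<close>

definition in_L_inf_loc :: "real set \<Rightarrow> (real \<Rightarrow> ennreal) \<Rightarrow> bool" where
  "in_L_inf_loc I g \<longleftrightarrow> g \<in> borel_measurable (lebesgue_on I) \<and>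
     (\<forall>a b. {a..b} \<subseteq> I \<longrightarrow> (\<exists>C::real. AE t in lebesgue_on {a..b}. g t \<le> ennreal C))"

definition in_L1_loc :: "real set \<Rightarrow> (real \<Rightarrow> ennreal) \<Rightarrow> bool" where
  "in_L1_loc I g \<longleftrightarrow> g \<in> borel_measurable (lebesgue_on I) \<and>
     (\<forall>a b. {a..b} \<subseteq> I \<longrightarrow> (\<integral>\<^sup>+t\<in>{a..b}. g t \<partial>lebesgue) < \<infinity>)"

section \<open>Leray--Hopf weak solutions\<close>

definition stokes_op :: "flow_domain \<Rightarrow> l2_field \<Rightarrow> l2_field \<Rightarrow> real" where
  "stokes_op D u = (\<lambda>v\<in>V_space D. H1_inner D u v)"

definition trilinear :: "flow_domain \<Rightarrow> l2_field \<Rightarrow> l2_field \<Rightarrow> l2_field \<Rightarrow> real" where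
  "trilinear D u v w = (LINT x:region D|lebesgue.
     (\<Sum>i\<in>UNIV. (rep_l2_field u x $ i) *\<^sub>R rep_l2_field (weak_partial D i v) x) \<bullet> rep_l2_field w x)"

definition bilinear_op :: "flow_domain \<Rightarrow> l2_field \<Rightarrow> l2_field \<Rightarrow> l2_field \<Rightarrow> real" where
  "bilinear_op D u v = (\<lambda>w\<in>V_space D. trilinear D u v w)"

definition NS_rhs ::
    "flow_domain \<Rightarrow> real \<Rightarrow> (real \<Rightarrow> l2_field) \<Rightarrow> real \<Rightarrow> l2_field \<Rightarrow> l2_field \<Rightarrow> real" where
  "NS_rhs D \<nu> f s u = (\<lambda>v\<in>V_space D. f s \<bullet> v - \<nu> * stokes_op D u v - bilinear_op D u u v)"

text \<open>\<open>du/dt = g\<close> in the sense of \<open>V'\<close>-valued distributions on the interior of \<open>I\<close>, where \<open>u\<close> is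
  \<open>H\<close>-valued; the identity between \<open>V'\<close>-valued integrals is written out on elements of \<open>V\<close>.\<close>

definition has_distr_deriv ::
    "flow_domain \<Rightarrow> real set \<Rightarrow> (real \<Rightarrow> l2_field) \<Rightarrow> (real \<Rightarrow> l2_field \<Rightarrow> real) \<Rightarrow> bool" where
  "has_distr_deriv D I u g \<longleftrightarrow> (\<forall>\<theta>\<in>test_functions (interior I). \<forall>v\<in>V_space D.
     - (LINT t:interior I|lebesgue. deriv \<theta> t * (u t \<bullet> v)) =
       (LINT t:interior I|lebesgue. \<theta> t * g t v))"

definition left_endpoint :: "real set \<Rightarrow> real \<Rightarrow> bool" where
  "left_endpoint I t\<^sub>0 \<longleftrightarrow> t\<^sub>0 \<in> I \<and> (\<forall>t\<in>I. t\<^sub>0 \<le> t)"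

definition weak_solution ::
    "flow_domain \<Rightarrow> real \<Rightarrow> (real \<Rightarrow> l2_field) \<Rightarrow> real set \<Rightarrow> (real \<Rightarrow> l2_field) \<Rightarrow> bool" where
  "weak_solution D \<nu> f I u \<longleftrightarrow>
     u \<in> I \<rightarrow> H_space D \<and>
     u \<in> L_inf_loc I (H_borel D) norm \<and>
     u \<in> L_p_loc 2 I (V_borel D) (H1_norm D) \<and>
     (\<exists>g \<in> L_p_loc (4/3) I (V_dual_borel D) (dual_norm D). has_distr_deriv D I u g) \<and>
     continuous_map (top_of_set I) (H_weak D) u \<and>
     has_distr_deriv D I u (\<lambda>t. NS_rhs D \<nu> f t (u t)) \<and>
     (AE t' in lebesgue_on I. \<forall>t\<in>I. t' < t \<longrightarrow>
        1/2 * (norm (u t))\<^sup>2 + \<nu> * (LINT s:{t'..t}|lebesgue. (H1_norm D (u s))\<^sup>2)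
        \<le> 1/2 * (norm (u t'))\<^sup>2 + (LINT s:{t'..t}|lebesgue. f s \<bullet> u s)) \<and>
     (\<forall>t\<^sub>0. left_endpoint I t\<^sub>0 \<longrightarrow> (u \<longlongrightarrow> u t\<^sub>0) (at t\<^sub>0 within I))"

section \<open>Vishik--Fursikov measures\<close>

definition path_space :: "flow_domain \<Rightarrow> real set \<Rightarrow> (real \<Rightarrow> l2_field) set" where
  "path_space D I = {u \<in> extensional I. continuous_map (top_of_set I) (H_weak D) u}"

text \<open>The topology of uniform weak convergence on compact subintervals.\<close>

definition path_topology :: "flow_domain \<Rightarrow> real set \<Rightarrow> (real \<Rightarrow> l2_field) topology" where
  "path_topology D I = topology_generated_by
     {{u \<in> path_space D I. \<forall>t\<in>{a..b}. \<bar>(u t - u\<^sub>0 t) \<bullet> w\<bar> < \<epsilon>} | a b u\<^sub>0 w \<epsilon>.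
        {a..b} \<subseteq> I \<and> u\<^sub>0 \<in> path_space D I \<and> w \<in> H_space D \<and> 0 < \<epsilon>}"

definition U_sharp ::
    "flow_domain \<Rightarrow> real \<Rightarrow> (real \<Rightarrow> l2_field) \<Rightarrow> real set \<Rightarrow> (real \<Rightarrow> l2_field) set" where
  "U_sharp D \<nu> f I = {u \<in> path_space D I. weak_solution D \<nu> f (interior I) u}"

definition energy_function :: "(real \<Rightarrow> real) \<Rightarrow> (real \<Rightarrow> real) \<Rightarrow> bool" where
  "energy_function \<psi> \<psi>' \<longleftrightarrow>
     (\<forall>r\<ge>0. 0 \<le> \<psi> r) \<and> mono_on {0..} \<psi> \<and>
     (\<forall>r\<ge>0. (\<psi> has_real_derivative \<psi>' r) (at r within {0..})) \<and>
     continuous_on {0..} \<psi>' \<and> bounded (\<psi>' ` {0..})"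

text \<open>``Carried by \<open>\<U>\<^sub>I\<^sup>\<sharp>\<close>'' is stated as an almost-everywhere property, so measurability of \<open>\<U>\<^sub>I\<^sup>\<sharp>\<close>
  is not an extra hypothesis; the integrals over \<open>\<U>\<^sub>I\<^sup>\<sharp>\<close> then equal those over the whole space.\<close>

definition vishik_fursikov_measure ::
    "flow_domain \<Rightarrow> real \<Rightarrow> (real \<Rightarrow> l2_field) \<Rightarrow> real set \<Rightarrow> (real \<Rightarrow> l2_field) measure \<Rightarrow> bool" where
  "vishik_fursikov_measure D \<nu> f I \<rho> \<longleftrightarrow>
     prob_space \<rho> \<and> sets \<rho> = sets (borel_of (path_topology D I)) \<and>
     (AE u in \<rho>. u \<in> U_sharp D \<nu> f I) \<and>
     in_L_inf_loc I (\<lambda>t. \<integral>\<^sup>+u\<in>U_sharp D \<nu> f I. ennreal ((norm (u t))\<^sup>2) \<partial>\<rho>) \<and>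
     (\<forall>t\<^sub>0. left_endpoint I t\<^sub>0 \<longrightarrow> (\<forall>\<psi> \<psi>'. energy_function \<psi> \<psi>' \<longrightarrow>
        ((\<lambda>t. \<integral>\<^sup>+u\<in>U_sharp D \<nu> f I. ennreal (\<psi> ((norm (u t))\<^sup>2)) \<partial>\<rho>) \<longlongrightarrow>
           (\<integral>\<^sup>+u\<in>U_sharp D \<nu> f I. ennreal (\<psi> ((norm (u t\<^sub>0))\<^sup>2)) \<partial>\<rho>)) (at t\<^sub>0 within I) \<and>
        (\<integral>\<^sup>+u\<in>U_sharp D \<nu> f I. ennreal (\<psi> ((norm (u t\<^sub>0))\<^sup>2)) \<partial>\<rho>) < \<infinity>))"

definition time_projection ::
    "flow_domain \<Rightarrow> (real \<Rightarrow> l2_field) measure \<Rightarrow> real \<Rightarrow> l2_field measure" where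
  "time_projection D \<rho> t = distr \<rho> (H_borel D) (\<lambda>u. u t)"

section \<open>Statistical solutions\<close>

text \<open>\<open>\<phi>\<close> is a compactly supported \<open>C\<^sup>1\<close> function on \<open>\<real>\<^sup>k\<close>, with partial derivatives \<open>d\<phi> j\<close>, \<open>j < k\<close>.\<close>

definition C1_compact_support ::
    "nat \<Rightarrow> ((nat \<Rightarrow> real) \<Rightarrow> real) \<Rightarrow> (nat \<Rightarrow> (nat \<Rightarrow> real) \<Rightarrow> real) \<Rightarrow> bool" where
  "C1_compact_support k \<phi> d\<phi> \<longleftrightarrow>
     continuous_map (Euclidean_space k) euclideanreal \<phi> \<and>
     (\<forall>j<k. continuous_map (Euclidean_space k) euclideanreal (d\<phi> j) \<and>
        (\<forall>x\<in>topspace (Euclidean_space k).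
           ((\<lambda>h. \<phi> (x(j := h))) has_real_derivative d\<phi> j x) (at (x j)))) \<and>
     compactin (Euclidean_space k)
       (Euclidean_space k closure_of {x \<in> topspace (Euclidean_space k). \<phi> x \<noteq> 0})"

text \<open>\<open>\<Phi>\<close> is a cylindrical test function with Frechet derivative \<open>d\<Phi>\<close>.\<close>

definition cylindrical ::
    "flow_domain \<Rightarrow> (l2_field \<Rightarrow> real) \<Rightarrow> (l2_field \<Rightarrow> l2_field) \<Rightarrow> bool" where
  "cylindrical D \<Phi> d\<Phi> \<longleftrightarrow> (\<exists>k \<phi> d\<phi> v.
     C1_compact_support k \<phi> d\<phi> \<and> (\<forall>j<k. v j \<in> V_space D) \<and>
     (let coords = (\<lambda>u j. if j < k then u \<bullet> v j else 0) in
        \<Phi> = (\<lambda>u. \<phi> (coords u)) \<and>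
        d\<Phi> = (\<lambda>u. \<Sum>j<k. d\<phi> j (coords u) *\<^sub>R v j)))"

definition enstrophy :: "flow_domain \<Rightarrow> l2_field \<Rightarrow> ennreal" where
  "enstrophy D u = (if u \<in> V_space D then ennreal ((H1_norm D u)\<^sup>2) else \<infinity>)"

text \<open>Bochner integrals default to 0, so that the iterated integrals below make sense is asserted
  separately.\<close>

definition iterated_integrable ::
    "(real \<Rightarrow> 'a measure) \<Rightarrow> real \<Rightarrow> real \<Rightarrow> (real \<Rightarrow> 'a \<Rightarrow> real) \<Rightarrow> bool" where
  "iterated_integrable \<mu> t' t g \<longleftrightarrow>
     (AE s in lebesgue_on (closed_segment t' t). integrable (\<mu> s) (g s)) \<and>
     integrable (lebesgue_on (closed_segment t' t)) (\<lambda>s. \<integral>u. g s u \<partial>\<mu> s)"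

text \<open>The time integral is oriented.\<close>

definition iterated_integral ::
    "(real \<Rightarrow> 'a measure) \<Rightarrow> real \<Rightarrow> real \<Rightarrow> (real \<Rightarrow> 'a \<Rightarrow> real) \<Rightarrow> real" where
  "iterated_integral \<mu> t' t g =
     interval_lebesgue_integral lebesgue (ereal t') (ereal t) (\<lambda>s. \<integral>u. g s u \<partial>\<mu> s)"

text \<open>Integrands involving \<open>F(s,u)\<close> or \<open>\<parallel>u\<parallel>\<close> are set to 0 off \<open>V\<close>, which is a null set of \<open>\<mu> s\<close> for
  almost every \<open>s\<close> by the \<open>L\<^sup>1\<close> condition on the enstrophy.\<close>

definition statistical_solution ::
    "flow_domain \<Rightarrow> real \<Rightarrow> (real \<Rightarrow> l2_field) \<Rightarrow> real set \<Rightarrow> (real \<Rightarrow> l2_field measure) \<Rightarrow> bool" where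
  "statistical_solution D \<nu> f I \<mu> \<longleftrightarrow>
     (\<forall>t\<in>I. prob_space (\<mu> t) \<and> sets (\<mu> t) = sets (H_borel D)) \<and>
     (\<forall>\<Phi>::l2_field \<Rightarrow> real. continuous_on (H_space D) \<Phi> \<and> bounded (\<Phi> ` H_space D) \<longrightarrow>
        (\<lambda>t. \<integral>u. \<Phi> u \<partial>\<mu> t) \<in> borel_measurable (lebesgue_on I)) \<and>
     in_L_inf_loc I (\<lambda>t. \<integral>\<^sup>+u. ennreal ((norm u)\<^sup>2) \<partial>\<mu> t) \<and>
     in_L1_loc I (\<lambda>t. \<integral>\<^sup>+u. enstrophy D u \<partial>\<mu> t) \<and>
     (\<forall>\<Phi> d\<Phi>. cylindrical D \<Phi> d\<Phi> \<longrightarrow> (\<forall>t'\<in>I. \<forall>t\<in>I.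
        let g = (\<lambda>s u. indicator (V_space D) u * NS_rhs D \<nu> f s u (d\<Phi> u)) in
        iterated_integrable \<mu> t' t g \<and>
        (\<integral>u. \<Phi> u \<partial>\<mu> t) = (\<integral>u. \<Phi> u \<partial>\<mu> t') + iterated_integral \<mu> t' t g)) \<and>
     (\<exists>I' \<subseteq> I. I - I' \<in> null_sets lebesgue \<and>
        (\<forall>\<psi> \<psi>'. energy_function \<psi> \<psi>' \<longrightarrow> (\<forall>t'\<in>I'. \<forall>t\<in>I. t' \<le> t \<longrightarrow>
           (let e = (\<lambda>u. \<psi> ((norm u)\<^sup>2));
                g = (\<lambda>s u. indicator (V_space D) u * (\<psi>' ((norm u)\<^sup>2) * (H1_norm D u)\<^sup>2));
                h = (\<lambda>s u. \<psi>' ((norm u)\<^sup>2) * (f s \<bullet> u)) in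
            integrable (\<mu> t) e \<and> integrable (\<mu> t') e \<and>
            iterated_integrable \<mu> t' t g \<and> iterated_integrable \<mu> t' t h \<and>
            1/2 * (\<integral>u. e u \<partial>\<mu> t) + \<nu> * iterated_integral \<mu> t' t g
            \<le> 1/2 * (\<integral>u. e u \<partial>\<mu> t') + iterated_integral \<mu> t' t h)))) \<and>
     (\<forall>t\<^sub>0. left_endpoint I t\<^sub>0 \<longrightarrow> (\<forall>\<psi> \<psi>'. energy_function \<psi> \<psi>' \<longrightarrow>
        ((\<lambda>t. \<integral>\<^sup>+u. ennreal (\<psi> ((norm u)\<^sup>2)) \<partial>\<mu> t) \<longlongrightarrow>
           (\<integral>\<^sup>+u. ennreal (\<psi> ((norm u)\<^sup>2)) \<partial>\<mu> t\<^sub>0)) (at t\<^sub>0 within I) \<and>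
        (\<integral>\<^sup>+u. ennreal (\<psi> ((norm u)\<^sup>2)) \<partial>\<mu> t\<^sub>0) < \<infinity>))"

definition statistical_solution_with_data ::
    "flow_domain \<Rightarrow> real \<Rightarrow> (real \<Rightarrow> l2_field) \<Rightarrow> real set \<Rightarrow> real \<Rightarrow> l2_field measure \<Rightarrow>
     (real \<Rightarrow> l2_field measure) \<Rightarrow> bool" where
  "statistical_solution_with_data D \<nu> f I t\<^sub>0 \<mu>\<^sub>0 \<mu> \<longleftrightarrow>
     statistical_solution D \<nu> f I \<mu> \<and> \<mu> t\<^sub>0 = \<mu>\<^sub>0"

end

theory Submission
  imports Defs
begin

text \<open>Each identity for \<open>\<rho>\<^sub>t\<close> is the \<open>\<rho>\<close>-average of an identity along single paths, so the work lies in
  the path identities and in the joint measurability that permits Fubini. Weak continuity makes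
  \<open>(t, u) \<mapsto> u(t)\<close> jointly measurable, and the closed balls of \<open>V\<close> are closed in \<open>H\<close> (parallelogram law), so
  the enstrophy is a Borel function on \<open>H\<close>. Fubini turns ``for almost every path the energy inequality
  starts at almost every time'' into the same statement with the quantifiers exchanged; by weak lower
  semicontinuity of the norm, rational end times suffice. Averaging that inequality and letting the
  starting time decrease to \<open>t\<^sub>0\<close> bounds the mean enstrophy up to \<open>t\<^sub>0\<close>, although the paths solve the
  equations on the interior only. Then almost every path has finite energy up to \<open>t\<^sub>0\<close>, the weak equation
  extends to \<open>I\<close> by continuity, and telescoping over fine partitions whose nodes are good starting times
  gives the chain rules for cylindrical functions and, as \<open>\<psi>' \<ge> 0\<close>, for \<open>\<psi>(|u|\<^sup>2)\<close>. The cubic term is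
  integrable along paths by Ladyzhenskaya's inequality.\<close>

section \<open>Square-integrable fields\<close>

text \<open>Every integrand that has to be averaged is dominated by a constant times
  \<open>1 + |u|^2 + ||u||^2\<close>, and the mean of this quantity is integrable over compact time
  intervals; one growth condition thus serves all uses of Fubini. It dictates the form of the
  estimate of b(u,u,v): the test direction v lies only in \<open>V\<close>, so |u||v| must be placed
  in L^2, at the price of two powers of the norm of u. \<open>V\<close> carries a finer topology
  than \<open>H\<close>, while all measures live on \<open>H\<close>; functionals of the gradient
  become Borel on \<open>H\<close> through the map sending u to the quadruple of u and its partial
  derivatives, whose image is separable and lies in a complete space. Along a path, |u|^2 is not
  known to be absolutely continuous: on the admissible starting times it is an absolutely continuous
  function minus a nondecreasing one, so relative to these times it has only countably many
  discontinuities, which is what the chain rule for \<psi> relies on. The forcing agrees only almost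
  everywhere with a measurable function, and a bounded version of it with values in \<open>H\<close>
  takes its place throughout.\<close>

lemma sq_integrable_rep: "sq_integrable (rep_l2_field u)"
  using Quotient_rep_reflp[OF Quotient_l2_field, of u] by simp

lemma rep_l2_measurable [measurable]: "rep_l2_field u \<in> borel_measurable lebesgue"
  using sq_integrable_rep[of u] by (simp add: sq_integrable_def)

lemma rep_abs_l2: "sq_integrable f \<Longrightarrow> AE x in lebesgue. rep_l2_field (abs_l2_field f) x = f x"
  using Quotient_rep_abs[OF Quotient_l2_field, of f] by simp

lemma l2_eqI:
  assumes "AE x in lebesgue. rep_l2_field u x = rep_l2_field v x"
  shows "u = v"
  using assms Quotient_rel_rep[OF Quotient_l2_field, of u v] sq_integrable_rep by auto

lemma inner_l2_rep: "u \<bullet> v = (\<integral>x. rep_l2_field u x \<bullet> rep_l2_field v x \<partial>lebesgue)"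
  by (rule inner_l2_field.rep_eq)

lemma norm2_l2_rep: "(norm u)\<^sup>2 = (\<integral>x. (norm (rep_l2_field u x))\<^sup>2 \<partial>lebesgue)"
  by (simp add: power2_norm_eq_inner inner_l2_rep)

lemma inner_l2_cong:
  assumes "AE x in lebesgue. rep_l2_field u x = f x" "AE x in lebesgue. rep_l2_field v x = g x"
    and "sq_integrable f" "sq_integrable g"
  shows "u \<bullet> v = (\<integral>x. f x \<bullet> g x \<partial>lebesgue)"
  unfolding inner_l2_rep
proof (rule integral_cong_AE)
  show "AE x in lebesgue. rep_l2_field u x \<bullet> rep_l2_field v x = f x \<bullet> g x"
    using assms(1,2) by eventually_elim simp
qed (use assms(3,4) in \<open>auto simp: sq_integrable_def\<close>)

lemma rep_l2_add: "AE x in lebesgue. rep_l2_field (u + v) x = rep_l2_field u x + rep_l2_field v x"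
  using rep_abs_l2[OF sq_integrable_add[OF sq_integrable_rep sq_integrable_rep, of u v]]
  by (simp add: plus_l2_field_def)

lemma rep_l2_scaleR: "AE x in lebesgue. rep_l2_field (c *\<^sub>R u) x = c *\<^sub>R rep_l2_field u x"
  using rep_abs_l2[OF sq_integrable_scaleR[OF sq_integrable_rep, of c u]]
  by (simp add: scaleR_l2_field_def)

lemma rep_l2_diff: "AE x in lebesgue. rep_l2_field (u - v) x = rep_l2_field u x - rep_l2_field v x"
proof -
  have "u - v = u + (-1) *\<^sub>R v" by simp
  then show ?thesis
    using rep_l2_add[of u "(-1) *\<^sub>R v"] rep_l2_scaleR[of "-1" v] by auto
qed

lemma rep_l2_zero: "AE x in lebesgue. rep_l2_field 0 x = 0"
  using rep_abs_l2[OF sq_integrable_zero] by (simp add: zero_l2_field_def)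

text \<open>Stated in \<open>ennreal\<close> because distances in L^2 are later compared through
  Fatou's lemma, where finiteness is part of the conclusion.\<close>

lemma norm2_l2_diff_nn:
  "ennreal ((norm (u - v))\<^sup>2) =
    (\<integral>\<^sup>+x. ennreal ((norm (rep_l2_field u x - rep_l2_field v x))\<^sup>2) \<partial>lebesgue)"
proof -
  have "ennreal ((norm (u - v))\<^sup>2) = (\<integral>\<^sup>+x. ennreal ((norm (rep_l2_field (u - v) x))\<^sup>2) \<partial>lebesgue)"
    unfolding norm2_l2_rep
    by (rule nn_integral_eq_integral[symmetric]) (use sq_integrable_rep[of "u - v"] in \<open>auto simp: sq_integrable_def\<close>)
  also have "\<dots> = (\<integral>\<^sup>+x. ennreal ((norm (rep_l2_field u x - rep_l2_field v x))\<^sup>2) \<partial>lebesgue)"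
    by (rule nn_integral_cong_AE) (use rep_l2_diff[of u v] in eventually_elim, simp)
  finally show ?thesis .
qed

section \<open>Completeness of L^2\<close>

lemma Cauchy_fast_indices:
  fixes X :: "nat \<Rightarrow> 'a::metric_space"
  assumes "Cauchy X"
  obtains r :: "nat \<Rightarrow> nat" where "strict_mono r"
    and "\<And>j k. k \<le> j \<Longrightarrow> dist (X (r j)) (X (r k)) < (1/4) ^ k"
proof -
  have "\<forall>k. \<exists>N. \<forall>m\<ge>N. \<forall>n\<ge>N. dist (X m) (X n) < (1/4) ^ k"
    using assms unfolding Cauchy_def by simp
  then obtain N where N: "\<And>k m n. m \<ge> N k \<Longrightarrow> n \<ge> N k \<Longrightarrow> dist (X m) (X n) < (1/4) ^ k"
    by metis
  \<comment> \<open>The summand \<open>k\<close> keeps \<open>r\<close> strictly increasing even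
    where \<open>N\<close> vanishes; the partial sums dominate every single
    \<open>N k\<close>.\<close>
  define r where "r k = (\<Sum>i\<le>k. N i) + k" for k
  have sm: "strict_mono r" unfolding strict_mono_Suc_iff r_def by simp
  have ge: "N k \<le> r k" for k unfolding r_def by (cases k) simp_all
  have "dist (X (r j)) (X (r k)) < (1/4) ^ k" if "k \<le> j" for j k
    using N[of k "r j" "r k"] ge[of k] strict_mono_leD[OF sm that] by linarith
  with sm that show ?thesis by blast
qed

text \<open>Riesz-Fischer argument. The increments along the subsequence have squared norms at most
  \<open>(1/16)^k\<close>, so they stay summable after multiplication by \<open>2^k\<close>; this
  yields pointwise convergence almost everywhere, and Fatou's lemma turns the pointwise limit into a
  limit in norm.\<close>

lemma l2_complete:
  fixes X :: "nat \<Rightarrow> l2_field"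
  assumes "Cauchy X"
  shows "convergent X"
proof -
  obtain r :: "nat \<Rightarrow> nat" where r: "strict_mono r"
    and fast: "\<And>j k. k \<le> j \<Longrightarrow> dist (X (r j)) (X (r k)) < (1/4) ^ k"
    using Cauchy_fast_indices[OF assms] by blast
  define F where "F k = rep_l2_field (X (r k))" for k
  have [measurable]: "F k \<in> borel_measurable lebesgue" for k unfolding F_def by simp
  have fast2: "(norm (X (r j) - X (r k)))\<^sup>2 \<le> (1/16) ^ k" if "k \<le> j" for j k
  proof -
    have "(norm (X (r j) - X (r k)))\<^sup>2 \<le> ((1/4) ^ k)\<^sup>2"
      using fast[OF that] by (intro power_mono) (auto simp: dist_norm)
    also have "\<dots> = (1/16) ^ k" by (simp add: power2_eq_square power_mult_distrib[symmetric])
    finally show ?thesis .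
  qed
  have nn: "(\<integral>\<^sup>+x. ennreal ((norm (F j x - F k x))\<^sup>2) \<partial>lebesgue) \<le> ennreal ((1/16) ^ k)"
    if "k \<le> j" for j k
    unfolding F_def norm2_l2_diff_nn[symmetric] using fast2[OF that] by (rule ennreal_leI)
  \<comment> \<open>On a space of infinite measure only the squares of the increments are
    integrable. The weight \<open>2^k\<close> converts their summability into geometric decay of the
    increments themselves, as needed for absolute convergence at almost every point.\<close>
  have fin: "AE x in lebesgue. (\<Sum>k. ennreal (2 ^ k * (norm (F (Suc k) x - F k x))\<^sup>2)) \<noteq> \<infinity>"
  proof (rule nn_integral_PInf_AE)
    have "(\<integral>\<^sup>+x. (\<Sum>k. ennreal (2 ^ k * (norm (F (Suc k) x - F k x))\<^sup>2)) \<partial>lebesgue) =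
      (\<Sum>k. \<integral>\<^sup>+x. ennreal (2 ^ k) * ennreal ((norm (F (Suc k) x - F k x))\<^sup>2) \<partial>lebesgue)"
      by (subst nn_integral_suminf) (simp_all add: ennreal_mult)
    also have "\<dots> \<le> (\<Sum>k. ennreal ((1/8) ^ k))"
    proof (rule suminf_le)
      fix k
      have "(\<integral>\<^sup>+x. ennreal (2 ^ k) * ennreal ((norm (F (Suc k) x - F k x))\<^sup>2) \<partial>lebesgue)
        = ennreal (2 ^ k) * (\<integral>\<^sup>+x. ennreal ((norm (F (Suc k) x - F k x))\<^sup>2) \<partial>lebesgue)"
        by (simp add: nn_integral_cmult)
      also have "\<dots> \<le> ennreal (2 ^ k) * ennreal ((1/16) ^ k)"
        by (intro mult_left_mono nn) simp_all
      also have "\<dots> = ennreal ((1/8) ^ k)"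
        by (simp add: ennreal_mult[symmetric] power_mult_distrib[symmetric])
      finally show "(\<integral>\<^sup>+x. ennreal (2 ^ k) * ennreal ((norm (F (Suc k) x - F k x))\<^sup>2) \<partial>lebesgue)
        \<le> ennreal ((1/8) ^ k)" .
    qed simp_all
    also have "\<dots> = ennreal (\<Sum>k. (1/8) ^ k)"
      by (rule suminf_ennreal_eq) (auto intro!: summable_sums summable_geometric)
    finally show "(\<integral>\<^sup>+x. (\<Sum>k. ennreal (2 ^ k * (norm (F (Suc k) x - F k x))\<^sup>2)) \<partial>lebesgue) \<noteq> \<infinity>"
      by (auto simp: top_unique)
  qed simp
  have conv: "AE x in lebesgue. convergent (\<lambda>k. F k x)"
    using fin
  proof eventually_elim
    case (elim x)
    define a where "a k = norm (F (Suc k) x - F k x)" for k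
    have "summable (\<lambda>k. 2 ^ k * (a k)\<^sup>2)"
      using elim by (intro summable_suminf_not_top) (auto simp: a_def)
    then have "(\<lambda>k. 2 ^ k * (a k)\<^sup>2) \<longlonglongrightarrow> 0" by (rule summable_LIMSEQ_zero)
    then obtain C where C: "\<And>k. norm (2 ^ k * (a k)\<^sup>2) \<le> C" "C > 0"
      using convergent_imp_Bseq[of "\<lambda>k. 2 ^ k * (a k)\<^sup>2"] unfolding Bseq_def convergent_def by blast
    have "a k \<le> sqrt C * (1 / sqrt 2) ^ k" for k
    proof (rule power2_le_imp_le)
      have "(1 / sqrt 2) ^ k * (1 / sqrt 2) ^ k = (1/2::real) ^ k"
        by (simp add: power_mult_distrib[symmetric])
      then have "(sqrt C * (1 / sqrt 2) ^ k)\<^sup>2 = C * (1/2) ^ k"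
        using C(2) by (simp add: power2_eq_square algebra_simps)
      moreover have "(a k)\<^sup>2 \<le> C * (1/2) ^ k"
        using C(1)[of k] by (simp add: field_simps power_one_over)
      ultimately show "(a k)\<^sup>2 \<le> (sqrt C * (1 / sqrt 2) ^ k)\<^sup>2" by simp
    qed (use C(2) in simp)
    then have le: "norm (F (Suc k) x - F k x) \<le> sqrt C * (1 / sqrt 2) ^ k" for k
      unfolding a_def .
    have "summable (\<lambda>k. sqrt C * (1 / sqrt 2) ^ k)"
      by (rule summable_mult, rule summable_geometric) simp
    then have "summable (\<lambda>k. F (Suc k) x - F k x)"
      by (rule summable_comparison_test'[where N = 0]) (rule le)
    then have "convergent (\<lambda>n. \<Sum>k<n. F (Suc k) x - F k x)"
      by (simp only: summable_iff_convergent)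
    moreover have "(\<Sum>k<n. F (Suc k) x - F k x) = F n x - F 0 x" for n
      by (rule sum_lessThan_telescope)
    ultimately have "convergent (\<lambda>n. F n x - F 0 x)" by simp
    then show ?case using convergent_diff_const_right_iff by blast
  qed
  define f where "f x = lim (\<lambda>k. F k x)" for x
  have [measurable]: "f \<in> borel_measurable lebesgue" unfolding f_def by measurable
  have lim: "AE x in lebesgue. (\<lambda>k. F k x) \<longlonglongrightarrow> f x"
    using conv by eventually_elim (simp add: f_def convergent_LIMSEQ_iff)
  have fatou: "(\<integral>\<^sup>+x. ennreal ((norm (f x - F k x))\<^sup>2) \<partial>lebesgue) \<le> ennreal ((1/16) ^ k)" for k
  proof -
    have "(\<integral>\<^sup>+x. ennreal ((norm (f x - F k x))\<^sup>2) \<partial>lebesgue)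
      = (\<integral>\<^sup>+x. liminf (\<lambda>j. ennreal ((norm (F j x - F k x))\<^sup>2)) \<partial>lebesgue)"
    proof (rule nn_integral_cong_AE, use lim in eventually_elim)
      case (elim x)
      have "(\<lambda>j. ennreal ((norm (F j x - F k x))\<^sup>2)) \<longlonglongrightarrow> ennreal ((norm (f x - F k x))\<^sup>2)"
        by (intro tendsto_intros elim)
      then show ?case by (intro lim_imp_Liminf[symmetric]) simp_all
    qed
    also have "\<dots> \<le> liminf (\<lambda>j. \<integral>\<^sup>+x. ennreal ((norm (F j x - F k x))\<^sup>2) \<partial>lebesgue)"
      by (rule nn_integral_liminf) simp
    also have "\<dots> \<le> ennreal ((1/16) ^ k)"
    proof -
      have "liminf (\<lambda>j. \<integral>\<^sup>+x. ennreal ((norm (F j x - F k x))\<^sup>2) \<partial>lebesgue)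
        \<le> liminf (\<lambda>j. ennreal ((1/16) ^ k))"
        by (intro Liminf_mono eventually_sequentiallyI[of k] nn)
      then show ?thesis by (simp add: Liminf_const)
    qed
    finally show ?thesis .
  qed
  have sqd: "sq_integrable (\<lambda>x. f x - F k x)" for k
    unfolding sq_integrable_def
    by (auto intro!: integrableI_bounded order.strict_trans1[OF fatou[of k]])
  have sqf: "sq_integrable f"
    using sq_integrable_add[OF sqd[of 0] sq_integrable_rep[of "X (r 0)"]] by (simp add: F_def)
  have "(norm (abs_l2_field f - X (r k)))\<^sup>2 \<le> (1/16) ^ k" for k
  proof -
    have "ennreal ((norm (abs_l2_field f - X (r k)))\<^sup>2) = (\<integral>\<^sup>+x. ennreal ((norm (f x - F k x))\<^sup>2) \<partial>lebesgue)"
      unfolding norm2_l2_diff_nn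
      by (rule nn_integral_cong_AE) (use rep_abs_l2[OF sqf] in eventually_elim, simp add: F_def)
    with fatou[of k] show ?thesis by (metis ennreal_le_iff zero_le_power zero_le_divide_1_iff zero_le_numeral)
  qed
  moreover have "((1/4::real) ^ k)\<^sup>2 = (1/16) ^ k" for k
    by (simp add: power2_eq_square power_mult_distrib[symmetric])
  ultimately have "norm (abs_l2_field f - X (r k)) \<le> (1/4) ^ k" for k
    using power2_le_imp_le[of "norm (abs_l2_field f - X (r k))" "(1/4) ^ k"] by simp
  note bound = this
  have "(\<lambda>k. X (r k) - abs_l2_field f) \<longlonglongrightarrow> 0"
  proof (rule Lim_null_comparison)
    show "\<forall>\<^sub>F k in sequentially. norm (X (r k) - abs_l2_field f) \<le> (1/4) ^ k"
      using bound by (simp add: norm_minus_commute)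
    show "(\<lambda>k. (1/4::real) ^ k) \<longlonglongrightarrow> 0" by (rule LIMSEQ_realpow_zero) simp_all
  qed
  then have "(\<lambda>k. X (r k)) \<longlonglongrightarrow> abs_l2_field f" by (rule LIM_zero_cancel)
  then have "(X \<circ> r) \<longlonglongrightarrow> abs_l2_field f" by (simp add: o_def)
  then have "X \<longlonglongrightarrow> abs_l2_field f"
    by (rule Cauchy_converges_subseq[OF assms r])
  then show ?thesis by (auto simp: convergent_def)
qed

lemma l2_limit_AE_subseq:
  fixes X :: "nat \<Rightarrow> l2_field"
  assumes "X \<longlonglongrightarrow> u"
  obtains r :: "nat \<Rightarrow> nat" where "strict_mono r"
    "AE x in lebesgue. (\<lambda>n. rep_l2_field (X (r n)) x) \<longlonglongrightarrow> rep_l2_field u x"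
proof -
  let ?d = "\<lambda>n x. (norm (rep_l2_field (X n - u) x))\<^sup>2"
  have int: "integrable lebesgue (?d n)" for n
    using sq_integrable_rep[of "X n - u"] by (simp add: sq_integrable_def)
  have "(\<lambda>n. (norm (X n - u))\<^sup>2) \<longlonglongrightarrow> 0"
    using tendsto_power[OF tendsto_norm_zero[OF LIM_zero[OF assms]], of 2] by simp
  then have "(\<lambda>n. \<integral>x. norm (?d n x) \<partial>lebesgue) \<longlonglongrightarrow> 0"
    by (simp add: norm2_l2_rep)
  from tendsto_L1_AE_subseq[OF int this]
  obtain r where r: "strict_mono r" "AE x in lebesgue. (\<lambda>n. ?d (r n) x) \<longlonglongrightarrow> 0" by blast
  have "AE x in lebesgue. \<forall>n. rep_l2_field (X (r n) - u) x = rep_l2_field (X (r n)) x - rep_l2_field u x"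
    unfolding AE_all_countable using rep_l2_diff by blast
  with r(2) have "AE x in lebesgue. (\<lambda>n. rep_l2_field (X (r n)) x) \<longlonglongrightarrow> rep_l2_field u x"
  proof eventually_elim
    case (elim x)
    have "(\<lambda>n. sqrt ((norm (rep_l2_field (X (r n)) x - rep_l2_field u x))\<^sup>2)) \<longlonglongrightarrow> sqrt 0"
      using elim by (intro tendsto_real_sqrt) simp
    then show ?case by (simp add: tendsto_norm_zero_iff LIM_zero_iff)
  qed
  with r(1) that show ?thesis by blast
qed

subsection \<open>Classes of functions on a region\<close>

lemma sq_integrable_bounded_on:
  fixes w :: "real^3 \<Rightarrow> real^3"
  assumes "w \<in> borel_measurable lebesgue" "\<Omega> \<in> lmeasurable" "\<And>x. x \<in> \<Omega> \<Longrightarrow> norm (w x) \<le> B"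
  shows "sq_integrable (\<lambda>x. indicator \<Omega> x *\<^sub>R w x)"
  unfolding sq_integrable_def
proof
  have [measurable]: "\<Omega> \<in> sets lebesgue" "w \<in> borel_measurable lebesgue"
    using assms by (auto simp: fmeasurable_def)
  show "(\<lambda>x. indicator \<Omega> x *\<^sub>R w x) \<in> borel_measurable lebesgue" by measurable
  show "integrable lebesgue (\<lambda>x. (norm (indicator \<Omega> x *\<^sub>R w x))\<^sup>2)"
  proof (rule Bochner_Integration.integrable_bound[where f = "\<lambda>x. B\<^sup>2 * indicator \<Omega> x"])
    show "integrable lebesgue (\<lambda>x. B\<^sup>2 * indicator \<Omega> x)"
      using assms(2) by (auto simp: fmeasurable_def)
    show "AE x in lebesgue. norm ((norm (indicator \<Omega> x *\<^sub>R w x))\<^sup>2) \<le> norm (B\<^sup>2 * indicator \<Omega> x :: real)"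
      using assms(3) by (auto intro!: AE_I2 power_mono simp: indicator_def)
  qed measurable
qed

lemma continuous_lebesgue_measurable:
  fixes w :: "'a::euclidean_space \<Rightarrow> 'b::{second_countable_topology, metric_space}"
  assumes "continuous_on UNIV w"
  shows "w \<in> borel_measurable lebesgue"
  by (rule measurable_completion) (simp add: borel_measurable_continuous_onI[OF assms])

lemma sq_integrable_continuous_on:
  fixes w :: "real^3 \<Rightarrow> real^3"
  assumes "continuous_on UNIV w" "\<Omega> \<in> lmeasurable" "bounded \<Omega>"
  shows "sq_integrable (\<lambda>x. indicator \<Omega> x *\<^sub>R w x)"
proof -
  have "compact (w ` closure \<Omega>)"
    using assms by (intro compact_continuous_image) (auto intro: continuous_on_subset)
  then have "bounded (w ` closure \<Omega>)" by (rule compact_imp_bounded)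
  then obtain B where "\<And>x. x \<in> closure \<Omega> \<Longrightarrow> norm (w x) \<le> B" unfolding bounded_iff by blast
  then show ?thesis using closure_subset[of \<Omega>]
    by (intro sq_integrable_bounded_on[OF _ assms(2), where B = B] continuous_lebesgue_measurable assms) auto
qed

lemma rep_l2_class:
  "sq_integrable (\<lambda>x. indicator \<Omega> x *\<^sub>R w x) \<Longrightarrow>
    AE x in lebesgue. rep_l2_field (l2_class \<Omega> w) x = indicator \<Omega> x *\<^sub>R w x"
  unfolding l2_class_def by (rule rep_abs_l2)

lemma l2_class_eqI:
  assumes "sq_integrable (\<lambda>x. indicator \<Omega> x *\<^sub>R w x)"
    "AE x in lebesgue. rep_l2_field u x = indicator \<Omega> x *\<^sub>R w x"
  shows "l2_class \<Omega> w = u"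
  by (rule l2_eqI) (use rep_l2_class[OF assms(1)] assms(2) in eventually_elim, simp)

lemma l2_class_in_l2_on:
  assumes "sq_integrable (\<lambda>x. indicator \<Omega> x *\<^sub>R w x)"
  shows "l2_class \<Omega> w \<in> l2_on \<Omega>"
  unfolding l2_on_def using rep_l2_class[OF assms] by auto

lemma l2_class_add:
  assumes "sq_integrable (\<lambda>x. indicator \<Omega> x *\<^sub>R v x)" "sq_integrable (\<lambda>x. indicator \<Omega> x *\<^sub>R w x)"
  shows "l2_class \<Omega> (\<lambda>x. v x + w x) = l2_class \<Omega> v + l2_class \<Omega> w"
proof (rule l2_class_eqI)
  show "sq_integrable (\<lambda>x. indicator \<Omega> x *\<^sub>R (v x + w x))"
    using sq_integrable_add[OF assms] by (simp add: scaleR_add_right)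
  show "AE x in lebesgue. rep_l2_field (l2_class \<Omega> v + l2_class \<Omega> w) x = indicator \<Omega> x *\<^sub>R (v x + w x)"
    using rep_l2_class[OF assms(1)] rep_l2_class[OF assms(2)] rep_l2_add[of "l2_class \<Omega> v" "l2_class \<Omega> w"]
    by eventually_elim (simp add: scaleR_add_right)
qed

lemma l2_class_scaleR:
  assumes "sq_integrable (\<lambda>x. indicator \<Omega> x *\<^sub>R w x)"
  shows "l2_class \<Omega> (\<lambda>x. c *\<^sub>R w x) = c *\<^sub>R l2_class \<Omega> w"
proof (rule l2_class_eqI)
  show "sq_integrable (\<lambda>x. indicator \<Omega> x *\<^sub>R c *\<^sub>R w x)"
    using sq_integrable_scaleR[OF assms, of c] by (simp add: mult.commute)
  show "AE x in lebesgue. rep_l2_field (c *\<^sub>R l2_class \<Omega> w) x = indicator \<Omega> x *\<^sub>R c *\<^sub>R w x"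
    using rep_l2_class[OF assms] rep_l2_scaleR[of c "l2_class \<Omega> w"]
    by eventually_elim (simp add: mult.commute)
qed

lemma l2_on_add: "u \<in> l2_on \<Omega> \<Longrightarrow> v \<in> l2_on \<Omega> \<Longrightarrow> u + v \<in> l2_on \<Omega>"
  unfolding l2_on_def mem_Collect_eq
proof -
  assume "AE x in lebesgue. x \<notin> \<Omega> \<longrightarrow> rep_l2_field u x = 0" "AE x in lebesgue. x \<notin> \<Omega> \<longrightarrow> rep_l2_field v x = 0"
  then show "AE x in lebesgue. x \<notin> \<Omega> \<longrightarrow> rep_l2_field (u + v) x = 0"
    using rep_l2_add[of u v] by eventually_elim simp
qed

lemma l2_on_scaleR: "u \<in> l2_on \<Omega> \<Longrightarrow> c *\<^sub>R u \<in> l2_on \<Omega>"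
  unfolding l2_on_def mem_Collect_eq
proof -
  assume "AE x in lebesgue. x \<notin> \<Omega> \<longrightarrow> rep_l2_field u x = 0"
  then show "AE x in lebesgue. x \<notin> \<Omega> \<longrightarrow> rep_l2_field (c *\<^sub>R u) x = 0"
    using rep_l2_scaleR[of c u] by eventually_elim simp
qed

lemma l2_on_diff: "u \<in> l2_on \<Omega> \<Longrightarrow> v \<in> l2_on \<Omega> \<Longrightarrow> u - v \<in> l2_on \<Omega>"
  using l2_on_add[of u \<Omega> "(-1) *\<^sub>R v"] l2_on_scaleR[of v \<Omega> "-1"] by simp

lemma l2_on_limit:
  assumes "\<And>n. X n \<in> l2_on \<Omega>" "X \<longlonglongrightarrow> u"
  shows "u \<in> l2_on \<Omega>"
proof -
  obtain r where r: "AE x in lebesgue. (\<lambda>n. rep_l2_field (X (r n)) x) \<longlonglongrightarrow> rep_l2_field u x"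
    using l2_limit_AE_subseq[OF assms(2)] by blast
  have "AE x in lebesgue. \<forall>n. x \<notin> \<Omega> \<longrightarrow> rep_l2_field (X (r n)) x = 0"
    unfolding AE_all_countable using assms(1) unfolding l2_on_def mem_Collect_eq by blast
  with r show ?thesis unfolding l2_on_def mem_Collect_eq
  proof eventually_elim
    case (elim x)
    show ?case
    proof
      assume "x \<notin> \<Omega>"
      with elim show "rep_l2_field u x = 0" using LIMSEQ_unique[OF tendsto_const[of 0]] by fastforce
    qed
  qed
qed

lemma inner_l2_class:
  assumes "sq_integrable (\<lambda>x. indicator \<Omega> x *\<^sub>R w x)"
  shows "u \<bullet> l2_class \<Omega> w = (\<integral>x. rep_l2_field u x \<bullet> (indicator \<Omega> x *\<^sub>R w x) \<partial>lebesgue)"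
  by (rule inner_l2_cong[OF _ rep_l2_class[OF assms] sq_integrable_rep assms]) simp

subsection \<open>Separability\<close>

text \<open>The countable set may leave \<open>S\<close>, which makes the notion pass to subsets at
  once; \<open>separable_set_dense_subset\<close> moves it back inside.\<close>

definition separable_set :: "'a::metric_space set \<Rightarrow> bool" where
  "separable_set S \<longleftrightarrow> (\<exists>C. countable C \<and> S \<subseteq> closure C)"

lemma separable_set_subset: "separable_set S \<Longrightarrow> T \<subseteq> S \<Longrightarrow> separable_set T"
  unfolding separable_set_def by blast

lemma separable_set_closure: "separable_set S \<Longrightarrow> separable_set (closure S)"
  unfolding separable_set_def by (metis closed_closure closure_minimal)

lemma separable_set_Times: "separable_set S \<Longrightarrow> separable_set T \<Longrightarrow> separable_set (S \<times> T)"
  unfolding separable_set_def by (metis closure_Times countable_SIGMA Sigma_mono)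

text \<open>One point of \<open>S\<close> is chosen in each ball of radius
  \<open>1 / (n + 1)\<close> about a point of the given countable set that meets \<open>S\<close>;
  the triangle inequality costs a factor of two in the radius.\<close>

lemma separable_set_dense_subset:
  assumes "separable_set S"
  obtains C where "countable C" "C \<subseteq> S" "S \<subseteq> closure C"
proof -
  obtain D where D: "countable D" "S \<subseteq> closure D" using assms unfolding separable_set_def by blast
  define I where "I = {(d, n). d \<in> D \<and> ball d (1 / real (Suc n)) \<inter> S \<noteq> {}}"
  define p where "p = (\<lambda>(d, n). SOME y. y \<in> ball d (1 / real (Suc n)) \<inter> S)"
  have p: "p (d, n) \<in> ball d (1 / real (Suc n)) \<inter> S" if "(d, n) \<in> I" for d n
  proof -
    have "\<exists>y. y \<in> ball d (1 / real (Suc n)) \<inter> S" using that unfolding I_def by blast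
    then have "(SOME y. y \<in> ball d (1 / real (Suc n)) \<inter> S) \<in> ball d (1 / real (Suc n)) \<inter> S" by (rule someI_ex)
    then show ?thesis by (simp only: p_def prod.case)
  qed
  have cI: "countable I"
    by (rule countable_subset[of _ "D \<times> (UNIV :: nat set)"]) (auto simp: I_def D)
  have dense: "S \<subseteq> closure (p ` I)"
  proof
    fix x assume x: "x \<in> S"
    show "x \<in> closure (p ` I)" unfolding closure_approachable
    proof (intro allI impI)
      fix e :: real assume "0 < e"
      then obtain n where n: "1 / real (Suc n) < e / 2"
        using reals_Archimedean[of "e/2"] by (auto simp: inverse_eq_divide)
      obtain d where d: "d \<in> D" "dist d x < 1 / real (Suc n)"
        using subsetD[OF D(2) x] unfolding closure_approachable by (metis divide_pos_pos of_nat_0_less_iff zero_less_Suc zero_less_one)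
      then have I: "(d, n) \<in> I" using x by (auto simp: I_def)
      from p[OF this] have "dist d (p (d, n)) < 1 / real (Suc n)" by simp
      then have "dist (p (d, n)) x < e"
        using d(2) n dist_triangle[of "p (d, n)" x d] by (simp add: dist_commute)
      with I show "\<exists>y\<in>p ` I. dist y x < e" by blast
    qed
  qed
  have sub: "p ` I \<subseteq> S"
  proof (rule image_subsetI)
    fix z assume "z \<in> I"
    then show "p z \<in> S" using p[of "fst z" "snd z"] by (simp only: prod.collapse Int_iff)
  qed
  from countable_image[OF cI] sub dense show ?thesis by (rule that)
qed

text \<open>Lindelof's covering in the form needed for measurability: a map into \<open>S\<close>
  has measurable preimages of open sets as soon as its distance to each point of \<open>C\<close> is
  measurable.\<close>

lemma separable_open_balls:
  assumes "S \<subseteq> closure C" "open U"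
  shows "S \<inter> U = (\<Union>(c, n)\<in>{(c, n). c \<in> C \<and> ball c (1 / real (Suc n)) \<subseteq> U}. S \<inter> ball c (1 / real (Suc n)))"
    (is "_ = ?R")
proof
  show "S \<inter> U \<subseteq> ?R"
  proof
    fix x assume x: "x \<in> S \<inter> U"
    then obtain e where e: "e > 0" "ball x e \<subseteq> U" using assms(2) openE by blast
    obtain n where n: "1 / real (Suc n) < e / 2"
      using reals_Archimedean[of "e/2"] e by (auto simp: inverse_eq_divide)
    have "x \<in> closure C" using x assms by blast
    then obtain c where c: "c \<in> C" "dist c x < 1 / real (Suc n)"
      unfolding closure_approachable by (meson divide_pos_pos of_nat_0_less_iff zero_less_Suc zero_less_one)
    have "ball c (1 / real (Suc n)) \<subseteq> ball x e"
    proof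
      fix y assume "y \<in> ball c (1 / real (Suc n))"
      then show "y \<in> ball x e" using c(2) n dist_triangle[of x y c] by (simp add: dist_commute)
    qed
    then show "x \<in> ?R" using c x e by auto
  qed
qed auto

lemma separable_set_span:
  fixes B :: "'a::real_normed_vector set"
  assumes "countable B"
  shows "separable_set (span B)"
proof -
  define C where "C = (\<lambda>l. \<Sum>(q, b)\<leftarrow>l. of_rat q *\<^sub>R b) ` lists ((UNIV :: rat set) \<times> B)"
  have "countable C" unfolding C_def using assms by auto
  have "x \<in> closure C" if "x \<in> span B" for x
    using that
  proof (induction rule: span_induct_alt)
    case base
    have "(\<Sum>(q, b)\<leftarrow>[]. of_rat q *\<^sub>R b) \<in> C" unfolding C_def by (rule imageI) simp
    then show ?case using closure_subset[of C] by auto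
  next
    case (step c b y)
    show ?case unfolding closure_approachable
    proof (intro allI impI)
      fix e :: real assume "0 < e"
      then obtain z where z: "z \<in> C" "dist z y < e / 2"
        using step(2) unfolding closure_approachable by (meson half_gt_zero)
      \<comment> \<open>The \<open>+ 1\<close> covers \<open>b = 0\<close>; the other half of
        \<open>e\<close> is spent on approximating \<open>y\<close>.\<close>
      have pos: "e / 2 / (norm b + 1) > 0" using \<open>0 < e\<close> by (auto intro!: divide_pos_pos add_nonneg_pos)
      then obtain q :: rat where q: "c < of_rat q" "of_rat q < c + e / 2 / (norm b + 1)"
        using of_rat_dense[of c "c + e / 2 / (norm b + 1)"] by auto
      obtain l where l: "l \<in> lists (UNIV \<times> B)" "z = (\<Sum>(q, b)\<leftarrow>l. of_rat q *\<^sub>R b)"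
        using z(1) unfolding C_def by blast
      have in_C: "of_rat q *\<^sub>R b + z \<in> C"
        unfolding C_def using l step(1) by (intro image_eqI[where x = "(q, b) # l"]) auto
      have "dist (of_rat q *\<^sub>R b + z) (c *\<^sub>R b + y) \<le> norm ((of_rat q - c) *\<^sub>R b) + norm (z - y)"
        unfolding dist_norm by (rule order_trans[OF _ norm_triangle_ineq]) (simp add: algebra_simps)
      also have "norm ((of_rat q - c) *\<^sub>R b) \<le> (e / 2 / (norm b + 1)) * norm b"
        using q by (simp only: norm_scaleR, intro mult_right_mono) auto
      also have "(e / 2 / (norm b + 1)) * norm b \<le> e / 2"
        using \<open>0 < e\<close> mult_left_le[of "norm b / (norm b + 1)" "e / 2"]
        by (simp add: divide_le_eq_1 add_nonneg_pos)
      finally show "\<exists>y'\<in>C. dist y' (c *\<^sub>R b + y) < e"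
        using in_C z(2) by (intro bexI[of _ "of_rat q *\<^sub>R b + z"]) (auto simp: dist_norm)
    qed
  qed
  with \<open>countable C\<close> show ?thesis unfolding separable_set_def by blast
qed

section \<open>Approximation by step fields on cubic grids\<close>

definition grid_cell :: "nat \<Rightarrow> int^3 \<Rightarrow> (real^3) set" where
  "grid_cell n k = {x. \<forall>j. \<lfloor>real (Suc n) * x $ j\<rfloor> = k $ j}"

text \<open>A countable family, indexed by mesh, cell and direction. The closure of its span
  contains the classes of all continuous fields on a bounded set, hence all of \<open>H\<close> and
  the weak derivatives of all elements of \<open>V\<close>.\<close>

definition grid_steps :: "(real^3) set \<Rightarrow> l2_field set" where
  "grid_steps \<Omega> = range (\<lambda>(n, k, i). l2_class \<Omega> (\<lambda>x. indicator (grid_cell n k) x *\<^sub>R axis i 1))"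

lemma countable_grid_steps: "countable (grid_steps \<Omega>)"
  unfolding grid_steps_def by (intro countable_image countableI_type)

lemma grid_cell_borel [measurable]: "grid_cell n k \<in> sets borel"
proof -
  have "grid_cell n k = (\<Inter>j. {x \<in> space borel. \<lfloor>real (Suc n) * x $ j\<rfloor> = k $ j})"
    unfolding grid_cell_def by auto
  also have "\<dots> \<in> sets borel" by measurable
  finally show ?thesis .
qed

lemma finite_bounded_int_vecs: "finite {k :: int^3. \<forall>j. \<bar>k $ j\<bar> \<le> M}"
proof (rule finite_imageD[of vec_nth])
  have "vec_nth ` {k :: int^3. \<forall>j. \<bar>k $ j\<bar> \<le> M} \<subseteq> PiE UNIV (\<lambda>_. {-M..M})" by (auto simp: abs_le_iff minus_le_iff)
  then show "finite (vec_nth ` {k :: int^3. \<forall>j. \<bar>k $ j\<bar> \<le> M})"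
    by (rule finite_subset) (intro finite_PiE; simp)
  show "inj_on vec_nth {k :: int^3. \<forall>j. \<bar>k $ j\<bar> \<le> M}" by (auto simp: inj_on_def vec_nth_inject)
qed

text \<open>The field is sampled at the lower corner of the grid cell containing the point; uniform
  boundedness on a slightly larger ball and dominated convergence give convergence in L^2.\<close>

lemma l2_class_continuous_in_steps:
  fixes w :: "real^3 \<Rightarrow> real^3"
  assumes w: "continuous_on UNIV w" and \<Omega>: "\<Omega> \<in> lmeasurable" "bounded \<Omega>"
  shows "l2_class \<Omega> w \<in> closure (span (grid_steps \<Omega>))"
proof -
  have [measurable]: "\<Omega> \<in> sets lebesgue" using \<Omega>(1) by (simp add: fmeasurable_def)
  obtain R where R: "R > 0" "\<And>x. x \<in> \<Omega> \<Longrightarrow> norm x \<le> R"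
    using \<Omega>(2) unfolding bounded_pos by blast
  define g :: "nat \<Rightarrow> real^3 \<Rightarrow> int^3" where "g n x = (\<chi> j. \<lfloor>real (Suc n) * x $ j\<rfloor>)" for n x
  define p :: "nat \<Rightarrow> int^3 \<Rightarrow> real^3" where "p n k = (\<chi> j. real_of_int (k $ j) / real (Suc n))" for n k
  \<comment> \<open>Each of the three coordinates is off by at most one mesh width, and the
    Euclidean norm is bounded by the sum of the absolute coordinates.\<close>
  have near: "norm (p n (g n x) - x) \<le> 3 / real (Suc n)" for n x
  proof -
    have "\<bar>(p n (g n x) - x) $ j\<bar> \<le> 1 / real (Suc n)" for j
    proof -
      have "\<bar>real_of_int \<lfloor>real (Suc n) * x $ j\<rfloor> - real (Suc n) * x $ j\<bar> \<le> 1" by linarith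
      then have "\<bar>(real_of_int \<lfloor>real (Suc n) * x $ j\<rfloor> - real (Suc n) * x $ j) / real (Suc n)\<bar> \<le> 1 / real (Suc n)"
        by (simp add: divide_right_mono)
      then show ?thesis by (simp add: p_def g_def diff_divide_distrib)
    qed
    then have "(\<Sum>j\<in>UNIV. \<bar>(p n (g n x) - x) $ j\<bar>) \<le> (\<Sum>j\<in>(UNIV::3 set). 1 / real (Suc n))"
      by (intro sum_mono)
    then show ?thesis using norm_le_l1_cart[of "p n (g n x) - x"] by simp
  qed
  have lim: "(\<lambda>n. p n (g n x)) \<longlonglongrightarrow> x" for x
  proof -
    have "(\<lambda>n. 3 * (1 / real (Suc n))) \<longlonglongrightarrow> 3 * 0"
      by (intro tendsto_mult tendsto_const LIMSEQ_Suc[OF lim_1_over_n])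
    then have "(\<lambda>n. 3 / real (Suc n)) \<longlonglongrightarrow> 0" by simp
    then have "(\<lambda>n. p n (g n x) - x) \<longlonglongrightarrow> 0"
      by (rule Lim_null_comparison[rotated]) (simp add: near del: of_nat_Suc)
    then show ?thesis by (simp add: LIM_zero_iff)
  qed
  \<comment> \<open>The sampling corner may lie outside \<Omega>, by at most 3, the error bound at
    the coarsest mesh.\<close>
  have "bounded (w ` cball 0 (R + 3))"
    using w by (intro compact_imp_bounded compact_continuous_image) (auto intro: continuous_on_subset)
  then obtain B where B: "\<And>x. norm x \<le> R + 3 \<Longrightarrow> norm (w x) \<le> B"
    unfolding bounded_iff by (metis image_eqI mem_cball_0)
  have B1: "norm (w x) \<le> B" if "x \<in> \<Omega>" for x using B R(2)[OF that] by simp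
  have B2: "norm (w (p n (g n x))) \<le> B" if "x \<in> \<Omega>" for n x
  proof (rule B)
    have "3 / real (Suc n) \<le> 3" by (simp add: field_simps)
    then show "norm (p n (g n x)) \<le> R + 3"
      using near[of n x] R(2)[OF that] norm_triangle_ineq[of "p n (g n x) - x" x] by simp
  qed
  have "B \<ge> 0" using B[of 0] R(1) norm_ge_zero[of "w 0"] by (simp, linarith)
  have wl [measurable]: "w \<in> borel_measurable lebesgue" using w by (rule continuous_lebesgue_measurable)
  \<comment> \<open>A cell whose label lies outside this finite set misses \<Omega>; finiteness is
    what puts the step field in the span.\<close>
  define K :: "nat \<Rightarrow> (int^3) set" where "K n = {k. \<forall>j. \<bar>k $ j\<bar> \<le> \<lceil>real (Suc n) * R\<rceil> + 1}" for n
  have finK: "finite (K n)" for n unfolding K_def by (rule finite_bounded_int_vecs)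
  have gK: "g n x \<in> K n" if "x \<in> \<Omega>" for n x
  proof -
    have "\<bar>\<lfloor>real (Suc n) * x $ j\<rfloor>\<bar> \<le> \<lceil>real (Suc n) * R\<rceil> + 1" for j
    proof -
      have "\<bar>x $ j\<bar> \<le> R" using component_le_norm_cart[of x j] R(2)[OF that] by linarith
      then have "\<bar>real (Suc n) * x $ j\<bar> \<le> real (Suc n) * R"
        by (simp add: abs_mult mult_left_mono)
      then show ?thesis by linarith
    qed
    then show ?thesis by (simp add: K_def g_def)
  qed
  define s :: "nat \<Rightarrow> real^3 \<Rightarrow> real^3" where "s n x = (\<Sum>k\<in>K n. \<Sum>i\<in>UNIV.
    (w (p n k) $ i) *\<^sub>R (indicator (grid_cell n k) x *\<^sub>R axis i 1))" for n x
  have cellL [measurable]: "grid_cell n k \<in> sets lebesgue" for n k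
    using grid_cell_borel[of n k] by auto
  have s_eq: "s n x = w (p n (g n x))" if "x \<in> \<Omega>" for n x
  proof -
    have "s n x = (\<Sum>k\<in>K n. indicator (grid_cell n k) x *\<^sub>R w (p n k))"
      unfolding s_def
    proof (rule sum.cong[OF refl])
      fix k
      have "(\<Sum>i\<in>UNIV. (w (p n k) $ i) *\<^sub>R (indicator (grid_cell n k) x *\<^sub>R (axis i 1 :: real^3)))
        = indicator (grid_cell n k) x *\<^sub>R (\<Sum>i\<in>UNIV. (w (p n k) $ i) *\<^sub>R axis i 1)"
        by (simp add: scaleR_sum_right mult.commute)
      also have "(\<Sum>i\<in>UNIV. (w (p n k) $ i) *\<^sub>R (axis i 1 :: real^3)) = w (p n k)"
        using basis_expansion[of "w (p n k)"] by (simp add: scalar_mult_eq_scaleR)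
      finally show "(\<Sum>i\<in>UNIV. (w (p n k) $ i) *\<^sub>R (indicator (grid_cell n k) x *\<^sub>R (axis i 1 :: real^3)))
        = indicator (grid_cell n k) x *\<^sub>R w (p n k)" .
    qed
    also have "\<dots> = (\<Sum>k\<in>K n. if k = g n x then w (p n k) else 0)"
      by (rule sum.cong) (auto simp: grid_cell_def g_def indicator_def vec_eq_iff)
    also have "\<dots> = w (p n (g n x))" using gK[OF that] finK by simp
    finally show ?thesis .
  qed
  have [measurable]: "s n \<in> borel_measurable lebesgue" for n unfolding s_def by measurable
  have B2': "norm (s n x) \<le> B" if "x \<in> \<Omega>" for n x using B2[OF that] s_eq[OF that] by simp
  have sqw: "sq_integrable (\<lambda>x. indicator \<Omega> x *\<^sub>R w x)"
    using w \<Omega> by (rule sq_integrable_continuous_on)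
  have sqs: "sq_integrable (\<lambda>x. indicator \<Omega> x *\<^sub>R s n x)" for n
    by (rule sq_integrable_bounded_on[OF _ \<Omega>(1) B2']) auto
  have sqc: "sq_integrable (\<lambda>x. indicator \<Omega> x *\<^sub>R (c *\<^sub>R (indicator (grid_cell n k) x *\<^sub>R axis i 1)))" for n k i c
    by (rule sq_integrable_bounded_on[OF _ \<Omega>(1), where B = "\<bar>c\<bar>"]) (auto simp: indicator_def)
  have in_span: "l2_class \<Omega> (s n) \<in> span (grid_steps \<Omega>)" for n
  proof -
    have base: "l2_class \<Omega> (\<lambda>x. c *\<^sub>R (indicator (grid_cell n k) x *\<^sub>R axis i 1)) \<in> span (grid_steps \<Omega>)" for k i c
    proof -
      have "l2_class \<Omega> (\<lambda>x. indicator (grid_cell n k) x *\<^sub>R axis i 1) \<in> span (grid_steps \<Omega>)"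
        unfolding grid_steps_def by (rule span_base, rule range_eqI[of _ _ "(n, k, i)"]) simp
      then show ?thesis
        using sqc[of 1 n k i] by (subst l2_class_scaleR) (auto intro: span_scale)
    qed
    have "finite A \<Longrightarrow> sq_integrable (\<lambda>x. indicator \<Omega> x *\<^sub>R (\<Sum>a\<in>A. F a x)) \<and>
        l2_class \<Omega> (\<lambda>x. \<Sum>a\<in>A. F a x) \<in> span (grid_steps \<Omega>)"
      if F: "\<And>a. sq_integrable (\<lambda>x. indicator \<Omega> x *\<^sub>R F a x)" "\<And>a. l2_class \<Omega> (F a) \<in> span (grid_steps \<Omega>)"
      for A :: "'z set" and F :: "'z \<Rightarrow> real^3 \<Rightarrow> real^3"
    proof (induction A rule: finite_induct)
      case empty
      have "l2_class \<Omega> (\<lambda>x. 0) = 0"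
        using sq_integrable_zero rep_l2_zero by (intro l2_class_eqI) simp_all
      then show ?case using sq_integrable_zero by (simp add: span_zero)
    next
      case (insert a A)
      then show ?case
        using sq_integrable_add[OF F(1)[of a] conjunct1[OF insert(3)]]
        by (simp add: scaleR_add_right l2_class_add[OF F(1)] span_add F(2))
    qed
    note sum_closed = this
    have inner_sum: "sq_integrable (\<lambda>x. indicator \<Omega> x *\<^sub>R (\<Sum>i\<in>UNIV. (w (p n k) $ i) *\<^sub>R (indicator (grid_cell n k) x *\<^sub>R axis i 1)))"
      "l2_class \<Omega> (\<lambda>x. \<Sum>i\<in>UNIV. (w (p n k) $ i) *\<^sub>R (indicator (grid_cell n k) x *\<^sub>R axis i 1)) \<in> span (grid_steps \<Omega>)" for k
      using sum_closed[of "\<lambda>i x. (w (p n k) $ i) *\<^sub>R (indicator (grid_cell n k) x *\<^sub>R axis i 1)" UNIV] sqc base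
      by (auto simp del: scaleR_scaleR)
    show ?thesis unfolding s_def
      using sum_closed[of "\<lambda>k x. \<Sum>i\<in>UNIV. (w (p n k) $ i) *\<^sub>R (indicator (grid_cell n k) x *\<^sub>R axis i 1)" "K n"]
        inner_sum finK by blast
  qed
  have "(\<lambda>n. \<integral>x. (norm (indicator \<Omega> x *\<^sub>R (s n x - w x)))\<^sup>2 \<partial>lebesgue) \<longlonglongrightarrow> (\<integral>x. 0 \<partial>(lebesgue :: (real^3) measure))"
  proof (rule integral_dominated_convergence[where w = "\<lambda>x. (2 * B)\<^sup>2 * indicator \<Omega> x"])
    show "integrable lebesgue (\<lambda>x. (2 * B)\<^sup>2 * indicator \<Omega> x :: real)"
      using \<Omega>(1) by (auto simp: fmeasurable_def)
    show "AE x in lebesgue. (\<lambda>n. (norm (indicator \<Omega> x *\<^sub>R (s n x - w x)))\<^sup>2) \<longlonglongrightarrow> 0"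
    proof (rule AE_I2)
      fix x
      have "isCont w x" using w by (simp add: continuous_on_eq_continuous_at)
      then have "(\<lambda>n. w (p n (g n x))) \<longlonglongrightarrow> w x" using isCont_tendsto_compose[OF _ lim] by blast
      then have "(\<lambda>n. (norm (indicator \<Omega> x *\<^sub>R (w (p n (g n x)) - w x)))\<^sup>2) \<longlonglongrightarrow> (norm (indicator \<Omega> x *\<^sub>R (w x - w x)))\<^sup>2"
        by (intro tendsto_intros)
      then show "(\<lambda>n. (norm (indicator \<Omega> x *\<^sub>R (s n x - w x)))\<^sup>2) \<longlonglongrightarrow> 0"
        by (cases "x \<in> \<Omega>") (simp_all add: s_eq)
    qed
    show "AE x in lebesgue. norm ((norm (indicator \<Omega> x *\<^sub>R (s n x - w x)))\<^sup>2) \<le> (2 * B)\<^sup>2 * indicator \<Omega> x" for n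
    proof (rule AE_I2)
      fix x
      show "norm ((norm (indicator \<Omega> x *\<^sub>R (s n x - w x)))\<^sup>2) \<le> (2 * B)\<^sup>2 * indicator \<Omega> x"
        using B2'[of x n] B1[of x] norm_triangle_ineq4[of "s n x" "w x"]
          power_mono[of "norm (s n x - w x)" "2 * B" 2]
        by (cases "x \<in> \<Omega>") auto
    qed
  qed simp_all
  moreover have "(\<integral>x. (norm (indicator \<Omega> x *\<^sub>R (s n x - w x)))\<^sup>2 \<partial>lebesgue) = (norm (l2_class \<Omega> (s n) - l2_class \<Omega> w))\<^sup>2" for n
    unfolding norm2_l2_rep
  proof (rule integral_cong_AE)
    show "AE x in lebesgue. (norm (indicator \<Omega> x *\<^sub>R (s n x - w x)))\<^sup>2 = (norm (rep_l2_field (l2_class \<Omega> (s n) - l2_class \<Omega> w) x))\<^sup>2"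
      using rep_l2_class[OF sqw] rep_l2_class[OF sqs[of n]] rep_l2_diff[of "l2_class \<Omega> (s n)" "l2_class \<Omega> w"]
      by eventually_elim (simp add: scaleR_diff_right)
  qed measurable
  ultimately have "(\<lambda>n. sqrt ((norm (l2_class \<Omega> (s n) - l2_class \<Omega> w))\<^sup>2)) \<longlonglongrightarrow> sqrt 0"
    by (intro tendsto_real_sqrt) simp
  then have "(\<lambda>n. l2_class \<Omega> (s n)) \<longlonglongrightarrow> l2_class \<Omega> w"
    by (simp add: tendsto_norm_zero_iff LIM_zero_iff)
  then show ?thesis using in_span unfolding closure_sequential by (intro exI[of _ "\<lambda>n. l2_class \<Omega> (s n)"]) blast
qed

section \<open>Smooth functions\<close>

lemma C_k_continuous: "C_k n f \<Longrightarrow> continuous_on UNIV f"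
  by (cases n) (auto intro!: continuous_at_imp_continuous_on dest: has_derivative_continuous)

lemma C_k_Suc_imp: "C_k (Suc n) f \<Longrightarrow> C_k n f"
proof (induction n arbitrary: f)
  case 0
  show ?case using C_k_continuous[OF 0] by simp
next
  case (Suc n)
  obtain f' where f': "\<And>x. (f has_derivative f' x) (at x)" "\<And>v. C_k (Suc n) (\<lambda>x. f' x v)"
    using Suc.prems by (subst (asm) C_k.simps(2)) blast
  show ?case unfolding C_k.simps(2)[of n f] using f' Suc.IH by blast
qed

lemma C_k_Suc_I:
  assumes "\<And>x. (f has_derivative f' x) (at x)" "\<And>v. C_k n (\<lambda>x. f' x v)"
  shows "C_k (Suc n) f"
  unfolding C_k.simps(2) using assms by blast

lemma C_k_const: "C_k n (\<lambda>x. c)"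
proof (induction n arbitrary: c)
  case (Suc n)
  show ?case by (rule C_k_Suc_I[where f' = "\<lambda>_ _. 0"]) (use Suc in \<open>auto intro!: derivative_eq_intros\<close>)
qed simp

lemma C_k_add:
  fixes f g :: "'a::real_normed_vector \<Rightarrow> 'b::real_normed_vector"
  shows "C_k n f \<Longrightarrow> C_k n g \<Longrightarrow> C_k n (\<lambda>x. f x + g x)"
proof (induction n arbitrary: f g)
  case (Suc n)
  obtain f' where f': "\<And>x. (f has_derivative f' x) (at x)" "\<And>v. C_k n (\<lambda>x. f' x v)"
    using Suc.prems(1) unfolding C_k.simps(2) by blast
  obtain g' where g': "\<And>x. (g has_derivative g' x) (at x)" "\<And>v. C_k n (\<lambda>x. g' x v)"
    using Suc.prems(2) unfolding C_k.simps(2) by blast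
  show ?case
    by (rule C_k_Suc_I[where f' = "\<lambda>x v. f' x v + g' x v"])
      (auto intro!: has_derivative_add f' g' Suc.IH)
qed (auto intro: continuous_intros)

lemma C_k_scaleR:
  fixes f :: "'a::real_normed_vector \<Rightarrow> real" and g :: "'a \<Rightarrow> 'b::real_normed_vector"
  shows "C_k n f \<Longrightarrow> C_k n g \<Longrightarrow> C_k n (\<lambda>x. f x *\<^sub>R g x)"
proof (induction n arbitrary: f g)
  case (Suc n)
  obtain f' where f': "\<And>x. (f has_derivative f' x) (at x)" "\<And>v. C_k n (\<lambda>x. f' x v)"
    using Suc.prems(1) unfolding C_k.simps(2) by blast
  obtain g' where g': "\<And>x. (g has_derivative g' x) (at x)" "\<And>v. C_k n (\<lambda>x. g' x v)"
    using Suc.prems(2) unfolding C_k.simps(2) by blast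
  show ?case
    by (rule C_k_Suc_I[where f' = "\<lambda>x v. f x *\<^sub>R g' x v + f' x v *\<^sub>R g x"])
      (rule has_derivative_scaleR f' g' C_k_add Suc.IH Suc.prems C_k_Suc_imp)+
qed (auto intro: continuous_intros)

lemma C_k_mult:
  fixes f g :: "'a::real_normed_vector \<Rightarrow> real"
  shows "C_k n f \<Longrightarrow> C_k n g \<Longrightarrow> C_k n (\<lambda>x. f x * g x)"
  using C_k_scaleR[of n f g] by simp

lemma C_k_prod:
  fixes f :: "'i \<Rightarrow> 'a::real_normed_vector \<Rightarrow> real"
  assumes "\<And>i. i \<in> A \<Longrightarrow> C_k n (f i)"
  shows "C_k n (\<lambda>x. \<Prod>i\<in>A. f i x)"
  using assms by (induction A rule: infinite_finite_induct) (auto intro: C_k_const C_k_mult)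

text \<open>The inner derivative \<open>L\<close> does not depend on the point, so differentiating
  reproduces the same shape and the induction closes without a higher-order chain rule.\<close>

lemma C_k_affine:
  fixes f :: "real \<Rightarrow> 'b::real_normed_vector" and A :: "'a::real_normed_vector \<Rightarrow> real"
  assumes "C_k n f" "\<And>x. (A has_derivative L) (at x)"
  shows "C_k n (\<lambda>x. f (A x))"
  using assms(1)
proof (induction n arbitrary: f)
  case 0
  have "continuous_on UNIV A"
    using assms(2) by (auto intro!: continuous_at_imp_continuous_on dest: has_derivative_continuous)
  with 0 show ?case by (auto intro: continuous_on_compose2)
next
  case (Suc n)
  obtain f' where f': "\<And>x. (f has_derivative f' x) (at x)" "\<And>v. C_k n (\<lambda>x. f' x v)"
    using Suc.prems unfolding C_k.simps(2) by blast
  show ?case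
  proof (rule C_k_Suc_I[where f' = "\<lambda>x v. f' (A x) (L v)"])
    show "((\<lambda>x. f (A x)) has_derivative (\<lambda>v. f' (A x) (L v))) (at x)" for x
      using has_derivative_compose[OF assms(2) f'(1)] .
    show "C_k n (\<lambda>x. f' (A x) (L v))" for v by (rule Suc.IH[OF f'(2)])
  qed
qed

lemma smooth_has_derivative:
  assumes "smooth f"
  shows "(f has_derivative frechet_derivative f (at x)) (at x)"
    "continuous_on UNIV (\<lambda>x. frechet_derivative f (at x) v)"
proof -
  have "C_k (Suc 0) f" using assms by (simp add: smooth_def del: C_k.simps)
  then obtain f' where f': "\<And>x. (f has_derivative f' x) (at x)" "\<And>v. C_k 0 (\<lambda>x. f' x v)"
    unfolding C_k.simps(2) by blast
  have eq: "frechet_derivative f (at x) = f' x" for x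
    using frechet_derivative_at[OF f'(1)] by simp
  show "(f has_derivative frechet_derivative f (at x)) (at x)" using f'(1) eq by simp
  show "continuous_on UNIV (\<lambda>x. frechet_derivative f (at x) v)" using f'(2) eq by simp
qed

lemma smooth_continuous: "smooth f \<Longrightarrow> continuous_on UNIV f"
  using C_k_continuous unfolding smooth_def by blast

subsection \<open>Bump functions\<close>

text \<open>The flat function \<open>x^(-m) exp(-c/x)\<close>, extended by zero. The exponent
  \<open>m\<close> makes the family closed under differentiation; the parameter \<open>c\<close> is
  there to be sent to zero, when the function with \<open>m = 0\<close> tends to 1 on the positive
  half-line.\<close>

definition flat_exp :: "real \<Rightarrow> nat \<Rightarrow> real \<Rightarrow> real" where
  "flat_exp c m x = (if 0 < x then (1 / x) ^ m * exp (- (c / x)) else 0)"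

lemma flat_exp_tendsto_0:
  assumes "0 < c"
  shows "(flat_exp c m \<longlongrightarrow> 0) (at_right 0)"
proof -
  have "filterlim (\<lambda>x::real. c * inverse x) at_top (at_right 0)"
    by (rule filterlim_tendsto_pos_mult_at_top[OF tendsto_const assms filterlim_inverse_at_top_right])
  then have "((\<lambda>x. (c * inverse x) ^ m / exp (c * inverse x)) \<longlongrightarrow> 0) (at_right 0)"
    by (rule filterlim_compose[OF tendsto_power_div_exp_0])
  then have "((\<lambda>x. inverse (c ^ m) * ((c * inverse x) ^ m / exp (c * inverse x))) \<longlongrightarrow> inverse (c ^ m) * 0) (at_right 0)"
    by (rule tendsto_mult_left)
  moreover have "\<forall>\<^sub>F x in at_right 0. inverse (c ^ m) * ((c * inverse x) ^ m / exp (c * inverse x)) = flat_exp c m x"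
    unfolding eventually_at_right_field
    by (rule exI[of _ 1]) (use assms in \<open>auto simp: flat_exp_def exp_minus field_simps\<close>)
  ultimately show ?thesis by (simp add: tendsto_cong)
qed

text \<open>At the origin the right difference quotient of the function with index \<open>m\<close>
  is the function with index \<open>m + 1\<close>, which tends to zero; so the formula, whose terms
  all vanish there, remains valid.\<close>

lemma flat_exp_deriv:
  assumes "0 < c"
  shows "(flat_exp c m has_real_derivative (c * flat_exp c (m + 2) x - real m * flat_exp c (m + 1) x)) (at x)"
proof (cases x "0::real" rule: linorder_cases)
  case less
  have "((\<lambda>x. 0) has_real_derivative 0) (at x)" by simp
  then show ?thesis
  proof (rule DERIV_cong[OF has_field_derivative_transform_within_open[where S = "{..<0}"]])
  qed (use less in \<open>auto simp: flat_exp_def\<close>)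
next
  case greater
  have "((\<lambda>x. (1 / x) ^ m * exp (- (c / x))) has_real_derivative
      (c * flat_exp c (m + 2) x - real m * flat_exp c (m + 1) x)) (at x)"
  proof -
    have inv: "((\<lambda>x. 1 / x) has_real_derivative - ((1 / x) ^ 2)) (at x)"
      using greater by (auto intro!: derivative_eq_intros simp: power2_eq_square)
    have pow: "((\<lambda>x. (1 / x) ^ m) has_real_derivative - (real m * (1 / x) ^ (m + 1))) (at x)"
      by (rule DERIV_cong[OF DERIV_power[OF inv]]) (cases m; simp add: power2_eq_square)
    have "((\<lambda>x. exp (- (c / x))) has_real_derivative c * (1 / x) ^ 2 * exp (- (c / x))) (at x)"
      using greater by (auto intro!: derivative_eq_intros simp: power2_eq_square)
    from DERIV_mult[OF pow this] show ?thesis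
      by (rule DERIV_cong) (use greater in \<open>simp add: flat_exp_def power2_eq_square algebra_simps\<close>)
  qed
  then show ?thesis
    by (rule has_field_derivative_transform_within_open[where S = "{0<..}"])
      (use greater in \<open>auto simp: flat_exp_def\<close>)
next
  case equal
  have "((\<lambda>h. (flat_exp c m h - flat_exp c m 0) / (h - 0)) \<longlongrightarrow> 0) (at 0)"
  proof (rule filterlim_split_at)
    show "((\<lambda>h. (flat_exp c m h - flat_exp c m 0) / (h - 0)) \<longlongrightarrow> 0) (at_left 0)"
      by (rule tendsto_eventually) (auto simp: eventually_at_left_field flat_exp_def intro: exI[of _ "-1"])
    have "\<forall>\<^sub>F h in at_right 0. flat_exp c (m + 1) h = (flat_exp c m h - flat_exp c m 0) / (h - 0)"
      unfolding eventually_at_right_field by (rule exI[of _ 1]) (auto simp: flat_exp_def)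
    then show "((\<lambda>h. (flat_exp c m h - flat_exp c m 0) / (h - 0)) \<longlongrightarrow> 0) (at_right 0)"
      using flat_exp_tendsto_0[OF assms, of "m + 1"] by (simp add: tendsto_cong)
  qed
  then show ?thesis unfolding has_field_derivative_iff using equal by (simp add: flat_exp_def)
qed

lemma flat_exp_smooth:
  assumes "0 < c"
  shows "C_k n (flat_exp c m)"
proof (induction n arbitrary: m)
  case 0
  show ?case using flat_exp_deriv[OF assms]
    by (auto intro!: continuous_at_imp_continuous_on dest: DERIV_isCont)
next
  case (Suc n)
  show ?case
  proof (rule C_k_Suc_I[where f' = "\<lambda>x v. (c * flat_exp c (m + 2) x + (- real m) * flat_exp c (m + 1) x) * v"])
    show "(flat_exp c m has_derivative (\<lambda>v. (c * flat_exp c (m + 2) x + (- real m) * flat_exp c (m + 1) x) * v)) (at x)" for x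
      using flat_exp_deriv[OF assms, of m x] by (simp add: has_field_derivative_def)
    show "C_k n (\<lambda>x. (c * flat_exp c (m + 2) x + (- real m) * flat_exp c (m + 1) x) * v)" for v
      by (intro C_k_mult C_k_add C_k_const Suc.IH)
  qed
qed

text \<open>Flat one-sided factors at both ends of every edge: for positive \<open>c\<close> the
  product lies between 0 and 1 and is nonzero exactly on the open box, so it can be used in
  dominated convergence without normalisation.\<close>

definition bump :: "real \<Rightarrow> 'a::euclidean_space \<Rightarrow> 'a \<Rightarrow> 'a \<Rightarrow> real" where
  "bump c a b x = (\<Prod>i\<in>Basis. flat_exp c 0 (x \<bullet> i - a \<bullet> i) * flat_exp c 0 (b \<bullet> i - x \<bullet> i))"

lemma bump_smooth: "0 < c \<Longrightarrow> smooth (bump c a b)"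
  unfolding smooth_def
proof
  fix n assume "0 < c"
  show "C_k n (bump c a b)" unfolding bump_def
    by (intro C_k_prod C_k_mult C_k_affine[OF flat_exp_smooth[OF \<open>0 < c\<close>]])
      (auto intro!: derivative_eq_intros)
qed

lemma flat_exp_0_bounds: "0 < c \<Longrightarrow> 0 \<le> flat_exp c 0 x \<and> flat_exp c 0 x \<le> 1"
  unfolding flat_exp_def by auto

lemma bump_bounds: "0 < c \<Longrightarrow> 0 \<le> bump c a b x" "0 < c \<Longrightarrow> bump c a b x \<le> 1"
  unfolding bump_def using flat_exp_0_bounds[of c]
  by (auto intro!: prod_nonneg prod_le_1 mult_le_one)

lemma bump_nonzero: "bump c a b x \<noteq> 0 \<longleftrightarrow> x \<in> box a b"
  unfolding bump_def by (auto simp: box_def flat_exp_def prod_zero_iff)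

lemma bump_support: "closure {x. bump c a b x \<noteq> 0} \<subseteq> cbox a b"
  unfolding bump_nonzero using closure_minimal[OF box_subset_cbox closed_cbox] by simp

lemma bump_compact: "compact (closure {x. bump c a b x \<noteq> 0})"
  using compact_Int_closed[OF compact_cbox closed_closure, of a b "{x. bump c a b x \<noteq> 0}"] bump_support[of c a b]
  by (simp add: Int_absorb1)

lemma bump_test_function:
  assumes "0 < c" "cbox a b \<subseteq> U"
  shows "bump c a b \<in> test_functions U"
  unfolding test_functions_def using bump_smooth[OF assms(1)] bump_compact bump_support assms(2) by blast

lemma closure_support_scaleR:
  fixes v :: "'b::real_vector"
  shows "closure {x. \<theta> x *\<^sub>R v \<noteq> 0} \<subseteq> closure {x. \<theta> x \<noteq> (0::real)}"
  by (rule closure_mono) auto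

lemma test_function_scaleR:
  assumes "\<theta> \<in> test_functions U"
  shows "(\<lambda>x. \<theta> x *\<^sub>R v) \<in> test_functions U"
proof -
  have "smooth (\<lambda>x. \<theta> x *\<^sub>R v)" using assms unfolding test_functions_def smooth_def
    by (auto intro: C_k_scaleR C_k_const)
  moreover have "compact (closure {x. \<theta> x *\<^sub>R v \<noteq> 0})"
    using compact_Int_closed[of "closure {x. \<theta> x \<noteq> 0}" "closure {x. \<theta> x *\<^sub>R v \<noteq> 0}"] assms
      closure_support_scaleR[of \<theta> v] by (simp add: test_functions_def Int_absorb1)
  ultimately show ?thesis using assms closure_support_scaleR[of \<theta> v] unfolding test_functions_def by auto
qed

text \<open>The box is shrunk by \<open>1 / (n + 1)\<close>, so that the support is a compact subset
  of the open box, while the flatness constant tends to zero at the same rate; the limit is the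
  indicator of the whole open box.\<close>

definition box_bump :: "'a::euclidean_space \<Rightarrow> 'a \<Rightarrow> nat \<Rightarrow> 'a \<Rightarrow> real" where
  "box_bump a b n = bump (1 / real (Suc n)) (a + (1 / real (Suc n)) *\<^sub>R One) (b - (1 / real (Suc n)) *\<^sub>R One)"

lemma box_bump_cbox: "cbox (a + (1 / real (Suc n)) *\<^sub>R One) (b - (1 / real (Suc n)) *\<^sub>R One) \<subseteq> box a (b::'a::euclidean_space)"
proof
  fix x assume x: "x \<in> cbox (a + (1 / real (Suc n)) *\<^sub>R One) (b - (1 / real (Suc n)) *\<^sub>R One)"
  have pos: "0 < 1 / real (Suc n)" by simp
  show "x \<in> box a b" unfolding mem_box
  proof
    fix i :: 'a assume i: "i \<in> Basis"
    have "a \<bullet> i + 1 / real (Suc n) \<le> x \<bullet> i" "x \<bullet> i \<le> b \<bullet> i - 1 / real (Suc n)"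
      using x i by (auto simp: mem_box inner_add_left inner_diff_left simp del: of_nat_Suc)
    then show "a \<bullet> i < x \<bullet> i \<and> x \<bullet> i < b \<bullet> i" using pos by linarith
  qed
qed

lemma box_bump_test: "box a b \<subseteq> U \<Longrightarrow> box_bump a b n \<in> test_functions U"
  unfolding box_bump_def using box_bump_cbox[of a n b] by (intro bump_test_function) auto

lemma box_bump_bounds: "0 \<le> box_bump a b n x" "box_bump a b n x \<le> 1"
  unfolding box_bump_def by (rule bump_bounds, simp)+

lemma flat_exp_limit:
  assumes "0 < d"
  shows "(\<lambda>n. flat_exp (1 / real (Suc n)) 0 (d - 1 / real (Suc n))) \<longlonglongrightarrow> 1"
proof -
  have r: "(\<lambda>n. 1 / real (Suc n)) \<longlonglongrightarrow> 0" by (rule LIMSEQ_Suc[OF lim_1_over_n])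
  have "(\<lambda>n. exp (- ((1 / real (Suc n)) / (d - 1 / real (Suc n))))) \<longlonglongrightarrow> exp (- (0 / (d - 0)))"
    by (intro tendsto_intros r) (use assms in simp)
  moreover have "\<forall>\<^sub>F n in sequentially. 1 / real (Suc n) < d"
    using order_tendstoD(2)[OF r assms] .
  then have "\<forall>\<^sub>F n in sequentially. exp (- ((1 / real (Suc n)) / (d - 1 / real (Suc n)))) =
      flat_exp (1 / real (Suc n)) 0 (d - 1 / real (Suc n))"
    by (rule eventually_mono) (simp add: flat_exp_def)
  ultimately show ?thesis by (simp add: tendsto_cong)
qed

lemma box_bump_limit: "(\<lambda>n. box_bump a b n x) \<longlonglongrightarrow> indicator (box a b) (x::'a::euclidean_space)"
proof (cases "x \<in> box a b")
  case True
  have "(\<lambda>n. \<Prod>i\<in>Basis. flat_exp (1 / real (Suc n)) 0 ((x \<bullet> i - a \<bullet> i) - 1 / real (Suc n))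
      * flat_exp (1 / real (Suc n)) 0 ((b \<bullet> i - x \<bullet> i) - 1 / real (Suc n))) \<longlonglongrightarrow> (\<Prod>i\<in>(Basis::'a set). 1 * 1)"
    by (intro tendsto_prod tendsto_mult flat_exp_limit) (use True in \<open>auto simp: mem_box\<close>)
  moreover have "box_bump a b n x = (\<Prod>i\<in>Basis. flat_exp (1 / real (Suc n)) 0 ((x \<bullet> i - a \<bullet> i) - 1 / real (Suc n))
      * flat_exp (1 / real (Suc n)) 0 ((b \<bullet> i - x \<bullet> i) - 1 / real (Suc n)))" for n
    unfolding box_bump_def bump_def
    by (rule prod.cong) (auto simp: inner_add_left inner_diff_left algebra_simps simp del: of_nat_Suc)
  ultimately show ?thesis using True by simp
next
  case False
  have "box_bump a b n x = 0" for n
  proof (rule ccontr)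
    assume "box_bump a b n x \<noteq> 0"
    then have "x \<in> box (a + (1 / real (Suc n)) *\<^sub>R One) (b - (1 / real (Suc n)) *\<^sub>R One)"
      unfolding box_bump_def bump_nonzero .
    then show False using False box_bump_cbox[of a n b] box_subset_cbox by blast
  qed
  with False show ?thesis by simp
qed

subsection \<open>Integration by parts\<close>

lemma derivative_zero_outside_support:
  assumes "(f has_derivative f') (at x)" "x \<notin> K" "closed K" "\<And>y. y \<notin> K \<Longrightarrow> f y = 0"
  shows "f' v = 0"
proof -
  have "((\<lambda>y. 0) has_derivative f') (at x)"
    by (rule has_derivative_transform_within_open[OF assms(1), where s = "- K"]) (use assms in auto)
  then have "f' = (\<lambda>v. 0)" by (rule has_derivative_unique) (rule has_derivative_const)
  then show ?thesis by simp
qed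

text \<open>Translation invariance makes the integral of every difference quotient zero. The mean
  value theorem bounds the quotients by the supremum of the derivative, and they live on one fixed
  ball, so the limit may be taken under the integral.\<close>

lemma integral_directional_derivative_zero:
  fixes \<psi> :: "'a::euclidean_space \<Rightarrow> real"
  assumes d: "\<And>x. (\<psi> has_derivative \<psi>' x) (at x)"
    and c: "continuous_on UNIV (\<lambda>x. \<psi>' x e)"
    and K: "compact K" "\<And>x. x \<notin> K \<Longrightarrow> \<psi> x = 0"
  shows "(\<integral>x. \<psi>' x e \<partial>lborel) = 0"
proof -
  define D where "D n x = (\<psi> (x + (1 / real (Suc n)) *\<^sub>R e) - \<psi> x) * real (Suc n)" for n x
  have cont: "continuous_on UNIV \<psi>"
    using d by (auto intro!: continuous_at_imp_continuous_on dest: has_derivative_continuous)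
  have [measurable]: "\<psi> \<in> borel_measurable borel" using cont by (rule borel_measurable_continuous_onI)
  have zero: "\<psi>' x e = 0" if "x \<notin> K" for x
    by (rule derivative_zero_outside_support[OF d that compact_imp_closed[OF K(1)] K(2)])
  have "bounded ((\<lambda>x. \<psi>' x e) ` K)"
    by (intro compact_imp_bounded compact_continuous_image continuous_on_subset[OF c] K) auto
  then obtain B where B: "B > 0" "\<And>x. x \<in> K \<Longrightarrow> \<bar>\<psi>' x e\<bar> \<le> B" unfolding bounded_pos by auto
  have B': "\<bar>\<psi>' x e\<bar> \<le> B" for x using B zero[of x] by (cases "x \<in> K") auto
  obtain R where R: "R > 0" "\<And>x. x \<in> K \<Longrightarrow> norm x \<le> R"
    using compact_imp_bounded[OF K(1)] unfolding bounded_pos by blast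
  have Dle: "\<bar>D n x\<bar> \<le> B" for n x
  proof -
    define h where "h = 1 / real (Suc n)"
    have h: "h > 0" by (simp add: h_def)
    have "((\<lambda>t. \<psi> (x + t *\<^sub>R e)) has_derivative (\<lambda>s. \<psi>' (x + t *\<^sub>R e) (s *\<^sub>R e))) (at t within {0..h})" for t
      by (rule has_derivative_compose[OF _ d]) (auto intro!: derivative_eq_intros)
    then have "\<exists>t\<in>{0<..<h}. \<psi> (x + h *\<^sub>R e) - \<psi> (x + 0 *\<^sub>R e) = \<psi>' (x + t *\<^sub>R e) ((h - 0) *\<^sub>R e)"
      using mvt_simple[OF h, of "\<lambda>t. \<psi> (x + t *\<^sub>R e)" "\<lambda>t s. \<psi>' (x + t *\<^sub>R e) (s *\<^sub>R e)"] by auto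
    then obtain t where "\<psi> (x + h *\<^sub>R e) - \<psi> x = \<psi>' (x + t *\<^sub>R e) (h *\<^sub>R e)" by auto
    also have "\<dots> = h * \<psi>' (x + t *\<^sub>R e) e"
      using has_derivative_bounded_linear[OF d[of "x + t *\<^sub>R e"]] by (simp add: linear_simps)
    finally have "D n x = \<psi>' (x + t *\<^sub>R e) e" using h by (simp add: D_def h_def field_simps)
    then show ?thesis using B' by simp
  qed
  \<comment> \<open>The step length is at most 1, so enlarging the support by \<open>norm e\<close>
    suffices for all \<open>n\<close>.\<close>
  have D0: "D n x = 0" if "x \<notin> cball 0 (R + norm e)" for n x
  proof -
    have nx: "norm x > R + norm e" using that by simp
    have "norm ((1 / real (Suc n)) *\<^sub>R e) \<le> norm e"
      by (simp add: field_simps mult_left_le_one_le)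
    then have "norm (x + (1 / real (Suc n)) *\<^sub>R e) > R"
      using nx norm_triangle_ineq2[of x "- ((1 / real (Suc n)) *\<^sub>R e)"] by simp
    then have "x + (1 / real (Suc n)) *\<^sub>R e \<notin> K" using R(2) by force
    moreover have "x \<notin> K" using R(2)[of x] nx norm_ge_zero[of e] by linarith
    ultimately show ?thesis using K(2) by (simp add: D_def)
  qed
  have int\<psi>: "integrable lborel \<psi>"
  proof -
    have "integrable lborel (\<lambda>x. indicator K x *\<^sub>R \<psi> x)"
      by (rule borel_integrable_compact[OF K(1)]) (auto intro: continuous_on_subset[OF cont])
    also have "(\<lambda>x. indicator K x *\<^sub>R \<psi> x) = \<psi>"
      using K(2) by (auto simp: indicator_def fun_eq_iff)
    finally show ?thesis .
  qed
  have intD: "(\<integral>x. D n x \<partial>lborel) = 0" for n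
  proof -
    define v where "v = (1 / real (Suc n)) *\<^sub>R e"
    have i2: "integrable lborel (\<lambda>x. \<psi> (v + x))"
      by (rule integrable_distr[of "(+) v" lborel borel]) (simp_all add: lborel_distr_plus int\<psi>)
    have "(\<integral>x. \<psi> (v + x) \<partial>lborel) = (\<integral>x. \<psi> x \<partial>distr lborel borel ((+) v))"
      by (rule integral_distr[symmetric]) simp_all
    then have "(\<integral>x. \<psi> (v + x) \<partial>lborel) = (\<integral>x. \<psi> x \<partial>lborel)"
      by (simp only: lborel_distr_plus)
    moreover have "(\<lambda>x. \<psi> (x + (1 / real (Suc n)) *\<^sub>R e)) = (\<lambda>x. \<psi> (v + x))"
      by (simp add: v_def add.commute)
    ultimately have "integrable lborel (\<lambda>x. \<psi> (x + (1 / real (Suc n)) *\<^sub>R e))"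
      "(\<integral>x. \<psi> (x + (1 / real (Suc n)) *\<^sub>R e) \<partial>lborel) = (\<integral>x. \<psi> x \<partial>lborel)"
      using i2 by (simp_all del: of_nat_Suc)
    then show ?thesis unfolding D_def using int\<psi> by (simp del: of_nat_Suc)
  qed
  have "(\<lambda>n. \<integral>x. D n x \<partial>lborel) \<longlonglongrightarrow> (\<integral>x. \<psi>' x e \<partial>lborel)"
  proof (rule integral_dominated_convergence[where w = "\<lambda>x. B * indicator (cball 0 (R + norm e)) x"])
    show "(\<lambda>x. \<psi>' x e) \<in> borel_measurable lborel" using borel_measurable_continuous_onI[OF c] by simp
    show "D n \<in> borel_measurable lborel" for n unfolding D_def by measurable
    show "integrable lborel (\<lambda>x. B * indicator (cball 0 (R + norm e)) x :: real)"
      by (intro integrable_mult_right integrable_real_indicator emeasure_lborel_cball_finite) simp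
    show "AE x in lborel. (\<lambda>n. D n x) \<longlonglongrightarrow> \<psi>' x e"
    proof (rule AE_I2)
      fix x
      have "((\<lambda>t. \<psi> (x + t *\<^sub>R e)) has_derivative (\<lambda>s. \<psi>' (x + 0 *\<^sub>R e) (s *\<^sub>R e))) (at 0)"
        by (rule has_derivative_compose[OF _ d]) (auto intro!: derivative_eq_intros)
      moreover have "(\<lambda>s. \<psi>' (x + 0 *\<^sub>R e) (s *\<^sub>R e)) = (\<lambda>s. \<psi>' x e * s)"
        using has_derivative_bounded_linear[OF d[of x]] by (auto simp: linear_simps)
      ultimately have "((\<lambda>t. \<psi> (x + t *\<^sub>R e)) has_real_derivative \<psi>' x e) (at 0)"
        by (simp add: has_field_derivative_def)
      then have "((\<lambda>t. (\<psi> (x + t *\<^sub>R e) - \<psi> x) / t) \<longlongrightarrow> \<psi>' x e) (at 0)"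
        unfolding has_field_derivative_iff by simp
      moreover have "filterlim (\<lambda>n. 1 / real (Suc n)) (at 0) sequentially"
        unfolding filterlim_at using LIMSEQ_Suc[OF lim_1_over_n] by auto
      ultimately have "(\<lambda>n. (\<psi> (x + (1 / real (Suc n)) *\<^sub>R e) - \<psi> x) / (1 / real (Suc n))) \<longlonglongrightarrow> \<psi>' x e"
        by (rule filterlim_compose)
      then show "(\<lambda>n. D n x) \<longlonglongrightarrow> \<psi>' x e" by (simp add: D_def)
    qed
    show "AE x in lborel. norm (D n x) \<le> B * indicator (cball 0 (R + norm e)) x" for n
      using Dle D0 by (intro AE_I2) (auto simp: indicator_def)
  qed
  then show ?thesis using intD by (simp add: LIMSEQ_const_iff)
qed

text \<open>Registered as a class instance so that the fourfold product, in which the graph of the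
  gradient lives, is complete as well.\<close>

instance l2_field :: complete_space
proof
  fix X :: "nat \<Rightarrow> l2_field"
  show "Cauchy X \<Longrightarrow> convergent X" by (rule l2_complete)
qed

subsection \<open>Uniqueness of weak derivatives\<close>

lemma sq_integrable_abs_on:
  assumes "\<Omega> \<in> lmeasurable"
  shows "integrable lebesgue (\<lambda>x. indicator \<Omega> x * norm (rep_l2_field g x))"
proof (rule Bochner_Integration.integrable_bound[where f = "\<lambda>x. indicator \<Omega> x + (norm (rep_l2_field g x))\<^sup>2"])
  have [measurable]: "\<Omega> \<in> sets lebesgue" using assms by (simp add: fmeasurable_def)
  show "integrable lebesgue (\<lambda>x. indicator \<Omega> x + (norm (rep_l2_field g x))\<^sup>2 :: real)"
    using assms sq_integrable_rep[of g] by (auto simp: fmeasurable_def sq_integrable_def)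
  show "(\<lambda>x. indicator \<Omega> x * norm (rep_l2_field g x)) \<in> borel_measurable lebesgue" by measurable
  have "t \<le> 1 + t\<^sup>2" for t :: real using sum_squares_bound[of t 1] by (simp, smt (verit) zero_le_power2)
  then show "AE x in lebesgue. norm (indicator \<Omega> x * norm (rep_l2_field g x)) \<le> norm (indicator \<Omega> x + (norm (rep_l2_field g x))\<^sup>2 :: real)"
    by (intro AE_I2) (auto simp: indicator_def)
qed

lemma continuous_on_vec_nth_UNIV: "continuous_on UNIV (\<lambda>x::real^3. x $ k)"
  by (intro continuous_intros)

lemma box_Int_boxE:
  fixes a b c d :: "'a::euclidean_space"
  obtains r s where "box a b \<inter> box c d = box r s"
  unfolding box_Int_box by blast

text \<open>The bumps of the box, pointing in direction \<open>k\<close>, are admissible test fields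
  and tend to its indicator; the modulus of \<open>g\<close> is integrable on the bounded set
  \<Omega> and dominates.\<close>

lemma box_integral_zero:
  fixes g :: l2_field
  assumes \<Omega>: "open \<Omega>" "bounded \<Omega>" and ab: "box a b \<subseteq> \<Omega>"
    and orth: "\<And>\<phi>. \<phi> \<in> test_functions \<Omega> \<Longrightarrow> g \<bullet> l2_class \<Omega> \<phi> = 0"
  shows "(\<integral>x. indicator (box a b) x * rep_l2_field g x $ k \<partial>lebesgue) = 0"
proof -
  have lm: "\<Omega> \<in> lmeasurable" using \<Omega> by (intro lmeasurable_open)
  have [measurable]: "\<Omega> \<in> sets lebesgue" "box a b \<in> sets lebesgue" using lm by (auto simp: fmeasurable_def)
  have cont: "continuous_on UNIV (box_bump a b n)" for n
    using box_bump_test[of a b UNIV n] smooth_continuous unfolding test_functions_def by auto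
  have [measurable]: "box_bump a b n \<in> borel_measurable lebesgue" for n
    using continuous_lebesgue_measurable[OF cont] .
  have [measurable]: "(\<lambda>x. rep_l2_field g x $ k) \<in> borel_measurable lebesgue"
    using measurable_compose[OF rep_l2_measurable borel_measurable_continuous_onI[OF continuous_on_vec_nth_UNIV]] .
  have zero: "(\<integral>x. indicator \<Omega> x * box_bump a b n x * rep_l2_field g x $ k \<partial>lebesgue) = 0" for n
  proof -
    let ?\<phi> = "\<lambda>x. box_bump a b n x *\<^sub>R (axis k 1 :: real^3)"
    have t: "?\<phi> \<in> test_functions \<Omega>" by (rule test_function_scaleR[OF box_bump_test[OF ab]])
    have "continuous_on UNIV ?\<phi>" by (intro continuous_intros cont)
    then have "g \<bullet> l2_class \<Omega> ?\<phi> = (\<integral>x. rep_l2_field g x \<bullet> (indicator \<Omega> x *\<^sub>R ?\<phi> x) \<partial>lebesgue)"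
      by (intro inner_l2_class sq_integrable_continuous_on lm \<Omega>)
    also have "\<dots> = (\<integral>x. indicator \<Omega> x * box_bump a b n x * rep_l2_field g x $ k \<partial>lebesgue)"
      by (simp add: inner_axis mult_ac)
    finally show ?thesis using orth[OF t] by simp
  qed
  have "(\<lambda>n. \<integral>x. indicator \<Omega> x * box_bump a b n x * rep_l2_field g x $ k \<partial>lebesgue)
    \<longlonglongrightarrow> (\<integral>x. indicator (box a b) x * rep_l2_field g x $ k \<partial>lebesgue)"
  proof (rule integral_dominated_convergence[OF _ _ sq_integrable_abs_on[OF lm, of g]])
    show "AE x in lebesgue. (\<lambda>n. indicator \<Omega> x * box_bump a b n x * rep_l2_field g x $ k)
        \<longlonglongrightarrow> indicator (box a b) x * rep_l2_field g x $ k"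
    proof (rule AE_I2)
      fix x
      have "(\<lambda>n. indicator \<Omega> x * box_bump a b n x * rep_l2_field g x $ k)
        \<longlonglongrightarrow> indicator \<Omega> x * indicator (box a b) x * rep_l2_field g x $ k"
        by (intro tendsto_intros box_bump_limit)
      then show "(\<lambda>n. indicator \<Omega> x * box_bump a b n x * rep_l2_field g x $ k)
        \<longlonglongrightarrow> indicator (box a b) x * rep_l2_field g x $ k"
        using ab by (cases "x \<in> box a b") auto
    qed
    show "AE x in lebesgue. norm (indicator \<Omega> x * box_bump a b n x * rep_l2_field g x $ k)
      \<le> indicator \<Omega> x * norm (rep_l2_field g x)" for n
    proof (rule AE_I2)
      fix x
      have "box_bump a b n x * \<bar>rep_l2_field g x $ k\<bar> \<le> 1 * norm (rep_l2_field g x)"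
        by (intro mult_mono box_bump_bounds component_le_norm_cart) auto
      then show "norm (indicator \<Omega> x * box_bump a b n x * rep_l2_field g x $ k)
        \<le> indicator \<Omega> x * norm (rep_l2_field g x)"
        using box_bump_bounds(1)[of a b n x] by (auto simp: indicator_def abs_mult)
    qed
  qed measurable
  then show ?thesis using zero by (simp add: LIMSEQ_const_iff)
qed

text \<open>Boxes form an intersection-stable generator of the Borel sets, and the sets over which
  \<open>F\<close> integrates to zero form a Dynkin system. The whole space is not a box, so its
  integral is a separate assumption, used for complements.\<close>

lemma AE_zero_from_boxes:
  fixes F :: "real^3 \<Rightarrow> real"
  assumes F: "integrable lborel F" and boxes: "\<And>a b. (\<integral>x. indicator (box a b) x * F x \<partial>lborel) = 0"
    and all: "(\<integral>x. F x \<partial>lborel) = 0"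
  shows "AE x in lborel. F x = 0"
proof (rule sigma_finite_measure.density_zero[OF sigma_finite_lborel F])
  let ?G = "range (\<lambda>(a, b). box a b :: (real^3) set)"
  fix A :: "(real^3) set" assume "A \<in> sets lborel"
  then have A1: "A \<in> sigma_sets UNIV ?G" by (simp add: borel_eq_box sets_measure_of)
  have st: "Int_stable ?G"
  proof (rule Int_stableI)
    fix X Y :: "(real^3) set" assume "X \<in> ?G" "Y \<in> ?G"
    then obtain a b c d where "X = box a b" "Y = box c d" by auto
    then show "X \<inter> Y \<in> ?G" by (auto simp: box_Int_box)
  qed
  have sub: "?G \<subseteq> Pow UNIV" by simp
  show "set_lebesgue_integral lborel A F = 0"
  proof (rule sigma_sets_induct_disjoint[OF st sub A1, of "\<lambda>A. set_lebesgue_integral lborel A F = 0"])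
    fix A assume "A \<in> ?G"
    then show "set_lebesgue_integral lborel A F = 0"
      using boxes by (auto simp: set_lebesgue_integral_def)
  next
    show "set_lebesgue_integral lborel {} F = 0" by (simp add: set_lebesgue_integral_def)
  next
    fix A assume A0: "A \<in> sigma_sets UNIV ?G" and IH: "set_lebesgue_integral lborel A F = 0"
    from A0 have A: "A \<in> sets lborel" by (simp add: borel_eq_box sets_measure_of)
    have "set_lebesgue_integral lborel (UNIV - A) F = (\<integral>x. F x - indicator A x *\<^sub>R F x \<partial>lborel)"
      unfolding set_lebesgue_integral_def by (intro Bochner_Integration.integral_cong) (auto simp: indicator_def)
    also have "\<dots> = 0"
      using F all IH integrable_mult_indicator[OF A F] by (simp add: set_lebesgue_integral_def)
    finally show "set_lebesgue_integral lborel (UNIV - A) F = 0" .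
  next
    fix A :: "nat \<Rightarrow> (real^3) set"
    assume dj: "disjoint_family A" and A0: "range A \<subseteq> sigma_sets UNIV ?G"
      and IH: "\<And>i. set_lebesgue_integral lborel (A i) F = 0"
    from A0 have A: "\<And>i. A i \<in> sets lborel" by (auto simp: borel_eq_box sets_measure_of)
    have "set_lebesgue_integral lborel (\<Union>i. A i) F = (\<Sum>i. set_lebesgue_integral lborel (A i) F)"
    proof (rule lebesgue_integral_countable_add[OF A])
      show "i \<noteq> j \<Longrightarrow> A i \<inter> A j = {}" for i j using dj by (auto simp: disjoint_family_on_def)
      show "set_integrable lborel (\<Union>i. A i) F"
        unfolding set_integrable_def using A by (intro integrable_mult_indicator F sets.countable_UN) auto
    qed
    then show "set_lebesgue_integral lborel (\<Union>i. A i) F = 0" using IH by simp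
  qed
qed

text \<open>Fundamental lemma of the calculus of variations. Orthogonality to bumps kills the
  integral of each component over every box, hence the component almost everywhere in each box
  inside \<Omega>; countably many rational boxes exhaust \<Omega>, and outside of it the field
  vanishes by assumption.\<close>

lemma l2_zero_if_orthogonal_test:
  assumes \<Omega>: "open \<Omega>" "bounded \<Omega>" and g: "g \<in> l2_on \<Omega>"
    and orth: "\<And>\<phi>. \<phi> \<in> test_functions \<Omega> \<Longrightarrow> g \<bullet> l2_class \<Omega> \<phi> = 0"
  shows "g = 0"
proof -
  have lm: "\<Omega> \<in> lmeasurable" using \<Omega> by (intro lmeasurable_open)
  have box: "AE x in lebesgue. x \<in> box p q \<longrightarrow> rep_l2_field g x $ k = 0" if pq: "box p q \<subseteq> \<Omega>" for p q k
  proof -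
    define F where "F x = indicator (box p q) x * rep_l2_field g x $ k" for x
    have [measurable]: "(\<lambda>x. rep_l2_field g x $ k) \<in> borel_measurable lebesgue"
      using measurable_compose[OF rep_l2_measurable borel_measurable_continuous_onI[OF continuous_on_vec_nth_UNIV]] .
    have [measurable]: "box p q \<in> sets lebesgue" by simp
    have Fm: "F \<in> borel_measurable lebesgue" unfolding F_def by measurable
    have Fi: "integrable lebesgue F"
    proof (rule Bochner_Integration.integrable_bound[OF sq_integrable_abs_on[OF lm, of g] Fm])
      show "AE x in lebesgue. norm (F x) \<le> norm (indicator \<Omega> x * norm (rep_l2_field g x) :: real)"
        using pq component_le_norm_cart by (intro AE_I2) (auto simp: F_def indicator_def)
    qed
    \<comment> \<open>The representative is only Lebesgue measurable, whereas the Dynkin argument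
      runs over Borel sets; a Borel version bridges the two measures.\<close>
    obtain F' where F': "F' \<in> borel_measurable lborel" "AE x in lborel. F x = F' x"
      using completion_ex_borel_measurable_real[OF Fm] by blast
    have F'L: "F' \<in> borel_measurable lebesgue" using F'(1) by (rule measurable_completion)
    have ae: "AE x in lebesgue. F x = F' x" using F'(2) by (rule AE_completion)
    have "integrable lebesgue F'" using Fi Fm F'L ae integrable_cong_AE by blast
    then have F'i: "integrable lborel F'" using integrable_completion[OF F'(1)] by simp
    have eq: "(\<integral>x. indicator A x * F' x \<partial>lborel) = (\<integral>x. indicator A x * F x \<partial>lebesgue)" if A: "A \<in> sets borel" for A
    proof -
      have [measurable]: "A \<in> sets lborel" "A \<in> sets lebesgue" using A by auto
      note [measurable] = F'(1) F'L Fm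
      have "(\<integral>x. indicator A x * F' x \<partial>lborel) = (\<integral>x. indicator A x * F' x \<partial>lebesgue)"
        by (rule integral_completion[symmetric]) measurable
      also have "\<dots> = (\<integral>x. indicator A x * F x \<partial>lebesgue)"
        by (rule integral_cong_AE) (use ae in \<open>auto\<close>)
      finally show ?thesis .
    qed
    have zero: "(\<integral>x. indicator (box a b) x * F' x \<partial>lborel) = 0" for a b
    proof -
      obtain r s where rs: "box a b \<inter> box p q = box r s" by (rule box_Int_boxE)
      have "(\<integral>x. indicator (box a b) x * F x \<partial>lebesgue) = (\<integral>x. indicator (box r s) x * rep_l2_field g x $ k \<partial>lebesgue)"
        by (rule Bochner_Integration.integral_cong) (auto simp: F_def rs[symmetric] indicator_def)
      also have "\<dots> = 0" by (rule box_integral_zero[OF \<Omega> _ orth]) (use rs pq in auto)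
      finally show ?thesis using eq[of "box a b"] by simp
    qed
    have "(\<integral>x. F' x \<partial>lborel) = 0"
      using eq[of UNIV] box_integral_zero[OF \<Omega> pq orth, of k] by (simp add: F_def)
    then have "AE x in lborel. F' x = 0" by (intro AE_zero_from_boxes F'i zero)
    then have "AE x in lebesgue. F' x = 0" by (rule AE_completion)
    with ae show ?thesis by eventually_elim (auto simp: F_def)
  qed
  let ?I = "{f\<in>Basis \<rightarrow>\<^sub>E \<rat> \<times> \<rat>. box (\<Sum>(i::real^3)\<in>Basis. fst (f i) *\<^sub>R i) (\<Sum>i\<in>Basis. snd (f i) *\<^sub>R i) \<subseteq> \<Omega>}"
  have U: "\<Omega> = (\<Union>f\<in>?I. box (\<Sum>(i::real^3)\<in>Basis. fst (f i) *\<^sub>R i) (\<Sum>i\<in>Basis. snd (f i) *\<^sub>R i))"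
    by (rule open_UNION_box[OF \<Omega>(1)])
  have "countable (Basis \<rightarrow>\<^sub>E \<rat> \<times> \<rat> :: (real^3 \<Rightarrow> real \<times> real) set)"
    by (intro countable_PiE) (auto simp: countable_rat)
  then have cI: "countable ?I" by (rule countable_subset[rotated]) auto
  have "AE x in lebesgue. \<forall>f\<in>?I. \<forall>k. x \<in> box (\<Sum>(i::real^3)\<in>Basis. fst (f i) *\<^sub>R i) (\<Sum>i\<in>Basis. snd (f i) *\<^sub>R i) \<longrightarrow> rep_l2_field g x $ k = 0"
  proof (subst AE_ball_countable[OF cI], intro ballI)
    fix f assume "f \<in> ?I"
    then show "AE x in lebesgue. \<forall>k. x \<in> box (\<Sum>(i::real^3)\<in>Basis. fst (f i) *\<^sub>R i) (\<Sum>i\<in>Basis. snd (f i) *\<^sub>R i) \<longrightarrow> rep_l2_field g x $ k = 0"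
      unfolding AE_all_countable using box by blast
  qed
  then have "AE x in lebesgue. x \<in> \<Omega> \<longrightarrow> rep_l2_field g x = 0"
    by eventually_elim (subst U, auto simp: vec_eq_iff)
  moreover have "AE x in lebesgue. x \<notin> \<Omega> \<longrightarrow> rep_l2_field g x = 0" using g by (simp add: l2_on_def)
  moreover note rep_l2_zero
  ultimately have "AE x in lebesgue. rep_l2_field g x = rep_l2_field 0 x"
    by eventually_elim auto
  then show ?thesis by (rule l2_eqI)
qed

subsection \<open>Test fields\<close>

lemma frechet_derivative_add_smooth:
  assumes "smooth v" "smooth w"
  shows "frechet_derivative (\<lambda>x. v x + w x) (at x) = (\<lambda>h. frechet_derivative v (at x) h + frechet_derivative w (at x) h)"
  by (rule frechet_derivative_at[symmetric]) (intro has_derivative_add smooth_has_derivative assms)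

lemma frechet_derivative_scaleR_smooth:
  assumes "smooth w"
  shows "frechet_derivative (\<lambda>x. c *\<^sub>R w x) (at x) = (\<lambda>h. c *\<^sub>R frechet_derivative w (at x) h)"
  by (rule frechet_derivative_at[symmetric]) (intro has_derivative_scaleR_right smooth_has_derivative assms)

lemma smooth_add: "smooth v \<Longrightarrow> smooth w \<Longrightarrow> smooth (\<lambda>x. v x + w x)"
  unfolding smooth_def by (auto intro: C_k_add)

lemma smooth_scaleR: "smooth w \<Longrightarrow> smooth (\<lambda>x. c *\<^sub>R w x)"
  unfolding smooth_def by (auto intro: C_k_scaleR C_k_const)

lemma divergence_free_add:
  "smooth v \<Longrightarrow> smooth w \<Longrightarrow> divergence_free v \<Longrightarrow> divergence_free w \<Longrightarrow> divergence_free (\<lambda>x. v x + w x)"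
  unfolding divergence_free_def partial_deriv_def
  by (simp add: frechet_derivative_add_smooth sum.distrib)

lemma divergence_free_scaleR:
  "smooth w \<Longrightarrow> divergence_free w \<Longrightarrow> divergence_free (\<lambda>x. c *\<^sub>R w x)"
  unfolding divergence_free_def partial_deriv_def
  by (simp add: frechet_derivative_scaleR_smooth sum_distrib_left[symmetric])

lemma test_functions_add:
  assumes "v \<in> test_functions U" "w \<in> test_functions U"
  shows "(\<lambda>x. v x + w x) \<in> test_functions U"
proof -
  have sub: "closure {x. v x + w x \<noteq> 0} \<subseteq> closure {x. v x \<noteq> 0} \<union> closure {x. w x \<noteq> 0}"
    unfolding closure_Un[symmetric] by (rule closure_mono) auto
  have "compact (closure {x. v x \<noteq> 0} \<union> closure {x. w x \<noteq> 0})"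
    using assms by (intro compact_Un) (auto simp: test_functions_def)
  then have "compact (closure {x. v x + w x \<noteq> 0})"
    using compact_Int_closed[OF _ closed_closure[of "{x. v x + w x \<noteq> 0}"], of "closure {x. v x \<noteq> 0} \<union> closure {x. w x \<noteq> 0}"]
    by (simp only: Int_absorb1[OF sub])
  moreover have "smooth (\<lambda>x. v x + w x)"
    using assms by (intro smooth_add) (auto simp: test_functions_def)
  moreover have "closure {x. v x + w x \<noteq> 0} \<subseteq> U"
    using assms by (intro order_trans[OF sub]) (auto simp: test_functions_def)
  ultimately show ?thesis by (simp only: test_functions_def mem_Collect_eq)
qed

lemma test_functions_scaleR:
  fixes w :: "'a::real_normed_vector \<Rightarrow> 'b::real_normed_vector"
  assumes "w \<in> test_functions U"
  shows "(\<lambda>x. c *\<^sub>R w x) \<in> test_functions U"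
proof -
  have sub: "closure {x. c *\<^sub>R w x \<noteq> 0} \<subseteq> closure {x. w x \<noteq> 0}"
    by (rule closure_mono) auto
  then have "compact (closure {x. c *\<^sub>R w x \<noteq> 0})"
    using compact_Int_closed[OF _ closed_closure[of "{x. c *\<^sub>R w x \<noteq> 0}"], of "closure {x. w x \<noteq> 0}"] assms
    unfolding test_functions_def mem_Collect_eq Int_absorb1[OF sub] by blast
  then show ?thesis using assms sub smooth_scaleR unfolding test_functions_def by blast
qed

section \<open>Test fields on an admissible domain\<close>

locale flow_setting =
  fixes D :: flow_domain
  assumes admissible: "admissible D"
begin

abbreviation \<Omega> :: "(real^3) set" where "\<Omega> \<equiv> region D"
abbreviation cls :: "(real^3 \<Rightarrow> real^3) \<Rightarrow> l2_field" where "cls \<equiv> l2_class \<Omega>"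
abbreviation wp :: "3 \<Rightarrow> l2_field \<Rightarrow> l2_field" where "wp \<equiv> weak_partial D"

lemma region_open: "open \<Omega>" and region_bounded: "bounded \<Omega>"
  using admissible by (cases D; auto simp: open_box bounded_box)+

lemma region_lmeasurable: "\<Omega> \<in> lmeasurable"
  by (rule lmeasurable_open[OF region_bounded region_open])

lemma region_sets [measurable]: "\<Omega> \<in> sets lebesgue" "\<Omega> \<in> sets borel"
  using region_lmeasurable region_open by (auto simp: fmeasurable_def)

lemma sq_integrable_cont: "continuous_on UNIV w \<Longrightarrow> sq_integrable (\<lambda>x. indicator \<Omega> x *\<^sub>R w x)"
  by (rule sq_integrable_continuous_on[OF _ region_lmeasurable region_bounded])

lemma test_field_smooth: "w \<in> test_fields D \<Longrightarrow> smooth w"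
  by (cases D) (auto simp: test_functions_def)

lemma test_fields_add: "v \<in> test_fields D \<Longrightarrow> w \<in> test_fields D \<Longrightarrow> (\<lambda>x. v x + w x) \<in> test_fields D"
proof (cases D)
  case (Periodic L)
  assume vw: "v \<in> test_fields D" "w \<in> test_fields D"
  \<comment> \<open>Additivity of the mean-zero condition needs integrability, as the integral of a
    non-integrable field is 0 by default.\<close>
  have si: "set_integrable lebesgue (box 0 L) w" if "smooth w" for w :: "real^3 \<Rightarrow> real^3"
  proof -
    have "integrable lborel (\<lambda>x. indicator (cbox 0 L) x *\<^sub>R w x)"
      by (rule borel_integrable_compact[OF compact_cbox continuous_on_subset[OF smooth_continuous[OF that] subset_UNIV]])
    then have "set_integrable lborel (cbox 0 L) w" by (simp add: set_integrable_def)
    then have "set_integrable lborel (box 0 L) w"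
      by (rule set_integrable_subset) (auto simp: box_subset_cbox)
    moreover have "(\<lambda>x. indicator (box 0 L) x *\<^sub>R w x) \<in> borel_measurable lborel"
      using borel_measurable_continuous_onI[OF smooth_continuous[OF that]] by measurable
    ultimately show ?thesis unfolding set_integrable_def using integrable_completion by blast
  qed
  show ?thesis using vw Periodic si
    by (auto intro!: smooth_add divergence_free_add simp: set_integral_add)
next
  case (No_Slip U)
  assume "v \<in> test_fields D" "w \<in> test_fields D"
  then show ?thesis using No_Slip test_field_smooth[of v] test_field_smooth[of w]
    by (auto intro!: test_functions_add divergence_free_add)
qed

lemma test_fields_scaleR: "w \<in> test_fields D \<Longrightarrow> (\<lambda>x. c *\<^sub>R w x) \<in> test_fields D"
proof (cases D)
  case (No_Slip U)
  assume "w \<in> test_fields D"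
  then show ?thesis using No_Slip test_field_smooth[of w]
    by (auto intro!: test_functions_scaleR divergence_free_scaleR)
qed (auto intro!: smooth_scaleR divergence_free_scaleR)

lemma test_fields_zero: "(\<lambda>x. 0) \<in> test_fields D"
proof -
  have "partial_deriv i (\<lambda>x. 0) x = 0" for i x
    unfolding partial_deriv_def by simp
  then show ?thesis
    by (cases D) (auto simp: smooth_def C_k_const divergence_free_def test_functions_def)
qed

lemma cls_zero: "cls (\<lambda>x. 0) = 0"
  using sq_integrable_zero rep_l2_zero by (intro l2_class_eqI) simp_all

lemma smooth_partial_continuous: "smooth w \<Longrightarrow> continuous_on UNIV (partial_deriv i w)"
  unfolding partial_deriv_def using smooth_has_derivative(2)[of w] by simp

lemma cls_add: "smooth v \<Longrightarrow> smooth w \<Longrightarrow> cls (\<lambda>x. v x + w x) = cls v + cls w"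
  by (rule l2_class_add; rule sq_integrable_cont; rule smooth_continuous)

lemma cls_scaleR: "smooth w \<Longrightarrow> cls (\<lambda>x. c *\<^sub>R w x) = c *\<^sub>R cls w"
  by (rule l2_class_scaleR; rule sq_integrable_cont; rule smooth_continuous)

text \<open>The product rule is applied on the whole space to \<open>w \<bullet> \<phi>\<close>,
  whose support is compact in \<Omega>. Hence boundary values of \<open>w\<close> do not enter,
  which covers the periodic fields together with the fields vanishing near the boundary.\<close>

lemma smooth_weak_partial:
  assumes w: "smooth w"
  shows "has_weak_partial D i (cls w) (cls (partial_deriv i w))"
  unfolding has_weak_partial_def
proof (intro conjI ballI)
  show "cls (partial_deriv i w) \<in> l2_on \<Omega>"
    by (intro l2_class_in_l2_on sq_integrable_cont smooth_partial_continuous w)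
  fix \<phi> assume \<phi>: "\<phi> \<in> (test_functions \<Omega> :: (real^3 \<Rightarrow> real^3) set)"
  let ?e = "axis i 1 :: real^3"
  define K where "K = closure {x. \<phi> x \<noteq> 0}"
  have s: "smooth \<phi>" and K: "compact K" "K \<subseteq> \<Omega>" using \<phi> by (auto simp: test_functions_def K_def)
  have z: "\<phi> x = 0" if "x \<notin> K" for x using that closure_subset[of "{x. \<phi> x \<noteq> 0}"] unfolding K_def by blast
  have dz: "partial_deriv i \<phi> x = 0" if "x \<notin> K" for x
    unfolding partial_deriv_def
    by (rule derivative_zero_outside_support[OF smooth_has_derivative(1)[OF s] that compact_imp_closed[OF K(1)] z])
  define \<psi> where "\<psi> x = w x \<bullet> \<phi> x" for x
  define \<psi>' where "\<psi>' x h = w x \<bullet> frechet_derivative \<phi> (at x) h + frechet_derivative w (at x) h \<bullet> \<phi> x" for x h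
  note cont = smooth_continuous[OF w] smooth_continuous[OF s] smooth_has_derivative(2)[OF w] smooth_has_derivative(2)[OF s]
  have "(\<integral>x. \<psi>' x ?e \<partial>lborel) = 0"
  proof (rule integral_directional_derivative_zero[where K = K and \<psi> = \<psi>])
    show "(\<psi> has_derivative \<psi>' x) (at x)" for x
      unfolding \<psi>_def[abs_def] \<psi>'_def[abs_def]
      by (intro has_derivative_inner smooth_has_derivative w s)
    show "continuous_on UNIV (\<lambda>x. \<psi>' x ?e)"
      unfolding \<psi>'_def by (intro continuous_intros cont)
    show "\<psi> x = 0" if "x \<notin> K" for x using z[OF that] by (simp add: \<psi>_def)
  qed (rule K)
  moreover have i1: "integrable lborel (\<lambda>x. w x \<bullet> partial_deriv i \<phi> x)"
  proof -
    have "integrable lborel (\<lambda>x. indicator K x *\<^sub>R (w x \<bullet> partial_deriv i \<phi> x))"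
      unfolding partial_deriv_def
      by (rule borel_integrable_compact[OF K(1)]) (intro continuous_intros continuous_on_subset[OF cont(1)] continuous_on_subset[OF cont(4)], auto)
    also have "(\<lambda>x. indicator K x *\<^sub>R (w x \<bullet> partial_deriv i \<phi> x)) = (\<lambda>x. w x \<bullet> partial_deriv i \<phi> x)"
      using dz by (auto simp: indicator_def fun_eq_iff)
    finally show ?thesis .
  qed
  moreover have i2: "integrable lborel (\<lambda>x. partial_deriv i w x \<bullet> \<phi> x)"
  proof -
    have "integrable lborel (\<lambda>x. indicator K x *\<^sub>R (partial_deriv i w x \<bullet> \<phi> x))"
      unfolding partial_deriv_def
      by (rule borel_integrable_compact[OF K(1)]) (intro continuous_intros continuous_on_subset[OF cont(3)] continuous_on_subset[OF cont(2)], auto)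
    also have "(\<lambda>x. indicator K x *\<^sub>R (partial_deriv i w x \<bullet> \<phi> x)) = (\<lambda>x. partial_deriv i w x \<bullet> \<phi> x)"
      using z by (auto simp: indicator_def fun_eq_iff)
    finally show ?thesis .
  qed
  ultimately have sum: "(\<integral>x. w x \<bullet> partial_deriv i \<phi> x \<partial>lborel) = - (\<integral>x. partial_deriv i w x \<bullet> \<phi> x \<partial>lborel)"
    unfolding \<psi>'_def partial_deriv_def by simp
  have "cls w \<bullet> cls (partial_deriv i \<phi>) = (\<integral>x. (indicator \<Omega> x *\<^sub>R w x) \<bullet> (indicator \<Omega> x *\<^sub>R partial_deriv i \<phi> x) \<partial>lebesgue)"
    by (intro inner_l2_cong rep_l2_class sq_integrable_cont smooth_partial_continuous smooth_continuous w s)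
  also have "\<dots> = (\<integral>x. w x \<bullet> partial_deriv i \<phi> x \<partial>lebesgue)"
  proof (rule Bochner_Integration.integral_cong[OF refl])
    fix x show "(indicator \<Omega> x *\<^sub>R w x) \<bullet> (indicator \<Omega> x *\<^sub>R partial_deriv i \<phi> x) = w x \<bullet> partial_deriv i \<phi> x"
    proof (cases "x \<in> \<Omega>")
      case False
      then have "x \<notin> K" using K(2) by blast
      with False show ?thesis using dz by simp
    qed simp
  qed
  also have "\<dots> = (\<integral>x. w x \<bullet> partial_deriv i \<phi> x \<partial>lborel)"
    by (rule integral_completion[OF borel_measurable_integrable[OF i1]])
  also note sum
  also have "(\<integral>x. partial_deriv i w x \<bullet> \<phi> x \<partial>lborel) = (\<integral>x. partial_deriv i w x \<bullet> \<phi> x \<partial>lebesgue)"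
    by (rule integral_completion[OF borel_measurable_integrable[OF i2], symmetric])
  also have "\<dots> = (\<integral>x. (indicator \<Omega> x *\<^sub>R partial_deriv i w x) \<bullet> (indicator \<Omega> x *\<^sub>R \<phi> x) \<partial>lebesgue)"
  proof (rule Bochner_Integration.integral_cong[OF refl])
    fix x show "partial_deriv i w x \<bullet> \<phi> x = (indicator \<Omega> x *\<^sub>R partial_deriv i w x) \<bullet> (indicator \<Omega> x *\<^sub>R \<phi> x)"
    proof (cases "x \<in> \<Omega>")
      case False
      then have "x \<notin> K" using K(2) by blast
      with False show ?thesis using z by simp
    qed simp
  qed
  also have "\<dots> = cls (partial_deriv i w) \<bullet> cls \<phi>"
    by (intro inner_l2_cong[symmetric] rep_l2_class sq_integrable_cont smooth_partial_continuous smooth_continuous w s)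
  finally show "cls w \<bullet> cls (partial_deriv i \<phi>) = - (cls (partial_deriv i w) \<bullet> cls \<phi>)" .
qed

end

text \<open>Nested sets closed under midpoints take the place of weak compactness. The infima of the
  norm increase to a limit, and by the parallelogram law elements of nearly minimal norm in deeper
  and deeper sets are close to each other.\<close>

lemma convex_decseq_Cauchy:
  fixes C :: "nat \<Rightarrow> 'a::real_inner set"
  assumes dec: "\<And>m n. m \<le> n \<Longrightarrow> C n \<subseteq> C m" and mid: "\<And>n x y. x \<in> C n \<Longrightarrow> y \<in> C n \<Longrightarrow> (1/2) *\<^sub>R (x + y) \<in> C n"
    and ne: "\<And>n. C n \<noteq> {}" and bd: "\<And>x. x \<in> C 0 \<Longrightarrow> norm x \<le> M"
  obtains y where "\<And>n. y n \<in> C n" "Cauchy y"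
proof -
  define d where "d n = (INF x\<in>C n. norm x)" for n
  have bdd: "bdd_below (norm ` C n)" for n by (rule bdd_belowI[of _ 0]) auto
  have d_le: "d n \<le> norm x" if "x \<in> C n" for n x unfolding d_def by (rule cINF_lower[OF bdd that])
  have d0: "0 \<le> d n" for n unfolding d_def by (rule cINF_greatest[OF ne]) simp
  have dM: "d n \<le> M" for n
  proof -
    obtain x where "x \<in> C n" using ne[of n] by blast
    then show ?thesis using d_le[of x n] bd[of x] dec[of 0 n] by fastforce
  qed
  have mono: "d m \<le> d n" if "m \<le> n" for m n
    unfolding d_def by (rule cINF_superset_mono[OF ne bdd dec[OF that]]) simp
  have "convergent d"
    by (rule Bseq_mono_convergent[of d]) (use d0 dM mono in \<open>auto intro!: BseqI'[of d M]\<close>)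
  then obtain L where L: "d \<longlonglongrightarrow> L" by (auto simp: convergent_def)
  have "\<exists>x\<in>C n. norm x < d n + 1 / real (Suc n)" for n
    using cINF_less_iff[OF ne bdd, of n "d n + 1 / real (Suc n)"] unfolding d_def by simp
  then obtain y where y: "\<And>n. y n \<in> C n" "\<And>n. norm (y n) < d n + 1 / real (Suc n)" by metis
  define a where "a n = d n + 1 / real (Suc n)" for n
  have aL: "(\<lambda>n. (a n)\<^sup>2) \<longlonglongrightarrow> L\<^sup>2"
    using tendsto_power[OF tendsto_add[OF L LIMSEQ_Suc[OF lim_1_over_n]], of 2] by (simp add: a_def del: of_nat_Suc)
  have dL: "(\<lambda>n. (d n)\<^sup>2) \<longlonglongrightarrow> L\<^sup>2" by (intro tendsto_intros L)
  \<comment> \<open>For \<open>m \<le> j\<close> the midpoint lies in \<open>C m\<close>, so its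
    norm is at least \<open>d m\<close>; the parallelogram law converts this into a bound on the
    difference.\<close>
  have key: "(norm (y j - y m))\<^sup>2 \<le> 2 * (a j)\<^sup>2 + 2 * (a m)\<^sup>2 - 4 * (d m)\<^sup>2" if "m \<le> j" for m j
  proof -
    have "d m \<le> norm ((1/2) *\<^sub>R (y j + y m))"
      using d_le[OF mid[of "y j" m "y m"]] y(1)[of m] y(1)[of j] dec[OF that] by blast
    then have "d m * 2 \<le> norm (y j + y m)" by simp
    then have "(d m * 2)\<^sup>2 \<le> (norm (y j + y m))\<^sup>2" using d0[of m] by (intro power_mono) auto
    moreover have "(norm (y j + y m))\<^sup>2 + (norm (y j - y m))\<^sup>2 = 2 * (norm (y j))\<^sup>2 + 2 * (norm (y m))\<^sup>2"
      by (simp add: power2_norm_eq_inner inner_add_left inner_add_right inner_diff_left inner_diff_right inner_commute)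
    moreover have ya: "(norm (y n))\<^sup>2 \<le> (a n)\<^sup>2" for n
      using y(2)[of n] by (intro power_mono) (auto simp: a_def)
    moreover have "(d m * 2)\<^sup>2 = 4 * (d m)\<^sup>2" by (simp add: power_mult_distrib)
    ultimately show ?thesis using ya[of j] ya[of m] by linarith
  qed
  have "Cauchy y"
  proof (rule metric_CauchyI)
    fix e :: real assume e: "0 < e"
    \<comment> \<open>With all three squares within \<open>q\<close> of \<open>L^2\<close>, the
      bound in \<open>key\<close> is at most \<open>8 * q\<close>, which is below the square of
      \<open>e\<close>.\<close>
    define q where "q = e\<^sup>2 / 10"
    have q: "q > 0" using e by (simp add: q_def)
    obtain N1 where N1: "\<And>n. n \<ge> N1 \<Longrightarrow> \<bar>(a n)\<^sup>2 - L\<^sup>2\<bar> < q" using LIMSEQ_D[OF aL q] by auto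
    obtain N2 where N2: "\<And>n. n \<ge> N2 \<Longrightarrow> \<bar>(d n)\<^sup>2 - L\<^sup>2\<bar> < q" using LIMSEQ_D[OF dL q] by auto
    have half: "dist (y j) (y m) < e" if "m \<ge> max N1 N2" "m \<le> j" for m j
    proof -
      have "(norm (y j - y m))\<^sup>2 < e\<^sup>2"
        using key[OF that(2)] N1[of j] N1[of m] N2[of m] that q unfolding q_def by (auto simp: abs_if split: if_splits)
      then show ?thesis using e power2_less_imp_less[of "norm (y j - y m)" e] by (simp add: dist_norm)
    qed
    have "dist (y m) (y n) < e" if "m \<ge> max N1 N2" "n \<ge> max N1 N2" for m n
      using half[of m n] half[of n m] that by (cases "m \<le> n") (auto simp: dist_commute)
    then show "\<exists>K. \<forall>m\<ge>K. \<forall>n\<ge>K. dist (y m) (y n) < e" by blast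
  qed
  with y(1) that show ?thesis by blast
qed

context flow_setting
begin

section \<open>The space \<open>V\<close>\<close>

text \<open>This justifies the definite description in \<open>weak_partial\<close>. The test fields
  in the definition of a weak derivative are not restricted to be divergence free, so they detect
  every square-integrable difference supported in \<Omega>.\<close>

lemma weak_partial_unique:
  assumes "has_weak_partial D i u g" "has_weak_partial D i u h"
  shows "g = h"
proof -
  have "g - h = 0"
  proof (rule l2_zero_if_orthogonal_test[OF region_open region_bounded])
    show "g - h \<in> l2_on \<Omega>" using assms by (intro l2_on_diff) (auto simp: has_weak_partial_def)
    show "(g - h) \<bullet> cls \<phi> = 0" if "\<phi> \<in> test_functions \<Omega>" for \<phi>
      using assms that unfolding has_weak_partial_def by (simp add: inner_diff_left)
  qed
  then show ?thesis by simp
qed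

lemma weak_partial_eqI: "has_weak_partial D i u g \<Longrightarrow> wp i u = g"
  unfolding weak_partial_def using weak_partial_unique by blast

lemma has_weak_partial_add:
  "has_weak_partial D i u g \<Longrightarrow> has_weak_partial D i v h \<Longrightarrow> has_weak_partial D i (u + v) (g + h)"
  unfolding has_weak_partial_def by (auto intro: l2_on_add simp: inner_add_left)

lemma has_weak_partial_scaleR:
  "has_weak_partial D i u g \<Longrightarrow> has_weak_partial D i (c *\<^sub>R u) (c *\<^sub>R g)"
  unfolding has_weak_partial_def by (auto intro: l2_on_scaleR)

lemma has_weak_partial_limit:
  assumes "\<And>n. has_weak_partial D i (X n) (G n)" "X \<longlonglongrightarrow> u" "G \<longlonglongrightarrow> g"
  shows "has_weak_partial D i u g"
  unfolding has_weak_partial_def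
proof (intro conjI ballI)
  show "g \<in> l2_on \<Omega>" using l2_on_limit[OF _ assms(3)] assms(1) by (auto simp: has_weak_partial_def)
  fix \<phi> :: "real^3 \<Rightarrow> real^3" assume "\<phi> \<in> test_functions \<Omega>"
  then have eq: "X n \<bullet> cls (partial_deriv i \<phi>) = - (G n \<bullet> cls \<phi>)" for n
    using assms(1) by (simp add: has_weak_partial_def)
  have "(\<lambda>n. X n \<bullet> cls (partial_deriv i \<phi>)) \<longlonglongrightarrow> u \<bullet> cls (partial_deriv i \<phi>)"
    by (intro tendsto_intros assms)
  moreover have "(\<lambda>n. - (G n \<bullet> cls \<phi>)) \<longlonglongrightarrow> - (g \<bullet> cls \<phi>)" by (intro tendsto_intros assms)
  ultimately show "u \<bullet> cls (partial_deriv i \<phi>) = - (g \<bullet> cls \<phi>)"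
    unfolding eq by (rule LIMSEQ_unique)
qed

lemma H1_space_weak_partial: "u \<in> H1_space D \<Longrightarrow> has_weak_partial D i u (wp i u)"
  unfolding H1_space_def using weak_partial_eqI by blast

lemma H1_space_I: "u \<in> l2_on \<Omega> \<Longrightarrow> (\<And>i. has_weak_partial D i u (g i)) \<Longrightarrow> u \<in> H1_space D"
  unfolding H1_space_def by blast

lemma H1_space_add: "u \<in> H1_space D \<Longrightarrow> v \<in> H1_space D \<Longrightarrow> u + v \<in> H1_space D"
  by (rule H1_space_I[OF l2_on_add has_weak_partial_add[OF H1_space_weak_partial H1_space_weak_partial]])
    (auto simp: H1_space_def)

lemma H1_space_scaleR: "u \<in> H1_space D \<Longrightarrow> c *\<^sub>R u \<in> H1_space D"
  by (rule H1_space_I[OF l2_on_scaleR has_weak_partial_scaleR[OF H1_space_weak_partial]])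
    (auto simp: H1_space_def)

lemma wp_add: "u \<in> H1_space D \<Longrightarrow> v \<in> H1_space D \<Longrightarrow> wp i (u + v) = wp i u + wp i v"
  by (intro weak_partial_eqI has_weak_partial_add H1_space_weak_partial)

lemma wp_scaleR: "u \<in> H1_space D \<Longrightarrow> wp i (c *\<^sub>R u) = c *\<^sub>R wp i u"
  by (intro weak_partial_eqI has_weak_partial_scaleR H1_space_weak_partial)

lemma wp_diff: "u \<in> H1_space D \<Longrightarrow> v \<in> H1_space D \<Longrightarrow> wp i (u - v) = wp i u - wp i v"
  using wp_add[of u "(-1) *\<^sub>R v" i] wp_scaleR[of v i "-1"] H1_space_scaleR[of v "-1"] by simp

lemma smooth_wp: "smooth w \<Longrightarrow> wp i (cls w) = cls (partial_deriv i w)"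
  by (rule weak_partial_eqI[OF smooth_weak_partial])

lemma smooth_H1_space: "smooth w \<Longrightarrow> cls w \<in> H1_space D"
  by (rule H1_space_I[OF l2_class_in_l2_on[OF sq_integrable_cont[OF smooth_continuous]] smooth_weak_partial])

lemma H1_norm_sq: "(H1_norm D u)\<^sup>2 = (norm (wp 1 u))\<^sup>2 + (norm (wp 2 u))\<^sup>2 + (norm (wp 3 u))\<^sup>2"
  unfolding H1_norm_def H1_inner_def
  by (simp add: sum_3 power2_norm_eq_inner)

lemma H1_norm_nonneg: "0 \<le> H1_norm D u"
  unfolding H1_norm_def H1_inner_def by (auto intro!: sum_nonneg)

text \<open>Embeds the Sobolev space isometrically, for its full norm, in four copies of L^2.
  Density, completeness, separability and measurability on \<open>V\<close> are all read off in this
  product.\<close>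

definition jet :: "l2_field \<Rightarrow> l2_field \<times> l2_field \<times> l2_field \<times> l2_field" where
  "jet u = (u, wp 1 u, wp 2 u, wp 3 u)"

lemma norm_jet: "(norm (jet u))\<^sup>2 = (norm u)\<^sup>2 + (H1_norm D u)\<^sup>2"
  unfolding jet_def H1_norm_sq by (simp add: norm_Pair)

lemma jet_add: "u \<in> H1_space D \<Longrightarrow> v \<in> H1_space D \<Longrightarrow> jet (u + v) = jet u + jet v"
  by (simp add: jet_def wp_add)

lemma jet_scaleR: "u \<in> H1_space D \<Longrightarrow> jet (c *\<^sub>R u) = c *\<^sub>R jet u"
  by (simp add: jet_def wp_scaleR)

lemma jet_diff: "u \<in> H1_space D \<Longrightarrow> v \<in> H1_space D \<Longrightarrow> jet (u - v) = jet u - jet v"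
  by (simp add: jet_def wp_diff)

lemma V_H1: "u \<in> V_space D \<Longrightarrow> u \<in> H1_space D"
  by (simp add: V_space_def)

lemma V_space_iff: "u \<in> V_space D \<longleftrightarrow> u \<in> H1_space D \<and> jet u \<in> closure (jet ` cls ` test_fields D)"
proof -
  have "(norm (u - cls w))\<^sup>2 + (H1_norm D (u - cls w))\<^sup>2 < e\<^sup>2 \<longleftrightarrow> dist (jet (cls w)) (jet u) < e"
    if "u \<in> H1_space D" "w \<in> test_fields D" "e > 0" for w e
  proof -
    have "(norm (u - cls w))\<^sup>2 + (H1_norm D (u - cls w))\<^sup>2 = (dist (jet (cls w)) (jet u))\<^sup>2"
      using that smooth_H1_space[OF test_field_smooth[OF that(2)]]
      by (simp add: norm_jet[symmetric] jet_diff dist_norm norm_minus_commute)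
    then show ?thesis using that(3) by (auto intro: power2_less_imp_less power_strict_mono)
  qed
  then show ?thesis unfolding V_space_def closure_approachable by auto
qed

lemma V_space_sequence:
  assumes "u \<in> V_space D"
  obtains w where "\<And>n. w n \<in> test_fields D" "(\<lambda>n. jet (cls (w n))) \<longlonglongrightarrow> jet u"
proof -
  obtain x where x: "\<And>n. x n \<in> jet ` cls ` test_fields D" "x \<longlonglongrightarrow> jet u"
    using assms unfolding V_space_iff closure_sequential by blast
  then have "\<forall>n. \<exists>w. w \<in> test_fields D \<and> x n = jet (cls w)" by blast
  then obtain w where w: "\<And>n. w n \<in> test_fields D" "\<And>n. x n = jet (cls (w n))" by metis
  have "x = (\<lambda>n. jet (cls (w n)))" using w(2) by auto
  with x(2) w(1) that show ?thesis by blast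
qed

lemma jet_tendstoD:
  assumes "(\<lambda>n. jet (X n)) \<longlonglongrightarrow> (u, g1, g2, g3)"
  shows "X \<longlonglongrightarrow> u" "(\<lambda>n. wp 1 (X n)) \<longlonglongrightarrow> g1" "(\<lambda>n. wp 2 (X n)) \<longlonglongrightarrow> g2" "(\<lambda>n. wp 3 (X n)) \<longlonglongrightarrow> g3"
  using tendsto_fst[OF assms] tendsto_fst[OF tendsto_snd[OF assms]]
    tendsto_fst[OF tendsto_snd[OF tendsto_snd[OF assms]]] tendsto_snd[OF tendsto_snd[OF tendsto_snd[OF assms]]]
  by (simp_all add: jet_def)

text \<open>Weak derivatives survive joint L^2 limits of function and derivatives, so a limit of
  graph points is again a graph point, and it stays in the closure of the test fields; this is the
  completeness of \<open>V\<close>.\<close>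

lemma V_space_closed_graph:
  assumes X: "\<And>n. X n \<in> V_space D" and lim: "(\<lambda>n. jet (X n)) \<longlonglongrightarrow> p"
  shows "fst p \<in> V_space D" "jet (fst p) = p"
proof -
  obtain u g1 g2 g3 where p: "p = (u, g1, g2, g3)" by (cases p)
  define g where "g i = (if i = 1 then g1 else if i = 2 then g2 else g3)" for i :: 3
  note lims = jet_tendstoD[OF lim[unfolded p]]
  have hw: "has_weak_partial D i u (g i)" for i
  proof (rule has_weak_partial_limit[of i X "\<lambda>n. wp i (X n)"])
    show "has_weak_partial D i (X n) (wp i (X n))" for n by (intro H1_space_weak_partial V_H1 X)
    show "(\<lambda>n. wp i (X n)) \<longlonglongrightarrow> g i" using lims exhaust_3[of i] by (auto simp: g_def)
  qed (rule lims)
  have "u \<in> l2_on \<Omega>" by (rule l2_on_limit[OF _ lims(1)]) (use X in \<open>auto simp: V_space_def H1_space_def\<close>)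
  then have H1: "u \<in> H1_space D" using hw by (rule H1_space_I)
  have j: "jet u = p" unfolding p jet_def using weak_partial_eqI[OF hw] by (simp add: g_def)
  have "jet (X n) \<in> closure (jet ` cls ` test_fields D)" for n using X[of n] unfolding V_space_iff by (rule conjunct2)
  from closed_sequentially[OF closed_closure this lim]
  have "u \<in> V_space D" using H1 unfolding V_space_iff j by (rule conjI[rotated])
  then show "fst p \<in> V_space D" "jet (fst p) = p" using p j by auto
qed

lemma test_field_V: "w \<in> test_fields D \<Longrightarrow> cls w \<in> V_space D"
  unfolding V_space_iff
  by (intro conjI smooth_H1_space test_field_smooth subsetD[OF closure_subset] imageI)

lemma V_add:
  assumes "u \<in> V_space D" "v \<in> V_space D"
  shows "u + v \<in> V_space D"
proof -
  obtain x where x: "\<And>n. x n \<in> test_fields D" "(\<lambda>n. jet (cls (x n))) \<longlonglongrightarrow> jet u" using V_space_sequence[OF assms(1)] by blast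
  obtain y where y: "\<And>n. y n \<in> test_fields D" "(\<lambda>n. jet (cls (y n))) \<longlonglongrightarrow> jet v" using V_space_sequence[OF assms(2)] by blast
  have "jet (cls (\<lambda>z. x n z + y n z)) = jet (cls (x n)) + jet (cls (y n))" for n
    using x(1)[of n] y(1)[of n] by (simp add: cls_add test_field_smooth jet_add smooth_H1_space)
  then have "(\<lambda>n. jet (cls (\<lambda>z. x n z + y n z))) \<longlonglongrightarrow> jet u + jet v"
    using tendsto_add[OF x(2) y(2)] by simp
  from V_space_closed_graph(1)[OF test_field_V[OF test_fields_add[OF x(1) y(1)]] this]
  show ?thesis by (simp add: jet_def)
qed

lemma V_scaleR:
  assumes "u \<in> V_space D"
  shows "c *\<^sub>R u \<in> V_space D"
proof -
  obtain x where x: "\<And>n. x n \<in> test_fields D" "(\<lambda>n. jet (cls (x n))) \<longlonglongrightarrow> jet u" using V_space_sequence[OF assms(1)] by blast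
  have "jet (cls (\<lambda>z. c *\<^sub>R x n z)) = c *\<^sub>R jet (cls (x n))" for n
    using x(1)[of n] by (simp add: cls_scaleR test_field_smooth jet_scaleR smooth_H1_space)
  then have "(\<lambda>n. jet (cls (\<lambda>z. c *\<^sub>R x n z))) \<longlonglongrightarrow> c *\<^sub>R jet u"
    using tendsto_scaleR[OF tendsto_const x(2), of c] by simp
  from V_space_closed_graph(1)[OF test_field_V[OF test_fields_scaleR[OF x(1)]] this]
  show ?thesis by (simp add: jet_def)
qed

lemma V_diff: "u \<in> V_space D \<Longrightarrow> v \<in> V_space D \<Longrightarrow> u - v \<in> V_space D"
  using V_add[of u "(-1) *\<^sub>R v"] V_scaleR[of v "-1"] by simp

lemma V_zero: "0 \<in> V_space D"
  using test_field_V[OF test_fields_zero] by (simp add: cls_zero)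

lemma V_sum: "(\<And>j. j \<in> A \<Longrightarrow> g j \<in> V_space D) \<Longrightarrow> (\<Sum>j\<in>A. g j) \<in> V_space D"
  by (induction A rule: infinite_finite_induct) (auto intro: V_zero V_add)

lemma V_subset_H: "V_space D \<subseteq> H_space D"
proof
  fix u assume "u \<in> V_space D"
  then obtain x where x: "\<And>n. x n \<in> test_fields D" "(\<lambda>n. jet (cls (x n))) \<longlonglongrightarrow> jet u" using V_space_sequence by blast
  have "(\<lambda>n. cls (x n)) \<longlonglongrightarrow> u" using tendsto_fst[OF x(2)] by (simp add: jet_def)
  then show "u \<in> H_space D" unfolding H_space_def closure_sequential using x(1)
    by (intro exI[of _ "\<lambda>n. cls (x n)"]) auto
qed

text \<open>Convergence is in L^2 only, with bounded gradients. The elements of the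
  \<open>V\<close>-ball close to \<open>u\<close> form nested sets closed under midpoints, and so do
  their images under \<open>jet\<close>; near-minimal points give a sequence converging in the graph
  norm, whose limit can only have first component \<open>u\<close>.\<close>

lemma V_ball_closed: "closed {u \<in> V_space D. H1_norm D u \<le> r}"
  unfolding closed_sequential_limits
proof (intro allI impI, elim conjE)
  fix X u assume X: "\<forall>n. X n \<in> {u \<in> V_space D. H1_norm D u \<le> r}" and lim: "X \<longlonglongrightarrow> u"
  define S where "S m = {v \<in> V_space D. H1_norm D v \<le> r \<and> dist v u \<le> 1 / real (Suc m)}" for m
  have mid: "(1/2) *\<^sub>R (v + v') \<in> S m" if "v \<in> S m" "v' \<in> S m" for v v' m
  proof -
    have V: "v \<in> V_space D" "v' \<in> V_space D" using that by (auto simp: S_def)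
    have w: "wp i ((1/2) *\<^sub>R (v + v')) = (1/2) *\<^sub>R (wp i v + wp i v')" for i
      by (simp only: wp_add wp_scaleR V_H1 H1_space_add V)
    have "(H1_norm D ((1/2) *\<^sub>R (v + v')))\<^sup>2 \<le> ((H1_norm D v)\<^sup>2 + (H1_norm D v')\<^sup>2) / 2"
    proof -
      have "(norm ((1/2) *\<^sub>R (a + b)))\<^sup>2 \<le> ((norm a)\<^sup>2 + (norm b)\<^sup>2) / 2" for a b :: l2_field
      proof -
        have "(norm (a + b))\<^sup>2 + (norm (a - b))\<^sup>2 = 2 * (norm a)\<^sup>2 + 2 * (norm b)\<^sup>2"
          by (simp add: power2_norm_eq_inner inner_add_left inner_add_right inner_diff_left inner_diff_right inner_commute)
        moreover have "(norm ((1/2) *\<^sub>R (a + b)))\<^sup>2 = (norm (a + b))\<^sup>2 / 4"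
          by (simp only: norm_scaleR) (simp add: power_divide)
        moreover have "p + q = 2 * x + 2 * y \<Longrightarrow> z = p / 4 \<Longrightarrow> 0 \<le> q \<Longrightarrow> z \<le> (x + y) / 2" for p q x y z :: real
          by (simp add: field_simps)
        ultimately show ?thesis using zero_le_power2[of "norm (a - b)"] by blast
      qed
      from this[of "wp 1 v" "wp 1 v'"] this[of "wp 2 v" "wp 2 v'"] this[of "wp 3 v" "wp 3 v'"]
      show ?thesis unfolding H1_norm_sq w by argo
    qed
    also have "\<dots> \<le> r\<^sup>2"
      using that power_mono[of "H1_norm D v" r 2] power_mono[of "H1_norm D v'" r 2] H1_norm_nonneg by (auto simp: S_def)
    finally have "H1_norm D ((1/2) *\<^sub>R (v + v')) \<le> r"
    proof (rule power2_le_imp_le)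
      show "0 \<le> r" using that(1) H1_norm_nonneg[of v] unfolding S_def by simp
    qed
    moreover have "dist ((1/2) *\<^sub>R (v + v')) u \<le> 1 / real (Suc m)"
    proof -
      have "(1/2) *\<^sub>R (v + v') - u = (1/2) *\<^sub>R (v - u) + (1/2) *\<^sub>R (v' - u)"
        by (simp add: scaleR_add_right scaleR_diff_right flip: scaleR_left_distrib) (simp add: algebra_simps flip: scaleR_left_distrib)
      then have "dist ((1/2) *\<^sub>R (v + v')) u \<le> norm ((1/2) *\<^sub>R (v - u)) + norm ((1/2) *\<^sub>R (v' - u))"
        unfolding dist_norm by (metis norm_triangle_ineq)
      also have "\<dots> = (dist v u + dist v' u) / 2" by (simp add: dist_norm)
      finally show ?thesis using that unfolding S_def by simp
    qed
    ultimately show ?thesis unfolding S_def using V by (auto intro: V_scaleR V_add)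
  qed
  have dec: "S n \<subseteq> S m" if "m \<le> n" for m n
  proof -
    have "1 / real (Suc n) \<le> 1 / real (Suc m)" using that by (simp add: frac_le)
    then show ?thesis by (auto simp: S_def)
  qed
  have ne: "S m \<noteq> {}" for m
  proof -
    obtain n where "dist (X n) u < 1 / real (Suc m)"
      using lim unfolding lim_sequentially by (meson order_refl divide_pos_pos of_nat_0_less_iff zero_less_Suc zero_less_one)
    then have "X n \<in> S m" using X by (auto simp: S_def)
    then show ?thesis by blast
  qed
  have r0: "0 \<le> r"
    using order_trans[OF H1_norm_nonneg[of "X 0"]] X by blast
  \<comment> \<open>A bound on the full graph norm: the L^2 part is within 1 of \<open>u\<close>,
    the gradient part is at most \<open>r\<close>.\<close>
  have bd: "norm x \<le> (norm u + 1) + r" if x: "x \<in> jet ` S 0" for x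
  proof -
    obtain v where v: "v \<in> S 0" "x = jet v" using x by blast
    have "norm v \<le> norm u + 1" using v norm_triangle_ineq2[of v u] by (auto simp: S_def dist_norm)
    then have "(norm v)\<^sup>2 \<le> (norm u + 1)\<^sup>2" by (intro power_mono) auto
    moreover have "(H1_norm D v)\<^sup>2 \<le> r\<^sup>2" using v H1_norm_nonneg by (intro power_mono) (auto simp: S_def)
    moreover have "(norm u + 1)\<^sup>2 + r\<^sup>2 \<le> ((norm u + 1) + r)\<^sup>2" using r0 by (simp add: power2_sum)
    ultimately have "(norm x)\<^sup>2 \<le> ((norm u + 1) + r)\<^sup>2" unfolding v(2) norm_jet by linarith
    then show ?thesis by (rule power2_le_imp_le) (use r0 in simp)
  qed
  have mid': "(1/2) *\<^sub>R (x + y) \<in> jet ` S n" if xy: "x \<in> jet ` S n" "y \<in> jet ` S n" for n x y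
  proof -
    obtain v v' where v: "v \<in> S n" "x = jet v" "v' \<in> S n" "y = jet v'" using xy by blast
    have V: "v \<in> V_space D" "v' \<in> V_space D" using v by (simp_all add: S_def)
    have "(1/2) *\<^sub>R (x + y) = jet ((1/2) *\<^sub>R (v + v'))"
      unfolding v by (simp only: jet_add jet_scaleR V_H1 H1_space_add V)
    then show ?thesis using mid[OF v(1,3)] by blast
  qed
  obtain y where y: "\<And>n. y n \<in> jet ` S n" "Cauchy y"
  proof (rule convex_decseq_Cauchy[of "\<lambda>n. jet ` S n" "(norm u + 1) + r"])
    show "jet ` S n \<subseteq> jet ` S m" if "m \<le> n" for m n using dec[OF that] by (rule image_mono)
    show "jet ` S n \<noteq> {}" for n using ne[of n] by simp
    show "norm x \<le> (norm u + 1) + r" if "x \<in> jet ` S 0" for x by (rule bd[OF that])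
    show "(1/2) *\<^sub>R (x + y) \<in> jet ` S n" if "x \<in> jet ` S n" "y \<in> jet ` S n" for n x y by (rule mid'[OF that])
    fix y assume "\<And>n. y n \<in> jet ` S n" "Cauchy y"
    then show thesis by (rule that)
  qed
  obtain v where v: "\<And>n. v n \<in> S n" "\<And>n. y n = jet (v n)"
  proof -
    have "\<forall>n. \<exists>v. v \<in> S n \<and> y n = jet v" using y(1) by blast
    from choice[OF this] show thesis using that by blast
  qed
  have yv: "y = (\<lambda>n. jet (v n))" using v(2) by auto
  obtain p where p: "(\<lambda>n. jet (v n)) \<longlonglongrightarrow> p" using Cauchy_convergent[OF y(2)] unfolding yv convergent_def by blast
  have V: "v n \<in> V_space D" for n using v(1)[of n] by (simp add: S_def)
  note cg = V_space_closed_graph[OF V p]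
  have "(\<lambda>n. v n) \<longlonglongrightarrow> fst p" using tendsto_fst[OF p] by (simp add: jet_def)
  moreover have "(\<lambda>n. v n) \<longlonglongrightarrow> u"
  proof (rule metric_LIMSEQ_I)
    fix e :: real assume "0 < e"
    then obtain N where N: "1 / real (Suc N) < e" using reals_Archimedean[of e] by (auto simp: inverse_eq_divide)
    have "dist (v n) u < e" if "n \<ge> N" for n
      using dec[OF that] v(1)[of n] N unfolding S_def by fastforce
    then show "\<exists>N. \<forall>n\<ge>N. dist (v n) u < e" by blast
  qed
  ultimately have pu: "fst p = u" by (rule LIMSEQ_unique)
  have uV: "u \<in> V_space D" and ju: "jet u = p" using cg pu by auto
  have jl: "(\<lambda>n. jet (v n)) \<longlonglongrightarrow> (u, wp 1 u, wp 2 u, wp 3 u)" using p ju by (simp add: jet_def)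
  have "(\<lambda>n. (H1_norm D (v n))\<^sup>2) \<longlonglongrightarrow> (H1_norm D u)\<^sup>2"
    unfolding H1_norm_sq by (intro tendsto_intros jet_tendstoD[OF jl])
  moreover have "(H1_norm D (v n))\<^sup>2 \<le> r\<^sup>2" for n
    using v(1)[of n] H1_norm_nonneg by (intro power_mono) (auto simp: S_def)
  ultimately have "(H1_norm D u)\<^sup>2 \<le> r\<^sup>2" by (intro LIMSEQ_le_const2) auto
  then have "H1_norm D u \<le> r" using r0 by (rule power2_le_imp_le)
  with uV show "u \<in> {u \<in> V_space D. H1_norm D u \<le> r}" by blast
qed

subsection \<open>Measurability on \<open>V\<close>\<close>

text \<open>Sublevel sets at finite levels are translates of balls of \<open>V\<close>, which are
  closed in L^2. The shift by \<open>c\<close> lets the distance between two graph points be written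
  with \<open>enstrophy\<close>.\<close>

lemma enstrophy_measurable: "(\<lambda>u. enstrophy D (u - c)) \<in> borel_measurable borel"
proof (rule borel_measurableI_le)
  fix y :: ennreal
  show "{u \<in> space borel. enstrophy D (u - c) \<le> y} \<in> sets borel"
  proof (cases y)
    case (real r)
    have eq: "enstrophy D v \<le> y \<longleftrightarrow> v \<in> {u \<in> V_space D. H1_norm D u \<le> sqrt r}" for v
    proof (cases "v \<in> V_space D")
      case True
      have "(H1_norm D v)\<^sup>2 \<le> r \<longleftrightarrow> H1_norm D v \<le> sqrt r"
        using real_le_rsqrt[of "H1_norm D v" r] power_mono[OF _ H1_norm_nonneg[of v], of "sqrt r" 2] real(1) by auto
      then show ?thesis using True real by (simp add: enstrophy_def)
    next
      case False
      then show ?thesis using real by (simp add: enstrophy_def top_unique)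
    qed
    have "{u \<in> space borel. enstrophy D (u - c) \<le> y} = (\<lambda>u. u - c) -` {u \<in> V_space D. H1_norm D u \<le> sqrt r}"
      using eq by auto
    moreover have "closed ((\<lambda>u. u - c) -` {u \<in> V_space D. H1_norm D u \<le> sqrt r})"
      by (intro closed_vimage V_ball_closed continuous_intros)
    ultimately show ?thesis by simp
  qed simp
qed

lemma V_space_sets [measurable]: "V_space D \<in> sets borel"
proof -
  have "V_space D = {u \<in> space borel. enstrophy D (u - 0) < \<infinity>}" by (auto simp: enstrophy_def)
  also have "\<dots> \<in> sets borel"
    using measurable_sets[OF enstrophy_measurable[of 0], of "{..<\<infinity>}"] by (simp add: vimage_def)
  finally show ?thesis .
qed

definition step_closure :: "l2_field set" where "step_closure = closure (span (grid_steps \<Omega>))"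

lemma step_closure_separable: "separable_set step_closure"
  unfolding step_closure_def by (intro separable_set_closure separable_set_span countable_grid_steps)

lemma cls_step_closure: "continuous_on UNIV w \<Longrightarrow> cls w \<in> step_closure"
  unfolding step_closure_def by (intro l2_class_continuous_in_steps region_lmeasurable region_bounded)

lemma H_separable: "separable_set (H_space D)"
proof (rule separable_set_subset[OF step_closure_separable])
  have "cls ` test_fields D \<subseteq> step_closure" using cls_step_closure smooth_continuous test_field_smooth by blast
  then show "H_space D \<subseteq> step_closure"
    unfolding H_space_def by (rule closure_minimal) (simp add: step_closure_def)
qed

text \<open>The derivatives of test fields are continuous, so the graph points of test fields lie in
  a closed separable product, and those of \<open>V\<close> lie in the closure.\<close>

lemma jet_V_separable: "separable_set (jet ` V_space D)"
proof (rule separable_set_subset)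
  let ?P = "step_closure \<times> step_closure \<times> step_closure \<times> step_closure"
  show "separable_set ?P" by (intro separable_set_Times step_closure_separable)
  have "closed step_closure" by (simp add: step_closure_def)
  then have "closed ?P" by (intro closed_Times)
  moreover have "jet ` cls ` test_fields D \<subseteq> ?P"
    using test_field_smooth by (auto simp: jet_def smooth_wp intro!: cls_step_closure smooth_continuous smooth_partial_continuous)
  ultimately show "jet ` V_space D \<subseteq> ?P" using closure_minimal V_space_iff by blast
qed

text \<open>Although \<open>jet\<close> need not be continuous for the norm of \<open>H\<close>, the
  preimage of a ball about \<open>jet v\<close> is a sublevel set of
  \<open>enstrophy D (u - v)\<close> plus the squared distance, hence Borel; separability of the
  image reduces open sets to countable unions of such balls.\<close>

lemma jet_measurable: "jet \<in> borel_measurable (restrict_space borel (V_space D))"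
proof (rule borel_measurableI)
  fix U :: "(l2_field \<times> l2_field \<times> l2_field \<times> l2_field) set" assume U: "open U"
  obtain C where C: "countable C" "C \<subseteq> jet ` V_space D" "jet ` V_space D \<subseteq> closure C"
    using separable_set_dense_subset[OF jet_V_separable] by blast
  let ?I = "{(c, n). c \<in> C \<and> ball c (1 / real (Suc n)) \<subseteq> U}"
  have "countable ?I" by (rule countable_subset[of _ "C \<times> (UNIV :: nat set)"]) (use C in auto)
  moreover have "{u \<in> V_space D. jet u \<in> ball c e} \<in> sets borel" if c: "c \<in> C" and e: "e > 0" for c e
  proof -
    obtain v where v: "v \<in> V_space D" "c = jet v" using c C(2) by blast
    have "jet u \<in> ball c e \<longleftrightarrow> enstrophy D (u - v) + ennreal ((norm (u - v))\<^sup>2) < ennreal (e\<^sup>2)" if "u \<in> V_space D" for u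
    proof -
      have "(dist c (jet u))\<^sup>2 = (H1_norm D (u - v))\<^sup>2 + (norm (u - v))\<^sup>2"
      proof -
        have "dist c (jet u) = norm (jet (u - v))"
          unfolding v(2) jet_diff[OF V_H1[OF that] V_H1[OF v(1)]] by (simp add: dist_norm norm_minus_commute)
        then show ?thesis by (simp add: norm_jet)
      qed
      moreover have "dist c (jet u) < e \<longleftrightarrow> (dist c (jet u))\<^sup>2 < e\<^sup>2"
        using e by (auto intro: power2_less_imp_less power_strict_mono)
      ultimately show ?thesis using V_diff[OF that v(1)] by (simp add: enstrophy_def ennreal_less_iff flip: ennreal_plus)
    qed
    then have "{u \<in> V_space D. jet u \<in> ball c e} = V_space D \<inter> {u \<in> space borel. enstrophy D (u - v) + ennreal ((norm (u - v))\<^sup>2) < ennreal (e\<^sup>2)}"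
      by auto
    also have "\<dots> \<in> sets borel"
    proof -
      have [measurable]: "(\<lambda>u. ennreal ((norm (u - v))\<^sup>2)) \<in> borel_measurable borel"
        by (intro measurable_compose[OF _ measurable_ennreal] borel_measurable_continuous_onI continuous_intros)
      note [measurable] = enstrophy_measurable[of v]
      show ?thesis by measurable
    qed
    finally show ?thesis .
  qed
  ultimately have "(\<Union>(c, n)\<in>?I. {u \<in> V_space D. jet u \<in> ball c (1 / real (Suc n))}) \<in> sets borel"
    by (intro sets.countable_UN') auto
  also have "(\<Union>(c, n)\<in>?I. {u \<in> V_space D. jet u \<in> ball c (1 / real (Suc n))}) = {u \<in> V_space D. jet u \<in> U}"
    using separable_open_balls[OF C(3) U] by blast
  finally show "jet -` U \<inter> space (restrict_space borel (V_space D)) \<in> sets (restrict_space borel (V_space D))"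
    by (auto simp: sets_restrict_space_iff space_restrict_space intro: back_subst[of "\<lambda>A. A \<in> sets borel"])
qed

text \<open>Transfers functionals that are continuous in the norm of \<open>V\<close> to Borel
  functionals for the norm of \<open>H\<close>.\<close>

lemma jet_continuous_measurable:
  fixes G :: "_ \<Rightarrow> 'z::topological_space"
  assumes "continuous_on (jet ` V_space D) G"
  shows "(\<lambda>u. G (jet u)) \<in> borel_measurable (restrict_space borel (V_space D))"
proof -
  have "jet \<in> restrict_space borel (V_space D) \<rightarrow>\<^sub>M restrict_space borel (jet ` V_space D)"
    by (rule measurable_restrict_space2) (auto simp: jet_measurable space_restrict_space)
  from measurable_compose[OF this borel_measurable_continuous_on_restrict[OF assms]] show ?thesis .
qed

end

section \<open>Ladyzhenskaya's inequality\<close>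

lemma prod_Basis_real3:
  fixes f :: "real^3 \<Rightarrow> 'a::comm_monoid_mult"
  shows "(\<Prod>b\<in>Basis. f b) = f (axis 1 1) * f (axis 2 1) * f (axis 3 1)"
proof -
  have "(Basis :: (real^3) set) = range (\<lambda>i. axis i 1)"
    by (auto simp: Basis_vec_def)
  then have B: "(Basis :: (real^3) set) = {axis 1 1, axis 2 1, axis 3 1}"
    unfolding UNIV_3 by simp
  show ?thesis unfolding B by (simp add: axis_eq_axis mult.assoc)
qed

text \<open>The outermost integration variable comes first, to match the right-nested product
  measure; the vector itself has its coordinates in the usual order.\<close>

definition coord3 :: "real \<times> real \<times> real \<Rightarrow> real^3" where
  "coord3 = (\<lambda>(z, y, x). vector [x, y, z])"

lemma coord3_nth: "coord3 (z, y, x) $ 1 = x" "coord3 (z, y, x) $ 2 = y" "coord3 (z, y, x) $ 3 = z"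
  by (simp_all add: coord3_def)

lemma coord3_continuous: "continuous_on UNIV coord3"
proof -
  have "coord3 = (\<lambda>p. snd (snd p) *\<^sub>R axis 1 1 + fst (snd p) *\<^sub>R axis 2 1 + fst p *\<^sub>R axis 3 1)"
    by (auto simp: fun_eq_iff vec_eq_iff forall_3 coord3_nth axis_def)
  note eq = this
  show ?thesis unfolding eq by (intro continuous_intros)
qed

lemma coord3_measurable [measurable]: "coord3 \<in> borel_measurable (lborel \<Otimes>\<^sub>M lborel \<Otimes>\<^sub>M lborel)"
  using borel_measurable_continuous_onI[OF coord3_continuous]
  by (simp add: lborel_prod)

lemma lborel_coord3: "lborel = distr (lborel \<Otimes>\<^sub>M lborel \<Otimes>\<^sub>M lborel) borel coord3"
proof (rule lborel_eqI)
  fix l u :: "real^3" assume le: "\<And>b. b \<in> Basis \<Longrightarrow> l \<bullet> b \<le> u \<bullet> b"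
  have le': "l $ i \<le> u $ i" for i using le[of "axis i 1"] by (simp add: inner_axis axis_in_Basis_iff)
  have "coord3 -` box l u \<inter> space (lborel \<Otimes>\<^sub>M lborel \<Otimes>\<^sub>M lborel) = {l $ 3<..<u $ 3} \<times> {l $ 2<..<u $ 2} \<times> {l $ 1<..<u $ 1}"
    by (auto simp: mem_box_cart forall_3 coord3_nth space_pair_measure)
  then have "emeasure (distr (lborel \<Otimes>\<^sub>M lborel \<Otimes>\<^sub>M lborel) borel coord3) (box l u) =
    emeasure (lborel \<Otimes>\<^sub>M lborel \<Otimes>\<^sub>M lborel) ({l $ 3<..<u $ 3} \<times> {l $ 2<..<u $ 2} \<times> {l $ 1<..<u $ 1})"
    by (subst emeasure_distr) auto
  also have "\<dots> = emeasure lborel {l $ 3<..<u $ 3} * (emeasure lborel {l $ 2<..<u $ 2} * emeasure lborel {l $ 1<..<u $ 1})"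
  proof -
    have sf: "sigma_finite_measure (lborel \<Otimes>\<^sub>M lborel :: (real \<times> real) measure)"
      by (simp add: lborel_prod sigma_finite_lborel)
    have "emeasure (lborel \<Otimes>\<^sub>M lborel) ({l $ 2<..<u $ 2} \<times> {l $ 1<..<u $ 1}) =
      emeasure lborel {l $ 2<..<u $ 2} * emeasure lborel {l $ 1<..<u $ 1}"
      by (rule lborel.emeasure_pair_measure_Times) simp_all
    moreover have "emeasure (lborel \<Otimes>\<^sub>M lborel \<Otimes>\<^sub>M lborel) ({l $ 3<..<u $ 3} \<times> {l $ 2<..<u $ 2} \<times> {l $ 1<..<u $ 1}) =
      emeasure lborel {l $ 3<..<u $ 3} * emeasure (lborel \<Otimes>\<^sub>M lborel) ({l $ 2<..<u $ 2} \<times> {l $ 1<..<u $ 1})"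
      by (rule sigma_finite_measure.emeasure_pair_measure_Times[OF sf]) auto
    ultimately show ?thesis by simp
  qed
  also have "\<dots> = ennreal ((u $ 3 - l $ 3) * ((u $ 2 - l $ 2) * (u $ 1 - l $ 1)))"
    using le' by (simp add: ennreal_mult)
  also have "\<dots> = ennreal (\<Prod>b\<in>Basis. (u - l) \<bullet> b)"
    by (simp add: prod_Basis_real3 inner_axis mult_ac)
  finally show "emeasure (distr (lborel \<Otimes>\<^sub>M lborel \<Otimes>\<^sub>M lborel) borel coord3) (box l u) = ennreal (\<Prod>b\<in>Basis. (u - l) \<bullet> b)" .
qed simp

lemma nn_integral_coord3:
  assumes [measurable]: "f \<in> borel_measurable borel"
  shows "(\<integral>\<^sup>+x. f x \<partial>lborel) = (\<integral>\<^sup>+z. \<integral>\<^sup>+y. \<integral>\<^sup>+x. f (coord3 (z, y, x)) \<partial>lborel \<partial>lborel \<partial>lborel)"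
proof -
  have sf: "sigma_finite_measure (lborel \<Otimes>\<^sub>M lborel :: (real \<times> real) measure)"
    by (simp add: lborel_prod sigma_finite_lborel)
  have m: "(\<lambda>p. f (coord3 p)) \<in> borel_measurable (lborel \<Otimes>\<^sub>M lborel \<Otimes>\<^sub>M lborel)" by measurable
  have m2: "(\<lambda>q. f (coord3 (z, q))) \<in> borel_measurable (lborel \<Otimes>\<^sub>M lborel)" for z by measurable
  have "(\<integral>\<^sup>+x. f x \<partial>lborel) = (\<integral>\<^sup>+p. f (coord3 p) \<partial>(lborel \<Otimes>\<^sub>M lborel \<Otimes>\<^sub>M lborel))"
    by (subst lborel_coord3) (rule nn_integral_distr[OF coord3_measurable], simp add: assms)
  also have "\<dots> = (\<integral>\<^sup>+z. \<integral>\<^sup>+q. f (coord3 (z, q)) \<partial>(lborel \<Otimes>\<^sub>M lborel) \<partial>lborel)"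
    by (rule sigma_finite_measure.nn_integral_fst[OF sf m, symmetric])
  also have "\<dots> = (\<integral>\<^sup>+z. \<integral>\<^sup>+y. \<integral>\<^sup>+x. f (coord3 (z, y, x)) \<partial>lborel \<partial>lborel \<partial>lborel)"
    by (intro nn_integral_cong sigma_finite_measure.nn_integral_fst[OF sigma_finite_lborel m2, symmetric])
  finally show ?thesis .
qed

lemma ennreal_mult_le_squares: "a * b \<le> a\<^sup>2 + b\<^sup>2" for a b :: ennreal
proof (cases "a \<le> b")
  case True
  then have "a * b \<le> b * b" by (rule mult_right_mono) simp
  then show ?thesis by (simp add: power2_eq_square add_increasing)
next
  case False
  then have "a * b \<le> a * a" by (intro mult_left_mono) auto
  then show ?thesis by (simp add: power2_eq_square add_increasing2)
qed

text \<open>Here \<open>m\<close> stands for the modulus of the field and \<open>e1\<close>,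
  \<open>e2\<close>, \<open>e3\<close> for one-dimensional derivative bounds. For fixed
  \<open>z\<close>, writing \<open>m^4\<close> as a product of two squares separates the variables
  \<open>x\<close> and \<open>y\<close>, and Cauchy-Schwarz on the slice leaves the slice energy
  \<open>M z\<close>; the third direction bounds \<open>M z\<close> uniformly in
  \<open>z\<close>.\<close>

lemma ladyzhenskaya_slices:
  fixes m e1 e2 e3 :: "real \<times> real \<times> real \<Rightarrow> ennreal"
  assumes [measurable]: "m \<in> borel_measurable (lborel \<Otimes>\<^sub>M lborel \<Otimes>\<^sub>M lborel)"
    "e1 \<in> borel_measurable (lborel \<Otimes>\<^sub>M lborel \<Otimes>\<^sub>M lborel)"
    "e2 \<in> borel_measurable (lborel \<Otimes>\<^sub>M lborel \<Otimes>\<^sub>M lborel)"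
    "e3 \<in> borel_measurable (lborel \<Otimes>\<^sub>M lborel \<Otimes>\<^sub>M lborel)"
  assumes h1: "\<And>x y z. (m (z, y, x))\<^sup>2 \<le> (\<integral>\<^sup>+t. m (z, y, t) * e1 (z, y, t) \<partial>lborel)"
    and h2: "\<And>x y z. (m (z, y, x))\<^sup>2 \<le> (\<integral>\<^sup>+t. m (z, t, x) * e2 (z, t, x) \<partial>lborel)"
    and h3: "\<And>x y z. (m (z, y, x))\<^sup>2 \<le> (\<integral>\<^sup>+t. m (t, y, x) * e3 (t, y, x) \<partial>lborel)"
  shows "(\<integral>\<^sup>+z. \<integral>\<^sup>+y. \<integral>\<^sup>+x. (m (z, y, x))^4 \<partial>lborel \<partial>lborel \<partial>lborel) \<le>
    (\<integral>\<^sup>+z. \<integral>\<^sup>+y. \<integral>\<^sup>+x. m (z, y, x) * e3 (z, y, x) \<partial>lborel \<partial>lborel \<partial>lborel) *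
    ((\<integral>\<^sup>+z. \<integral>\<^sup>+y. \<integral>\<^sup>+x. (e1 (z, y, x))\<^sup>2 \<partial>lborel \<partial>lborel \<partial>lborel) +
     (\<integral>\<^sup>+z. \<integral>\<^sup>+y. \<integral>\<^sup>+x. (e2 (z, y, x))\<^sup>2 \<partial>lborel \<partial>lborel \<partial>lborel))" (is "_ \<le> ?K * (?E1 + ?E2)")
proof -
  define M where "M z = (\<integral>\<^sup>+y. \<integral>\<^sup>+x. (m (z, y, x))\<^sup>2 \<partial>lborel \<partial>lborel)" for z
  have CS: "(\<integral>\<^sup>+y. \<integral>\<^sup>+x. m (z, y, x) * e (z, y, x) \<partial>lborel \<partial>lborel)\<^sup>2 \<le> M z * (\<integral>\<^sup>+y. \<integral>\<^sup>+x. (e (z, y, x))\<^sup>2 \<partial>lborel \<partial>lborel)"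
    if [measurable]: "e \<in> borel_measurable (lborel \<Otimes>\<^sub>M lborel \<Otimes>\<^sub>M lborel)" for e :: "real \<times> real \<times> real \<Rightarrow> ennreal" and z
  proof -
    have fst: "(\<integral>\<^sup>+y. \<integral>\<^sup>+x. g (y, x) \<partial>lborel \<partial>lborel) = (\<integral>\<^sup>+q. g q \<partial>(lborel \<Otimes>\<^sub>M lborel))"
      if "g \<in> borel_measurable (lborel \<Otimes>\<^sub>M lborel)" for g :: "real \<times> real \<Rightarrow> ennreal"
      by (rule sigma_finite_measure.nn_integral_fst[OF sigma_finite_lborel that])
    have [measurable]: "(\<lambda>q. m (z, q)) \<in> borel_measurable (lborel \<Otimes>\<^sub>M lborel)" "(\<lambda>q. e (z, q)) \<in> borel_measurable (lborel \<Otimes>\<^sub>M lborel)"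
      by measurable
    show ?thesis
      using Cauchy_Schwarz_nn_integral[of "\<lambda>q. m (z, q)" "lborel \<Otimes>\<^sub>M lborel" "\<lambda>q. e (z, q)"]
        fst[of "\<lambda>q. m (z, q) * e (z, q)"] fst[of "\<lambda>q. (m (z, q))\<^sup>2"] fst[of "\<lambda>q. (e (z, q))\<^sup>2"]
      by (simp add: M_def)
  qed
  \<comment> \<open>The right-hand side of \<open>h3\<close> does not involve \<open>z\<close>;
    integrating it over the slice gives the full triple integral after two exchanges of
    order.\<close>
  have MK: "M z \<le> ?K" for z
  proof -
    have "M z \<le> (\<integral>\<^sup>+y. \<integral>\<^sup>+x. \<integral>\<^sup>+t. m (t, y, x) * e3 (t, y, x) \<partial>lborel \<partial>lborel \<partial>lborel)"
      unfolding M_def by (intro nn_integral_mono h3)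
    also have "\<dots> = (\<integral>\<^sup>+y. \<integral>\<^sup>+t. \<integral>\<^sup>+x. m (t, y, x) * e3 (t, y, x) \<partial>lborel \<partial>lborel \<partial>lborel)"
      by (intro nn_integral_cong lborel_pair.Fubini') simp
    also have "\<dots> = ?K"
      by (rule lborel_pair.Fubini') simp
    finally show ?thesis .
  qed
  have inner: "(\<integral>\<^sup>+y. \<integral>\<^sup>+x. (m (z, y, x))^4 \<partial>lborel \<partial>lborel) \<le>
      ?K * ((\<integral>\<^sup>+y. \<integral>\<^sup>+x. (e1 (z, y, x))\<^sup>2 \<partial>lborel \<partial>lborel) + (\<integral>\<^sup>+y. \<integral>\<^sup>+x. (e2 (z, y, x))\<^sup>2 \<partial>lborel \<partial>lborel))" for z
  proof -
    define \<alpha> where "\<alpha> y = (\<integral>\<^sup>+t. m (z, y, t) * e1 (z, y, t) \<partial>lborel)" for y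
    define \<beta> where "\<beta> x = (\<integral>\<^sup>+t. m (z, t, x) * e2 (z, t, x) \<partial>lborel)" for x
    have [measurable]: "\<alpha> \<in> borel_measurable lborel" "\<beta> \<in> borel_measurable lborel"
      unfolding \<alpha>_def \<beta>_def by measurable
    have p4: "(m (z, y, x))^4 \<le> \<alpha> y * \<beta> x" for x y
    proof -
      have "(m (z, y, x))^4 = (m (z, y, x))\<^sup>2 * (m (z, y, x))\<^sup>2" by (simp add: power_add[symmetric])
      also have "\<dots> \<le> \<alpha> y * \<beta> x" unfolding \<alpha>_def \<beta>_def by (intro mult_mono h1 h2) auto
      finally show ?thesis .
    qed
    have "(\<integral>\<^sup>+y. \<integral>\<^sup>+x. (m (z, y, x))^4 \<partial>lborel \<partial>lborel) \<le> (\<integral>\<^sup>+y. \<integral>\<^sup>+x. \<alpha> y * \<beta> x \<partial>lborel \<partial>lborel)"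
      by (intro nn_integral_mono p4)
    also have "\<dots> = (\<integral>\<^sup>+y. \<alpha> y \<partial>lborel) * (\<integral>\<^sup>+x. \<beta> x \<partial>lborel)"
      by (simp add: nn_integral_cmult nn_integral_multc)
    also have "(\<integral>\<^sup>+x. \<beta> x \<partial>lborel) = (\<integral>\<^sup>+y. \<integral>\<^sup>+x. m (z, y, x) * e2 (z, y, x) \<partial>lborel \<partial>lborel)"
      unfolding \<beta>_def by (rule lborel_pair.Fubini') simp
    \<comment> \<open>This crude splitting produces the sum of the two gradient terms and leaves
      each slice integral squared, ready for Cauchy-Schwarz.\<close>
    also have "(\<integral>\<^sup>+y. \<alpha> y \<partial>lborel) * \<dots> \<le> (\<integral>\<^sup>+y. \<alpha> y \<partial>lborel)\<^sup>2 + (\<integral>\<^sup>+y. \<integral>\<^sup>+x. m (z, y, x) * e2 (z, y, x) \<partial>lborel \<partial>lborel)\<^sup>2"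
      by (rule ennreal_mult_le_squares)
    also have "\<dots> \<le> M z * (\<integral>\<^sup>+y. \<integral>\<^sup>+x. (e1 (z, y, x))\<^sup>2 \<partial>lborel \<partial>lborel) + M z * (\<integral>\<^sup>+y. \<integral>\<^sup>+x. (e2 (z, y, x))\<^sup>2 \<partial>lborel \<partial>lborel)"
      unfolding \<alpha>_def by (intro add_mono CS) measurable
    also have "\<dots> = M z * ((\<integral>\<^sup>+y. \<integral>\<^sup>+x. (e1 (z, y, x))\<^sup>2 \<partial>lborel \<partial>lborel) + (\<integral>\<^sup>+y. \<integral>\<^sup>+x. (e2 (z, y, x))\<^sup>2 \<partial>lborel \<partial>lborel))"
      by (simp add: distrib_left)
    also have "\<dots> \<le> ?K * ((\<integral>\<^sup>+y. \<integral>\<^sup>+x. (e1 (z, y, x))\<^sup>2 \<partial>lborel \<partial>lborel) + (\<integral>\<^sup>+y. \<integral>\<^sup>+x. (e2 (z, y, x))\<^sup>2 \<partial>lborel \<partial>lborel))"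
      by (intro mult_right_mono MK) simp
    finally show ?thesis .
  qed
  have "(\<integral>\<^sup>+z. \<integral>\<^sup>+y. \<integral>\<^sup>+x. (m (z, y, x))^4 \<partial>lborel \<partial>lborel \<partial>lborel) \<le>
    (\<integral>\<^sup>+z. ?K * ((\<integral>\<^sup>+y. \<integral>\<^sup>+x. (e1 (z, y, x))\<^sup>2 \<partial>lborel \<partial>lborel) + (\<integral>\<^sup>+y. \<integral>\<^sup>+x. (e2 (z, y, x))\<^sup>2 \<partial>lborel \<partial>lborel)) \<partial>lborel)"
    by (intro nn_integral_mono inner)
  also have "\<dots> = ?K * (?E1 + ?E2)"
    by (simp add: nn_integral_cmult nn_integral_add)
  finally show ?thesis .
qed

text \<open>The fundamental theorem of calculus is applied to \<open>|w|^2\<close> from a point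
  where it is minimal on the interval, and there it is at most its average. The term with
  \<open>q - p\<close> in the denominator is the price for fields that do not vanish at the
  ends.\<close>

lemma sobolev_1d:
  fixes w w' :: "real \<Rightarrow> 'a::euclidean_space"
  assumes d: "\<And>t. (w has_vector_derivative w' t) (at t)" and c: "continuous_on UNIV w'"
    and pq: "p < q" and x: "x \<in> {p..q}"
  shows "ennreal ((norm (w x))\<^sup>2) \<le>
    (\<integral>\<^sup>+t. ennreal (norm (w t)) * ennreal (norm (w t) / (q - p) + 2 * norm (w' t)) * indicator {p..q} t \<partial>lborel)"
proof -
  define \<phi> where "\<phi> t = (norm (w t))\<^sup>2" for t
  define \<phi>' where "\<phi>' t = 2 * (w t \<bullet> w' t)" for t
  have cw: "continuous_on UNIV w"
    using d by (auto intro!: continuous_at_imp_continuous_on has_vector_derivative_continuous)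
  have D: "(\<phi> has_real_derivative \<phi>' t) (at t)" for t
  proof -
    have "((\<lambda>t. w t \<bullet> w t) has_vector_derivative (w t \<bullet> w' t + w' t \<bullet> w t)) (at t)"
      by (rule bounded_bilinear.has_vector_derivative[OF bounded_bilinear_inner d d])
    then show ?thesis
      by (simp add: \<phi>_def[abs_def] \<phi>'_def power2_norm_eq_inner inner_commute has_real_derivative_iff_has_vector_derivative)
  qed
  have c\<phi>': "continuous_on UNIV \<phi>'" unfolding \<phi>'_def by (intro continuous_intros cw c)
  have c\<phi>: "continuous_on UNIV \<phi>" unfolding \<phi>_def by (intro continuous_intros cw)
  obtain s where s: "s \<in> {p..q}" "\<And>t. t \<in> {p..q} \<Longrightarrow> \<phi> s \<le> \<phi> t"
    using continuous_attains_inf[of "{p..q}" \<phi>] pq continuous_on_subset[OF c\<phi>] by (metis atLeastAtMost_iff compact_Icc empty_iff less_imp_le subset_UNIV order_refl)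
  have int: "integrable lborel (\<lambda>t. indicator {p..q} t *\<^sub>R g t)" if "continuous_on UNIV g" for g :: "real \<Rightarrow> real"
    by (rule borel_integrable_compact) (auto intro: continuous_on_subset[OF that])
  have "(q - p) * \<phi> s = (\<integral>t. indicator {p..q} t *\<^sub>R \<phi> s \<partial>lborel)" using pq by simp
  also have "\<dots> \<le> (\<integral>t. indicator {p..q} t *\<^sub>R \<phi> t \<partial>lborel)"
    by (intro integral_mono int c\<phi> continuous_on_const) (auto simp: indicator_def s)
  finally have s_le: "\<phi> s \<le> (\<integral>t. indicator {p..q} t *\<^sub>R (\<phi> t / (q - p)) \<partial>lborel)"
    using pq by (simp add: field_simps)
  have diff: "\<phi> b - \<phi> a \<le> (\<integral>t. indicator {p..q} t *\<^sub>R \<bar>\<phi>' t\<bar> \<partial>lborel) \<and> \<phi> a - \<phi> b \<le> (\<integral>t. indicator {p..q} t *\<^sub>R \<bar>\<phi>' t\<bar> \<partial>lborel)"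
    if "p \<le> a" "a \<le> b" "b \<le> q" for a b
  proof -
    have "(\<integral>t. \<phi>' t * indicator {a..b} t \<partial>lborel) = \<phi> b - \<phi> a"
      by (rule integral_FTC_Icc_real[OF that(2)]) (use D c\<phi>' in \<open>auto simp: continuous_on_eq_continuous_at\<close>)
    moreover have "\<bar>\<integral>t. \<phi>' t * indicator {a..b} t \<partial>lborel\<bar> \<le> (\<integral>t. \<bar>\<phi>' t * indicator {a..b} t\<bar> \<partial>lborel)"
      by (rule integral_abs_bound)
    moreover have "(\<integral>t. \<bar>\<phi>' t * indicator {a..b} t\<bar> \<partial>lborel) \<le> (\<integral>t. indicator {p..q} t *\<^sub>R \<bar>\<phi>' t\<bar> \<partial>lborel)"
    proof (rule integral_mono)
      have "integrable lborel (\<lambda>t. indicator {a..b} t *\<^sub>R \<phi>' t)"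
        by (rule borel_integrable_compact) (auto intro: continuous_on_subset[OF c\<phi>'])
      then show "integrable lborel (\<lambda>t. \<bar>\<phi>' t * indicator {a..b} t\<bar>)" by (simp add: mult.commute)
      show "integrable lborel (\<lambda>t. indicator {p..q} t *\<^sub>R \<bar>\<phi>' t\<bar>)" by (intro int continuous_intros c\<phi>')
    qed (use that in \<open>auto simp: indicator_def\<close>)
    ultimately show ?thesis by linarith
  qed
  have "\<phi> x - \<phi> s \<le> (\<integral>t. indicator {p..q} t *\<^sub>R \<bar>\<phi>' t\<bar> \<partial>lborel)"
    using diff[of s x] diff[of x s] s(1) x by (cases "s \<le> x") auto
  then have "\<phi> x \<le> (\<integral>t. indicator {p..q} t *\<^sub>R (\<phi> t / (q - p)) \<partial>lborel) + (\<integral>t. indicator {p..q} t *\<^sub>R \<bar>\<phi>' t\<bar> \<partial>lborel)"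
    using s_le by linarith
  also have "\<dots> = (\<integral>t. indicator {p..q} t *\<^sub>R (\<phi> t / (q - p) + \<bar>\<phi>' t\<bar>) \<partial>lborel)"
    unfolding scaleR_add_right by (intro Bochner_Integration.integral_add[symmetric] int continuous_intros c\<phi> c\<phi>') (use pq in auto)
  also have "\<dots> \<le> (\<integral>t. indicator {p..q} t *\<^sub>R (norm (w t) * (norm (w t) / (q - p) + 2 * norm (w' t))) \<partial>lborel)"
  proof (rule integral_mono)
    show "integrable lborel (\<lambda>t. indicator {p..q} t *\<^sub>R (\<phi> t / (q - p) + \<bar>\<phi>' t\<bar>))"
      by (intro int continuous_intros c\<phi> c\<phi>') (use pq in auto)
    show "integrable lborel (\<lambda>t. indicator {p..q} t *\<^sub>R (norm (w t) * (norm (w t) / (q - p) + 2 * norm (w' t))))"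
      by (intro int continuous_intros cw c) (use pq in auto)
    fix t
    have "\<bar>\<phi>' t\<bar> \<le> 2 * (norm (w t) * norm (w' t))" using Cauchy_Schwarz_ineq2[of "w t" "w' t"] by (simp add: \<phi>'_def abs_mult)
    then have "\<phi> t / (q - p) + \<bar>\<phi>' t\<bar> \<le> norm (w t) * (norm (w t) / (q - p) + 2 * norm (w' t))"
      by (simp add: \<phi>_def power2_eq_square algebra_simps)
    then show "indicator {p..q} t *\<^sub>R (\<phi> t / (q - p) + \<bar>\<phi>' t\<bar>) \<le> indicator {p..q} t *\<^sub>R (norm (w t) * (norm (w t) / (q - p) + 2 * norm (w' t)))"
      by (simp add: indicator_def)
  qed
  finally have "ennreal (\<phi> x) \<le> ennreal (\<integral>t. indicator {p..q} t *\<^sub>R (norm (w t) * (norm (w t) / (q - p) + 2 * norm (w' t))) \<partial>lborel)"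
    by (rule ennreal_leI)
  also have "\<dots> = (\<integral>\<^sup>+t. ennreal (indicator {p..q} t *\<^sub>R (norm (w t) * (norm (w t) / (q - p) + 2 * norm (w' t)))) \<partial>lborel)"
    by (rule nn_integral_eq_integral[symmetric], intro int continuous_intros cw c) (use pq in auto)
  also have "\<dots> = (\<integral>\<^sup>+t. ennreal (norm (w t)) * ennreal (norm (w t) / (q - p) + 2 * norm (w' t)) * indicator {p..q} t \<partial>lborel)"
    using pq by (intro nn_integral_cong) (auto simp: indicator_def ennreal_mult)
  finally show ?thesis by (simp add: \<phi>_def)
qed

lemma coord3_vector_derivatives:
  fixes w :: "real^3 \<Rightarrow> real^3"
  assumes w: "smooth w"
  shows "((\<lambda>t. w (coord3 (z, y, t))) has_vector_derivative partial_deriv 1 w (coord3 (z, y, t))) (at t)"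
    "((\<lambda>t. w (coord3 (z, t, x))) has_vector_derivative partial_deriv 2 w (coord3 (z, t, x))) (at t)"
    "((\<lambda>t. w (coord3 (t, y, x))) has_vector_derivative partial_deriv 3 w (coord3 (t, y, x))) (at t)"
proof -
  have lin: "coord3 (z, y, x) = x *\<^sub>R axis 1 1 + y *\<^sub>R axis 2 1 + z *\<^sub>R axis 3 1" for x y z
    by (simp add: vec_eq_iff forall_3 coord3_nth axis_def)
  have gen: "((\<lambda>t. w (c t)) has_vector_derivative partial_deriv i w (c t)) (at t)"
    if "(c has_vector_derivative axis i 1) (at t)" for c :: "real \<Rightarrow> real^3" and t i
  proof -
    have "((\<lambda>t. w (c t)) has_derivative (\<lambda>h. frechet_derivative w (at (c t)) (h *\<^sub>R axis i 1))) (at t)"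
      using has_derivative_compose[OF that[unfolded has_vector_derivative_def] smooth_has_derivative(1)[OF w]] .
    moreover have "frechet_derivative w (at (c t)) (h *\<^sub>R axis i 1) = h *\<^sub>R partial_deriv i w (c t)" for h
      using has_derivative_bounded_linear[OF smooth_has_derivative(1)[OF w]] by (simp add: partial_deriv_def linear_simps)
    ultimately show ?thesis by (simp add: has_vector_derivative_def)
  qed
  show "((\<lambda>t. w (coord3 (z, y, t))) has_vector_derivative partial_deriv 1 w (coord3 (z, y, t))) (at t)"
    by (rule gen) (auto simp: lin intro!: derivative_eq_intros)
  show "((\<lambda>t. w (coord3 (z, t, x))) has_vector_derivative partial_deriv 2 w (coord3 (z, t, x))) (at t)"
    by (rule gen) (auto simp: lin intro!: derivative_eq_intros)
  show "((\<lambda>t. w (coord3 (t, y, x))) has_vector_derivative partial_deriv 3 w (coord3 (t, y, x))) (at t)"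
    by (rule gen) (auto simp: lin intro!: derivative_eq_intros)
qed

text \<open>Ladyzhenskaya's inequality with both factors enlarged to the full Sobolev norm, so that
  no boundary condition on the box is involved; the constant depends on the side lengths
  alone.\<close>

lemma ladyzhenskaya_box:
  fixes a b :: "real^3"
  assumes ab: "\<And>i. a $ i < b $ i"
  obtains C where "0 \<le> C" "\<And>w. smooth w \<Longrightarrow>
    (\<integral>\<^sup>+x. ennreal ((norm (w x))^4) * indicator (cbox a b) x \<partial>lborel) \<le>
    ennreal C * (\<integral>\<^sup>+x. ennreal ((norm (w x))\<^sup>2 + (\<Sum>i\<in>UNIV. (norm (partial_deriv i w x))\<^sup>2)) * indicator (cbox a b) x \<partial>lborel)\<^sup>2"
proof -
  define c where "c = (\<Sum>i\<in>UNIV. 1 / (b $ i - a $ i))"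
  have ci: "1 / (b $ i - a $ i) \<le> c" for i
    unfolding c_def using ab by (intro member_le_sum) (auto simp: less_imp_le)
  have c0: "0 \<le> c" unfolding c_def using ab by (intro sum_nonneg) (auto simp: less_imp_le)
  \<comment> \<open>The factor \<open>c + 1\<close> bounds \<open>m * e 3\<close> by
    \<open>S\<close>, the factor \<open>2 * c^2 + 8\<close> bounds the square of each
    \<open>e i\<close>, and 2 counts the two remaining directions.\<close>
  define C where "C = (c + 1) * (2 * (2 * c\<^sup>2 + 8))"
  have "(\<integral>\<^sup>+x. ennreal ((norm (w x))^4) * indicator (cbox a b) x \<partial>lborel) \<le>
    ennreal C * (\<integral>\<^sup>+x. ennreal ((norm (w x))\<^sup>2 + (\<Sum>i\<in>UNIV. (norm (partial_deriv i w x))\<^sup>2)) * indicator (cbox a b) x \<partial>lborel)\<^sup>2"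
    if w: "smooth w" for w :: "real^3 \<Rightarrow> real^3"
  proof -
    let ?Q = "cbox a b"
    define S where "S x = (norm (w x))\<^sup>2 + (\<Sum>i\<in>UNIV. (norm (partial_deriv i w x))\<^sup>2)" for x
    have S0: "0 \<le> S x" for x unfolding S_def by (intro add_nonneg_nonneg sum_nonneg) auto
    define I where "I = (\<integral>\<^sup>+x. ennreal (S x) * indicator ?Q x \<partial>lborel)"
    have [measurable]: "w \<in> borel_measurable borel" "partial_deriv i w \<in> borel_measurable borel" for i
      using smooth_continuous[OF w] smooth_has_derivative(2)[OF w] unfolding partial_deriv_def[abs_def]
      by (auto intro!: borel_measurable_continuous_onI)
    have [measurable]: "S \<in> borel_measurable borel" unfolding S_def by measurable
    \<comment> \<open>The weight that \<open>sobolev_1d\<close> produces along direction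
      \<open>i\<close>, cut off to the box.\<close>
    define e where "e i x = ennreal (norm (w x) / (b $ i - a $ i) + 2 * norm (partial_deriv i w x)) * indicator ?Q x" for i x
    define m where "m x = ennreal (norm (w x)) * indicator ?Q x" for x
    have [measurable]: "e i \<in> borel_measurable borel" "m \<in> borel_measurable borel" for i
      unfolding e_def m_def by measurable
    have Q: "coord3 (z, y, x) \<in> ?Q \<longleftrightarrow> x \<in> {a $ 1..b $ 1} \<and> y \<in> {a $ 2..b $ 2} \<and> z \<in> {a $ 3..b $ 3}" for x y z
      by (simp add: mem_box_cart forall_3 coord3_nth)
    have cont: "continuous_on UNIV (\<lambda>t. partial_deriv i w (c t))" if "continuous_on UNIV c" for c :: "real \<Rightarrow> real^3" and i
      using smooth_has_derivative(2)[OF w] unfolding partial_deriv_def by (rule continuous_on_compose2[OF _ that]) simp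
    have cc: "continuous_on UNIV (\<lambda>t. coord3 (z, y, t))" "continuous_on UNIV (\<lambda>t. coord3 (z, t, x))" "continuous_on UNIV (\<lambda>t. coord3 (t, y, x))" for x y z
      by (rule continuous_on_compose2[OF coord3_continuous]; auto intro!: continuous_intros)+
    have h1: "(m (coord3 (z, y, x)))\<^sup>2 \<le> (\<integral>\<^sup>+t. m (coord3 (z, y, t)) * e 1 (coord3 (z, y, t)) \<partial>lborel)" for x y z
    proof (cases "coord3 (z, y, x) \<in> ?Q")
      case True
      have "ennreal ((norm (w (coord3 (z, y, x))))\<^sup>2) \<le> (\<integral>\<^sup>+t. ennreal (norm (w (coord3 (z, y, t)))) * ennreal (norm (w (coord3 (z, y, t))) / (b $ 1 - a $ 1) + 2 * norm (partial_deriv 1 w (coord3 (z, y, t)))) * indicator {a $ 1..b $ 1} t \<partial>lborel)"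
        by (rule sobolev_1d[OF coord3_vector_derivatives(1)[OF w] cont[OF cc(1)] ab]) (use True Q in auto)
      also have "\<dots> = (\<integral>\<^sup>+t. m (coord3 (z, y, t)) * e 1 (coord3 (z, y, t)) \<partial>lborel)"
        using True Q by (intro nn_integral_cong) (auto simp: m_def e_def indicator_def)
      finally show ?thesis using True by (simp add: m_def ennreal_power)
    qed (simp add: m_def)
    have h2: "(m (coord3 (z, y, x)))\<^sup>2 \<le> (\<integral>\<^sup>+t. m (coord3 (z, t, x)) * e 2 (coord3 (z, t, x)) \<partial>lborel)" for x y z
    proof (cases "coord3 (z, y, x) \<in> ?Q")
      case True
      have "ennreal ((norm (w (coord3 (z, y, x))))\<^sup>2) \<le> (\<integral>\<^sup>+t. ennreal (norm (w (coord3 (z, t, x)))) * ennreal (norm (w (coord3 (z, t, x))) / (b $ 2 - a $ 2) + 2 * norm (partial_deriv 2 w (coord3 (z, t, x)))) * indicator {a $ 2..b $ 2} t \<partial>lborel)"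
        by (rule sobolev_1d[OF coord3_vector_derivatives(2)[OF w] cont[OF cc(2)] ab]) (use True Q in auto)
      also have "\<dots> = (\<integral>\<^sup>+t. m (coord3 (z, t, x)) * e 2 (coord3 (z, t, x)) \<partial>lborel)"
        using True Q by (intro nn_integral_cong) (auto simp: m_def e_def indicator_def)
      finally show ?thesis using True by (simp add: m_def ennreal_power)
    qed (simp add: m_def)
    have h3: "(m (coord3 (z, y, x)))\<^sup>2 \<le> (\<integral>\<^sup>+t. m (coord3 (t, y, x)) * e 3 (coord3 (t, y, x)) \<partial>lborel)" for x y z
    proof (cases "coord3 (z, y, x) \<in> ?Q")
      case True
      have "ennreal ((norm (w (coord3 (z, y, x))))\<^sup>2) \<le> (\<integral>\<^sup>+t. ennreal (norm (w (coord3 (t, y, x)))) * ennreal (norm (w (coord3 (t, y, x))) / (b $ 3 - a $ 3) + 2 * norm (partial_deriv 3 w (coord3 (t, y, x)))) * indicator {a $ 3..b $ 3} t \<partial>lborel)"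
        by (rule sobolev_1d[OF coord3_vector_derivatives(3)[OF w] cont[OF cc(3)] ab]) (use True Q in auto)
      also have "\<dots> = (\<integral>\<^sup>+t. m (coord3 (t, y, x)) * e 3 (coord3 (t, y, x)) \<partial>lborel)"
        using True Q by (intro nn_integral_cong) (auto simp: m_def e_def indicator_def)
      finally show ?thesis using True by (simp add: m_def ennreal_power)
    qed (simp add: m_def)
    have s1: "(\<integral>\<^sup>+x. (m x)^4 \<partial>lborel) \<le> (\<integral>\<^sup>+x. m x * e 3 x \<partial>lborel) * ((\<integral>\<^sup>+x. (e 1 x)\<^sup>2 \<partial>lborel) + (\<integral>\<^sup>+x. (e 2 x)\<^sup>2 \<partial>lborel))"
      using ladyzhenskaya_slices[of "\<lambda>p. m (coord3 p)" "\<lambda>p. e 1 (coord3 p)" "\<lambda>p. e 2 (coord3 p)" "\<lambda>p. e 3 (coord3 p)", OF _ _ _ _ h1 h2 h3]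
      by (simp add: nn_integral_coord3)
    have "(\<integral>\<^sup>+x. m x * e 3 x \<partial>lborel) \<le> (\<integral>\<^sup>+x. ennreal (c + 1) * (ennreal (S x) * indicator ?Q x) \<partial>lborel)"
    proof (rule nn_integral_mono)
      fix x
      have "norm (w x) * (norm (w x) / (b $ 3 - a $ 3) + 2 * norm (partial_deriv 3 w x)) \<le> (c + 1) * S x"
      proof -
        have "(norm (partial_deriv 3 w x))\<^sup>2 \<le> (\<Sum>i\<in>UNIV. (norm (partial_deriv i w x))\<^sup>2)"
          by (intro member_le_sum) auto
        moreover have "norm (w x) * (norm (w x) / (b $ 3 - a $ 3)) \<le> c * (norm (w x))\<^sup>2"
          using mult_right_mono[OF ci[of 3], of "(norm (w x))\<^sup>2"] by (simp add: power2_eq_square)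
        moreover have "2 * norm (w x) * norm (partial_deriv 3 w x) \<le> (norm (w x))\<^sup>2 + (norm (partial_deriv 3 w x))\<^sup>2"
          by (rule sum_squares_bound)
        moreover have "0 \<le> c * (\<Sum>i\<in>UNIV. (norm (partial_deriv i w x))\<^sup>2)" using c0 by (intro mult_nonneg_nonneg sum_nonneg) auto
        ultimately show ?thesis unfolding S_def by (simp add: algebra_simps)
      qed
      then have le: "ennreal (norm (w x) * (norm (w x) / (b $ 3 - a $ 3) + 2 * norm (partial_deriv 3 w x))) \<le> ennreal ((c + 1) * S x)"
        by (rule ennreal_leI)
      have "ennreal (norm (w x)) * ennreal (norm (w x) / (b $ 3 - a $ 3) + 2 * norm (partial_deriv 3 w x)) =
        ennreal (norm (w x) * (norm (w x) / (b $ 3 - a $ 3) + 2 * norm (partial_deriv 3 w x)))"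
        using ab[of 3] by (intro ennreal_mult[symmetric] add_nonneg_nonneg) auto
      moreover have "ennreal ((c + 1) * S x) = ennreal (c + 1) * ennreal (S x)"
        using c0 S0 by (intro ennreal_mult) auto
      ultimately show "m x * e 3 x \<le> ennreal (c + 1) * (ennreal (S x) * indicator ?Q x)"
        using le unfolding m_def e_def by (cases "x \<in> ?Q") (simp_all del: ennreal_plus)
    qed
    also have "\<dots> = ennreal (c + 1) * I" unfolding I_def by (rule nn_integral_cmult) measurable
    finally have s2: "(\<integral>\<^sup>+x. m x * e 3 x \<partial>lborel) \<le> ennreal (c + 1) * I" .
    have "(\<integral>\<^sup>+x. (e i x)\<^sup>2 \<partial>lborel) \<le> ennreal (2 * c\<^sup>2 + 8) * I" for i
    proof -
      have "(\<integral>\<^sup>+x. (e i x)\<^sup>2 \<partial>lborel) \<le> (\<integral>\<^sup>+x. ennreal (2 * c\<^sup>2 + 8) * (ennreal (S x) * indicator ?Q x) \<partial>lborel)"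
      proof (rule nn_integral_mono)
        fix x
        have "(norm (w x) / (b $ i - a $ i) + 2 * norm (partial_deriv i w x))\<^sup>2 \<le> (2 * c\<^sup>2 + 8) * S x"
        proof -
          have "(norm (partial_deriv i w x))\<^sup>2 \<le> (\<Sum>i\<in>UNIV. (norm (partial_deriv i w x))\<^sup>2)"
            by (intro member_le_sum) auto
          then have le: "(norm (w x))\<^sup>2 + (norm (partial_deriv i w x))\<^sup>2 \<le> S x" by (simp add: S_def)
          have "norm (w x) / (b $ i - a $ i) + 2 * norm (partial_deriv i w x) \<le> c * norm (w x) + 2 * norm (partial_deriv i w x)"
            using mult_right_mono[OF ci[of i], of "norm (w x)"] by simp
          then have "(norm (w x) / (b $ i - a $ i) + 2 * norm (partial_deriv i w x))\<^sup>2 \<le> (c * norm (w x) + 2 * norm (partial_deriv i w x))\<^sup>2"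
            using ab[of i] by (intro power_mono) auto
          also have "\<dots> \<le> 2 * c\<^sup>2 * (norm (w x))\<^sup>2 + 8 * (norm (partial_deriv i w x))\<^sup>2"
            using sum_squares_bound[of "c * norm (w x)" "2 * norm (partial_deriv i w x)"] by (simp add: power2_sum power_mult_distrib)
          also have "\<dots> \<le> (2 * c\<^sup>2 + 8) * ((norm (w x))\<^sup>2 + (norm (partial_deriv i w x))\<^sup>2)"
            by (simp add: algebra_simps)
          also have "\<dots> \<le> (2 * c\<^sup>2 + 8) * S x" by (intro mult_left_mono le) simp
          finally show ?thesis .
        qed
        then have le: "ennreal ((norm (w x) / (b $ i - a $ i) + 2 * norm (partial_deriv i w x))\<^sup>2) \<le> ennreal ((2 * c\<^sup>2 + 8) * S x)"
          by (rule ennreal_leI)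
        have "(ennreal (norm (w x) / (b $ i - a $ i) + 2 * norm (partial_deriv i w x)))\<^sup>2 =
          ennreal ((norm (w x) / (b $ i - a $ i) + 2 * norm (partial_deriv i w x))\<^sup>2)"
          using ab[of i] by (intro ennreal_power add_nonneg_nonneg) auto
        moreover have "ennreal ((2 * c\<^sup>2 + 8) * S x) = ennreal (2 * c\<^sup>2 + 8) * ennreal (S x)"
          using S0 by (intro ennreal_mult) auto
        ultimately show "(e i x)\<^sup>2 \<le> ennreal (2 * c\<^sup>2 + 8) * (ennreal (S x) * indicator ?Q x)"
          using le unfolding e_def by (cases "x \<in> ?Q") (simp_all del: ennreal_plus)
      qed
      also have "\<dots> = ennreal (2 * c\<^sup>2 + 8) * I" unfolding I_def by (rule nn_integral_cmult) measurable
      finally show ?thesis .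
    qed
    note eI = this
    have "(\<integral>\<^sup>+x. (m x)^4 \<partial>lborel) \<le> ennreal (c + 1) * I * (ennreal (2 * c\<^sup>2 + 8) * I + ennreal (2 * c\<^sup>2 + 8) * I)"
      by (rule order_trans[OF s1]) (intro mult_mono add_mono s2 eI; simp)
    also have "\<dots> = ennreal C * I\<^sup>2"
    proof -
      have "ennreal (2 * c\<^sup>2 + 8) * I + ennreal (2 * c\<^sup>2 + 8) * I = ennreal (2 * (2 * c\<^sup>2 + 8)) * I"
        by (simp add: distrib_right[symmetric] flip: ennreal_plus)
      moreover have "ennreal C = ennreal (c + 1) * ennreal (2 * (2 * c\<^sup>2 + 8))"
        unfolding C_def using c0 by (intro ennreal_mult) auto
      ultimately show ?thesis by (simp only: power2_eq_square mult_ac)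
    qed
    also have "(\<integral>\<^sup>+x. (m x)^4 \<partial>lborel) = (\<integral>\<^sup>+x. ennreal ((norm (w x))^4) * indicator ?Q x \<partial>lborel)"
      by (intro nn_integral_cong) (auto simp: m_def indicator_def ennreal_power)
    finally show ?thesis unfolding I_def S_def .
  qed
  moreover have "0 \<le> C" using c0 by (simp add: C_def)
  ultimately show ?thesis using that by blast
qed

lemma fourth_power_mono_ennreal: "a ^ 4 \<le> b ^ 4 \<Longrightarrow> a \<le> (b::ennreal)"
proof (rule ccontr)
  assume le: "a ^ 4 \<le> b ^ 4" and "\<not> a \<le> b"
  then have "b < a" by simp
  then obtain r where r: "b = ennreal r" "0 \<le> r" by (cases b) auto
  show False
  proof (cases a)
    case (real s)
    then have "s ^ 4 \<le> r ^ 4" "r < s" using le \<open>b < a\<close> r by (auto simp: ennreal_power ennreal_less_iff)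
    then show False using power_strict_mono[of r s 4] r by simp
  next
    case top
    then show False using le r by (simp add: ennreal_power top_unique)
  qed
qed

section \<open>Fourth-power integrability on V\<close>

context flow_setting
begin

text \<open>Slices of \<Omega> need not be intervals, so the estimate is made on a box whose excess
  over \<Omega> is harmless: a null set in the periodic case, and in the no-slip case a region where
  the fields vanish together with their derivatives.\<close>

lemma region_in_box:
  obtains a b :: "real^3" where "\<And>i. a $ i < b $ i" "\<Omega> \<subseteq> cbox a b"
    "\<And>w i. w \<in> test_fields D \<Longrightarrow> AE x in lborel. x \<in> cbox a b \<longrightarrow> x \<notin> \<Omega> \<longrightarrow> w x = 0 \<and> partial_deriv i w x = 0"
proof (cases D)
  case (Periodic L)
  have L: "0 < L $ i" for i using admissible Periodic by simp
  have "cbox 0 L - box 0 L \<in> null_sets lborel"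
    by (simp add: null_sets_def emeasure_lborel_cbox_eq emeasure_lborel_box_eq emeasure_Diff box_subset_cbox)
  then have "AE x in lborel. x \<notin> cbox 0 L - box 0 L" by (rule AE_not_in)
  then have "AE x in lborel. x \<in> cbox 0 L \<longrightarrow> x \<notin> \<Omega> \<longrightarrow> w x = 0 \<and> partial_deriv i w x = 0" for w i
    by eventually_elim (use Periodic in auto)
  moreover have "\<Omega> \<subseteq> cbox 0 L" using Periodic box_subset_cbox by simp
  ultimately show ?thesis using that[of 0 L] L by simp
next
  case (No_Slip U)
  obtain r where r: "r > 0" "\<And>x. x \<in> \<Omega> \<Longrightarrow> norm x \<le> r" using region_bounded unfolding bounded_pos by blast
  have "\<Omega> \<subseteq> cbox (\<chi> i. - r) (\<chi> i. r)"
  proof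
    fix x assume "x \<in> \<Omega>"
    then have "\<bar>x $ i\<bar> \<le> r" for i using r(2) component_le_norm_cart[of x i] by (meson order_trans)
    then show "x \<in> cbox (\<chi> i. - r) (\<chi> i. r)" by (auto simp: mem_box_cart abs_le_iff minus_le_iff)
  qed
  moreover have "w x = 0 \<and> partial_deriv i w x = 0" if w: "w \<in> test_fields D" and x: "x \<notin> \<Omega>" for w i x
  proof -
    have t: "w \<in> test_functions \<Omega>" using w No_Slip by simp
    define K where "K = closure {x. w x \<noteq> 0}"
    have K: "K \<subseteq> \<Omega>" "closed K" using t by (auto simp: test_functions_def K_def)
    have z: "w y = 0" if "y \<notin> K" for y using that closure_subset[of "{x. w x \<noteq> 0}"] unfolding K_def by blast
    have xK: "x \<notin> K" using K(1) x by blast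
    have "partial_deriv i w x = 0" unfolding partial_deriv_def
      by (rule derivative_zero_outside_support[OF smooth_has_derivative(1)[OF test_field_smooth[OF w]] xK K(2) z])
    with z[OF xK] show ?thesis by simp
  qed
  ultimately show ?thesis using that[of "\<chi> i. - r" "\<chi> i. r"] r(1) by simp
qed

lemma nn_integral_lebesgue_borel:
  fixes f :: "real^3 \<Rightarrow> ennreal"
  shows "f \<in> borel_measurable borel \<Longrightarrow> (\<integral>\<^sup>+x. f x \<partial>lebesgue) = (\<integral>\<^sup>+x. f x \<partial>lborel)"
  by (rule nn_integral_completion)

lemma test_field_L4:
  obtains C where "0 \<le> C" "\<And>w. w \<in> test_fields D \<Longrightarrow>
    (\<integral>\<^sup>+x. ennreal ((norm (rep_l2_field (cls w) x))^4) \<partial>lebesgue) \<le> ennreal (C * (norm (jet (cls w)))^4)"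
proof -
  obtain a b :: "real^3" where ab: "\<And>i. a $ i < b $ i" "\<Omega> \<subseteq> cbox a b"
    "\<And>w i. w \<in> test_fields D \<Longrightarrow> AE x in lborel. x \<in> cbox a b \<longrightarrow> x \<notin> \<Omega> \<longrightarrow> w x = 0 \<and> partial_deriv i w x = 0"
    using region_in_box by blast
  obtain C where C: "0 \<le> C" "\<And>w. smooth w \<Longrightarrow>
    (\<integral>\<^sup>+x. ennreal ((norm (w x))^4) * indicator (cbox a b) x \<partial>lborel) \<le>
    ennreal C * (\<integral>\<^sup>+x. ennreal ((norm (w x))\<^sup>2 + (\<Sum>i\<in>UNIV. (norm (partial_deriv i w x))\<^sup>2)) * indicator (cbox a b) x \<partial>lborel)\<^sup>2"
    using ladyzhenskaya_box[OF ab(1)] by blast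
  have "(\<integral>\<^sup>+x. ennreal ((norm (rep_l2_field (cls w) x))^4) \<partial>lebesgue) \<le> ennreal (C * (norm (jet (cls w)))^4)"
    if w: "w \<in> test_fields D" for w
  proof -
    note sm = test_field_smooth[OF w]
    have [measurable]: "w \<in> borel_measurable borel" "partial_deriv i w \<in> borel_measurable borel" for i
      using smooth_continuous[OF sm] smooth_partial_continuous[OF sm] by (auto intro!: borel_measurable_continuous_onI)
    note sqw = sq_integrable_cont[OF smooth_continuous[OF sm]]
    have sqi: "(\<integral>\<^sup>+x. ennreal ((norm (g x))\<^sup>2) * indicator \<Omega> x \<partial>lborel) = ennreal ((norm (cls g))\<^sup>2)"
      if g: "continuous_on UNIV g" for g
    proof -
      have [measurable]: "g \<in> borel_measurable borel" using g by (rule borel_measurable_continuous_onI)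
      have "ennreal ((norm (cls g))\<^sup>2) = (\<integral>\<^sup>+x. ennreal ((norm (rep_l2_field (cls g) x - rep_l2_field 0 x))\<^sup>2) \<partial>lebesgue)"
        using norm2_l2_diff_nn[of "cls g" 0] by simp
      also have "\<dots> = (\<integral>\<^sup>+x. ennreal ((norm (g x))\<^sup>2) * indicator \<Omega> x \<partial>lebesgue)"
        by (rule nn_integral_cong_AE)
          (use rep_l2_class[OF sq_integrable_cont[OF g]] rep_l2_zero in \<open>eventually_elim, simp add: indicator_def\<close>)
      also have "\<dots> = (\<integral>\<^sup>+x. ennreal ((norm (g x))\<^sup>2) * indicator \<Omega> x \<partial>lborel)"
        by (rule nn_integral_lebesgue_borel) measurable
      finally show ?thesis by simp
    qed
    have "(\<integral>\<^sup>+x. ennreal ((norm (rep_l2_field (cls w) x))^4) \<partial>lebesgue) = (\<integral>\<^sup>+x. ennreal ((norm (w x))^4) * indicator \<Omega> x \<partial>lebesgue)"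
      by (rule nn_integral_cong_AE) (use rep_l2_class[OF sqw] in \<open>eventually_elim, simp add: indicator_def\<close>)
    also have "\<dots> = (\<integral>\<^sup>+x. ennreal ((norm (w x))^4) * indicator \<Omega> x \<partial>lborel)"
      by (rule nn_integral_lebesgue_borel) measurable
    also have "\<dots> \<le> (\<integral>\<^sup>+x. ennreal ((norm (w x))^4) * indicator (cbox a b) x \<partial>lborel)"
      using ab(2) by (intro nn_integral_mono) (auto simp: indicator_def)
    also have "\<dots> \<le> ennreal C * (\<integral>\<^sup>+x. ennreal ((norm (w x))\<^sup>2 + (\<Sum>i\<in>UNIV. (norm (partial_deriv i w x))\<^sup>2)) * indicator (cbox a b) x \<partial>lborel)\<^sup>2"
      by (rule C(2)[OF sm])
    also have "(\<integral>\<^sup>+x. ennreal ((norm (w x))\<^sup>2 + (\<Sum>i\<in>UNIV. (norm (partial_deriv i w x))\<^sup>2)) * indicator (cbox a b) x \<partial>lborel)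
      = (\<integral>\<^sup>+x. ennreal ((norm (w x))\<^sup>2) * indicator \<Omega> x + (\<Sum>i\<in>UNIV. ennreal ((norm (partial_deriv i w x))\<^sup>2) * indicator \<Omega> x) \<partial>lborel)"
    proof (rule nn_integral_cong_AE)
      have "AE x in lborel. \<forall>i. x \<in> cbox a b \<longrightarrow> x \<notin> \<Omega> \<longrightarrow> w x = 0 \<and> partial_deriv i w x = 0"
        unfolding AE_all_countable using ab(3)[OF w] by blast
      then show "AE x in lborel. ennreal ((norm (w x))\<^sup>2 + (\<Sum>i\<in>UNIV. (norm (partial_deriv i w x))\<^sup>2)) * indicator (cbox a b) x
        = ennreal ((norm (w x))\<^sup>2) * indicator \<Omega> x + (\<Sum>i\<in>UNIV. ennreal ((norm (partial_deriv i w x))\<^sup>2) * indicator \<Omega> x)"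
      proof eventually_elim
        case (elim x)
        then show ?case using ab(2) by (cases "x \<in> \<Omega>"; cases "x \<in> cbox a b") (auto simp: sum_nonneg)
      qed
    qed
    also have "\<dots> = (\<integral>\<^sup>+x. ennreal ((norm (w x))\<^sup>2) * indicator \<Omega> x \<partial>lborel) + (\<Sum>i\<in>UNIV. (\<integral>\<^sup>+x. ennreal ((norm (partial_deriv i w x))\<^sup>2) * indicator \<Omega> x \<partial>lborel))"
    proof -
      have "(\<integral>\<^sup>+x. (\<Sum>i\<in>UNIV. ennreal ((norm (partial_deriv i w x))\<^sup>2) * indicator \<Omega> x) \<partial>lborel) =
        (\<Sum>i\<in>UNIV. (\<integral>\<^sup>+x. ennreal ((norm (partial_deriv i w x))\<^sup>2) * indicator \<Omega> x \<partial>lborel))"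
        by (rule nn_integral_sum) measurable
      moreover have "(\<integral>\<^sup>+x. ennreal ((norm (w x))\<^sup>2) * indicator \<Omega> x + (\<Sum>i\<in>UNIV. ennreal ((norm (partial_deriv i w x))\<^sup>2) * indicator \<Omega> x) \<partial>lborel) =
        (\<integral>\<^sup>+x. ennreal ((norm (w x))\<^sup>2) * indicator \<Omega> x \<partial>lborel) + (\<integral>\<^sup>+x. (\<Sum>i\<in>UNIV. ennreal ((norm (partial_deriv i w x))\<^sup>2) * indicator \<Omega> x) \<partial>lborel)"
        by (rule nn_integral_add) measurable
      ultimately show ?thesis by simp
    qed
    also have "\<dots> = ennreal ((norm (cls w))\<^sup>2) + (\<Sum>i\<in>UNIV. ennreal ((norm (cls (partial_deriv i w)))\<^sup>2))"
      by (simp only: sqi smooth_continuous smooth_partial_continuous sm)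
    also have "\<dots> = ennreal ((norm (jet (cls w)))\<^sup>2)"
      unfolding norm_jet H1_norm_sq smooth_wp[OF sm] sum_3 by (simp add: add.assoc)
    also have "ennreal C * (ennreal ((norm (jet (cls w)))\<^sup>2))\<^sup>2 = ennreal (C * (norm (jet (cls w)))^4)"
      using C(1) by (simp add: ennreal_power ennreal_mult flip: power_mult)
    finally show ?thesis .
  qed
  with C(1) that show ?thesis by blast
qed

text \<open>Density of the test fields: along a subsequence converging almost everywhere, Fatou's
  lemma carries the bound to the limit.\<close>

lemma V_L4:
  obtains C where "0 \<le> C" "\<And>u. u \<in> V_space D \<Longrightarrow>
    (\<integral>\<^sup>+x. ennreal ((norm (rep_l2_field u x))^4) \<partial>lebesgue) \<le> ennreal (C * (norm (jet u))^4)"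
proof -
  obtain C where C: "0 \<le> C" "\<And>w. w \<in> test_fields D \<Longrightarrow>
    (\<integral>\<^sup>+x. ennreal ((norm (rep_l2_field (cls w) x))^4) \<partial>lebesgue) \<le> ennreal (C * (norm (jet (cls w)))^4)"
    using test_field_L4 by blast
  have "(\<integral>\<^sup>+x. ennreal ((norm (rep_l2_field u x))^4) \<partial>lebesgue) \<le> ennreal (C * (norm (jet u))^4)"
    if u: "u \<in> V_space D" for u
  proof -
    obtain w where w: "\<And>n. w n \<in> test_fields D" "(\<lambda>n. jet (cls (w n))) \<longlonglongrightarrow> jet u"
      using V_space_sequence[OF u] by blast
    have "(\<lambda>n. cls (w n)) \<longlonglongrightarrow> u" using tendsto_fst[OF w(2)] by (simp add: jet_def)
    then obtain r :: "nat \<Rightarrow> nat" where r: "strict_mono r"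
      "AE x in lebesgue. (\<lambda>n. rep_l2_field (cls (w (r n))) x) \<longlonglongrightarrow> rep_l2_field u x"
      by (rule l2_limit_AE_subseq)
    have "(\<integral>\<^sup>+x. ennreal ((norm (rep_l2_field u x))^4) \<partial>lebesgue)
      = (\<integral>\<^sup>+x. liminf (\<lambda>n. ennreal ((norm (rep_l2_field (cls (w (r n))) x))^4)) \<partial>lebesgue)"
    proof (rule nn_integral_cong_AE, use r(2) in eventually_elim)
      case (elim x)
      have "(\<lambda>n. ennreal ((norm (rep_l2_field (cls (w (r n))) x))^4)) \<longlonglongrightarrow> ennreal ((norm (rep_l2_field u x))^4)"
        by (intro tendsto_intros elim)
      then show ?case by (intro lim_imp_Liminf[symmetric]) simp_all
    qed
    also have "\<dots> \<le> liminf (\<lambda>n. \<integral>\<^sup>+x. ennreal ((norm (rep_l2_field (cls (w (r n))) x))^4) \<partial>lebesgue)"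
      by (rule nn_integral_liminf) measurable
    also have "\<dots> \<le> liminf (\<lambda>n. ennreal (C * (norm (jet (cls (w (r n)))))^4))"
      by (intro Liminf_mono always_eventually allI C(2) w(1))
    also have "\<dots> = ennreal (C * (norm (jet u))^4)"
    proof (rule lim_imp_Liminf)
      have "(\<lambda>n. jet (cls (w (r n)))) \<longlonglongrightarrow> jet u" using LIMSEQ_subseq_LIMSEQ[OF w(2) r(1)] by (simp add: o_def)
      then show "(\<lambda>n. ennreal (C * (norm (jet (cls (w (r n)))))^4)) \<longlonglongrightarrow> ennreal (C * (norm (jet u))^4)"
        by (intro tendsto_intros)
    qed simp
    finally show ?thesis .
  qed
  with C(1) that show ?thesis by blast
qed

section \<open>The trilinear form\<close>

text \<open>Hoelder's inequality with exponents 4, 4, 2, as two applications of Cauchy-Schwarz.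
  Fourth powers are compared in order to stay free of roots of extended reals.\<close>

lemma triple_product_bound:
  obtains K where "0 \<le> K" "\<And>u w g. u \<in> V_space D \<Longrightarrow> w \<in> V_space D \<Longrightarrow>
    (\<integral>\<^sup>+x. ennreal (norm (rep_l2_field u x) * norm (rep_l2_field w x) * norm (rep_l2_field g x)) \<partial>lebesgue)
      \<le> ennreal (K * norm (jet u) * norm (jet w) * norm g)"
proof -
  obtain C where C: "0 \<le> C" "\<And>u. u \<in> V_space D \<Longrightarrow>
    (\<integral>\<^sup>+x. ennreal ((norm (rep_l2_field u x))^4) \<partial>lebesgue) \<le> ennreal (C * (norm (jet u))^4)"
    using V_L4 by blast
  have "(\<integral>\<^sup>+x. ennreal (norm (rep_l2_field u x) * norm (rep_l2_field w x) * norm (rep_l2_field g x)) \<partial>lebesgue)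
      \<le> ennreal (sqrt C * norm (jet u) * norm (jet w) * norm g)" (is "?I \<le> _")
    if uw: "u \<in> V_space D" "w \<in> V_space D" for u w g
  proof (rule fourth_power_mono_ennreal)
    let ?u = "\<lambda>x. ennreal (norm (rep_l2_field u x))" and ?w = "\<lambda>x. ennreal (norm (rep_l2_field w x))"
      and ?g = "\<lambda>x. ennreal (norm (rep_l2_field g x))"
    have I: "?I = (\<integral>\<^sup>+x. (?u x * ?w x) * ?g x \<partial>lebesgue)"
      by (simp add: ennreal_mult)
    have g2: "(\<integral>\<^sup>+x. (?g x)\<^sup>2 \<partial>lebesgue) = ennreal ((norm g)\<^sup>2)"
    proof -
      have "ennreal ((norm g)\<^sup>2) = (\<integral>\<^sup>+x. ennreal ((norm (rep_l2_field g x - rep_l2_field 0 x))\<^sup>2) \<partial>lebesgue)"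
        using norm2_l2_diff_nn[of g 0] by simp
      also have "\<dots> = (\<integral>\<^sup>+x. (?g x)\<^sup>2 \<partial>lebesgue)"
        by (rule nn_integral_cong_AE) (use rep_l2_zero in \<open>eventually_elim, simp add: ennreal_power\<close>)
      finally show ?thesis by simp
    qed
    have uw4: "(\<integral>\<^sup>+x. (?u x * ?w x)\<^sup>2 \<partial>lebesgue)\<^sup>2 \<le> ennreal (C * (norm (jet u))^4) * ennreal (C * (norm (jet w))^4)"
    proof -
      have "(\<integral>\<^sup>+x. (?u x * ?w x)\<^sup>2 \<partial>lebesgue)\<^sup>2 = (\<integral>\<^sup>+x. (?u x)\<^sup>2 * (?w x)\<^sup>2 \<partial>lebesgue)\<^sup>2"
        by (simp add: power_mult_distrib)
      also have "\<dots> \<le> (\<integral>\<^sup>+x. ((?u x)\<^sup>2)\<^sup>2 \<partial>lebesgue) * (\<integral>\<^sup>+x. ((?w x)\<^sup>2)\<^sup>2 \<partial>lebesgue)"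
        by (rule Cauchy_Schwarz_nn_integral) measurable
      also have "\<dots> = (\<integral>\<^sup>+x. ennreal ((norm (rep_l2_field u x))^4) \<partial>lebesgue) * (\<integral>\<^sup>+x. ennreal ((norm (rep_l2_field w x))^4) \<partial>lebesgue)"
        by (simp add: ennreal_power flip: power_mult)
      also have "\<dots> \<le> ennreal (C * (norm (jet u))^4) * ennreal (C * (norm (jet w))^4)"
        by (intro mult_mono C uw) auto
      finally show ?thesis .
    qed
    have "?I ^ 4 = (?I\<^sup>2)\<^sup>2" by (simp flip: power_mult)
    also have "\<dots> \<le> ((\<integral>\<^sup>+x. (?u x * ?w x)\<^sup>2 \<partial>lebesgue) * (\<integral>\<^sup>+x. (?g x)\<^sup>2 \<partial>lebesgue))\<^sup>2"
    proof (rule power_mono)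
      show "?I\<^sup>2 \<le> (\<integral>\<^sup>+x. (?u x * ?w x)\<^sup>2 \<partial>lebesgue) * (\<integral>\<^sup>+x. (?g x)\<^sup>2 \<partial>lebesgue)"
        unfolding I by (rule Cauchy_Schwarz_nn_integral) measurable
    qed simp
    also have "\<dots> = (\<integral>\<^sup>+x. (?u x * ?w x)\<^sup>2 \<partial>lebesgue)\<^sup>2 * (ennreal ((norm g)\<^sup>2))\<^sup>2"
      unfolding g2 by (rule power_mult_distrib)
    also have "\<dots> \<le> (ennreal (C * (norm (jet u))^4) * ennreal (C * (norm (jet w))^4)) * (ennreal ((norm g)\<^sup>2))\<^sup>2"
      by (intro mult_right_mono uw4) simp
    also have "\<dots> = ennreal (sqrt C * norm (jet u) * norm (jet w) * norm g) ^ 4"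
    proof -
      have "sqrt C ^ 4 = C * C"
        using C(1) real_sqrt_pow2[of C] by (simp add: numeral_eq_Suc power2_eq_square)
      then have "(sqrt C * norm (jet u) * norm (jet w) * norm g) ^ 4 = (C * (norm (jet u))^4) * (C * (norm (jet w))^4) * (norm g)^4"
        by (simp add: power_mult_distrib mult_ac)
      moreover have "(ennreal A * ennreal B) * (ennreal (G\<^sup>2))\<^sup>2 = ennreal (A * B * G ^ 4)" if "0 \<le> A" "0 \<le> B" "0 \<le> G" for A B G
        using that by (simp add: ennreal_power ennreal_mult flip: power_mult)
      moreover have "ennreal (sqrt C * norm (jet u) * norm (jet w) * norm g) ^ 4 = ennreal ((sqrt C * norm (jet u) * norm (jet w) * norm g) ^ 4)"
        using C(1) by (intro ennreal_power) auto
      ultimately show ?thesis using C(1) by simp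
    qed
    finally show "?I ^ 4 \<le> ennreal (sqrt C * norm (jet u) * norm (jet w) * norm g) ^ 4" .
  qed
  then show ?thesis using that[of "sqrt C"] C(1) by simp
qed

definition tri_integrand :: "l2_field \<Rightarrow> l2_field \<Rightarrow> l2_field \<Rightarrow> real^3 \<Rightarrow> real" where
  "tri_integrand u v w x = indicator \<Omega> x *\<^sub>R
     ((\<Sum>i\<in>UNIV. (rep_l2_field u x $ i) *\<^sub>R rep_l2_field (wp i v) x) \<bullet> rep_l2_field w x)"

lemma trilinear_integrand: "trilinear D u v w = (\<integral>x. tri_integrand u v w x \<partial>lebesgue)"
  unfolding trilinear_def tri_integrand_def set_lebesgue_integral_def ..

lemma norm_wp_le_jet: "norm (wp i u) \<le> norm (jet u)"
proof (rule power2_le_imp_le)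
  show "(norm (wp i u))\<^sup>2 \<le> (norm (jet u))\<^sup>2"
    using exhaust_3[of i] unfolding norm_jet H1_norm_sq by (auto simp: add_nonneg_nonneg)
qed simp

lemma tri_integrand_measurable: "tri_integrand u v w \<in> borel_measurable lebesgue"
proof -
  have [measurable]: "(\<lambda>x. rep_l2_field u x $ k) \<in> borel_measurable lebesgue" for u k
    using measurable_compose[OF rep_l2_measurable borel_measurable_continuous_onI[OF continuous_on_vec_nth_UNIV]] .
  show ?thesis unfolding tri_integrand_def by measurable
qed

text \<open>The derivative is put in the L^2 slot and the two undifferentiated factors in L^4; the
  sum over the three directions contributes a factor 3.\<close>

lemma tri_integrand_bound:
  obtains K where "0 \<le> K" "\<And>u v w. u \<in> V_space D \<Longrightarrow> w \<in> V_space D \<Longrightarrow>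
    (\<integral>\<^sup>+x. ennreal (norm (tri_integrand u v w x)) \<partial>lebesgue) \<le> ennreal (K * norm (jet u) * norm (jet v) * norm (jet w))"
proof -
  obtain K where K: "0 \<le> K" "\<And>u w g. u \<in> V_space D \<Longrightarrow> w \<in> V_space D \<Longrightarrow>
    (\<integral>\<^sup>+x. ennreal (norm (rep_l2_field u x) * norm (rep_l2_field w x) * norm (rep_l2_field g x)) \<partial>lebesgue)
      \<le> ennreal (K * norm (jet u) * norm (jet w) * norm g)"
    using triple_product_bound by blast
  have "(\<integral>\<^sup>+x. ennreal (norm (tri_integrand u v w x)) \<partial>lebesgue) \<le> ennreal ((3 * K) * norm (jet u) * norm (jet v) * norm (jet w))"
    if uw: "u \<in> V_space D" "w \<in> V_space D" for u v w
  proof -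
    have "(\<integral>\<^sup>+x. ennreal (norm (tri_integrand u v w x)) \<partial>lebesgue) \<le>
      (\<integral>\<^sup>+x. (\<Sum>i\<in>UNIV. ennreal (norm (rep_l2_field u x) * norm (rep_l2_field w x) * norm (rep_l2_field (wp i v) x))) \<partial>lebesgue)"
    proof (rule nn_integral_mono)
      fix x
      have "norm (tri_integrand u v w x) \<le> norm (\<Sum>i\<in>UNIV. (rep_l2_field u x $ i) *\<^sub>R rep_l2_field (wp i v) x) * norm (rep_l2_field w x)"
        unfolding tri_integrand_def using Cauchy_Schwarz_ineq2[of "\<Sum>i\<in>UNIV. (rep_l2_field u x $ i) *\<^sub>R rep_l2_field (wp i v) x" "rep_l2_field w x"]
        by (simp add: indicator_def)
      also have "\<dots> \<le> (\<Sum>i\<in>UNIV. norm (rep_l2_field u x) * norm (rep_l2_field (wp i v) x)) * norm (rep_l2_field w x)"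
      proof (rule mult_right_mono)
        show "norm (\<Sum>i\<in>UNIV. (rep_l2_field u x $ i) *\<^sub>R rep_l2_field (wp i v) x) \<le> (\<Sum>i\<in>UNIV. norm (rep_l2_field u x) * norm (rep_l2_field (wp i v) x))"
          by (rule sum_norm_le) (simp add: mult_right_mono component_le_norm_cart)
      qed simp
      also have "\<dots> = (\<Sum>i\<in>UNIV. norm (rep_l2_field u x) * norm (rep_l2_field w x) * norm (rep_l2_field (wp i v) x))"
        by (subst sum_distrib_right) (simp add: mult_ac)
      finally have "ennreal (norm (tri_integrand u v w x)) \<le> ennreal (\<Sum>i\<in>UNIV. norm (rep_l2_field u x) * norm (rep_l2_field w x) * norm (rep_l2_field (wp i v) x))"
        by (rule ennreal_leI)
      then show "ennreal (norm (tri_integrand u v w x)) \<le> (\<Sum>i\<in>UNIV. ennreal (norm (rep_l2_field u x) * norm (rep_l2_field w x) * norm (rep_l2_field (wp i v) x)))"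
        by (simp add: sum_ennreal)
    qed
    also have "\<dots> = (\<Sum>i\<in>UNIV. \<integral>\<^sup>+x. ennreal (norm (rep_l2_field u x) * norm (rep_l2_field w x) * norm (rep_l2_field (wp i v) x)) \<partial>lebesgue)"
      by (rule nn_integral_sum) measurable
    also have "\<dots> \<le> (\<Sum>i\<in>(UNIV::3 set). ennreal (K * norm (jet u) * norm (jet w) * norm (jet v)))"
    proof (rule sum_mono)
      fix i
      have "K * norm (jet u) * norm (jet w) * norm (wp i v) \<le> K * norm (jet u) * norm (jet w) * norm (jet v)"
        using K(1) by (intro mult_left_mono norm_wp_le_jet) auto
      then show "(\<integral>\<^sup>+x. ennreal (norm (rep_l2_field u x) * norm (rep_l2_field w x) * norm (rep_l2_field (wp i v) x)) \<partial>lebesgue)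
        \<le> ennreal (K * norm (jet u) * norm (jet w) * norm (jet v))"
        using K(2)[OF uw, of "wp i v"] by (meson ennreal_leI order_trans)
    qed
    also have "\<dots> = ennreal ((3 * K) * norm (jet u) * norm (jet v) * norm (jet w))"
      using K(1) by (subst sum_ennreal) (auto simp: mult_ac)
    finally show ?thesis .
  qed
  then show ?thesis using that[of "3 * K"] K(1) by simp
qed

lemma tri_integrand_integrable:
  assumes "u \<in> V_space D" "w \<in> V_space D"
  shows "integrable lebesgue (tri_integrand u v w)"
proof -
  obtain K where "(\<integral>\<^sup>+x. ennreal (norm (tri_integrand u v w x)) \<partial>lebesgue) \<le> ennreal K"
    using tri_integrand_bound assms by metis
  then show ?thesis
    by (intro integrableI_bounded tri_integrand_measurable) (auto intro: order.strict_trans1)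
qed

lemma trilinear_bound:
  obtains K where "0 \<le> K" "\<And>u v w. u \<in> V_space D \<Longrightarrow> w \<in> V_space D \<Longrightarrow>
    \<bar>trilinear D u v w\<bar> \<le> K * norm (jet u) * norm (jet v) * norm (jet w)"
proof -
  obtain K where K: "0 \<le> K" "\<And>u v w. u \<in> V_space D \<Longrightarrow> w \<in> V_space D \<Longrightarrow>
    (\<integral>\<^sup>+x. ennreal (norm (tri_integrand u v w x)) \<partial>lebesgue) \<le> ennreal (K * norm (jet u) * norm (jet v) * norm (jet w))"
    using tri_integrand_bound by blast
  have "\<bar>trilinear D u v w\<bar> \<le> K * norm (jet u) * norm (jet v) * norm (jet w)"
    if uw: "u \<in> V_space D" "w \<in> V_space D" for u v w
  proof -
    have "ennreal (norm (trilinear D u v w)) \<le> (\<integral>\<^sup>+x. ennreal (norm (tri_integrand u v w x)) \<partial>lebesgue)"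
      unfolding trilinear_integrand by (rule integral_norm_bound_ennreal[OF tri_integrand_integrable[OF uw]])
    also note K(2)[OF uw, of v]
    finally show ?thesis using K(1) by simp
  qed
  with K(1) that show ?thesis by blast
qed

lemma trilinear_add3:
  assumes "u \<in> V_space D" "w \<in> V_space D" "w' \<in> V_space D"
  shows "trilinear D u v (w + w') = trilinear D u v w + trilinear D u v w'"
proof -
  have "trilinear D u v (w + w') = (\<integral>x. tri_integrand u v w x + tri_integrand u v w' x \<partial>lebesgue)"
    unfolding trilinear_integrand
  proof (rule integral_cong_AE)
    show "AE x in lebesgue. tri_integrand u v (w + w') x = tri_integrand u v w x + tri_integrand u v w' x"
      using rep_l2_add[of w w'] by eventually_elim (simp add: tri_integrand_def inner_add_right distrib_left)
  qed (intro tri_integrand_measurable borel_measurable_add)+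
  then show ?thesis by (simp add: trilinear_integrand tri_integrand_integrable assms)
qed

lemma trilinear_scaleR3: "trilinear D u v (c *\<^sub>R w) = c * trilinear D u v w"
proof -
  have "trilinear D u v (c *\<^sub>R w) = (\<integral>x. c * tri_integrand u v w x \<partial>lebesgue)"
    unfolding trilinear_integrand
  proof (rule integral_cong_AE)
    show "AE x in lebesgue. tri_integrand u v (c *\<^sub>R w) x = c * tri_integrand u v w x"
      using rep_l2_scaleR[of c w] by eventually_elim (simp add: tri_integrand_def)
  qed (intro tri_integrand_measurable borel_measurable_times borel_measurable_const)+
  then show ?thesis by (simp add: trilinear_integrand)
qed

lemma trilinear_diff1:
  assumes "u \<in> V_space D" "u' \<in> V_space D" "w \<in> V_space D"
  shows "trilinear D (u - u') v w = trilinear D u v w - trilinear D u' v w"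
proof -
  have "trilinear D (u - u') v w = (\<integral>x. tri_integrand u v w x - tri_integrand u' v w x \<partial>lebesgue)"
    unfolding trilinear_integrand
  proof (rule integral_cong_AE)
    show "AE x in lebesgue. tri_integrand (u - u') v w x = tri_integrand u v w x - tri_integrand u' v w x"
      using rep_l2_diff[of u u'] by eventually_elim
        (simp add: tri_integrand_def scaleR_diff_left sum_subtractf inner_diff_left right_diff_distrib)
  qed (intro tri_integrand_measurable borel_measurable_diff)+
  then show ?thesis by (simp add: trilinear_integrand tri_integrand_integrable assms)
qed

lemma trilinear_diff2:
  assumes "u \<in> V_space D" "v \<in> V_space D" "v' \<in> V_space D" "w \<in> V_space D"
  shows "trilinear D u (v - v') w = trilinear D u v w - trilinear D u v' w"
proof -
  have "trilinear D u (v - v') w = (\<integral>x. tri_integrand u v w x - tri_integrand u v' w x \<partial>lebesgue)"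
    unfolding trilinear_integrand
  proof (rule integral_cong_AE)
    have "AE x in lebesgue. \<forall>i. rep_l2_field (wp i (v - v')) x = rep_l2_field (wp i v) x - rep_l2_field (wp i v') x"
      unfolding AE_all_countable using rep_l2_diff[of "wp _ v" "wp _ v'"] wp_diff[OF V_H1[OF assms(2)] V_H1[OF assms(3)]] by simp
    then show "AE x in lebesgue. tri_integrand u (v - v') w x = tri_integrand u v w x - tri_integrand u v' w x"
      by eventually_elim
        (simp add: tri_integrand_def scaleR_diff_right sum_subtractf inner_diff_left right_diff_distrib)
  qed (intro tri_integrand_measurable borel_measurable_diff)+
  then show ?thesis by (simp add: trilinear_integrand tri_integrand_integrable assms)
qed

text \<open>The difference of the quadratic expressions splits as b(u_n - u, u_n, v) + b(u, u_n - u,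
  v). Continuity is stated on graph points, the form that \<open>jet_continuous_measurable\<close>
  expects.\<close>

lemma trilinear_continuous:
  assumes v: "v \<in> V_space D"
  shows "continuous_on (jet ` V_space D) (\<lambda>p. trilinear D (fst p) (fst p) v)"
  unfolding continuous_on_sequentially
proof (intro ballI allI impI, elim conjE)
  fix p and X :: "nat \<Rightarrow> _" assume p: "p \<in> jet ` V_space D" and X: "\<forall>n. X n \<in> jet ` V_space D" and lim: "X \<longlonglongrightarrow> p"
  obtain K where K: "0 \<le> K" "\<And>u v w. u \<in> V_space D \<Longrightarrow> w \<in> V_space D \<Longrightarrow>
    \<bar>trilinear D u v w\<bar> \<le> K * norm (jet u) * norm (jet v) * norm (jet w)"
    using trilinear_bound by blast
  have fV: "fst q \<in> V_space D" "jet (fst q) = q" if "q \<in> jet ` V_space D" for q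
    using that by (auto simp: jet_def)
  have bound: "norm (trilinear D (fst (X n)) (fst (X n)) v - trilinear D (fst p) (fst p) v) \<le>
      K * norm (X n - p) * norm (X n) * norm (jet v) + K * norm p * norm (X n - p) * norm (jet v)" for n
  proof -
    have Xn: "X n \<in> jet ` V_space D" using X by blast
    note V = fV(1)[OF Xn] fV(1)[OF p]
    have j: "jet (fst (X n) - fst p) = X n - p"
      using jet_diff[OF V_H1[OF V(1)] V_H1[OF V(2)]] fV(2)[OF Xn] fV(2)[OF p] by simp
    have "trilinear D (fst (X n)) (fst (X n)) v - trilinear D (fst p) (fst p) v =
      trilinear D (fst (X n) - fst p) (fst (X n)) v + trilinear D (fst p) (fst (X n) - fst p) v"
      using V v by (simp add: trilinear_diff1 trilinear_diff2)
    moreover have "\<bar>trilinear D (fst (X n) - fst p) (fst (X n)) v\<bar> \<le> K * norm (X n - p) * norm (X n) * norm (jet v)"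
      using K(2)[OF V_diff[OF V] v, of "fst (X n)"] unfolding j fV(2)[OF Xn] .
    moreover have "\<bar>trilinear D (fst p) (fst (X n) - fst p) v\<bar> \<le> K * norm p * norm (X n - p) * norm (jet v)"
      using K(2)[OF V(2) v, of "fst (X n) - fst p"] unfolding j fV(2)[OF p] .
    ultimately show ?thesis by simp
  qed
  have "(\<lambda>n. K * norm (X n - p) * norm (X n) * norm (jet v) + K * norm p * norm (X n - p) * norm (jet v))
    \<longlonglongrightarrow> K * norm (p - p) * norm p * norm (jet v) + K * norm p * norm (p - p) * norm (jet v)"
    by (intro tendsto_intros lim)
  then have "(\<lambda>n. trilinear D (fst (X n)) (fst (X n)) v - trilinear D (fst p) (fst p) v) \<longlonglongrightarrow> 0"
    by (intro Lim_null_comparison[OF always_eventually[OF allI[OF bound]]]) simp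
  then show "((\<lambda>p. trilinear D (fst p) (fst p) v) \<circ> X) \<longlonglongrightarrow> trilinear D (fst p) (fst p) v"
    by (simp add: o_def LIM_zero_iff)
qed

lemma trilinear_measurable:
  "v \<in> V_space D \<Longrightarrow> (\<lambda>u. trilinear D u u v) \<in> borel_measurable (restrict_space borel (V_space D))"
  using jet_continuous_measurable[OF trilinear_continuous] by (simp add: jet_def)

lemma H1_inner_measurable: "(\<lambda>u. H1_inner D u v) \<in> borel_measurable (restrict_space borel (V_space D))"
proof -
  have "continuous_on (jet ` V_space D) (\<lambda>p. fst (snd p) \<bullet> wp 1 v + fst (snd (snd p)) \<bullet> wp 2 v + snd (snd (snd p)) \<bullet> wp 3 v)"
    by (intro continuous_intros)
  from jet_continuous_measurable[OF this] show ?thesis by (simp add: jet_def H1_inner_def sum_3)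
qed

lemma H1_norm_measurable: "H1_norm D \<in> borel_measurable (restrict_space borel (V_space D))"
proof -
  have "continuous_on (jet ` V_space D) (\<lambda>p. sqrt (fst (snd p) \<bullet> fst (snd p) + fst (snd (snd p)) \<bullet> fst (snd (snd p)) + snd (snd (snd p)) \<bullet> snd (snd (snd p))))"
    by (intro continuous_intros)
  from jet_continuous_measurable[OF this] show ?thesis by (simp add: jet_def H1_inner_def sum_3 H1_norm_def[abs_def])
qed

lemma H1_inner_bound: "\<bar>H1_inner D u v\<bar> \<le> 3 * norm (jet u) * norm (jet v)"
proof -
  have "\<bar>H1_inner D u v\<bar> \<le> (\<Sum>i\<in>UNIV. \<bar>wp i u \<bullet> wp i v\<bar>)" unfolding H1_inner_def by (rule sum_abs)
  also have "\<dots> \<le> (\<Sum>i\<in>(UNIV::3 set). norm (jet u) * norm (jet v))"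
    by (intro sum_mono order_trans[OF Cauchy_Schwarz_ineq2] mult_mono norm_wp_le_jet) auto
  finally show ?thesis by simp
qed

section \<open>The right-hand side of the equation against a fixed element of V\<close>

lemma H1_inner_add: "v \<in> V_space D \<Longrightarrow> v' \<in> V_space D \<Longrightarrow> H1_inner D u (v + v') = H1_inner D u v + H1_inner D u v'"
  unfolding H1_inner_def by (simp add: wp_add V_H1 inner_add_right sum.distrib)

lemma H1_inner_scaleR: "v \<in> V_space D \<Longrightarrow> H1_inner D u (c *\<^sub>R v) = c * H1_inner D u v"
  unfolding H1_inner_def by (simp add: wp_scaleR V_H1 sum_distrib_left)

lemma NS_rhs_V:
  "v \<in> V_space D \<Longrightarrow> NS_rhs D \<nu> f s u v = f s \<bullet> v - \<nu> * H1_inner D u v - trilinear D u u v"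
  by (simp add: NS_rhs_def stokes_op_def bilinear_op_def)

lemma NS_rhs_sum:
  assumes u: "u \<in> V_space D" and v: "\<And>j. j \<in> A \<Longrightarrow> v j \<in> V_space D" and "finite A"
  shows "NS_rhs D \<nu> f s u (\<Sum>j\<in>A. c j *\<^sub>R v j) = (\<Sum>j\<in>A. c j * NS_rhs D \<nu> f s u (v j))"
  using assms(3) v
proof (induction A rule: finite_induct)
  case empty
  have "trilinear D u u 0 = 0" using trilinear_scaleR3[of u u 0 0] by simp
  moreover have "H1_inner D u 0 = 0" using H1_inner_scaleR[OF V_zero, of u 0] by simp
  ultimately show ?case by (simp add: NS_rhs_V[OF V_zero])
next
  case (insert j A)
  have s: "(\<Sum>j\<in>A. c j *\<^sub>R v j) \<in> V_space D" using insert.prems by (intro V_sum V_scaleR) auto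
  have j: "v j \<in> V_space D" "c j *\<^sub>R v j \<in> V_space D" using insert.prems by (auto intro: V_scaleR)
  have "NS_rhs D \<nu> f s u (c j *\<^sub>R v j + (\<Sum>j\<in>A. c j *\<^sub>R v j)) = c j * NS_rhs D \<nu> f s u (v j) + NS_rhs D \<nu> f s u (\<Sum>j\<in>A. c j *\<^sub>R v j)"
    unfolding NS_rhs_V[OF V_add[OF j(2) s]] NS_rhs_V[OF j(1)] NS_rhs_V[OF s]
    by (simp add: H1_inner_add[OF j(2) s] H1_inner_scaleR[OF j(1)] trilinear_add3[OF u j(2) s] trilinear_scaleR3 inner_add_right algebra_simps)
  then show ?case using insert by simp
qed

text \<open>For a fixed direction \<open>v\<close> the growth in \<open>u\<close> is quadratic in
  the norm of \<open>V\<close>, the very power whose mean is integrable in time.\<close>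

lemma NS_rhs_bound:
  assumes v: "v \<in> V_space D"
  obtains C where "0 \<le> C" "\<And>f s u. u \<in> V_space D \<Longrightarrow>
    \<bar>NS_rhs D \<nu> f s u v\<bar> \<le> norm (f s) * norm v + C * (1 + (norm u)\<^sup>2 + (H1_norm D u)\<^sup>2)"
proof -
  obtain K where K: "0 \<le> K" "\<And>u v w. u \<in> V_space D \<Longrightarrow> w \<in> V_space D \<Longrightarrow>
    \<bar>trilinear D u v w\<bar> \<le> K * norm (jet u) * norm (jet v) * norm (jet w)"
    using trilinear_bound by blast
  define C where "C = \<bar>\<nu>\<bar> * 3 * norm (jet v) + K * norm (jet v)"
  have "\<bar>NS_rhs D \<nu> f s u v\<bar> \<le> norm (f s) * norm v + C * (1 + (norm u)\<^sup>2 + (H1_norm D u)\<^sup>2)"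
    if u: "u \<in> V_space D" for f s u
  proof -
    have a: "norm (jet u) \<le> 1 + (norm (jet u))\<^sup>2"
      using sum_squares_bound[of "norm (jet u)" 1] zero_le_power2[of "norm (jet u)"] by (simp, linarith)
    have "\<bar>\<nu> * H1_inner D u v\<bar> \<le> \<bar>\<nu>\<bar> * (3 * norm (jet u) * norm (jet v))"
      unfolding abs_mult by (intro mult_left_mono H1_inner_bound) simp
    also have "\<dots> = (\<bar>\<nu>\<bar> * 3 * norm (jet v)) * norm (jet u)" by simp
    also have "\<dots> \<le> (\<bar>\<nu>\<bar> * 3 * norm (jet v)) * (1 + (norm (jet u))\<^sup>2)" by (intro mult_left_mono a) simp
    finally have 1: "\<bar>\<nu> * H1_inner D u v\<bar> \<le> (\<bar>\<nu>\<bar> * 3 * norm (jet v)) * (1 + (norm (jet u))\<^sup>2)" .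
    have "\<bar>trilinear D u u v\<bar> \<le> K * norm (jet u) * norm (jet u) * norm (jet v)" by (rule K(2)[OF u v])
    also have "\<dots> = (K * norm (jet v)) * (norm (jet u))\<^sup>2" by (simp add: power2_eq_square)
    also have "\<dots> \<le> (K * norm (jet v)) * (1 + (norm (jet u))\<^sup>2)" using K(1) by (intro mult_left_mono) auto
    finally have 2: "\<bar>trilinear D u u v\<bar> \<le> (K * norm (jet v)) * (1 + (norm (jet u))\<^sup>2)" .
    have 3: "\<bar>f s \<bullet> v\<bar> \<le> norm (f s) * norm v" by (rule Cauchy_Schwarz_ineq2)
    have "C * (1 + (norm u)\<^sup>2 + (H1_norm D u)\<^sup>2) = (\<bar>\<nu>\<bar> * 3 * norm (jet v)) * (1 + (norm (jet u))\<^sup>2) + (K * norm (jet v)) * (1 + (norm (jet u))\<^sup>2)"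
      unfolding C_def norm_jet by (simp add: algebra_simps)
    with 1 2 3 show ?thesis unfolding NS_rhs_V[OF v] by linarith
  qed
  moreover have "0 \<le> C" unfolding C_def using K(1) by (intro add_nonneg_nonneg mult_nonneg_nonneg) auto
  ultimately show ?thesis using that by blast
qed

section \<open>Measurability of paths\<close>

lemma H_diff: "u \<in> H_space D \<Longrightarrow> v \<in> H_space D \<Longrightarrow> u - v \<in> H_space D"
proof -
  assume "u \<in> H_space D" "v \<in> H_space D"
  then obtain x y where x: "\<And>n. x n \<in> cls ` test_fields D" "x \<longlonglongrightarrow> u" and y: "\<And>n. y n \<in> cls ` test_fields D" "y \<longlonglongrightarrow> v"
    unfolding H_space_def closure_sequential by blast
  have "x n - y n \<in> cls ` test_fields D" for n
  proof -
    obtain a b where ab: "a \<in> test_fields D" "x n = cls a" "b \<in> test_fields D" "y n = cls b" using x(1)[of n] y(1)[of n] by blast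
    have t: "(\<lambda>z. (-1) *\<^sub>R b z) \<in> test_fields D" by (rule test_fields_scaleR[OF ab(3)])
    have "x n - y n = cls (\<lambda>z. a z + (-1) *\<^sub>R b z)"
      unfolding cls_add[OF test_field_smooth[OF ab(1)] test_field_smooth[OF t]] cls_scaleR[OF test_field_smooth[OF ab(3)]] ab by simp
    then show ?thesis using test_fields_add[OF ab(1) t] by blast
  qed
  moreover have "(\<lambda>n. x n - y n) \<longlonglongrightarrow> u - v" by (intro tendsto_intros x y)
  ultimately show ?thesis unfolding H_space_def closure_sequential by (intro exI[of _ "\<lambda>n. x n - y n"]) auto
qed

lemma zero_in_H: "0 \<in> H_space D"
  using V_zero V_subset_H by blast

lemma space_H_borel: "space (H_borel D) = H_space D"
  by (simp add: H_borel_def space_restrict_space)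

text \<open>Duality against a dense set: a norm bound becomes countably many conditions on inner
  products once \<open>W\<close> is countable.\<close>

lemma H_norm_le_iff:
  assumes z: "z \<in> H_space D" and W: "H_space D \<subseteq> closure W" "W \<subseteq> H_space D" and r: "0 \<le> r"
  shows "norm z \<le> r \<longleftrightarrow> (\<forall>w\<in>W. z \<bullet> w \<le> r * norm w)"
proof
  assume "norm z \<le> r"
  then show "\<forall>w\<in>W. z \<bullet> w \<le> r * norm w"
    by (meson norm_cauchy_schwarz mult_right_mono norm_ge_zero order_trans)
next
  assume le: "\<forall>w\<in>W. z \<bullet> w \<le> r * norm w"
  have "z \<in> closure W" using z W(1) by blast
  then obtain x where x: "\<And>n. x n \<in> W" "x \<longlonglongrightarrow> z" unfolding closure_sequential by blast
  have "(\<lambda>n. z \<bullet> x n) \<longlonglongrightarrow> z \<bullet> z" "(\<lambda>n. r * norm (x n)) \<longlonglongrightarrow> r * norm z" by (intro tendsto_intros x)+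
  then have "z \<bullet> z \<le> r * norm z" by (rule LIMSEQ_le) (use le x(1) in auto)
  then have "norm z * norm z \<le> r * norm z" by (simp add: dot_square_norm power2_eq_square)
  then show "norm z \<le> r" using r by (cases "norm z = 0") (auto simp: mult_le_cancel_right)
qed

lemma H_dist_measurable:
  assumes g: "\<And>x. x \<in> space M \<Longrightarrow> g x \<in> H_space D" and w: "\<And>w. w \<in> H_space D \<Longrightarrow> (\<lambda>x. g x \<bullet> w) \<in> borel_measurable M"
    and a: "a \<in> H_space D"
  shows "(\<lambda>x. norm (g x - a)) \<in> borel_measurable M"
proof (rule borel_measurableI_le)
  fix r :: real
  obtain W where W: "countable W" "W \<subseteq> H_space D" "H_space D \<subseteq> closure W"
    using separable_set_dense_subset[OF H_separable] by blast
  show "{x \<in> space M. norm (g x - a) \<le> r} \<in> sets M"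
  proof (cases "0 \<le> r")
    case True
    have "{x \<in> space M. norm (g x - a) \<le> r} = {x \<in> space M. \<forall>w\<in>W. g x \<bullet> w - a \<bullet> w \<le> r * norm w}"
      using H_norm_le_iff[OF H_diff[OF g a] W(3,2) True] by (auto simp: inner_diff_left)
    also have "\<dots> \<in> sets M"
    proof (rule sets.sets_Collect_countable_All'[OF _ W(1)])
      fix v assume "v \<in> W"
      then have [measurable]: "(\<lambda>x. g x \<bullet> v) \<in> borel_measurable M" using w W(2) by blast
      show "{x \<in> space M. g x \<bullet> v - a \<bullet> v \<le> r * norm v} \<in> sets M" by measurable
    qed
    finally show ?thesis .
  next
    case False
    then have "{x \<in> space M. norm (g x - a) \<le> r} = {}" by (auto simp: not_le) (meson norm_ge_zero order_trans not_le)
    then show ?thesis by (simp only: sets.empty_sets)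
  qed
qed

text \<open>Pettis's principle: \<open>H\<close> is separable, so measurability of all scalar
  products with elements of \<open>H\<close> already gives Borel measurability for the norm. Paths
  and evaluations are controlled only weakly and enter through this.\<close>

lemma measurable_H_borelI:
  assumes g: "\<And>x. x \<in> space M \<Longrightarrow> g x \<in> H_space D" and w: "\<And>w. w \<in> H_space D \<Longrightarrow> (\<lambda>x. g x \<bullet> w) \<in> borel_measurable M"
  shows "g \<in> M \<rightarrow>\<^sub>M H_borel D"
  unfolding H_borel_def
proof (rule measurable_restrict_space2)
  show "g \<in> space M \<rightarrow> H_space D" using g by blast
  show "g \<in> borel_measurable M"
  proof (rule borel_measurableI)
    fix U :: "l2_field set" assume U: "open U"
    obtain W where W: "countable W" "W \<subseteq> H_space D" "H_space D \<subseteq> closure W"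
      using separable_set_dense_subset[OF H_separable] by blast
    let ?J = "{(c, n). c \<in> W \<and> ball c (1 / real (Suc n)) \<subseteq> U}"
    have "countable ?J" by (rule countable_subset[of _ "W \<times> (UNIV :: nat set)"]) (use W in auto)
    moreover have "{x \<in> space M. g x \<in> ball c e} \<in> sets M" if "c \<in> W" for c e
    proof -
      have [measurable]: "(\<lambda>x. norm (g x - c)) \<in> borel_measurable M"
        using H_dist_measurable[OF g w, of c] W(2) that by blast
      have "{x \<in> space M. norm (g x - c) < e} \<in> sets M" by measurable
      then show ?thesis by (simp add: dist_norm norm_minus_commute)
    qed
    ultimately have "(\<Union>(c, n)\<in>?J. {x \<in> space M. g x \<in> ball c (1 / real (Suc n))}) \<in> sets M"
      by (intro sets.countable_UN') auto
    also have "(\<Union>(c, n)\<in>?J. {x \<in> space M. g x \<in> ball c (1 / real (Suc n))}) =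
        {x \<in> space M. g x \<in> (\<Union>(c, n)\<in>?J. H_space D \<inter> ball c (1 / real (Suc n)))}"
      using g by fast
    also have "\<dots> = {x \<in> space M. g x \<in> H_space D \<inter> U}"
      by (simp only: separable_open_balls[OF W(3) U])
    also have "\<dots> = g -` U \<inter> space M" using g by blast
    finally show "g -` U \<inter> space M \<in> sets M" .
  qed
qed

lemma H_borel_continuous_measurable:
  fixes \<Phi> :: "l2_field \<Rightarrow> 'z::topological_space"
  assumes "continuous_on (H_space D) \<Phi>"
  shows "\<Phi> \<in> borel_measurable (H_borel D)"
  unfolding H_borel_def by (rule borel_measurable_continuous_on_restrict[OF assms])

lemma H_borel_norm [measurable]: "norm \<in> borel_measurable (H_borel D)"
  by (intro H_borel_continuous_measurable continuous_intros)

lemma H_borel_inner: "(\<lambda>u. u \<bullet> w) \<in> borel_measurable (H_borel D)"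
  by (intro H_borel_continuous_measurable continuous_intros)

text \<open>The distance of two measurable maps is compared with a level through a countable dense
  set and a rational splitting of the radius; polarisation then yields the inner product.\<close>

lemma H_inner_measurable:
  assumes g: "g \<in> M \<rightarrow>\<^sub>M H_borel D" and h: "h \<in> M \<rightarrow>\<^sub>M H_borel D"
  shows "(\<lambda>x. g x \<bullet> h x) \<in> borel_measurable M"
proof -
  obtain W where W: "countable W" "W \<subseteq> H_space D" "H_space D \<subseteq> closure W"
    using separable_set_dense_subset[OF H_separable] by blast
  have gH: "g x \<in> H_space D" if "x \<in> space M" for x using measurable_space[OF g that] by (simp add: space_H_borel)
  have d: "(\<lambda>x. norm (k x - c)) \<in> borel_measurable M" if "k \<in> M \<rightarrow>\<^sub>M H_borel D" for k c
  proof -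
    have "(\<lambda>u. norm (u - c)) \<in> borel_measurable (H_borel D)"
      by (intro H_borel_continuous_measurable continuous_intros)
    from measurable_compose[OF that this] show ?thesis .
  qed
  have "(\<lambda>x. norm (g x - h x)) \<in> borel_measurable M"
  proof (rule borel_measurableI_less)
    fix r :: real
    have "{x \<in> space M. norm (g x - h x) < r} =
      (\<Union>(w, q)\<in>W \<times> \<rat>. {x \<in> space M. norm (g x - w) < q \<and> norm (h x - w) < r - q})" (is "?A = ?B")
    proof
      show "?A \<subseteq> ?B"
      proof
        fix x assume x: "x \<in> ?A"
        \<comment> \<open>Half the slack: with \<open>w\<close> within \<open>q < e\<close> of
          \<open>g x\<close>, the distance from \<open>h x\<close> to \<open>w\<close> stays below
          \<open>r - q\<close>.\<close>
        define e where "e = (r - norm (g x - h x)) / 2"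
        have e: "e > 0" using x by (simp add: e_def)
        then obtain q where q: "q \<in> \<rat>" "0 < q" "q < e" using Rats_dense_in_real by blast
        have "g x \<in> closure W" using gH x W(3) by blast
        then obtain w where w: "w \<in> W" "dist w (g x) < q" using q(2) unfolding closure_approachable by blast
        have "norm (g x - w) < q" using w(2) by (simp add: dist_norm norm_minus_commute)
        moreover have "norm (h x - w) \<le> norm (g x - h x) + norm (g x - w)"
          using norm_triangle_ineq[of "h x - g x" "g x - w"] by (simp add: norm_minus_commute)
        then have "norm (h x - w) < r - q" using calculation q(3) by (simp add: e_def field_simps)
        ultimately show "x \<in> ?B" using x w(1) q(1) by auto
      qed
      show "?B \<subseteq> ?A"
      proof
        fix x assume "x \<in> ?B"
        then obtain w q where "x \<in> space M" "norm (g x - w) < q" "norm (h x - w) < r - q" by blast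
        then show "x \<in> ?A"
          using norm_triangle_ineq4[of "g x - w" "h x - w"] by simp
      qed
    qed
    also have "\<dots> \<in> sets M"
    proof (rule sets.countable_UN'')
      show "countable (W \<times> \<rat> :: (l2_field \<times> real) set)" using W(1) countable_rat by auto
      show "(case z of (w, q) \<Rightarrow> {x \<in> space M. norm (g x - w) < q \<and> norm (h x - w) < r - q}) \<in> sets M" for z
      proof -
        note [measurable] = d[OF g] d[OF h]
        show ?thesis by (cases z) simp
      qed
    qed
    finally show "{x \<in> space M. norm (g x - h x) < r} \<in> sets M" .
  qed
  note [measurable] = this measurable_compose[OF g H_borel_norm] measurable_compose[OF h H_borel_norm]
  have "(\<lambda>x. ((norm (g x))\<^sup>2 + (norm (h x))\<^sup>2 - (norm (g x - h x))\<^sup>2) / 2) \<in> borel_measurable M" by measurable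
  moreover have "((norm (g x))\<^sup>2 + (norm (h x))\<^sup>2 - (norm (g x - h x))\<^sup>2) / 2 = g x \<bullet> h x" for x
    by (simp add: power2_norm_eq_inner inner_diff_left inner_diff_right inner_commute)
  ultimately show ?thesis by simp
qed

lemma V_supported_measurable:
  fixes F :: "l2_field \<Rightarrow> real"
  assumes "F \<in> borel_measurable (restrict_space borel (V_space D))"
  shows "(\<lambda>u. indicator (V_space D) u * F u) \<in> borel_measurable (H_borel D)"
proof -
  have "(\<lambda>u. indicator (V_space D) u * F u) \<in> borel_measurable borel"
    using assms borel_measurable_restrict_space_iff[of "V_space D" borel F] by simp
  then show ?thesis unfolding H_borel_def by (rule measurable_restrict_space1)
qed

lemma enstrophy_H_borel [measurable]: "enstrophy D \<in> borel_measurable (H_borel D)"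
  using measurable_restrict_space1[OF enstrophy_measurable[of 0]] unfolding H_borel_def by simp

lemma V_space_H_borel [measurable]: "V_space D \<in> sets (H_borel D)"
  unfolding H_borel_def using V_subset_H by (auto simp: sets_restrict_space intro!: image_eqI[of _ _ "V_space D"])

section \<open>Weak topology and weakly continuous paths\<close>

lemma topspace_H_weak: "topspace (H_weak D) = H_space D"
  unfolding H_weak_def topology_generated_by_topspace using zero_in_H by blast

lemma H_weak_continuousD:
  assumes u: "continuous_map (top_of_set I) (H_weak D) u"
  shows "t \<in> I \<Longrightarrow> u t \<in> H_space D" "w \<in> H_space D \<Longrightarrow> continuous_on I (\<lambda>t. u t \<bullet> w)"
proof -
  show H: "u t \<in> H_space D" if "t \<in> I" for t
    using continuous_map_funspace[OF u] that by (auto simp: topspace_H_weak Pi_iff)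
  show "continuous_on I (\<lambda>t. u t \<bullet> w)" if w: "w \<in> H_space D"
  proof -
    have "openin (top_of_set I) {t \<in> I. u t \<bullet> w \<in> U}" if "open U" for U
    proof -
    from that have "openin (H_weak D) {u \<in> H_space D. u \<bullet> w \<in> U}"
      unfolding H_weak_def using w by (intro topology_generated_by_Basis) blast
    from openin_continuous_map_preimage[OF u this]
    have "openin (top_of_set I) {t \<in> I. u t \<in> H_space D \<and> u t \<bullet> w \<in> U}" by simp
    also have "{t \<in> I. u t \<in> H_space D \<and> u t \<bullet> w \<in> U} = {t \<in> I. u t \<bullet> w \<in> U}" using H by auto
    finally show ?thesis .
    qed
    then have "continuous_map (top_of_set I) euclideanreal (\<lambda>t. u t \<bullet> w)"
      by (simp add: continuous_map_def)
    then show ?thesis by simp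
  qed
qed

lemma path_spaceD:
  assumes "u \<in> path_space D I"
  shows "t \<in> I \<Longrightarrow> u t \<in> H_space D" "w \<in> H_space D \<Longrightarrow> continuous_on I (\<lambda>t. u t \<bullet> w)"
  using H_weak_continuousD[of I u] assms by (auto simp: path_space_def)

end

section \<open>Borel structure of the path space\<close>

locale path_setting = flow_setting D for D +
  fixes I :: "real set" and t\<^sub>0 :: real and \<rho> :: "(real \<Rightarrow> l2_field) measure"
  assumes interval: "is_interval I" and left: "left_endpoint I t\<^sub>0"
    and sets_rho: "sets \<rho> = sets (borel_of (path_topology D I))"
    and prob: "prob_space \<rho>"
begin

sublocale rho: prob_space \<rho> by (rule prob)

lemma t0_in: "t\<^sub>0 \<in> I" and t0_le: "t \<in> I \<Longrightarrow> t\<^sub>0 \<le> t"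
  using left by (auto simp: left_endpoint_def)

lemma interval_mem: "a \<in> I \<Longrightarrow> b \<in> I \<Longrightarrow> a \<le> x \<Longrightarrow> x \<le> b \<Longrightarrow> x \<in> I"
  using mem_is_interval_1_I[OF interval] by blast

lemma I_cases:
  obtains "I = {t\<^sub>0..}" | T where "t\<^sub>0 \<le> T" "I = {t\<^sub>0..T}" | T where "t\<^sub>0 < T" "I = {t\<^sub>0..<T}"
proof (cases "bdd_above I")
  case True
  define T where "T = Sup I"
  have le: "t \<le> T" if "t \<in> I" for t using cSup_upper[OF that True] by (simp add: T_def)
  have less: "t \<in> I" if t: "t\<^sub>0 \<le> t" "t < T" for t
  proof -
    obtain s where "s \<in> I" "t < s" using less_cSupD[of I t] t t0_in by (auto simp: T_def)
    then show ?thesis using interval_mem[OF t0_in \<open>s \<in> I\<close>, of t] t by simp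
  qed
  show ?thesis
  proof (cases "T \<in> I")
    case True
    have "t \<in> I \<longleftrightarrow> t \<in> {t\<^sub>0..T}" for t using le[of t] t0_le[of t] interval_mem[OF t0_in True, of t] by auto
    then show ?thesis using that(2)[of T] le[OF t0_in] by blast
  next
    case False
    have "t \<in> I \<longleftrightarrow> t \<in> {t\<^sub>0..<T}" for t using le[of t] t0_le[of t] less[of t] False by (auto simp: less_le)
    then show ?thesis using that(3)[of T] le[OF t0_in] False t0_in by (metis atLeastLessThan_iff subsetI subset_antisym)
  qed
next
  case False
  have "t \<in> I" if t: "t\<^sub>0 \<le> t" for t
  proof -
    obtain s where "s \<in> I" "t < s" using False unfolding bdd_above_def by (meson not_le)
    then show ?thesis using interval_mem[OF t0_in, of s t] t by simp
  qed
  then have "I = {t\<^sub>0..}" using t0_le by auto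
  then show ?thesis using that(1) by blast
qed

lemma I_borel [measurable]: "I \<in> sets borel"
  by (rule I_cases) auto

lemma I_lebesgue [measurable]: "I \<in> sets lebesgue"
  using I_borel by auto

lemma path_subbasis_open:
  assumes "{a..b} \<subseteq> I" "u\<^sub>0 \<in> path_space D I" "w \<in> H_space D" "0 < \<epsilon>"
  shows "openin (path_topology D I) {u \<in> path_space D I. \<forall>t\<in>{a..b}. \<bar>(u t - u\<^sub>0 t) \<bullet> w\<bar> < \<epsilon>}"
  unfolding path_topology_def using assms by (intro topology_generated_by_Basis) blast

lemma topspace_path: "topspace (path_topology D I) = path_space D I"
proof
  show "topspace (path_topology D I) \<subseteq> path_space D I"
    unfolding path_topology_def topology_generated_by_topspace by blast
  show "path_space D I \<subseteq> topspace (path_topology D I)"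
  proof
    fix u assume u: "u \<in> path_space D I"
    \<comment> \<open>With a single time and the zero functional the subbasic set is the whole path
      space.\<close>
    have "openin (path_topology D I) {v \<in> path_space D I. \<forall>t\<in>{t\<^sub>0..t\<^sub>0}. \<bar>(v t - u t) \<bullet> 0\<bar> < 1}"
      using u t0_in zero_in_H by (intro path_subbasis_open) auto
    from openin_subset[OF this] u show "u \<in> topspace (path_topology D I)" by auto
  qed
qed

lemma space_rho: "space \<rho> = path_space D I"
  using sets_eq_imp_space_eq[OF sets_rho] unfolding borel_of_def topspace_path
  using openin_subset[of "path_topology D I"] by (subst (asm) space_measure_of) (auto simp: topspace_path)

lemma open_sets_rho: "openin (path_topology D I) U \<Longrightarrow> U \<in> sets \<rho>"
  unfolding sets_rho borel_of_def using openin_subset[of "path_topology D I"]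
  by (subst sets_measure_of) auto

lemma eval_inner_measurable:
  assumes "t \<in> I" "w \<in> H_space D"
  shows "(\<lambda>u. u t \<bullet> w) \<in> borel_measurable \<rho>"
proof (rule borel_measurableI)
  fix U :: "real set" assume U: "open U"
  have "openin (path_topology D I) {u \<in> path_space D I. u t \<bullet> w \<in> U}"
  proof (subst openin_subopen, intro ballI)
    fix u assume u: "u \<in> {u \<in> path_space D I. u t \<bullet> w \<in> U}"
    then obtain e where e: "e > 0" "ball (u t \<bullet> w) e \<subseteq> U" using U openE by blast
    \<comment> \<open>A one-point interval is admissible in the subbasis and yields evaluation at
      \<open>t\<close>.\<close>
    let ?T = "{v \<in> path_space D I. \<forall>s\<in>{t..t}. \<bar>(v s - u s) \<bullet> w\<bar> < e}"
    have "openin (path_topology D I) ?T" using u e assms by (intro path_subbasis_open) auto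
    moreover have "?T \<subseteq> {u \<in> path_space D I. u t \<bullet> w \<in> U}"
      using e(2) by (auto simp: inner_diff_left dist_real_def subset_iff abs_minus_commute)
    ultimately show "\<exists>T. openin (path_topology D I) T \<and> u \<in> T \<and> T \<subseteq> {u \<in> path_space D I. u t \<bullet> w \<in> U}"
      using u e(1) by (intro exI[of _ ?T]) auto
  qed
  from open_sets_rho[OF this] show "(\<lambda>u. u t \<bullet> w) -` U \<inter> space \<rho> \<in> sets \<rho>"
    unfolding space_rho by (auto simp: vimage_def Int_def conj_commute)
qed

lemma eval_measurable: "t \<in> I \<Longrightarrow> (\<lambda>u. u t) \<in> \<rho> \<rightarrow>\<^sub>M H_borel D"
  by (rule measurable_H_borelI) (auto simp: space_rho path_spaceD(1) intro: eval_inner_measurable)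

text \<open>The time is rounded down to the grid of mesh \<open>1 / (n + 1)\<close> based at
  \<open>t\<^sub>0\<close>. The rounded evaluation involves countably many times only, so it is
  measurable, and weak continuity carries this to the limit.\<close>

lemma eval_joint_measurable:
  assumes J: "J \<subseteq> I"
  shows "(\<lambda>(t, u). u t) \<in> (lebesgue_on J \<Otimes>\<^sub>M \<rho>) \<rightarrow>\<^sub>M H_borel D"
proof (rule measurable_H_borelI)
  fix x assume "x \<in> space (lebesgue_on J \<Otimes>\<^sub>M \<rho>)"
  then show "(case x of (t, u) \<Rightarrow> u t) \<in> H_space D"
    using J path_spaceD(1) by (auto simp: space_pair_measure space_rho)
next
  fix w assume w: "w \<in> H_space D"
  \<comment> \<open>Rounding towards the left end point keeps the grid time inside \<open>I\<close>,
    where evaluation is measurable.\<close>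
  define k where "k n t = \<lfloor>real (Suc n) * (t - t\<^sub>0)\<rfloor>" for n t
  define r where "r n i = t\<^sub>0 + real_of_int i / real (Suc n)" for n i
  have rI: "r n (k n t) \<in> I" if t: "t \<in> I" for n t
  proof (rule interval_mem[OF t0_in t])
    have "0 \<le> k n t" unfolding k_def using t0_le[OF t] by simp
    then show "t\<^sub>0 \<le> r n (k n t)" by (simp add: r_def)
    have "real_of_int (k n t) \<le> real (Suc n) * (t - t\<^sub>0)" unfolding k_def by (rule of_int_floor_le)
    then show "r n (k n t) \<le> t" by (simp add: r_def field_simps)
  qed
  have rlim: "(\<lambda>n. r n (k n t)) \<longlonglongrightarrow> t" for t
  proof -
    have "\<bar>r n (k n t) - t\<bar> \<le> 1 / real (Suc n)" for n
    proof -
      have "\<bar>real_of_int (k n t) - real (Suc n) * (t - t\<^sub>0)\<bar> \<le> 1" unfolding k_def by linarith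
      then have "\<bar>(real_of_int (k n t) - real (Suc n) * (t - t\<^sub>0)) / real (Suc n)\<bar> \<le> 1 / real (Suc n)"
        by (simp add: divide_right_mono)
      then show ?thesis by (simp add: r_def diff_divide_distrib del: of_nat_Suc)
    qed
    then have "(\<lambda>n. r n (k n t) - t) \<longlonglongrightarrow> 0"
      by (intro Lim_null_comparison[OF _ LIMSEQ_Suc[OF lim_1_over_n]]) auto
    then show ?thesis by (simp add: LIM_zero_iff)
  qed
  \<comment> \<open>The default value 0 gives a meaning to grid indices outside \<open>I\<close>;
    for times in \<open>J\<close> it never occurs.\<close>
  have "(\<lambda>x. lim (\<lambda>n. if r n (k n (fst x)) \<in> I then snd x (r n (k n (fst x))) \<bullet> w else 0)) \<in> borel_measurable (lebesgue_on J \<Otimes>\<^sub>M \<rho>)"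
  proof (rule borel_measurable_lim_metric)
    fix n
    show "(\<lambda>x. if r n (k n (fst x)) \<in> I then snd x (r n (k n (fst x))) \<bullet> w else 0) \<in> borel_measurable (lebesgue_on J \<Otimes>\<^sub>M \<rho>)"
    proof (rule measurable_compose_countable[where f = "\<lambda>i x. if r n i \<in> I then snd x (r n i) \<bullet> w else 0" and g = "\<lambda>x. k n (fst x)"])
      show "(\<lambda>x. if r n i \<in> I then snd x (r n i) \<bullet> w else 0) \<in> borel_measurable (lebesgue_on J \<Otimes>\<^sub>M \<rho>)" for i
        using measurable_compose[OF measurable_snd eval_inner_measurable[OF _ w, of "r n i"], of "lebesgue_on J"]
        by (cases "r n i \<in> I") simp_all
      have "(\<lambda>t. k n t) \<in> lebesgue_on J \<rightarrow>\<^sub>M count_space UNIV"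
      proof (rule measurable_restrict_space1)
        have "(\<lambda>t. k n t) \<in> borel \<rightarrow>\<^sub>M count_space UNIV" unfolding k_def by measurable
        then show "(\<lambda>t. k n t) \<in> lebesgue \<rightarrow>\<^sub>M count_space UNIV" by (intro measurable_completion) simp
      qed
      then show "(\<lambda>x. k n (fst x)) \<in> (lebesgue_on J \<Otimes>\<^sub>M \<rho>) \<rightarrow>\<^sub>M count_space UNIV"
        by (rule measurable_compose[OF measurable_fst])
    qed
  qed
  also have "?this \<longleftrightarrow> (\<lambda>x. (case x of (t, u) \<Rightarrow> u t) \<bullet> w) \<in> borel_measurable (lebesgue_on J \<Otimes>\<^sub>M \<rho>)"
  proof (rule measurable_cong)
    fix x assume x: "x \<in> space (lebesgue_on J \<Otimes>\<^sub>M \<rho>)"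
    obtain t u where tu: "x = (t, u)" by (cases x)
    have t: "t \<in> I" and u: "u \<in> path_space D I" using x J tu by (auto simp: space_pair_measure space_rho)
    have "(\<lambda>n. u (r n (k n t)) \<bullet> w) \<longlonglongrightarrow> u t \<bullet> w"
      by (rule continuous_on_tendsto_compose[OF path_spaceD(2)[OF u w] rlim t]) (simp add: rI[OF t])
    then show "lim (\<lambda>n. if r n (k n (fst x)) \<in> I then snd x (r n (k n (fst x))) \<bullet> w else 0) = (case x of (t, u) \<Rightarrow> u t) \<bullet> w"
      using rI[OF t] by (simp add: tu limI)
  qed
  finally show "(\<lambda>x. (case x of (t, u) \<Rightarrow> u t) \<bullet> w) \<in> borel_measurable (lebesgue_on J \<Otimes>\<^sub>M \<rho>)" .
qed

lemma path_time_measurable: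
  assumes "J \<subseteq> I" "u \<in> path_space D I"
  shows "u \<in> lebesgue_on J \<rightarrow>\<^sub>M H_borel D"
proof -
  have "(\<lambda>t. (t, u)) \<in> lebesgue_on J \<rightarrow>\<^sub>M (lebesgue_on J \<Otimes>\<^sub>M \<rho>)"
    by (rule measurable_Pair2') (simp add: space_rho assms)
  from measurable_compose[OF this eval_joint_measurable[OF assms(1)]] show ?thesis by simp
qed

end

section \<open>Chain rules along partitions\<close>

text \<open>Half-open intervals tile without overlap, so that a point belongs to exactly one cell of
  a partition.\<close>

lemma set_integral_Icc_Ico:
  fixes g :: "real \<Rightarrow> real"
  assumes "set_integrable lebesgue {a..b} g"
  shows "(LINT s:{a..b}|lebesgue. g s) = (\<integral>s. indicator {a..<b} s * g s \<partial>lebesgue)"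
  unfolding set_lebesgue_integral_def
proof (rule integral_cong_AE)
  have "AE s in lebesgue. s \<noteq> b" by (rule AE_completion[OF AE_lborel_singleton])
  then show "AE s in lebesgue. indicator {a..b} s *\<^sub>R g s = indicator {a..<b} s * g s"
    by eventually_elim (auto simp: indicator_def)
  show "(\<lambda>s. indicator {a..b} s *\<^sub>R g s) \<in> borel_measurable lebesgue"
    using assms unfolding set_integrable_def by (rule borel_measurable_integrable)
  have "set_integrable lebesgue {a..<b} g" by (rule set_integrable_subset[OF assms]) auto
  then show "(\<lambda>s. indicator {a..<b} s * g s) \<in> borel_measurable lebesgue"
    unfolding set_integrable_def by (simp add: borel_measurable_integrable)
qed

text \<open>One node of \<open>G\<close> is picked inside each of \<open>n + 1\<close> equal cells
  and the end points are added: \<open>n + 2\<close> steps, each no longer than two cells.\<close>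

lemma fine_partition:
  fixes p q :: real
  assumes pq: "p < q" "p \<in> G" "q \<in> G" and dense: "\<And>a b. p \<le> a \<Longrightarrow> a < b \<Longrightarrow> b \<le> q \<Longrightarrow> \<exists>g\<in>G. a < g \<and> g < b"
  obtains x :: "nat \<Rightarrow> real" where "x 0 = p" "x (Suc (Suc n)) = q" "\<And>i. i \<le> Suc (Suc n) \<Longrightarrow> x i \<in> G"
    "\<And>i. i < Suc (Suc n) \<Longrightarrow> x i < x (Suc i)" "\<And>i. i < Suc (Suc n) \<Longrightarrow> x (Suc i) - x i \<le> 2 * (q - p) / real (Suc n)"
proof -
  define d where "d = (q - p) / real (Suc n)"
  have d: "d > 0" using pq by (simp add: d_def)
  have dn: "p + real (Suc n) * d = q" unfolding d_def by simp
  have "\<exists>g\<in>G. p + (real i - 1) * d < g \<and> g < p + real i * d" if "1 \<le> i" "i \<le> Suc n" for i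
  proof (rule dense)
    show "p \<le> p + (real i - 1) * d" using that d by simp
    show "p + (real i - 1) * d < p + real i * d" using d by (simp add: algebra_simps)
    have "real i * d \<le> real (Suc n) * d" using that d by (intro mult_right_mono) auto
    then show "p + real i * d \<le> q" using dn by simp
  qed
  then obtain g where g: "\<And>i. 1 \<le> i \<Longrightarrow> i \<le> Suc n \<Longrightarrow> g i \<in> G \<and> p + (real i - 1) * d < g i \<and> g i < p + real i * d"
    by metis
  define x where "x i = (if i = 0 then p else if i \<le> Suc n then g i else q)" for i
  have lo: "p + (real i - 1) * d \<le> x i" if "i \<le> Suc (Suc n)" for i
    using that g[of i] d dn by (cases "i = 0"; cases "i \<le> Suc n") (auto simp: x_def le_Suc_eq algebra_simps)
  have hi: "x i \<le> p + real i * d" if "i \<le> Suc (Suc n)" for i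
    using that g[of i] d dn by (cases "i = 0"; cases "i \<le> Suc n") (auto simp: x_def le_Suc_eq algebra_simps)
  have hi': "x i < p + real i * d" if "1 \<le> i" "i \<le> Suc n" for i using g[OF that] that by (simp add: x_def)
  have "x i < x (Suc i)" if "i < Suc (Suc n)" for i
  proof (cases "i = 0")
    case True
    then show ?thesis using g[of 1] by (simp add: x_def)
  next
    case False
    then show ?thesis using hi'[of i] lo[of "Suc i"] that by simp
  qed
  moreover have "x (Suc i) - x i \<le> 2 * (q - p) / real (Suc n)" if "i < Suc (Suc n)" for i
  proof -
    have "x (Suc i) - x i \<le> 2 * d" using hi[of "Suc i"] lo[of i] that by (simp add: algebra_simps)
    then show ?thesis by (simp add: d_def)
  qed
  moreover have "x i \<in> G" if "i \<le> Suc (Suc n)" for i using g[of i] pq by (auto simp: x_def)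
  ultimately show ?thesis using that[of x] by (simp add: x_def)
qed

lemma partition_locate:
  fixes x :: "nat \<Rightarrow> real"
  assumes "x 0 \<le> s" "s < x N"
  shows "\<exists>i<N. x i \<le> s \<and> s < x (Suc i)"
  using assms(2)
proof (induction N)
  case (Suc N)
  then show ?case by (cases "s < x N") (auto simp: less_Suc_eq not_less)
qed (use assms(1) in simp)

text \<open>Common engine of both chain rules. Summing the increment bounds over a partition gives
  integrals of \<open>g j\<close> against step functions of the coefficients; these are bounded by
  \<open>B\<close> and converge almost everywhere to \<open>k j\<close> as the mesh shrinks.
  Convergence is demanded only at almost every \<open>s\<close> and along nodes of \<open>G\<close>
  enclosing it, which is all that an energy inequality can supply.\<close>

lemma partition_inequality:
  fixes c :: "'j \<Rightarrow> real \<Rightarrow> real \<Rightarrow> real" and g k :: "'j \<Rightarrow> real \<Rightarrow> real" and F :: "real \<Rightarrow> real"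
  assumes A: "finite A" and pq: "p < q" "p \<in> G" "q \<in> G"
    and dense: "\<And>a b. p \<le> a \<Longrightarrow> a < b \<Longrightarrow> b \<le> q \<Longrightarrow> \<exists>g\<in>G. a < g \<and> g < b"
    and g: "\<And>j. j \<in> A \<Longrightarrow> set_integrable lebesgue {p..q} (g j)"
    and inc: "\<And>a b. a \<in> G \<Longrightarrow> b \<in> G \<Longrightarrow> p \<le> a \<Longrightarrow> a < b \<Longrightarrow> b \<le> q \<Longrightarrow>
      F b - F a \<le> (\<Sum>j\<in>A. c j a b * (LINT s:{a..b}|lebesgue. g j s))"
    and bd: "\<And>j a b. j \<in> A \<Longrightarrow> a \<in> G \<Longrightarrow> b \<in> G \<Longrightarrow> p \<le> a \<Longrightarrow> a < b \<Longrightarrow> b \<le> q \<Longrightarrow> \<bar>c j a b\<bar> \<le> B"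
    and lim: "AE s in lebesgue. s \<in> {p<..<q} \<longrightarrow> (\<forall>a b. (\<forall>n. a n \<in> G \<and> b n \<in> G \<and> p \<le> a n \<and> a n \<le> s \<and> s < b n \<and> b n \<le> q) \<longrightarrow>
      a \<longlonglongrightarrow> s \<longrightarrow> b \<longlonglongrightarrow> s \<longrightarrow> (\<forall>j\<in>A. (\<lambda>n. c j (a n) (b n)) \<longlonglongrightarrow> k j s))"
    and k: "\<And>j. j \<in> A \<Longrightarrow> (\<lambda>s. indicator {p..q} s * k j s) \<in> borel_measurable lebesgue"
  shows "F q - F p \<le> (\<Sum>j\<in>A. LINT s:{p..q}|lebesgue. k j s * g j s)"
    and "\<And>j. j \<in> A \<Longrightarrow> set_integrable lebesgue {p..q} (\<lambda>s. k j s * g j s)"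
proof -
  have "\<exists>x. x 0 = p \<and> x (Suc (Suc n)) = q \<and> (\<forall>i\<le>Suc (Suc n). x i \<in> G) \<and>
    (\<forall>i<Suc (Suc n). x i < x (Suc i)) \<and> (\<forall>i<Suc (Suc n). x (Suc i) - x i \<le> 2 * (q - p) / real (Suc n))" for n
    by (rule fine_partition[OF pq dense, of n]) blast+
  then obtain x where x: "\<And>n. x n 0 = p" "\<And>n. x n (Suc (Suc n)) = q" "\<And>n i. i \<le> Suc (Suc n) \<Longrightarrow> x n i \<in> G"
    "\<And>n i. i < Suc (Suc n) \<Longrightarrow> x n i < x n (Suc i)" "\<And>n i. i < Suc (Suc n) \<Longrightarrow> x n (Suc i) - x n i \<le> 2 * (q - p) / real (Suc n)"
    by metis
  have xmono: "x n i \<le> x n j" if "i \<le> j" "j \<le> Suc (Suc n)" for n i j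
    using that
  proof (induction j)
    case (Suc j)
    show ?case
    proof (cases "i = Suc j")
      case False
      then have "x n i \<le> x n j" using Suc by simp
      then show ?thesis using x(4)[of j n] Suc.prems by simp
    qed simp
  qed simp
  have xin: "p \<le> x n i \<and> x n i \<le> q" if "i \<le> Suc (Suc n)" for n i
    using xmono[of 0 i n] xmono[of i "Suc (Suc n)" n] that x(1)[of n] x(2)[of n] by auto
  \<comment> \<open>At each \<open>s\<close> with \<open>p \<le> s\<close> and \<open>s < q\<close>
    exactly one summand has a nonzero indicator, that of the cell containing \<open>s\<close>;
    everywhere else the function vanishes.\<close>
  define C where "C n j s = (\<Sum>i<Suc (Suc n). indicator {x n i..<x n (Suc i)} s * c j (x n i) (x n (Suc i)))" for n j s
  have C_at: "C n j s = c j (x n i) (x n (Suc i))" if i: "i < Suc (Suc n)" "x n i \<le> s" "s < x n (Suc i)" for n j s i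
  proof -
    have "indicator {x n i'..<x n (Suc i')} s * c j (x n i') (x n (Suc i')) = (if i' = i then c j (x n i) (x n (Suc i)) else 0)"
      if i': "i' < Suc (Suc n)" for i'
    proof (cases i' i rule: linorder_cases)
      case less
      then have "x n (Suc i') \<le> x n i" using xmono[of "Suc i'" i n] i by simp
      then show ?thesis using i less by (auto simp: indicator_def)
    next
      case greater
      then have "x n (Suc i) \<le> x n i'" using xmono[of "Suc i" i' n] i' by simp
      then show ?thesis using i greater by (auto simp: indicator_def)
    qed (use i in \<open>simp add: indicator_def\<close>)
    then have "C n j s = (\<Sum>i'<Suc (Suc n). if i' = i then c j (x n i) (x n (Suc i)) else 0)"
      unfolding C_def by (intro sum.cong) auto
    also have "\<dots> = c j (x n i) (x n (Suc i))" using i(1) by (simp add: sum.delta)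
    finally show ?thesis .
  qed
  have C_out: "C n j s = 0" if "s \<notin> {p..<q}" for n j s
    unfolding C_def
  proof (rule sum.neutral, intro ballI)
    fix i assume i: "i \<in> {..<Suc (Suc n)}"
    have "p \<le> x n i" "x n (Suc i) \<le> q" using xin[of i n] xin[of "Suc i" n] i by auto
    then show "indicator {x n i..<x n (Suc i)} s * c j (x n i) (x n (Suc i)) = 0"
      using that by (auto simp: indicator_def)
  qed
  have C_bd: "\<bar>C n j s\<bar> \<le> B" if s: "s \<in> {p..<q}" and j: "j \<in> A" for n j s
  proof -
    obtain i where i: "i < Suc (Suc n)" "x n i \<le> s" "s < x n (Suc i)"
      using partition_locate[of "x n" s "Suc (Suc n)"] s x(1)[of n] x(2)[of n] by auto
    have "\<bar>c j (x n i) (x n (Suc i))\<bar> \<le> B"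
      using i(1) xin[of i n] xin[of "Suc i" n] by (intro bd j x) auto
    then show ?thesis unfolding C_at[OF i] .
  qed
  have gi: "integrable lebesgue (\<lambda>s. indicator {a..<b} s * g j s)" if "j \<in> A" "p \<le> a" "b \<le> q" for j a b
  proof -
    have "set_integrable lebesgue {a..<b} (g j)" by (rule set_integrable_subset[OF g[OF that(1)]]) (use that in auto)
    then show ?thesis by (simp add: set_integrable_def)
  qed
  have step: "F q - F p \<le> (\<Sum>j\<in>A. \<integral>s. C n j s * g j s \<partial>lebesgue)" for n
  proof -
    have "F q - F p = (\<Sum>i<Suc (Suc n). F (x n (Suc i)) - F (x n i))"
      unfolding sum_lessThan_telescope[of "\<lambda>i. F (x n i)"] x(1) x(2) ..
    also have "\<dots> \<le> (\<Sum>i<Suc (Suc n). \<Sum>j\<in>A. c j (x n i) (x n (Suc i)) * (\<integral>s. indicator {x n i..<x n (Suc i)} s * g j s \<partial>lebesgue))"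
    proof (rule sum_mono)
      fix i assume "i \<in> {..<Suc (Suc n)}"
      then have i: "i < Suc (Suc n)" by simp
      have "F (x n (Suc i)) - F (x n i) \<le> (\<Sum>j\<in>A. c j (x n i) (x n (Suc i)) * (LINT s:{x n i..x n (Suc i)}|lebesgue. g j s))"
        using i xin[of i n] xin[of "Suc i" n] by (intro inc x) auto
      also have "\<dots> = (\<Sum>j\<in>A. c j (x n i) (x n (Suc i)) * (\<integral>s. indicator {x n i..<x n (Suc i)} s * g j s \<partial>lebesgue))"
      proof (rule sum.cong[OF refl])
        fix j assume j: "j \<in> A"
        have "set_integrable lebesgue {x n i..x n (Suc i)} (g j)"
          by (rule set_integrable_subset[OF g[OF j]]) (use i xin[of i n] xin[of "Suc i" n] in auto)
        then show "c j (x n i) (x n (Suc i)) * (LINT s:{x n i..x n (Suc i)}|lebesgue. g j s) = c j (x n i) (x n (Suc i)) * (\<integral>s. indicator {x n i..<x n (Suc i)} s * g j s \<partial>lebesgue)"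
          by (simp only: set_integral_Icc_Ico)
      qed
      finally show "F (x n (Suc i)) - F (x n i) \<le> (\<Sum>j\<in>A. c j (x n i) (x n (Suc i)) * (\<integral>s. indicator {x n i..<x n (Suc i)} s * g j s \<partial>lebesgue))" .
    qed
    also have "\<dots> = (\<Sum>j\<in>A. \<Sum>i<Suc (Suc n). c j (x n i) (x n (Suc i)) * (\<integral>s. indicator {x n i..<x n (Suc i)} s * g j s \<partial>lebesgue))"
      by (rule sum.swap)
    also have "\<dots> = (\<Sum>j\<in>A. \<integral>s. C n j s * g j s \<partial>lebesgue)"
    proof (rule sum.cong[OF refl])
      fix j assume j: "j \<in> A"
      have "(\<integral>s. C n j s * g j s \<partial>lebesgue) = (\<integral>s. (\<Sum>i<Suc (Suc n). c j (x n i) (x n (Suc i)) * (indicator {x n i..<x n (Suc i)} s * g j s)) \<partial>lebesgue)"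
        unfolding C_def sum_distrib_right by (simp only: mult_ac)
      also have "\<dots> = (\<Sum>i<Suc (Suc n). \<integral>s. c j (x n i) (x n (Suc i)) * (indicator {x n i..<x n (Suc i)} s * g j s) \<partial>lebesgue)"
      proof (rule Bochner_Integration.integral_sum)
        fix i assume "i \<in> {..<Suc (Suc n)}"
        then have "p \<le> x n i" "x n (Suc i) \<le> q" using xin[of i n] xin[of "Suc i" n] by auto
        then show "integrable lebesgue (\<lambda>s. c j (x n i) (x n (Suc i)) * (indicator {x n i..<x n (Suc i)} s * g j s))"
          by (intro integrable_mult_right gi j)
      qed
      also have "\<dots> = (\<Sum>i<Suc (Suc n). c j (x n i) (x n (Suc i)) * (\<integral>s. indicator {x n i..<x n (Suc i)} s * g j s \<partial>lebesgue))"
        by (simp only: integral_mult_right_zero)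
      finally show "(\<Sum>i<Suc (Suc n). c j (x n i) (x n (Suc i)) * (\<integral>s. indicator {x n i..<x n (Suc i)} s * g j s \<partial>lebesgue)) = (\<integral>s. C n j s * g j s \<partial>lebesgue)" by simp
    qed
    finally show ?thesis .
  qed
  have ae: "AE s in lebesgue. (\<lambda>n. C n j s * g j s) \<longlonglongrightarrow> indicator {p..q} s *\<^sub>R (k j s * g j s)" if j: "j \<in> A" for j
  proof -
    have "AE s in lebesgue. s \<noteq> p" "AE s in lebesgue. s \<noteq> q" by (rule AE_completion[OF AE_lborel_singleton])+
    with lim show ?thesis
    proof eventually_elim
      case (elim s)
      show ?case
      proof (cases "s \<in> {p<..<q}")
        case True
        have "\<exists>i<Suc (Suc n). x n i \<le> s \<and> s < x n (Suc i)" for n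
          using partition_locate[of "x n" s "Suc (Suc n)"] True x(1)[of n] x(2)[of n] by auto
        then obtain i where i: "\<And>n. i n < Suc (Suc n)" "\<And>n. x n (i n) \<le> s" "\<And>n. s < x n (Suc (i n))" by metis
        have r: "(\<lambda>n. 2 * (q - p) / real (Suc n)) \<longlonglongrightarrow> 0"
          using tendsto_mult[OF tendsto_const[of "2 * (q - p)"] LIMSEQ_Suc[OF lim_1_over_n]] by simp
        have "(\<lambda>n. x n (i n) - s) \<longlonglongrightarrow> 0"
          by (rule Lim_null_comparison[OF always_eventually r]) (use i x(5)[OF i(1)] in \<open>smt (verit, best) real_norm_def\<close>)
        then have a: "(\<lambda>n. x n (i n)) \<longlonglongrightarrow> s" by (simp add: LIM_zero_iff)
        have "(\<lambda>n. x n (Suc (i n)) - s) \<longlonglongrightarrow> 0"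
          by (rule Lim_null_comparison[OF always_eventually r]) (use i x(5)[OF i(1)] in \<open>smt (verit, best) real_norm_def\<close>)
        then have b: "(\<lambda>n. x n (Suc (i n))) \<longlonglongrightarrow> s" by (simp add: LIM_zero_iff)
        have "\<forall>n. x n (i n) \<in> G \<and> x n (Suc (i n)) \<in> G \<and> p \<le> x n (i n) \<and> x n (i n) \<le> s \<and> s < x n (Suc (i n)) \<and> x n (Suc (i n)) \<le> q"
        proof
          fix n
          have "i n \<le> Suc (Suc n)" "Suc (i n) \<le> Suc (Suc n)" using i(1)[of n] by simp_all
          then show "x n (i n) \<in> G \<and> x n (Suc (i n)) \<in> G \<and> p \<le> x n (i n) \<and> x n (i n) \<le> s \<and> s < x n (Suc (i n)) \<and> x n (Suc (i n)) \<le> q"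
            using x(3)[of "i n" n] x(3)[of "Suc (i n)" n] xin[of "i n" n] xin[of "Suc (i n)" n] i(2,3)[of n] by simp
        qed
        then have "(\<lambda>n. c j (x n (i n)) (x n (Suc (i n)))) \<longlonglongrightarrow> k j s"
          using elim(1)[rule_format, OF True, of "\<lambda>n. x n (i n)" "\<lambda>n. x n (Suc (i n))"] a b j by blast
        then have "(\<lambda>n. C n j s) \<longlonglongrightarrow> k j s" unfolding C_at[OF i] .
        then have "(\<lambda>n. C n j s * g j s) \<longlonglongrightarrow> k j s * g j s" by (intro tendsto_intros)
        then show ?thesis using True by simp
      next
        case False
        then have "s \<notin> {p..q}" using elim by auto
        then have "C n j s = 0" for n using C_out[of s] by auto
        then show ?thesis using \<open>s \<notin> {p..q}\<close> by simp
      qed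
    qed
  qed
  have kg: "(\<lambda>s. indicator {p..q} s *\<^sub>R (k j s * g j s)) \<in> borel_measurable lebesgue" if j: "j \<in> A" for j
  proof -
    have [measurable]: "(\<lambda>s. indicator {p..q} s *\<^sub>R g j s) \<in> borel_measurable lebesgue"
      using g[OF j] unfolding set_integrable_def by (rule borel_measurable_integrable)
    note [measurable] = k[OF j]
    have "(\<lambda>s. (indicator {p..q} s * k j s) * (indicator {p..q} s *\<^sub>R g j s)) \<in> borel_measurable lebesgue" by measurable
    also have "(\<lambda>s. (indicator {p..q} s * k j s) * (indicator {p..q} s *\<^sub>R g j s)) = (\<lambda>s. indicator {p..q} s *\<^sub>R (k j s * g j s))"
      by (auto simp: indicator_def fun_eq_iff)
    finally show ?thesis .
  qed
  have Cm: "(\<lambda>s. C n j s * g j s) \<in> borel_measurable lebesgue" if j: "j \<in> A" for n j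
  proof -
    have "(\<lambda>s. \<Sum>i<Suc (Suc n). c j (x n i) (x n (Suc i)) * (indicator {x n i..<x n (Suc i)} s * g j s)) \<in> borel_measurable lebesgue"
    proof (rule borel_measurable_sum)
      fix i assume "i \<in> {..<Suc (Suc n)}"
      then have "p \<le> x n i" "x n (Suc i) \<le> q" using xin[of i n] xin[of "Suc i" n] by auto
      then show "(\<lambda>s. c j (x n i) (x n (Suc i)) * (indicator {x n i..<x n (Suc i)} s * g j s)) \<in> borel_measurable lebesgue"
        by (intro borel_measurable_integrable integrable_mult_right gi j)
    qed
    then show ?thesis unfolding C_def sum_distrib_right by (simp only: mult_ac)
  qed
  have dom: "AE s in lebesgue. norm (C n j s * g j s) \<le> B * norm (indicator {p..q} s *\<^sub>R g j s)" if j: "j \<in> A" for n j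
  proof (rule AE_I2)
    fix s
    show "norm (C n j s * g j s) \<le> B * norm (indicator {p..q} s *\<^sub>R g j s)"
    proof (cases "s \<in> {p..<q}")
      case True
      then show ?thesis using C_bd[OF True j, of n] by (auto simp: abs_mult intro!: mult_right_mono)
    next
      case False
      have "0 \<le> B" using C_bd[of p j n] j pq by fastforce
      then show ?thesis using C_out[OF False] by simp
    qed
  qed
  have domi: "integrable lebesgue (\<lambda>s. B * norm (indicator {p..q} s *\<^sub>R g j s))" if j: "j \<in> A" for j
    using g[OF j] unfolding set_integrable_def by (intro integrable_mult_right integrable_norm)
  have conv: "(\<lambda>n. \<integral>s. C n j s * g j s \<partial>lebesgue) \<longlonglongrightarrow> (\<integral>s. indicator {p..q} s *\<^sub>R (k j s * g j s) \<partial>lebesgue)" if j: "j \<in> A" for j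
    by (rule integral_dominated_convergence[OF kg[OF j] Cm[OF j] domi[OF j] ae[OF j] dom[OF j]])
  show "F q - F p \<le> (\<Sum>j\<in>A. LINT s:{p..q}|lebesgue. k j s * g j s)"
  proof (rule LIMSEQ_le_const)
    show "(\<lambda>n. \<Sum>j\<in>A. \<integral>s. C n j s * g j s \<partial>lebesgue) \<longlonglongrightarrow> (\<Sum>j\<in>A. LINT s:{p..q}|lebesgue. k j s * g j s)"
      unfolding set_lebesgue_integral_def by (intro tendsto_sum conv)
    show "\<exists>N. \<forall>n\<ge>N. F q - F p \<le> (\<Sum>j\<in>A. \<integral>s. C n j s * g j s \<partial>lebesgue)" using step by blast
  qed
  show "set_integrable lebesgue {p..q} (\<lambda>s. k j s * g j s)" if j: "j \<in> A" for j
    unfolding set_integrable_def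
    by (rule integrable_dominated_convergence[OF kg[OF j] Cm[OF j] domi[OF j] ae[OF j] dom[OF j]])
qed

section \<open>Energy functions along a path\<close>

lemma AE_dense:
  fixes p q :: real
  assumes "AE s in lebesgue. s \<in> {p..q} \<longrightarrow> P s" "p \<le> a" "a < b" "b \<le> q"
  shows "\<exists>g. P g \<and> a < g \<and> g < b"
proof (rule ccontr)
  assume "\<not> ?thesis"
  then have disj: "{a<..<b} \<inter> {s. P s} = {}" by auto
  have "AE s in lebesgue. s \<notin> {a<..<b}"
    using assms(1) by eventually_elim (use disj assms in auto)
  then have "{a<..<b} \<in> null_sets lebesgue" by (subst AE_iff_null_sets) auto
  then show False using assms by (simp add: null_sets_def)
qed

text \<open>The sign of the derivative comes from monotonicity. The mean value point lies between
  the two arguments in either order, since the energy of a path may rise or fall.\<close>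

lemma energy_function_props:
  assumes "energy_function \<psi> \<psi>'"
  shows "0 \<le> r \<Longrightarrow> 0 \<le> \<psi>' r"
    and "\<And>x y. 0 \<le> x \<Longrightarrow> 0 \<le> y \<Longrightarrow> \<exists>\<xi>. min x y \<le> \<xi> \<and> \<xi> \<le> max x y \<and> \<psi> y - \<psi> x = \<psi>' \<xi> * (y - x)"
    and "\<exists>B\<ge>0. \<forall>r\<ge>0. \<bar>\<psi>' r\<bar> \<le> B"
proof -
  have mono: "mono_on {0..} \<psi>" and d: "\<And>r. 0 \<le> r \<Longrightarrow> (\<psi> has_real_derivative \<psi>' r) (at r within {0..})"
    and b: "bounded (\<psi>' ` {0..})" using assms by (auto simp: energy_function_def)
  show "0 \<le> \<psi>' r" if r: "0 \<le> r"
  proof (rule ccontr)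
    assume "\<not> 0 \<le> \<psi>' r"
    then obtain e where e: "e > 0" "\<And>h. h > 0 \<Longrightarrow> r + h \<in> {0..} \<Longrightarrow> h < e \<Longrightarrow> \<psi> r > \<psi> (r + h)"
      using has_real_derivative_neg_dec_right[OF d[OF r]] by (meson not_le)
    have "\<psi> r \<le> \<psi> (r + e / 2)" using mono r e(1) by (intro mono_onD[OF mono]) auto
    then show False using e(2)[of "e / 2"] e(1) r by simp
  qed
  have lt: "\<exists>\<xi>. x \<le> \<xi> \<and> \<xi> \<le> y \<and> \<psi> y - \<psi> x = \<psi>' \<xi> * (y - x)" if "0 \<le> x" "x < y" for x y
  proof -
    have "(\<psi> has_derivative (\<lambda>h. \<psi>' t * h)) (at t within {x..y})" if "t \<in> {x..y}" for t
      using d[of t] that \<open>0 \<le> x\<close> unfolding has_field_derivative_def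
      by (auto intro: has_derivative_subset)
    then have "\<exists>t\<in>{x<..<y}. \<psi> y - \<psi> x = \<psi>' t * (y - x)"
      using mvt_simple[OF \<open>x < y\<close>, of \<psi> "\<lambda>t h. \<psi>' t * h"] by auto
    then obtain t where "t \<in> {x<..<y}" "\<psi> y - \<psi> x = \<psi>' t * (y - x)" by blast
    then show ?thesis by (intro exI[of _ t]) auto
  qed
  show "\<exists>\<xi>. min x y \<le> \<xi> \<and> \<xi> \<le> max x y \<and> \<psi> y - \<psi> x = \<psi>' \<xi> * (y - x)" if xy: "0 \<le> x" "0 \<le> y" for x y
  proof (cases x y rule: linorder_cases)
    case less
    then show ?thesis using lt[of x y] xy by auto
  next
    case greater
    then obtain \<xi> where "y \<le> \<xi>" "\<xi> \<le> x" "\<psi> x - \<psi> y = \<psi>' \<xi> * (x - y)" using lt[OF xy(2) greater] by blast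
    with greater show ?thesis by (intro exI[of _ \<xi>]) (auto simp: algebra_simps)
  qed auto
  obtain B where "\<And>z. z \<in> \<psi>' ` {0..} \<Longrightarrow> norm z \<le> B" using b unfolding bounded_iff by blast
  then show "\<exists>B\<ge>0. \<forall>r\<ge>0. \<bar>\<psi>' r\<bar> \<le> B"
    by (intro exI[of _ "max B 0"]) (auto simp: max_def, smt (verit) atLeast_iff image_eqI real_norm_def)
qed

text \<open>On \<open>G\<close> the function \<open>integral h - y\<close> is nondecreasing, so
  \<open>y\<close> restricted to \<open>G\<close> is continuous outside a countable set; at such
  times the mean value points converge to \<open>y s\<close>. Nonnegativity of
  \<open>\<psi>'\<close> lets an upper bound for the increment of \<open>y\<close> pass to the
  increment of \<psi> along \<open>y\<close>.\<close>

lemma energy_chain: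
  fixes y h :: "real \<Rightarrow> real"
  assumes \<psi>: "energy_function \<psi> \<psi>'" and pq: "p < q"
    and h: "set_integrable lebesgue {p..q} h" and y0: "\<And>s. s \<in> {p..q} \<Longrightarrow> 0 \<le> y s"
    and ym: "(\<lambda>s. indicator {p..q} s * y s) \<in> borel_measurable lebesgue"
    and G: "G \<subseteq> {p..<q}" "p \<in> G" "AE s in lebesgue. s \<in> {p..q} \<longrightarrow> s \<in> G"
    and en: "\<And>a b. a \<in> G \<Longrightarrow> a < b \<Longrightarrow> b \<le> q \<Longrightarrow> y b - y a \<le> (LINT s:{a..b}|lebesgue. h s)"
  shows "\<psi> (y q) - \<psi> (y p) \<le> (LINT s:{p..q}|lebesgue. \<psi>' (y s) * h s)"
    and "set_integrable lebesgue {p..q} (\<lambda>s. \<psi>' (y s) * h s)"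
proof -
  \<comment> \<open>The end time \<open>q\<close> is a node but never a starting time, so the
    inequality \<open>en\<close> is invoked only from points of \<open>G\<close>.\<close>
  let ?G = "insert q G"
  have Gsub: "?G \<subseteq> {p..q}" using G(1) pq by auto
  have "\<forall>a b. \<exists>\<xi>. a \<in> {p..q} \<longrightarrow> b \<in> {p..q} \<longrightarrow> min (y a) (y b) \<le> \<xi> \<and> \<xi> \<le> max (y a) (y b) \<and> \<psi> (y b) - \<psi> (y a) = \<psi>' \<xi> * (y b - y a)"
    using energy_function_props(2)[OF \<psi>] y0 by blast
  then obtain \<xi> where \<xi>: "\<And>a b. a \<in> {p..q} \<Longrightarrow> b \<in> {p..q} \<Longrightarrow> min (y a) (y b) \<le> \<xi> a b \<and> \<xi> a b \<le> max (y a) (y b) \<and> \<psi> (y b) - \<psi> (y a) = \<psi>' (\<xi> a b) * (y b - y a)"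
    by metis
  have \<xi>0: "0 \<le> \<xi> a b" if "a \<in> {p..q}" "b \<in> {p..q}" for a b
    using \<xi>[OF that] y0[OF that(1)] y0[OF that(2)] by (auto simp: min_def split: if_splits)
  obtain B where B: "B \<ge> 0" "\<And>r. r \<ge> 0 \<Longrightarrow> \<bar>\<psi>' r\<bar> \<le> B" using energy_function_props(3)[OF \<psi>] by blast
  have hs: "set_integrable lebesgue {a..b} h" if "p \<le> a" "b \<le> q" for a b
    by (rule set_integrable_subset[OF h]) (use that in auto)
  have hI: "(LINT s:{a..b}|lebesgue. h s) = integral {a..b} h" if "p \<le> a" "b \<le> q" for a b
    by (rule set_lebesgue_integral_eq_integral(2)[OF hs[OF that]])
  have hint: "h integrable_on {p..q}" by (rule set_lebesgue_integral_eq_integral(1)[OF h])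
  have icont: "continuous_on {p..q} (\<lambda>x. integral {p..x} h)" by (rule indefinite_integral_continuous_1[OF hint])
  \<comment> \<open>Up to an additive constant, the defect in the energy balance accumulated from
    \<open>p\<close> to \<open>a\<close>.\<close>
  define z where "z a = integral {p..a} h - y a" for a
  have zmono: "mono_on ?G z"
  proof (rule mono_onI)
    fix a b assume ab: "a \<in> ?G" "b \<in> ?G" "a \<le> b"
    show "z a \<le> z b"
    proof (cases "a = b")
      case False
      then have "a < b" "a \<in> G" "b \<le> q" using ab G(1) by auto
      then have "y b - y a \<le> integral {a..b} h" using en[of a b] hI[of a b] G(1) by auto
      moreover have "integral {p..a} h + integral {a..b} h = integral {p..b} h"
        using \<open>a < b\<close> \<open>a \<in> G\<close> \<open>b \<le> q\<close> G(1) by (intro Henstock_Kurzweil_Integration.integral_combine integrable_on_subinterval[OF hint]) auto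
      ultimately show ?thesis by (simp add: z_def)
    qed simp
  qed
  have "countable {a \<in> ?G. \<not> continuous (at a within ?G) z}" by (rule mono_on_ctble_discont[OF zmono])
  then have "{a \<in> ?G. \<not> continuous (at a within ?G) z} \<in> null_sets lborel" by (rule countable_imp_null_set_lborel)
  then have aec: "AE s in lebesgue. s \<notin> {a \<in> ?G. \<not> continuous (at a within ?G) z}"
    by (intro AE_completion AE_not_in)
  have lim: "AE s in lebesgue. s \<in> {p<..<q} \<longrightarrow> (\<forall>a b. (\<forall>n. a n \<in> ?G \<and> b n \<in> ?G \<and> p \<le> a n \<and> a n \<le> s \<and> s < b n \<and> b n \<le> q) \<longrightarrow>
      a \<longlonglongrightarrow> s \<longrightarrow> b \<longlonglongrightarrow> s \<longrightarrow> (\<forall>j\<in>{()}. (\<lambda>n. \<psi>' (\<xi> (a n) (b n))) \<longlonglongrightarrow> \<psi>' (y s)))"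
    using aec G(3)
  proof eventually_elim
    case (elim s)
    show ?case
    proof (intro impI allI ballI)
      fix a b :: "nat \<Rightarrow> real"
      assume s: "s \<in> {p<..<q}" and ab: "\<forall>n. a n \<in> ?G \<and> b n \<in> ?G \<and> p \<le> a n \<and> a n \<le> s \<and> s < b n \<and> b n \<le> q" and a: "a \<longlonglongrightarrow> s" and b: "b \<longlonglongrightarrow> s"
      have sG: "s \<in> ?G" using elim(2) s by auto
      then have cz: "continuous (at s within ?G) z" using elim(1) by blast
      have ylim: "(\<lambda>n. y (x n)) \<longlonglongrightarrow> y s" if x: "\<And>n. x n \<in> ?G" "x \<longlonglongrightarrow> s" for x
      proof -
        have "(\<lambda>n. z (x n)) \<longlonglongrightarrow> z s"
          using cz x unfolding continuous_within_sequentially o_def by blast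
        moreover have "(\<lambda>n. integral {p..x n} h) \<longlonglongrightarrow> integral {p..s} h"
        proof (rule continuous_on_tendsto_compose[OF icont x(2)])
          have "x n \<in> {p..q}" for n using x(1)[of n] Gsub by blast
          then show "\<forall>\<^sub>F n in sequentially. x n \<in> {p..q}" by simp
        qed (use s in simp)
        ultimately have "(\<lambda>n. integral {p..x n} h - z (x n)) \<longlonglongrightarrow> integral {p..s} h - z s" by (intro tendsto_intros)
        then show ?thesis by (simp add: z_def)
      qed
      have ya: "(\<lambda>n. y (a n)) \<longlonglongrightarrow> y s" and yb: "(\<lambda>n. y (b n)) \<longlonglongrightarrow> y s"
        using ylim[of a] ylim[of b] ab a b by blast+
      have abI: "a n \<in> {p..q}" "b n \<in> {p..q}" for n using ab Gsub by blast+
      have "(\<lambda>n. \<xi> (a n) (b n)) \<longlonglongrightarrow> y s"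
      proof (rule tendsto_sandwich)
        show "\<forall>\<^sub>F n in sequentially. min (y (a n)) (y (b n)) \<le> \<xi> (a n) (b n)" using \<xi>[OF abI] by simp
        show "\<forall>\<^sub>F n in sequentially. \<xi> (a n) (b n) \<le> max (y (a n)) (y (b n))" using \<xi>[OF abI] by simp
        show "(\<lambda>n. min (y (a n)) (y (b n))) \<longlonglongrightarrow> y s" using tendsto_min[OF ya yb] by simp
        show "(\<lambda>n. max (y (a n)) (y (b n))) \<longlonglongrightarrow> y s" using tendsto_max[OF ya yb] by simp
      qed
      moreover have "continuous_on {0..} \<psi>'" using \<psi> by (simp add: energy_function_def)
      ultimately show "(\<lambda>n. \<psi>' (\<xi> (a n) (b n))) \<longlonglongrightarrow> \<psi>' (y s)"
        by (intro continuous_on_tendsto_compose[of "{0..}" \<psi>']) (use y0[of s] s \<xi>0[OF abI] in auto)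
    qed
  qed
  have km: "(\<lambda>s. indicator {p..q} s * \<psi>' (y s)) \<in> borel_measurable lebesgue"
  proof -
    have "(\<lambda>r. indicator {0..} r *\<^sub>R \<psi>' r) \<in> borel_measurable borel"
      using \<psi> by (intro borel_measurable_continuous_on_indicator) (auto simp: energy_function_def)
    then have "(\<lambda>s. indicator {0..} (indicator {p..q} s * y s) *\<^sub>R \<psi>' (indicator {p..q} s * y s)) \<in> borel_measurable lebesgue"
      by (rule measurable_compose[OF ym])
    then have "(\<lambda>s. indicator {p..q} s * (indicator {0..} (indicator {p..q} s * y s) *\<^sub>R \<psi>' (indicator {p..q} s * y s))) \<in> borel_measurable lebesgue"
      by (intro borel_measurable_times borel_measurable_indicator) auto
    also have "(\<lambda>s. indicator {p..q} s * (indicator {0..} (indicator {p..q} s * y s) *\<^sub>R \<psi>' (indicator {p..q} s * y s))) = (\<lambda>s. indicator {p..q} s * \<psi>' (y s))"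
      using y0 by (auto simp: fun_eq_iff indicator_def)
    finally show ?thesis .
  qed
  have "\<exists>g\<in>?G. a < g \<and> g < b" if "p \<le> a" "a < b" "b \<le> q" for a b
    using AE_dense[OF G(3) that] by blast
  note dense = this
  have inc: "\<psi> (y b) - \<psi> (y a) \<le> (\<Sum>j\<in>{()}. \<psi>' (\<xi> a b) * (LINT s:{a..b}|lebesgue. h s))"
    if ab: "a \<in> ?G" "b \<in> ?G" "p \<le> a" "a < b" "b \<le> q" for a b
  proof -
    have I: "a \<in> {p..q}" "b \<in> {p..q}" using ab by auto
    have "\<psi> (y b) - \<psi> (y a) = \<psi>' (\<xi> a b) * (y b - y a)" using \<xi>[OF I] by blast
    also have "\<dots> \<le> \<psi>' (\<xi> a b) * (LINT s:{a..b}|lebesgue. h s)"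
      using en[of a b] ab G(1) energy_function_props(1)[OF \<psi> \<xi>0[OF I]] by (intro mult_left_mono) auto
    finally show ?thesis by simp
  qed
  have bd: "\<bar>\<psi>' (\<xi> a b)\<bar> \<le> B" if "a \<in> ?G" "b \<in> ?G" for a b
    using B(2) \<xi>0 that Gsub by blast
  note pi = partition_inequality[where A = "{()}" and G = ?G and p = p and q = q and g = "\<lambda>_. h" and F = "\<lambda>s. \<psi> (y s)"
      and c = "\<lambda>_ a b. \<psi>' (\<xi> a b)" and B = B and k = "\<lambda>_ s. \<psi>' (y s)", OF _ pq _ _ dense h inc bd lim km]
  show "\<psi> (y q) - \<psi> (y p) \<le> (LINT s:{p..q}|lebesgue. \<psi>' (y s) * h s)"
    using pi(1) G(2) by simp
  show "set_integrable lebesgue {p..q} (\<lambda>s. \<psi>' (y s) * h s)"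
    using pi(2) G(2) by simp
qed

subsection \<open>Cylindrical functions along absolutely continuous coordinates\<close>

lemma Euclidean_space_limit:
  assumes f: "continuous_map (Euclidean_space k) euclideanreal f"
    and X: "\<And>n. X n \<in> topspace (Euclidean_space k)" "L \<in> topspace (Euclidean_space k)" "\<And>i. (\<lambda>n. X n i) \<longlonglongrightarrow> L i"
  shows "(\<lambda>n. f (X n)) \<longlonglongrightarrow> f L"
proof -
  have "limitin (powertop_real UNIV) X L sequentially"
    unfolding limitin_componentwise using X(3) by simp
  then have "limitin (Euclidean_space k) X L sequentially"
    unfolding Euclidean_space_def limitin_subtopology using X(1,2) by (auto simp: topspace_Euclidean_space)
  from continuous_map_limit[OF f this] show ?thesis by (simp add: o_def)
qed

lemma fun_upd_topspace:
  "x \<in> topspace (Euclidean_space k) \<Longrightarrow> j < k \<Longrightarrow> x(j := h) \<in> topspace (Euclidean_space k)"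
  by (auto simp: topspace_Euclidean_space)

text \<open>Off the support, a small move in one coordinate stays off the support, so \<phi> is
  locally zero along the coordinate line and the partial derivative vanishes; on the compact support
  continuity gives the bound.\<close>

lemma C1_compact_support_bounded:
  assumes c: "C1_compact_support k \<phi> d\<phi>"
  shows "\<exists>B\<ge>0. \<forall>x\<in>topspace (Euclidean_space k). \<bar>\<phi> x\<bar> \<le> B"
    and "j < k \<Longrightarrow> \<exists>B\<ge>0. \<forall>x\<in>topspace (Euclidean_space k). \<bar>d\<phi> j x\<bar> \<le> B"
proof -
  let ?E = "Euclidean_space k"
  define K where "K = ?E closure_of {x \<in> topspace ?E. \<phi> x \<noteq> 0}"
  have cont: "continuous_map ?E euclideanreal \<phi>" "\<And>j. j < k \<Longrightarrow> continuous_map ?E euclideanreal (d\<phi> j)"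
    and der: "\<And>j x. j < k \<Longrightarrow> x \<in> topspace ?E \<Longrightarrow> ((\<lambda>h. \<phi> (x(j := h))) has_real_derivative d\<phi> j x) (at (x j))"
    and K: "compactin ?E K" using c by (auto simp: C1_compact_support_def K_def)
  have zero: "\<phi> x = 0" if "x \<in> topspace ?E" "x \<notin> K" for x
    using that closure_of_subset[of "{x \<in> topspace ?E. \<phi> x \<noteq> 0}" ?E] unfolding K_def by blast
  have Kc: "closedin ?E K" unfolding K_def by (rule closedin_closure_of)
  have gen: "\<exists>B\<ge>0. \<forall>x\<in>topspace ?E. \<bar>g x\<bar> \<le> B"
    if g: "continuous_map ?E euclideanreal g" and z: "\<And>x. x \<in> topspace ?E \<Longrightarrow> x \<notin> K \<Longrightarrow> g x = 0" for g
  proof -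
    have "compactin euclideanreal (g ` K)" by (rule image_compactin[OF K g])
    then have "bounded (g ` K)" by (simp add: compact_imp_bounded)
    then obtain B where "\<And>x. x \<in> K \<Longrightarrow> \<bar>g x\<bar> \<le> B" unfolding bounded_iff by auto
    then have "\<forall>x\<in>topspace ?E. \<bar>g x\<bar> \<le> max B 0" using z by (metis abs_zero max.cobounded2 max.coboundedI1)
    then show ?thesis by (intro exI[of _ "max B 0"]) auto
  qed
  show "\<exists>B\<ge>0. \<forall>x\<in>topspace ?E. \<bar>\<phi> x\<bar> \<le> B" by (rule gen[OF cont(1) zero])
  show "\<exists>B\<ge>0. \<forall>x\<in>topspace ?E. \<bar>d\<phi> j x\<bar> \<le> B" if j: "j < k"
  proof (rule gen[OF cont(2)[OF j]])
    fix x assume x: "x \<in> topspace ?E" "x \<notin> K"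
    have "continuous_map euclideanreal ?E (\<lambda>h i. if i < k then (x(j := h)) i else 0)"
      unfolding continuous_map_componentwise_Euclidean_space by auto
    moreover have "(\<lambda>h i. if i < k then (x(j := h)) i else 0) = (\<lambda>h. x(j := h))"
    proof (intro ext)
      fix h i
      show "(if i < k then (x(j := h)) i else 0) = (x(j := h)) i"
        using x(1) j by (auto simp: topspace_Euclidean_space)
    qed
    ultimately have cm: "continuous_map euclideanreal ?E (\<lambda>h. x(j := h))" by simp
    have "openin ?E (topspace ?E - K)" using Kc by (simp add: openin_closedin_eq Diff_Diff_Int closedin_subset Int_absorb1)
    from openin_continuous_map_preimage[OF cm this]
    have o: "open {h. x(j := h) \<in> topspace ?E - K}" by simp
    have "((\<lambda>h. 0) has_real_derivative d\<phi> j x) (at (x j))"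
      by (rule has_field_derivative_transform_within_open[OF der[OF j x(1)] o]) (use x zero in auto)
    then show "d\<phi> j x = 0" using DERIV_unique[OF _ DERIV_const] by blast
  qed
qed

lemma mvt_between:
  fixes f :: "real \<Rightarrow> real"
  assumes "\<And>x. (f has_real_derivative f' x) (at x)"
  shows "\<exists>\<zeta>. min a b \<le> \<zeta> \<and> \<zeta> \<le> max a b \<and> f b - f a = f' \<zeta> * (b - a)"
proof (cases a b rule: linorder_cases)
  case less
  then obtain z where "a < z" "z < b" "f b - f a = (b - a) * f' z" using MVT2[of a b f f'] assms by blast
  then show ?thesis by (intro exI[of _ z]) (auto simp: mult.commute)
next
  case greater
  then obtain z where "b < z" "z < a" "f a - f b = (a - b) * f' z" using MVT2[of b a f f'] assms by blast
  then show ?thesis by (intro exI[of _ z]) (auto simp: algebra_simps)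
qed auto

text \<open>The coordinates are changed one at a time, with a one-dimensional mean value theorem for
  each; the intermediate points lie coordinatewise between \<open>X\<close> and \<open>Y\<close>,
  which forces their convergence when \<open>X\<close> and \<open>Y\<close> merge.\<close>

lemma C1_increment:
  assumes c: "C1_compact_support k \<phi> d\<phi>" and X: "X \<in> topspace (Euclidean_space k)" and Y: "Y \<in> topspace (Euclidean_space k)"
  shows "\<exists>Z. (\<forall>j<k. Z j \<in> topspace (Euclidean_space k) \<and> (\<forall>i. min (X i) (Y i) \<le> Z j i \<and> Z j i \<le> max (X i) (Y i))) \<and>
    \<phi> Y - \<phi> X = (\<Sum>j<k. d\<phi> j (Z j) * (Y j - X j))"
proof -
  let ?E = "Euclidean_space k"
  \<comment> \<open>The hybrid point whose first \<open>j\<close> coordinates are already those of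
    \<open>Y\<close>.\<close>
  define W where "W j i = (if i < j then Y i else X i)" for j i :: nat
  have W: "W j \<in> topspace ?E" for j using X Y by (auto simp: W_def topspace_Euclidean_space)
  have der: "\<And>j x. j < k \<Longrightarrow> x \<in> topspace ?E \<Longrightarrow> ((\<lambda>h. \<phi> (x(j := h))) has_real_derivative d\<phi> j x) (at (x j))"
    using c by (auto simp: C1_compact_support_def)
  have ex: "\<exists>\<zeta>. min (X j) (Y j) \<le> \<zeta> \<and> \<zeta> \<le> max (X j) (Y j) \<and> \<phi> (W (Suc j)) - \<phi> (W j) = d\<phi> j ((W j)(j := \<zeta>)) * (Y j - X j)" if j: "j < k" for j
  proof -
    have "((\<lambda>h. \<phi> ((W j)(j := h))) has_real_derivative d\<phi> j ((W j)(j := x))) (at x)" for x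
      using der[OF j fun_upd_topspace[OF W j, of j x]] by simp
    from mvt_between[of "\<lambda>h. \<phi> ((W j)(j := h))" "\<lambda>x. d\<phi> j ((W j)(j := x))", OF this, of "X j" "Y j"]
    obtain \<zeta> where \<zeta>: "min (X j) (Y j) \<le> \<zeta>" "\<zeta> \<le> max (X j) (Y j)"
      "\<phi> ((W j)(j := Y j)) - \<phi> ((W j)(j := X j)) = d\<phi> j ((W j)(j := \<zeta>)) * (Y j - X j)" by blast
    have "(W j)(j := Y j) = W (Suc j)" "(W j)(j := X j) = W j" by (auto simp: W_def fun_eq_iff less_Suc_eq)
    with \<zeta> show ?thesis by auto
  qed
  then obtain \<zeta> where \<zeta>: "\<And>j. j < k \<Longrightarrow> min (X j) (Y j) \<le> \<zeta> j \<and> \<zeta> j \<le> max (X j) (Y j) \<and> \<phi> (W (Suc j)) - \<phi> (W j) = d\<phi> j ((W j)(j := \<zeta> j)) * (Y j - X j)"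
    by metis
  have W0: "W 0 = X" by (simp add: W_def fun_eq_iff)
  have Wk: "W k = Y" using X Y by (auto simp: W_def fun_eq_iff topspace_Euclidean_space)
  have "\<phi> Y - \<phi> X = (\<Sum>j<k. \<phi> (W (Suc j)) - \<phi> (W j))"
    unfolding sum_lessThan_telescope[of "\<lambda>j. \<phi> (W j)"] W0 Wk ..
  also have "\<dots> = (\<Sum>j<k. d\<phi> j ((W j)(j := \<zeta> j)) * (Y j - X j))" using \<zeta> by (intro sum.cong) auto
  finally have eq: "\<phi> Y - \<phi> X = (\<Sum>j<k. d\<phi> j ((W j)(j := \<zeta> j)) * (Y j - X j))" .
  show ?thesis
  proof (rule exI[of _ "\<lambda>j. (W j)(j := \<zeta> j)"], intro conjI allI impI eq)
    fix j assume j: "j < k"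
    show "(W j)(j := \<zeta> j) \<in> topspace ?E" by (rule fun_upd_topspace[OF W j])
    show "min (X i) (Y i) \<le> ((W j)(j := \<zeta> j)) i" "((W j)(j := \<zeta> j)) i \<le> max (X i) (Y i)" for i
      using \<zeta>[OF j] by (auto simp: W_def)
  qed
qed

text \<open>Here the coordinates have exact increments, so the partition inequality is used for
  \<phi> and for its negative and gives equality. All times may serve as nodes because the
  coordinates are continuous.\<close>

lemma cylinder_chain:
  fixes x g :: "nat \<Rightarrow> real \<Rightarrow> real"
  assumes c: "C1_compact_support k \<phi> d\<phi>" and pq: "p < q"
    and g: "\<And>j. j < k \<Longrightarrow> set_integrable lebesgue {p..q} (g j)"
    and x: "\<And>j a b. j < k \<Longrightarrow> p \<le> a \<Longrightarrow> a \<le> b \<Longrightarrow> b \<le> q \<Longrightarrow> x j b - x j a = (LINT s:{a..b}|lebesgue. g j s)"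
  defines "X \<equiv> \<lambda>s j. if j < k then x j s else 0"
  shows "\<phi> (X q) - \<phi> (X p) = (\<Sum>j<k. LINT s:{p..q}|lebesgue. d\<phi> j (X s) * g j s)"
    and "\<And>j. j < k \<Longrightarrow> set_integrable lebesgue {p..q} (\<lambda>s. d\<phi> j (X s) * g j s)"
proof -
  let ?E = "Euclidean_space k"
  have XE: "X s \<in> topspace ?E" for s by (auto simp: X_def topspace_Euclidean_space)
  define P where "P a b Z \<longleftrightarrow> (\<forall>j<k. Z j \<in> topspace ?E \<and> (\<forall>i. min (X a i) (X b i) \<le> Z j i \<and> Z j i \<le> max (X a i) (X b i))) \<and>
    \<phi> (X b) - \<phi> (X a) = (\<Sum>j<k. d\<phi> j (Z j) * (X b j - X a j))" for a b Z
  have "\<exists>Z. P a b Z" for a b unfolding P_def by (rule C1_increment[OF c XE XE])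
  then obtain Z where ZP: "\<And>a b. P a b (Z a b)" by metis
  have Z: "\<And>a b j. j < k \<Longrightarrow> Z a b j \<in> topspace ?E"
    "\<And>a b j i. j < k \<Longrightarrow> min (X a i) (X b i) \<le> Z a b j i \<and> Z a b j i \<le> max (X a i) (X b i)"
    "\<And>a b. \<phi> (X b) - \<phi> (X a) = (\<Sum>j<k. d\<phi> j (Z a b j) * (X b j - X a j))"
    using ZP unfolding P_def by blast+
  have Xcont: "continuous_on {p..q} (\<lambda>s. X s i)" for i
  proof (cases "i < k")
    case True
    have "continuous_on {p..q} (\<lambda>s. x i p + integral {p..s} (g i))"
      by (intro continuous_intros indefinite_integral_continuous_1 set_lebesgue_integral_eq_integral(1) g True)
    moreover have "x i p + integral {p..s} (g i) = X s i" if "s \<in> {p..q}" for s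
    proof -
      have "set_integrable lebesgue {p..s} (g i)" by (rule set_integrable_subset[OF g[OF True]]) (use that in auto)
      then show ?thesis using x[OF True, of p s] that True by (simp add: set_lebesgue_integral_eq_integral X_def)
    qed
    ultimately show ?thesis by (rule continuous_on_eq)
  qed (simp add: X_def)
  have dcont: "continuous_map ?E euclideanreal (d\<phi> j)" if "j < k" for j using c that by (simp add: C1_compact_support_def)
  have "\<exists>B\<ge>0. \<forall>j<k. \<forall>y\<in>topspace ?E. \<bar>d\<phi> j y\<bar> \<le> B"
  proof -
    have "\<forall>j. \<exists>B\<ge>0. j < k \<longrightarrow> (\<forall>y\<in>topspace ?E. \<bar>d\<phi> j y\<bar> \<le> B)"
      using C1_compact_support_bounded(2)[OF c] by (metis order_refl)
    then obtain B where B: "\<And>j. 0 \<le> B j" "\<And>j. j < k \<Longrightarrow> \<forall>y\<in>topspace ?E. \<bar>d\<phi> j y\<bar> \<le> B j" by metis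
    have "B j \<le> (\<Sum>j<k. B j)" if "j < k" for j using that B(1) by (intro member_le_sum) auto
    then have "\<forall>j<k. \<forall>y\<in>topspace ?E. \<bar>d\<phi> j y\<bar> \<le> (\<Sum>j<k. B j)" using B(2) by (meson order_trans)
    moreover have "0 \<le> (\<Sum>j<k. B j)" by (intro sum_nonneg B)
    ultimately show ?thesis by blast
  qed
  then obtain B where B: "\<And>j y. j < k \<Longrightarrow> y \<in> topspace ?E \<Longrightarrow> \<bar>d\<phi> j y\<bar> \<le> B" by blast
  have lim1: "(\<lambda>n. d\<phi> j (Z (a n) (b n) j)) \<longlonglongrightarrow> d\<phi> j (X s)"
    if j: "j < k" and s: "s \<in> {p..q}" and ab: "\<And>n. a n \<in> {p..q}" "\<And>n. b n \<in> {p..q}" "a \<longlonglongrightarrow> s" "b \<longlonglongrightarrow> s" for j s a b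
  proof (rule Euclidean_space_limit[OF dcont[OF j] Z(1)[OF j] XE])
    fix i
    have l: "(\<lambda>n. X (a n) i) \<longlonglongrightarrow> X s i" "(\<lambda>n. X (b n) i) \<longlonglongrightarrow> X s i"
      using ab s by (auto intro!: continuous_on_tendsto_compose[OF Xcont])
    show "(\<lambda>n. Z (a n) (b n) j i) \<longlonglongrightarrow> X s i"
    proof (rule tendsto_sandwich)
      show "(\<lambda>n. min (X (a n) i) (X (b n) i)) \<longlonglongrightarrow> X s i" using tendsto_min[OF l] by simp
      show "(\<lambda>n. max (X (a n) i) (X (b n) i)) \<longlonglongrightarrow> X s i" using tendsto_max[OF l] by simp
    qed (use Z(2)[OF j] in auto)
  qed
  have kcont: "continuous_on {p..q} (\<lambda>s. d\<phi> j (X s))" if j: "j < k" for j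
    unfolding continuous_on_sequentially o_def
  proof (intro allI ballI impI, elim conjE)
    fix a s assume as: "s \<in> {p..q}" "\<forall>n. a n \<in> {p..q}" "a \<longlonglongrightarrow> s"
    show "(\<lambda>n. d\<phi> j (X (a n))) \<longlonglongrightarrow> d\<phi> j (X s)"
      by (rule Euclidean_space_limit[OF dcont[OF j] XE XE]) (use as in \<open>auto intro!: continuous_on_tendsto_compose[OF Xcont]\<close>)
  qed
  have km: "(\<lambda>s. indicator {p..q} s * d\<phi> j (X s)) \<in> borel_measurable lebesgue" if j: "j < k" for j
  proof (rule measurable_completion)
    show "(\<lambda>s. indicator {p..q} s * d\<phi> j (X s)) \<in> borel_measurable lborel"
      using borel_measurable_continuous_on_indicator[OF _ kcont[OF j]] by simp
  qed
  have dense: "\<exists>g\<in>{p..q}. a < g \<and> g < b" if "p \<le> a" "a < b" "b \<le> q" for a b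
    using that by (intro bexI[of _ "(a + b) / 2"]) auto
  have eq: "\<phi> (X b) - \<phi> (X a) = (\<Sum>j<k. d\<phi> j (Z a b j) * (LINT s:{a..b}|lebesgue. g j s))" if "p \<le> a" "a < b" "b \<le> q" for a b
  proof -
    have "X b j - X a j = (LINT s:{a..b}|lebesgue. g j s)" if "j < k" for j
      using x[OF that, of a b] \<open>p \<le> a\<close> \<open>a < b\<close> \<open>b \<le> q\<close> that by (simp add: X_def)
    then show ?thesis unfolding Z(3) by (intro sum.cong) auto
  qed
  have limAE: "AE s in lebesgue. s \<in> {p<..<q} \<longrightarrow> (\<forall>a b. (\<forall>n. a n \<in> {p..q} \<and> b n \<in> {p..q} \<and> p \<le> a n \<and> a n \<le> s \<and> s < b n \<and> b n \<le> q) \<longrightarrow>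
      a \<longlonglongrightarrow> s \<longrightarrow> b \<longlonglongrightarrow> s \<longrightarrow> (\<forall>j\<in>{..<k}. (\<lambda>n. d\<phi> j (Z (a n) (b n) j)) \<longlonglongrightarrow> d\<phi> j (X s)))"
    using lim1 by (intro AE_I2) auto
  then have limAE': "AE s in lebesgue. s \<in> {p<..<q} \<longrightarrow> (\<forall>a b. (\<forall>n. a n \<in> {p..q} \<and> b n \<in> {p..q} \<and> p \<le> a n \<and> a n \<le> s \<and> s < b n \<and> b n \<le> q) \<longrightarrow>
      a \<longlonglongrightarrow> s \<longrightarrow> b \<longlonglongrightarrow> s \<longrightarrow> (\<forall>j\<in>{..<k}. (\<lambda>n. - d\<phi> j (Z (a n) (b n) j)) \<longlonglongrightarrow> - d\<phi> j (X s)))"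
    by eventually_elim (auto intro: tendsto_minus)
  have gk: "set_integrable lebesgue {p..q} (g j)" if "j \<in> {..<k}" for j using g that by simp
  have up: "\<phi> (X q) - \<phi> (X p) \<le> (\<Sum>j\<in>{..<k}. LINT s:{p..q}|lebesgue. d\<phi> j (X s) * g j s)"
    by (rule partition_inequality(1)[where A = "{..<k}" and G = "{p..q}" and p = p and q = q and g = g and F = "\<lambda>s. \<phi> (X s)"
      and c = "\<lambda>j a b. d\<phi> j (Z a b j)" and B = B and k = "\<lambda>j s. d\<phi> j (X s)", OF _ pq _ _ dense gk _ _ limAE])
      (use pq eq B Z(1) km in auto)
  have down: "(- \<phi> (X q)) - (- \<phi> (X p)) \<le> (\<Sum>j\<in>{..<k}. LINT s:{p..q}|lebesgue. (- d\<phi> j (X s)) * g j s)"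
    by (rule partition_inequality(1)[where A = "{..<k}" and G = "{p..q}" and p = p and q = q and g = g and F = "\<lambda>s. - \<phi> (X s)"
      and c = "\<lambda>j a b. - d\<phi> j (Z a b j)" and B = B and k = "\<lambda>j s. - d\<phi> j (X s)", OF _ pq _ _ dense gk _ _ limAE'])
      (use pq eq B Z(1) km in \<open>auto simp: sum_negf dest: eq\<close>)
  show "\<phi> (X q) - \<phi> (X p) = (\<Sum>j<k. LINT s:{p..q}|lebesgue. d\<phi> j (X s) * g j s)"
    using up down by (simp add: set_lebesgue_integral_def sum_negf)
  show "set_integrable lebesgue {p..q} (\<lambda>s. d\<phi> j (X s) * g j s)" if "j < k" for j
    by (rule partition_inequality(2)[where A = "{..<k}" and G = "{p..q}" and p = p and q = q and g = g and F = "\<lambda>s. \<phi> (X s)"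
      and c = "\<lambda>j a b. d\<phi> j (Z a b j)" and B = B and k = "\<lambda>j s. d\<phi> j (X s)", OF _ pq _ _ dense gk _ _ limAE])
      (use pq eq B Z(1) km that in auto)
qed

subsection \<open>The lemma of du Bois-Reymond on an interval\<close>

text \<open>A bump on the open interval from 0 to \<open>h\<close>, placed to the right of the
  origin. It is not normalised; its mass is \<open>kernel_primitive h h\<close>.\<close>

definition kernel :: "real \<Rightarrow> real \<Rightarrow> real" where "kernel h = bump 1 0 h"

text \<open>The lower limit -1 lies to the left of the support. Below it the interval of integration
  is empty, so the primitive vanishes on the whole nonpositive half-line.\<close>

definition kernel_primitive :: "real \<Rightarrow> real \<Rightarrow> real" where
  "kernel_primitive h x = integral {-1..x} (kernel h)"

lemma kernel_smooth: "smooth (kernel h)"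
  unfolding kernel_def by (rule bump_smooth) simp

lemma kernel_nonneg: "0 \<le> kernel h x"
  unfolding kernel_def by (rule bump_bounds) simp

lemma kernel_nonzero: "kernel h x \<noteq> 0 \<longleftrightarrow> 0 < x \<and> x < h"
  unfolding kernel_def bump_nonzero by (simp add: box_real)

lemma kernel_cont: "continuous_on S (kernel h)"
  using smooth_continuous[OF kernel_smooth] continuous_on_subset by blast

lemma kernel_primitive_left: "x \<le> 0 \<Longrightarrow> kernel_primitive h x = 0"
proof -
  assume "x \<le> 0"
  have "integral {-1..x} (kernel h) = integral {-1..x} (\<lambda>_. 0)"
  proof (rule Henstock_Kurzweil_Integration.integral_cong)
    fix y assume "y \<in> {-1..x}"
    then show "kernel h y = 0" using kernel_nonzero[of h y] \<open>x \<le> 0\<close> by auto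
  qed
  then show ?thesis by (simp add: kernel_primitive_def)
qed

lemma kernel_primitive_deriv: "(kernel_primitive h has_real_derivative kernel h x) (at x)"
proof (cases "x < 0")
  case True
  have "((\<lambda>x. 0) has_real_derivative 0) (at x)" by simp
  then have "(kernel_primitive h has_real_derivative 0) (at x)"
    by (rule has_field_derivative_transform_within_open[where S = "{..<0}"]) (use True kernel_primitive_left in auto)
  moreover have "kernel h x = 0" using kernel_nonzero[of h x] True by auto
  ultimately show ?thesis by simp
next
  case False
  have "((\<lambda>x. integral {-1..x} (kernel h)) has_real_derivative kernel h x) (at x within {-1..x + 1})"
    by (rule integral_has_real_derivative[OF kernel_cont]) (use False in auto)
  moreover have "at x within {-1..x + 1} = at x"
    by (rule at_within_interior) (use False in auto)
  ultimately show ?thesis by (simp add: kernel_primitive_def[abs_def])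
qed

lemma kernel_primitive_smooth: "smooth (kernel_primitive h)"
  unfolding smooth_def
proof
  fix n
  show "C_k n (kernel_primitive h)"
  proof (rule C_k_Suc_imp, rule C_k_Suc_I[where f' = "\<lambda>x v. kernel h x * v"])
    show "(kernel_primitive h has_derivative (\<lambda>v. kernel h x * v)) (at x)" for x
      using kernel_primitive_deriv[of h x] by (simp add: has_field_derivative_def)
    show "C_k n (\<lambda>x. kernel h x * v)" for v
      using kernel_smooth by (intro C_k_mult C_k_const) (simp add: smooth_def)
  qed
qed

lemma kernel_primitive_mono: "x \<le> y \<Longrightarrow> kernel_primitive h x \<le> kernel_primitive h y"
  by (rule DERIV_nonneg_imp_nondecreasing) (use kernel_primitive_deriv kernel_nonneg in blast)+

lemma kernel_primitive_right: "0 < h \<Longrightarrow> h \<le> x \<Longrightarrow> kernel_primitive h x = kernel_primitive h h"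
proof -
  assume h: "0 < h" "h \<le> x"
  show ?thesis
  proof (cases "h = x")
    case False
    then obtain z where "h < z" "kernel_primitive h x - kernel_primitive h h = (x - h) * kernel h z"
      using MVT2[of h x "kernel_primitive h" "kernel h"] kernel_primitive_deriv h by (metis less_le)
    then show ?thesis using kernel_nonzero[of h z] by auto
  qed simp
qed

lemma kernel_mass: "0 < h \<Longrightarrow> 0 < kernel_primitive h h"
proof -
  assume h: "0 < h"
  obtain z where z: "0 < z" "z < h" "kernel_primitive h h - kernel_primitive h 0 = (h - 0) * kernel h z"
    using MVT2[of 0 h "kernel_primitive h" "kernel h"] kernel_primitive_deriv h by blast
  have "kernel h z > 0" using kernel_nonzero[of h z] kernel_nonneg[of h z] z by linarith
  then show ?thesis using z h kernel_primitive_left[of 0 h] by simp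
qed

text \<open>One-sided mollification: only values of \<open>c\<close> to the right of
  \<open>s\<close> enter, and their deviation from \<open>c s\<close> bounds the error relative to
  the mass of the kernel.\<close>

lemma kernel_average:
  fixes c :: "real \<Rightarrow> real"
  assumes h: "0 < h" and c: "continuous_on {s..s + h} c" and e: "\<And>x. x \<in> {s..s + h} \<Longrightarrow> \<bar>c x - c s\<bar> \<le> e"
  shows "integrable lebesgue (\<lambda>x. kernel h (x - s) * c x)"
    and "\<bar>(\<integral>x. kernel h (x - s) * c x \<partial>lebesgue) - kernel_primitive h h * c s\<bar> \<le> kernel_primitive h h * e"
proof -
  have kc: "continuous_on {s..s + h} (\<lambda>x. kernel h (x - s))"
    by (rule continuous_on_compose2[OF kernel_cont]) (auto intro!: continuous_intros)
  have ind: "(\<lambda>x. indicator {s..s + h} x *\<^sub>R (kernel h (x - s) * f x)) = (\<lambda>x. kernel h (x - s) * f x)" for f :: "real \<Rightarrow> real"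
  proof
    fix x
    have "kernel h (x - s) = 0" if "x \<notin> {s..s + h}" using that kernel_nonzero[of h "x - s"] by auto
    then show "indicator {s..s + h} x *\<^sub>R (kernel h (x - s) * f x) = kernel h (x - s) * f x"
      by (cases "x \<in> {s..s + h}") simp_all
  qed
  have int: "integrable lebesgue (\<lambda>x. kernel h (x - s) * f x)" if "continuous_on {s..s + h} f" for f :: "real \<Rightarrow> real"
  proof -
    have "integrable lborel (\<lambda>x. indicator {s..s + h} x *\<^sub>R (kernel h (x - s) * f x))"
      by (intro borel_integrable_compact continuous_intros kc that) simp
    then have i: "integrable lborel (\<lambda>x. kernel h (x - s) * f x)" unfolding ind .
    show ?thesis
      using integrable_completion[of "\<lambda>x. kernel h (x - s) * f x" lborel, OF borel_measurable_integrable[OF i]] i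
      by (simp only: simp_thms)
  qed
  show "integrable lebesgue (\<lambda>x. kernel h (x - s) * c x)" by (rule int[OF c])
  have mass: "(\<integral>x. kernel h (x - s) * k \<partial>lebesgue) = kernel_primitive h h * k" for k
  proof -
    have "((\<lambda>x. kernel h (x - s)) has_integral (kernel_primitive h (s + h - s) - kernel_primitive h (s - s))) {s..s + h}"
    proof (rule fundamental_theorem_of_calculus)
      fix x
      have "((\<lambda>x. kernel_primitive h (x - s)) has_real_derivative kernel h (x - s) * (1 - 0)) (at x)"
        by (rule DERIV_chain2[OF kernel_primitive_deriv]) (intro derivative_intros)
      then show "((\<lambda>x. kernel_primitive h (x - s)) has_vector_derivative kernel h (x - s)) (at x within {s..s + h})"
        by (simp add: has_real_derivative_iff_has_vector_derivative has_vector_derivative_at_within)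
    qed (use h in simp)
    then have hi: "((\<lambda>x. kernel h (x - s)) has_integral kernel_primitive h h) {s..s + h}"
      using kernel_primitive_left[of 0 h] by simp
    have si: "set_integrable lebesgue {s..s + h} (\<lambda>x. kernel h (x - s))"
      using int[of "\<lambda>_. 1"] ind[of "\<lambda>_. 1"] by (simp add: set_integrable_def)
    have "(LINT x:{s..s + h}|lebesgue. kernel h (x - s)) = kernel_primitive h h"
      using set_lebesgue_integral_eq_integral(2)[OF si] hi by (simp add: integral_unique)
    then have "(\<integral>x. kernel h (x - s) \<partial>lebesgue) = kernel_primitive h h"
      using ind[of "\<lambda>_. 1"] by (simp add: set_lebesgue_integral_def)
    then show ?thesis by simp
  qed
  have "(\<integral>x. kernel h (x - s) * c x \<partial>lebesgue) - kernel_primitive h h * c s = (\<integral>x. kernel h (x - s) * c x - kernel h (x - s) * c s \<partial>lebesgue)"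
    using Bochner_Integration.integral_diff[OF int[OF c] int[OF continuous_on_const]] by (simp only: mass)
  moreover have "\<bar>\<integral>x. kernel h (x - s) * c x - kernel h (x - s) * c s \<partial>lebesgue\<bar> \<le> (\<integral>x. kernel h (x - s) * e \<partial>lebesgue)"
  proof -
    have i: "integrable lebesgue (\<lambda>x. kernel h (x - s) * c x - kernel h (x - s) * c s)"
      by (rule Bochner_Integration.integrable_diff[OF int[OF c] int[OF continuous_on_const]])
    have "\<bar>kernel h (x - s) * c x - kernel h (x - s) * c s\<bar> \<le> kernel h (x - s) * e" for x
    proof (cases "x \<in> {s..s + h}")
      case True
      have "\<bar>kernel h (x - s) * c x - kernel h (x - s) * c s\<bar> = kernel h (x - s) * \<bar>c x - c s\<bar>"
        using kernel_nonneg[of h "x - s"] by (simp add: abs_mult right_diff_distrib[symmetric])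
      also have "\<dots> \<le> kernel h (x - s) * e" using e[OF True] kernel_nonneg by (rule mult_left_mono)
      finally show ?thesis .
    next
      case False
      then have "kernel h (x - s) = 0" using kernel_nonzero[of h "x - s"] by auto
      then show ?thesis by simp
    qed
    then show ?thesis
      using Bochner_Integration.integral_norm_bound_integral[OF i int[OF continuous_on_const[of _ e]]] by simp
  qed
  ultimately show "\<bar>(\<integral>x. kernel h (x - s) * c x \<partial>lebesgue) - kernel_primitive h h * c s\<bar> \<le> kernel_primitive h h * e"
    using mass[of 1] by (simp add: mass)
qed

text \<open>The test function is a smooth plateau: it climbs from 0 to 1 just after \<open>s\<close>
  and descends just after \<open>t\<close>. Its derivative averages \<open>c\<close> next to
  \<open>t\<close> and next to \<open>s\<close>, and the plateau itself converges almost everywhere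
  to the indicator of the interval between them.\<close>

lemma du_Bois_Reymond:
  fixes c g :: "real \<Rightarrow> real"
  assumes J: "open J" "is_interval J" and st: "s \<in> J" "t \<in> J" "s < t"
    and c: "continuous_on J c" and g: "\<And>a b. {a..b} \<subseteq> J \<Longrightarrow> set_integrable lebesgue {a..b} g"
    and weak: "\<And>\<theta>. \<theta> \<in> (test_functions J :: (real \<Rightarrow> real) set) \<Longrightarrow>
      - (LINT x:J|lebesgue. deriv \<theta> x * c x) = (LINT x:J|lebesgue. \<theta> x * g x)"
  shows "c t - c s = (LINT x:{s..t}|lebesgue. g x)"
proof -
  \<comment> \<open>Both transition layers lie to the right of \<open>s\<close> and
    \<open>t\<close>, so some room beyond \<open>t\<close> inside the open set \<open>J\<close> is
    required.\<close>
  obtain r where r: "r > 0" "{s..t + r} \<subseteq> J"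
  proof -
    obtain e where e: "e > 0" "ball t e \<subseteq> J" using J(1) st(2) openE by blast
    then have "t + e / 2 \<in> J" by (auto simp: dist_real_def subset_iff)
    then have "{s..t + e / 2} \<subseteq> J" using mem_is_interval_1_I[OF J(2) st(1)] by auto
    then show thesis using that[of "e / 2"] e(1) by simp
  qed
  \<comment> \<open>The cap \<open>r\<close> keeps the second layer inside \<open>J\<close>; the cap
    \<open>t - s\<close> ends the first layer no later than the second begins.\<close>
  define h where "h n = min r (t - s) / real (Suc n)" for n
  have h: "0 < h n" "h n \<le> r" "h n \<le> t - s" for n
  proof -
    have m: "min r (t - s) > 0" using r st by simp
    then show "0 < h n" by (simp add: h_def)
    have "h n \<le> min r (t - s) / 1" unfolding h_def using m by (intro divide_left_mono) auto
    then have "h n \<le> min r (t - s)" by simp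
    then show "h n \<le> r" "h n \<le> t - s" by auto
  qed
  have hlim: "h \<longlonglongrightarrow> 0"
    unfolding h_def using tendsto_mult[OF tendsto_const[of "min r (t - s)"] LIMSEQ_Suc[OF lim_1_over_n]] by simp
  define m where "m n = kernel_primitive (h n) (h n)" for n
  have m: "0 < m n" for n unfolding m_def using kernel_mass h by blast
  define \<theta> where "\<theta> n x = (1 / m n) * (kernel_primitive (h n) (x - s) + (-1) * kernel_primitive (h n) (x - t))" for n x
  have \<theta>d: "(\<theta> n has_real_derivative (1 / m n) * (kernel (h n) (x - s) - kernel (h n) (x - t))) (at x)" for n x
  proof -
    have sh: "((\<lambda>x. kernel_primitive (h n) (x - a)) has_real_derivative kernel (h n) (x - a) * (1 - 0)) (at x)" for a
      by (rule DERIV_chain2[OF kernel_primitive_deriv]) (intro derivative_intros)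
    show ?thesis unfolding \<theta>_def[abs_def]
      by (rule DERIV_cong[OF DERIV_cmult[OF DERIV_add[OF sh DERIV_cmult[OF sh]]]]) simp
  qed
  have \<theta>smooth: "smooth (\<theta> n)" for n
    unfolding smooth_def \<theta>_def
  proof
    fix l
    have ck: "C_k l (kernel_primitive (h n))" using kernel_primitive_smooth by (simp add: smooth_def)
    have sh: "C_k l (\<lambda>x. kernel_primitive (h n) (x - a))" for a
      by (rule C_k_affine[OF ck, of _ "\<lambda>v. v"]) (auto intro!: derivative_eq_intros)
    show "C_k l (\<lambda>x. (1 / m n) * (kernel_primitive (h n) (x - s) + (-1) * kernel_primitive (h n) (x - t)))"
      by (rule C_k_mult[OF C_k_const C_k_add[OF sh C_k_mult[OF C_k_const sh]]])
  qed
  have \<theta>out: "\<theta> n x = 0" if "x \<notin> {s..t + h n}" for n x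
  proof -
    have "x < s \<or> x > t + h n" using that by (auto simp: not_le)
    then show ?thesis
    proof
      assume "x < s"
      then show ?thesis using kernel_primitive_left[of "x - s" "h n"] kernel_primitive_left[of "x - t" "h n"] st by (simp add: \<theta>_def)
    next
      assume "x > t + h n"
      then show ?thesis
        using kernel_primitive_right[OF h(1)[of n], of "x - s"] kernel_primitive_right[OF h(1)[of n], of "x - t"] st by (simp add: \<theta>_def)
    qed
  qed
  have \<theta>bd: "\<bar>\<theta> n x\<bar> \<le> 1" for n x
  proof -
    have b: "0 \<le> kernel_primitive (h n) y \<and> kernel_primitive (h n) y \<le> m n" for y
    proof
      show "0 \<le> kernel_primitive (h n) y"
        using kernel_primitive_left[of y "h n"] kernel_primitive_mono[of 0 y "h n"] kernel_primitive_left[of 0 "h n"] by (cases "y \<le> 0") auto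
      show "kernel_primitive (h n) y \<le> m n"
        unfolding m_def using kernel_primitive_right[OF h(1), of n y] kernel_primitive_mono[of y "h n" "h n"] by (cases "h n \<le> y") auto
    qed
    have "\<bar>kernel_primitive (h n) (x - s) + (-1) * kernel_primitive (h n) (x - t)\<bar> \<le> m n"
      using b[of "x - s"] b[of "x - t"] by (simp add: abs_le_iff)
    then show ?thesis using m[of n] by (simp add: \<theta>_def abs_mult)
  qed
  have \<theta>test: "\<theta> n \<in> test_functions J" for n
  proof -
    have sub: "closure {x. \<theta> n x \<noteq> 0} \<subseteq> {s..t + h n}"
    proof (rule closure_minimal)
      show "{x. \<theta> n x \<noteq> 0} \<subseteq> {s..t + h n}" using \<theta>out by blast
    qed simp
    have "compact (closure {x. \<theta> n x \<noteq> 0})"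
      using compact_Int_closed[OF compact_Icc closed_closure, of s "t + h n" "{x. \<theta> n x \<noteq> 0}"] by (simp only: Int_absorb1[OF sub])
    moreover have "{s..t + h n} \<subseteq> J" using r(2) h(2)[of n] by auto
    ultimately show ?thesis using sub \<theta>smooth by (auto simp: test_functions_def)
  qed
  have sI: "{s..s + h n} \<subseteq> J" "{t..t + h n} \<subseteq> J" for n using r(2) h(2,3)[of n] st by auto
  have avg: "(\<lambda>n. (1 / m n) * (\<integral>x. kernel (h n) (x - a) * c x \<partial>lebesgue)) \<longlonglongrightarrow> c a"
    if a: "\<And>n. {a..a + h n} \<subseteq> J" for a
  proof (rule LIMSEQ_I)
    fix e :: real assume e: "0 < e"
    have "a \<in> J" using a[of 0] h(1)[of 0] by auto
    then have "continuous (at a within J) c" using c by (simp add: continuous_on_eq_continuous_within)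
    then obtain d where d: "d > 0" "\<And>x. x \<in> J \<Longrightarrow> dist x a < d \<Longrightarrow> dist (c x) (c a) < e / 2"
      unfolding continuous_within_eps_delta using e by (meson half_gt_zero)
    obtain N where N: "\<And>n. n \<ge> N \<Longrightarrow> h n < d" using order_tendstoD(2)[OF hlim d(1)] unfolding eventually_sequentially by blast
    show "\<exists>N. \<forall>n\<ge>N. norm ((1 / m n) * (\<integral>x. kernel (h n) (x - a) * c x \<partial>lebesgue) - c a) < e"
    proof (intro exI[of _ N] allI impI)
      fix n assume n: "N \<le> n"
      have le: "\<bar>c x - c a\<bar> \<le> e / 2" if "x \<in> {a..a + h n}" for x
        using d(2)[of x] that a[of n] N[OF n] by (auto simp: dist_real_def subset_iff)
      have "\<bar>(\<integral>x. kernel (h n) (x - a) * c x \<partial>lebesgue) - m n * c a\<bar> \<le> m n * (e / 2)"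
        unfolding m_def by (rule kernel_average(2)[OF h(1) continuous_on_subset[OF c a] le])
      then have "\<bar>(1 / m n) * ((\<integral>x. kernel (h n) (x - a) * c x \<partial>lebesgue) - m n * c a)\<bar> \<le> (1 / m n) * (m n * (e / 2))"
        unfolding abs_mult using m[of n] by (intro mult_mono) auto
      then have "\<bar>(1 / m n) * (\<integral>x. kernel (h n) (x - a) * c x \<partial>lebesgue) - c a\<bar> \<le> e / 2"
        using m[of n] by (simp add: right_diff_distrib)
      then show "norm ((1 / m n) * (\<integral>x. kernel (h n) (x - a) * c x \<partial>lebesgue) - c a) < e" using e by simp
    qed
  qed
  have lhs: "- (LINT x:J|lebesgue. deriv (\<theta> n) x * c x) =
    (1 / m n) * (\<integral>x. kernel (h n) (x - t) * c x \<partial>lebesgue) - (1 / m n) * (\<integral>x. kernel (h n) (x - s) * c x \<partial>lebesgue)" for n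
  proof -
    have bdd: "\<exists>e. \<forall>x\<in>{a..a + h n}. \<bar>c x - c a\<bar> \<le> e" if "{a..a + h n} \<subseteq> J" for a
    proof -
      have "bounded ((\<lambda>x. c x - c a) ` {a..a + h n})"
        by (intro compact_imp_bounded compact_continuous_image continuous_intros continuous_on_subset[OF c that]) simp
      then show ?thesis unfolding bounded_iff by auto
    qed
    obtain e1 where e1: "\<And>x. x \<in> {s..s + h n} \<Longrightarrow> \<bar>c x - c s\<bar> \<le> e1" using bdd[OF sI(1)] by blast
    obtain e2 where e2: "\<And>x. x \<in> {t..t + h n} \<Longrightarrow> \<bar>c x - c t\<bar> \<le> e2" using bdd[OF sI(2)] by blast
    have i1: "integrable lebesgue (\<lambda>x. kernel (h n) (x - s) * c x)"
      by (rule kernel_average(1)[OF h(1) continuous_on_subset[OF c sI(1)] e1])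
    have i2: "integrable lebesgue (\<lambda>x. kernel (h n) (x - t) * c x)"
      by (rule kernel_average(1)[OF h(1) continuous_on_subset[OF c sI(2)] e2])
    have "(LINT x:J|lebesgue. deriv (\<theta> n) x * c x) = (\<integral>x. (1 / m n) * (kernel (h n) (x - s) * c x) - (1 / m n) * (kernel (h n) (x - t) * c x) \<partial>lebesgue)"
      unfolding set_lebesgue_integral_def
    proof (rule Bochner_Integration.integral_cong[OF refl])
      fix x
      have z: "kernel (h n) (x - s) = 0 \<and> kernel (h n) (x - t) = 0" if "x \<notin> J"
      proof -
        have "x \<notin> {s..s + h n}" "x \<notin> {t..t + h n}" using that sI[of n] by blast+
        then show ?thesis using kernel_nonzero[of "h n" "x - s"] kernel_nonzero[of "h n" "x - t"] by auto
      qed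
      show "indicator J x *\<^sub>R (deriv (\<theta> n) x * c x) = (1 / m n) * (kernel (h n) (x - s) * c x) - (1 / m n) * (kernel (h n) (x - t) * c x)"
        unfolding DERIV_imp_deriv[OF \<theta>d] using z by (cases "x \<in> J") (simp_all add: algebra_simps)
    qed
    also have "\<dots> = (1 / m n) * (\<integral>x. kernel (h n) (x - s) * c x \<partial>lebesgue) - (1 / m n) * (\<integral>x. kernel (h n) (x - t) * c x \<partial>lebesgue)"
      using i1 i2 by simp
    finally show ?thesis by simp
  qed
  have L: "(\<lambda>n. - (LINT x:J|lebesgue. deriv (\<theta> n) x * c x)) \<longlonglongrightarrow> c t - c s"
    unfolding lhs by (intro tendsto_diff avg sI)
  have g0: "set_integrable lebesgue {s..t + r} g" by (rule g[OF r(2)])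
  have R: "(\<lambda>n. LINT x:J|lebesgue. \<theta> n x * g x) \<longlonglongrightarrow> (LINT x:{s..t}|lebesgue. g x)"
    unfolding set_lebesgue_integral_def
  proof (rule integral_dominated_convergence[where w = "\<lambda>x. norm (indicator {s..t + r} x *\<^sub>R g x)"])
    have eq: "indicator J x *\<^sub>R (\<theta> n x * g x) = \<theta> n x * (indicator {s..t + r} x *\<^sub>R g x)" for n x
      using \<theta>out[of x n] h(2)[of n] r(2) by (cases "x \<in> {s..t + r}") (auto simp: indicator_def)
    have gm: "(\<lambda>x. indicator {s..t + r} x *\<^sub>R g x) \<in> borel_measurable lebesgue"
      using g0 unfolding set_integrable_def by (rule borel_measurable_integrable)
    have "set_integrable lebesgue {s..t} g" by (rule g) (use r in auto)
    then show "(\<lambda>x. indicator {s..t} x *\<^sub>R g x) \<in> borel_measurable lebesgue"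
      unfolding set_integrable_def by (rule borel_measurable_integrable)
    show "(\<lambda>x. indicator J x *\<^sub>R (\<theta> n x * g x)) \<in> borel_measurable lebesgue" for n
      unfolding eq by (intro borel_measurable_times gm continuous_lebesgue_measurable smooth_continuous \<theta>smooth)
    show "integrable lebesgue (\<lambda>x. norm (indicator {s..t + r} x *\<^sub>R g x))"
      using g0 unfolding set_integrable_def by (rule integrable_norm)
    show "AE x in lebesgue. norm (indicator J x *\<^sub>R (\<theta> n x * g x)) \<le> norm (indicator {s..t + r} x *\<^sub>R g x)" for n
      unfolding eq using \<theta>bd[of n] by (intro AE_I2) (simp add: abs_mult mult_left_le_one_le)
    have "AE x in lebesgue. x \<noteq> s" by (rule AE_completion[OF AE_lborel_singleton])
    then show "AE x in lebesgue. (\<lambda>n. indicator J x *\<^sub>R (\<theta> n x * g x)) \<longlonglongrightarrow> indicator {s..t} x *\<^sub>R g x"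
    proof eventually_elim
      case (elim x)
      consider "x < s" | "s < x" "x \<le> t" | "t < x" using elim by linarith
      then show ?case
      proof cases
        case 1
        then have "\<theta> n x = 0" for n using \<theta>out[of x n] by simp
        then show ?thesis using 1 by simp
      next
        case 2
        have "\<forall>\<^sub>F n in sequentially. h n < x - s" using order_tendstoD(2)[OF hlim, of "x - s"] 2 by simp
        then have "\<forall>\<^sub>F n in sequentially. indicator J x *\<^sub>R (\<theta> n x * g x) = indicator {s..t} x *\<^sub>R g x"
        proof eventually_elim
          case (elim n)
          have "kernel_primitive (h n) (x - s) = m n" unfolding m_def by (rule kernel_primitive_right[OF h(1)]) (use elim in simp)
          then have "\<theta> n x = 1" using kernel_primitive_left[of "x - t" "h n"] 2 m[of n] by (simp add: \<theta>_def)
          moreover have "x \<in> J" using 2 r by auto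
          ultimately show ?case using 2 by simp
        qed
        then show ?thesis by (rule tendsto_eventually)
      next
        case 3
        have "\<forall>\<^sub>F n in sequentially. h n < x - t" using order_tendstoD(2)[OF hlim, of "x - t"] 3 by simp
        then have "\<forall>\<^sub>F n in sequentially. indicator J x *\<^sub>R (\<theta> n x * g x) = indicator {s..t} x *\<^sub>R g x"
          by eventually_elim (use 3 \<theta>out[of x] in simp)
        then show ?thesis by (rule tendsto_eventually)
      qed
    qed
  qed
  have "(\<lambda>n. LINT x:J|lebesgue. \<theta> n x * g x) \<longlonglongrightarrow> c t - c s"
    using L by (simp only: weak[OF \<theta>test])
  from LIMSEQ_unique[OF this R] show ?thesis .
qed

section \<open>Estimates along weak solutions\<close>

lemma space_borel_of: "space (borel_of X) = topspace X"
  unfolding borel_of_def using openin_subset[of X] by (subst space_measure_of) auto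

lemma AE_lebesgue_on: "S \<in> sets lebesgue \<Longrightarrow> (AE x in lebesgue_on S. P x) \<longleftrightarrow> (AE x in lebesgue. x \<in> S \<longrightarrow> P x)"
  for S :: "real set" by (simp add: AE_restrict_space_iff)

lemma AE_lebesgue_on_mono: "AE x in lebesgue_on S. P x \<Longrightarrow> T \<subseteq> S \<Longrightarrow> S \<in> sets lebesgue \<Longrightarrow> T \<in> sets lebesgue \<Longrightarrow> AE x in lebesgue_on T. P x"
  for S T :: "real set" by (auto simp: AE_lebesgue_on elim!: eventually_mono)

lemma Icc_sets: "{a..b} \<in> sets lebesgue" for a b :: real
  by simp

lemma set_lebesgue_integral_cong_AE_lebesgue:
  fixes g h :: "real \<Rightarrow> real"
  assumes ae: "AE s in lebesgue_on S. g s = h s" and S: "S \<in> sets lebesgue" and h: "(\<lambda>s. indicator S s *\<^sub>R h s) \<in> borel_measurable lebesgue"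
  shows "(LINT s:S|lebesgue. g s) = (LINT s:S|lebesgue. h s)"
proof -
  have "AE s in lebesgue. indicator S s *\<^sub>R h s = indicator S s *\<^sub>R g s"
    using ae unfolding AE_lebesgue_on[OF S] by eventually_elim (auto simp: indicator_def)
  moreover from borel_measurable_AE[OF h this] have "(\<lambda>s. indicator S s *\<^sub>R g s) \<in> borel_measurable lebesgue" .
  ultimately show ?thesis unfolding set_lebesgue_integral_def using h by (intro integral_cong_AE) auto
qed

lemma set_integral_lebesgue_on:
  fixes g :: "real \<Rightarrow> real"
  shows "(LINT s:{a..b}|lebesgue. g s) = integral\<^sup>L (lebesgue_on {a..b}) g"
    and "set_integrable lebesgue {a..b} g \<longleftrightarrow> integrable (lebesgue_on {a..b}) g"
  by (simp_all add: set_lebesgue_integral_def set_integrable_def integral_restrict_space integrable_restrict_space)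

lemma borel_measurable_ident_lebesgue: "(\<lambda>x :: real. x) \<in> borel_measurable lebesgue"
  by (rule measurable_completion) simp

lemma nn_integral_Icc_mono:
  "{a..b} \<subseteq> {c..d} \<Longrightarrow> (\<integral>\<^sup>+s. g s \<partial>lebesgue_on {a..b}) \<le> (\<integral>\<^sup>+s. g s \<partial>lebesgue_on {c..d})" for a b c d :: real
  by (simp add: nn_integral_restrict_space) (intro nn_integral_mono mult_left_mono, auto simp: indicator_def)

text \<open>Monotone convergence over compact intervals exhausting the open one. A bound that is
  uniform away from the end points reaches the closed interval; this is how estimates from the
  interior of \<open>I\<close> arrive at \<open>t\<^sub>0\<close>.\<close>

lemma nn_integral_Icc_exhaust:
  fixes g :: "real \<Rightarrow> ennreal"
  assumes g: "g \<in> borel_measurable (lebesgue_on {a..b})"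
    and le: "\<And>e. 0 < e \<Longrightarrow> a + e \<le> b - e \<Longrightarrow> (\<integral>\<^sup>+s. g s \<partial>lebesgue_on {a + e..b - e}) \<le> K"
  shows "(\<integral>\<^sup>+s. g s \<partial>lebesgue_on {a..b}) \<le> K"
proof -
  define G where "G s = g s * indicator {a..b} s" for s
  have G: "G \<in> borel_measurable lebesgue"
    using g borel_measurable_restrict_space_iff_ennreal[of "{a..b}" lebesgue g] by (simp add: G_def[abs_def])
  let ?A = "\<lambda>n. {a + 1 / real (Suc n)..b - 1 / real (Suc n)}"
  have sub: "?A n \<subseteq> {a..b}" for n by (auto intro: order_trans[rotated])
  have val: "(\<integral>\<^sup>+s. G s * indicator A s \<partial>lebesgue) = (\<integral>\<^sup>+s. g s \<partial>lebesgue_on A)" if "A \<subseteq> {a..b}" "A \<in> sets lebesgue" for A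
    using that by (subst nn_integral_restrict_space) (auto intro!: nn_integral_cong simp: G_def indicator_def)
  have "(\<integral>\<^sup>+s. g s \<partial>lebesgue_on {a..b}) = (\<integral>\<^sup>+s. G s * indicator {a<..<b} s \<partial>lebesgue)"
  proof -
    have "AE s in lebesgue. s \<noteq> a" "AE s in lebesgue. s \<noteq> b" by (rule AE_completion[OF AE_lborel_singleton])+
    then have "AE s in lebesgue. G s * indicator {a..b} s = G s * indicator {a<..<b} s"
      by eventually_elim (auto simp: indicator_def)
    from nn_integral_cong_AE[OF this] val[of "{a..b}"] show ?thesis by simp
  qed
  also have "\<dots> = emeasure (density lebesgue G) {a<..<b}" by (rule emeasure_density[OF G, symmetric]) simp
  also have "{a<..<b} = (\<Union>n. ?A n)"
  proof
    show "{a<..<b} \<subseteq> (\<Union>n. ?A n)"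
    proof
      fix x assume x: "x \<in> {a<..<b}"
      then have "0 < min (x - a) (b - x)" by simp
      then obtain n where n: "inverse (real (Suc n)) < min (x - a) (b - x)" using reals_Archimedean by blast
      then have "x \<in> ?A n" by (simp add: inverse_eq_divide del: of_nat_Suc)
      then show "x \<in> (\<Union>n. ?A n)" by blast
    qed
    show "(\<Union>n. ?A n) \<subseteq> {a<..<b}"
    proof
      fix x assume "x \<in> (\<Union>n. ?A n)"
      then obtain n where n: "x \<in> ?A n" by blast
      have "0 < 1 / real (Suc n)" by simp
      moreover have "a + 1 / real (Suc n) \<le> x" "x \<le> b - 1 / real (Suc n)" using n by (auto simp del: of_nat_Suc)
      ultimately have "a < x" "x < b" by linarith+
      then show "x \<in> {a<..<b}" by simp
    qed
  qed
  also have "emeasure (density lebesgue G) (\<Union>n. ?A n) = (SUP n. emeasure (density lebesgue G) (?A n))"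
  proof (rule SUP_emeasure_incseq[symmetric])
    show "incseq ?A"
    proof (rule incseq_SucI)
      fix n
      have "1 / real (Suc (Suc n)) \<le> 1 / real (Suc n)" by (intro divide_left_mono) auto
      then show "?A n \<subseteq> ?A (Suc n)" by (auto simp del: of_nat_Suc)
    qed
  qed auto
  also have "\<dots> \<le> K"
  proof (rule SUP_least)
    fix n
    have "emeasure (density lebesgue G) (?A n) = (\<integral>\<^sup>+s. G s * indicator (?A n) s \<partial>lebesgue)" by (rule emeasure_density[OF G]) simp
    also have "\<dots> = (\<integral>\<^sup>+s. g s \<partial>lebesgue_on (?A n))" by (rule val[OF sub]) simp
    also have "\<dots> \<le> K"
    proof (cases "a + 1 / real (Suc n) \<le> b - 1 / real (Suc n)")
      case True
      show ?thesis by (rule le[OF _ True]) simp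
    next
      case False
      then have "?A n = {}" by simp
      then show ?thesis by (simp add: nn_integral_restrict_space del: of_nat_Suc)
    qed
    finally show "emeasure (density lebesgue G) (?A n) \<le> K" .
  qed
  finally show ?thesis .
qed

lemma set_integral_singleton: "(LINT s:{a..a}|lebesgue. g s) = 0" for a :: real and g :: "real \<Rightarrow> real"
proof -
  have "(LINT s:{a..a}|lebesgue. g s) = (LINT s:{a..a}|lebesgue. 0)"
  proof (rule set_lebesgue_integral_cong_AE_lebesgue)
    have "AE x in lebesgue. x \<noteq> a" by (rule AE_completion[OF AE_lborel_singleton])
    then show "AE s in lebesgue_on {a..a}. g s = 0" unfolding AE_lebesgue_on[OF Icc_sets] by eventually_elim simp
  qed simp_all
  then show ?thesis by (simp add: set_lebesgue_integral_def)
qed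

lemma sigma_finite_lebesgue_on:
  fixes S :: "real set"
  assumes "S \<in> sets lebesgue"
  shows "sigma_finite_measure (lebesgue_on S)"
proof (rule sigma_finite_measure_restrict_space[OF _ assms])
  have "{- real n..real n} \<in> sets lebesgue" for n by simp
  moreover have "(\<Union>n. {- real n..real n}) = UNIV"
  proof -
    have "\<exists>n. x \<in> {- real n..real n}" for x :: real
    proof -
      obtain n where "\<bar>x\<bar> \<le> real n" using real_arch_simple by blast
      then show ?thesis by (intro exI[of _ n]) (simp add: abs_le_iff)
    qed
    then show ?thesis by blast
  qed
  ultimately show "sigma_finite_measure (lebesgue :: real measure)"
    by (intro sigma_finite_measure.intro exI[of _ "range (\<lambda>n. {- real n..real n})"])
      (auto simp: emeasure_lborel_Icc_eq)
qed

text \<open>\<open>F\<close> replaces the forcing: a version that is measurable into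
  \<open>H\<close> on \<open>I\<close> and bounded at every time by \<open>Cf\<close>. Statements
  about \<open>f\<close> are moved to \<open>F\<close> at the cost of a null set of times.\<close>

locale ns_setting = path_setting D I t\<^sub>0 \<rho> for D I t\<^sub>0 \<rho> +
  fixes \<nu> :: real and f F :: "real \<Rightarrow> l2_field" and Cf :: real
  assumes nu: "0 < \<nu>" and F_meas: "F \<in> lebesgue_on I \<rightarrow>\<^sub>M H_borel D"
    and f_F: "AE t in lebesgue_on I. f t = F t" and F_bd: "\<And>t. norm (F t) \<le> Cf"
    and carried: "AE u in \<rho>. u \<in> U_sharp D \<nu> f I"
    and mean_bounded: "in_L_inf_loc I (\<lambda>t. \<integral>\<^sup>+u\<in>U_sharp D \<nu> f I. ennreal ((norm (u t))\<^sup>2) \<partial>\<rho>)"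
begin

abbreviation US :: "(real \<Rightarrow> l2_field) set" where "US \<equiv> U_sharp D \<nu> f I"

lemma Cf_nonneg: "0 \<le> Cf"
  using F_bd[of 0] norm_ge_zero order_trans by blast

lemma interior_I: "interior I \<subseteq> I" "open (interior I)" "is_interval (interior I)" "interior I \<in> sets lebesgue"
  using interval interior_subset[of I] convex_interior[of I] by (auto simp: is_interval_convex_1)

lemma interior_between: "a \<in> I \<Longrightarrow> b \<in> I \<Longrightarrow> a < x \<Longrightarrow> x < b \<Longrightarrow> x \<in> interior I"
  using interior_maximal[of "{a<..<b}" I] interval_mem[of a b] by force

lemma AE_interior: "AE t in lebesgue_on I. t \<in> interior I"
proof -
  have "negligible (frontier I)" by (rule negligible_convex_frontier) (use interval in \<open>simp add: is_interval_convex_1\<close>)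
  then have "AE t in lebesgue. t \<notin> frontier I" by (intro AE_not_in) (simp add: negligible_iff_null_sets)
  then show ?thesis unfolding AE_lebesgue_on[OF I_lebesgue]
    by eventually_elim (use closure_subset[of I] in \<open>auto simp: frontier_def\<close>)
qed

lemma AE_interior_iff: "(AE t in lebesgue_on I. P t) \<longleftrightarrow> (AE t in lebesgue_on (interior I). P t)"
proof
  assume "AE t in lebesgue_on I. P t"
  then show "AE t in lebesgue_on (interior I). P t" by (rule AE_lebesgue_on_mono) (use interior_I in auto)
next
  assume "AE t in lebesgue_on (interior I). P t"
  with AE_interior show "AE t in lebesgue_on I. P t"
    unfolding AE_lebesgue_on[OF I_lebesgue] AE_lebesgue_on[OF interior_I(4)] by eventually_elim auto
qed

text \<open>Zero off \<open>V\<close>, where \<open>enstrophy\<close> is infinite. Bochner integrals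
  along paths use this version, finiteness statements use the other; on a path of \<open>US\<close>
  the two agree at almost every time.\<close>

definition h1sq :: "l2_field \<Rightarrow> real" where "h1sq x = indicator (V_space D) x * (H1_norm D x)\<^sup>2"

lemma h1sq_measurable [measurable]: "h1sq \<in> borel_measurable (H_borel D)"
  unfolding h1sq_def[abs_def]
  by (rule V_supported_measurable) (intro borel_measurable_power H1_norm_measurable)

lemma h1sq_nonneg: "0 \<le> h1sq x" by (simp add: h1sq_def)

lemma enstrophy_h1sq: "x \<in> V_space D \<Longrightarrow> enstrophy D x = ennreal (h1sq x)"
  by (simp add: enstrophy_def h1sq_def)

lemma h1sq_le_enstrophy: "ennreal (h1sq x) \<le> enstrophy D x"
  by (cases "x \<in> V_space D") (simp_all add: enstrophy_def h1sq_def)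

definition fin_energy :: "(real \<Rightarrow> l2_field) \<Rightarrow> real \<Rightarrow> real \<Rightarrow> bool" where
  "fin_energy u a b \<longleftrightarrow> (\<integral>\<^sup>+s. ennreal ((norm (u s))\<^sup>2) + enstrophy D (u s) \<partial>lebesgue_on {a..b}) < \<infinity>"

lemma US_D: "u \<in> US \<Longrightarrow> u \<in> path_space D I" "u \<in> US \<Longrightarrow> weak_solution D \<nu> f (interior I) u"
  by (auto simp: U_sharp_def)

lemma path_measurable:
  assumes "u \<in> path_space D I" "S \<subseteq> I"
  shows "u \<in> lebesgue_on S \<rightarrow>\<^sub>M H_borel D" "(\<lambda>s. norm (u s)) \<in> borel_measurable (lebesgue_on S)"
    "(\<lambda>s. h1sq (u s)) \<in> borel_measurable (lebesgue_on S)" "(\<lambda>s. enstrophy D (u s)) \<in> borel_measurable (lebesgue_on S)"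
proof -
  show u: "u \<in> lebesgue_on S \<rightarrow>\<^sub>M H_borel D" by (rule path_time_measurable[OF assms(2,1)])
  show "(\<lambda>s. norm (u s)) \<in> borel_measurable (lebesgue_on S)" by (rule measurable_compose[OF u H_borel_norm])
  show "(\<lambda>s. h1sq (u s)) \<in> borel_measurable (lebesgue_on S)" by (rule measurable_compose[OF u h1sq_measurable])
  show "(\<lambda>s. enstrophy D (u s)) \<in> borel_measurable (lebesgue_on S)" by (rule measurable_compose[OF u enstrophy_H_borel])
qed

lemma F_measurable: "S \<subseteq> I \<Longrightarrow> F \<in> lebesgue_on S \<rightarrow>\<^sub>M H_borel D"
  using F_meas by (rule measurable_restrict_mono)

text \<open>Membership in the Lebesgue spaces is known only through versions taking all their values
  in the target space; equality with such a version almost everywhere places the path in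
  \<open>V\<close> at almost every time.\<close>

lemma US_AE_V_interior:
  assumes u: "u \<in> US"
  shows "AE s in lebesgue_on (interior I). u s \<in> V_space D"
    and "{a..b} \<subseteq> interior I \<Longrightarrow> fin_energy u a b"
proof -
  let ?J = "interior I"
  have w: "u \<in> L_inf_loc ?J (H_borel D) norm" "u \<in> L_p_loc 2 ?J (V_borel D) (H1_norm D)"
    using US_D(2)[OF u] by (auto simp: weak_solution_def)
  obtain v where v: "v \<in> lebesgue_on ?J \<rightarrow>\<^sub>M V_borel D" "AE t in lebesgue_on ?J. u t = v t"
    "\<And>a b. {a..b} \<subseteq> ?J \<Longrightarrow> (\<integral>\<^sup>+t\<in>{a..b}. ennreal (H1_norm D (v t) powr 2) \<partial>lebesgue) < \<infinity>"
    using w(2) unfolding L_p_loc_def by blast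
  have vV: "v t \<in> V_space D" if "t \<in> ?J" for t
  proof -
    have "v t \<in> space (V_borel D)" using measurable_space[OF v(1), of t] that interior_I(4) by (simp add: space_restrict_space)
    then show ?thesis unfolding V_borel_def space_borel_of metric_topology_def topology_generated_by_topspace by blast
  qed
  show V: "AE s in lebesgue_on ?J. u s \<in> V_space D"
    using v(2) unfolding AE_lebesgue_on[OF interior_I(4)] by eventually_elim (use vV in auto)
  assume ab: "{a..b} \<subseteq> ?J"
  have abI: "{a..b} \<subseteq> I" using ab interior_I(1) by blast
  obtain w' where w': "AE t in lebesgue_on ?J. u t = w' t" "\<And>a b. {a..b} \<subseteq> ?J \<Longrightarrow> \<exists>C. AE t in lebesgue_on {a..b}. norm (w' t) \<le> C"
    using w(1) unfolding L_inf_loc_def by blast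
  obtain C where C: "AE t in lebesgue_on {a..b}. norm (w' t) \<le> C" using w'(2)[OF ab] by blast
  note [measurable] = path_measurable[OF US_D(1)[OF u] abI]
  have "(\<integral>\<^sup>+s. ennreal ((norm (u s))\<^sup>2) \<partial>lebesgue_on {a..b}) \<le> (\<integral>\<^sup>+s. ennreal (C\<^sup>2) \<partial>lebesgue_on {a..b})"
  proof (rule nn_integral_mono_AE)
    have "AE t in lebesgue_on {a..b}. u t = w' t" by (rule AE_lebesgue_on_mono[OF w'(1) ab interior_I(4)]) simp
    with C show "AE s in lebesgue_on {a..b}. ennreal ((norm (u s))\<^sup>2) \<le> ennreal (C\<^sup>2)"
      by eventually_elim (auto intro!: ennreal_leI power_mono)
  qed
  also have "\<dots> < \<infinity>"
    by (simp add: emeasure_restrict_space ennreal_mult_less_top emeasure_lborel_Icc_eq less_top)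
  finally have 1: "(\<integral>\<^sup>+s. ennreal ((norm (u s))\<^sup>2) \<partial>lebesgue_on {a..b}) < \<infinity>" .
  have "(\<integral>\<^sup>+s. enstrophy D (u s) \<partial>lebesgue_on {a..b}) = (\<integral>\<^sup>+s. ennreal (H1_norm D (v s) powr 2) \<partial>lebesgue_on {a..b})"
  proof (rule nn_integral_cong_AE)
    have "AE t in lebesgue_on {a..b}. u t = v t" by (rule AE_lebesgue_on_mono[OF v(2) ab interior_I(4)]) simp
    then show "AE s in lebesgue_on {a..b}. enstrophy D (u s) = ennreal (H1_norm D (v s) powr 2)"
      unfolding AE_lebesgue_on[OF Icc_sets]
      by eventually_elim (use vV ab H1_norm_nonneg in \<open>auto simp: enstrophy_def powr_numeral\<close>)
  qed
  also have "\<dots> = (\<integral>\<^sup>+t\<in>{a..b}. ennreal (H1_norm D (v t) powr 2) \<partial>lebesgue)"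
    by (rule nn_integral_restrict_space) simp
  also have "\<dots> < \<infinity>" by (rule v(3)[OF ab])
  finally have 2: "(\<integral>\<^sup>+s. enstrophy D (u s) \<partial>lebesgue_on {a..b}) < \<infinity>" .
  show "fin_energy u a b"
    unfolding fin_energy_def using 1 2 by (subst nn_integral_add) simp_all
qed

lemma US_AE_V: "u \<in> US \<Longrightarrow> AE s in lebesgue_on I. u s \<in> V_space D"
  unfolding AE_interior_iff by (rule US_AE_V_interior(1))

text \<open>Turns \<open>fin_energy\<close> into Bochner integrability for every integrand of
  quadratic growth; the constant 1 in the bound is harmless on a bounded interval.\<close>

lemma set_integrable_dominated:
  assumes u: "u \<in> path_space D I" and ab: "{a..b} \<subseteq> I" and fin: "fin_energy u a b"
    and g: "g \<in> borel_measurable (lebesgue_on {a..b})" and c: "0 \<le> c"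
    and le: "AE s in lebesgue_on {a..b}. \<bar>g s\<bar> \<le> c * (1 + (norm (u s))\<^sup>2 + h1sq (u s))"
  shows "set_integrable lebesgue {a..b} g"
proof -
  note [measurable] = path_measurable[OF u ab]
  have "(\<integral>\<^sup>+s. ennreal (norm (g s)) \<partial>lebesgue_on {a..b}) \<le>
    (\<integral>\<^sup>+s. ennreal c * (1 + (ennreal ((norm (u s))\<^sup>2) + enstrophy D (u s))) \<partial>lebesgue_on {a..b})"
  proof (rule nn_integral_mono_AE, use le in eventually_elim)
    case (elim s)
    have "ennreal (norm (g s)) \<le> ennreal (c * (1 + (norm (u s))\<^sup>2 + h1sq (u s)))" using elim by (intro ennreal_leI) simp
    also have "\<dots> = ennreal c * (1 + (ennreal ((norm (u s))\<^sup>2) + ennreal (h1sq (u s))))"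
      using c h1sq_nonneg[of "u s"] by (simp add: ennreal_mult add.assoc)
    also have "\<dots> \<le> ennreal c * (1 + (ennreal ((norm (u s))\<^sup>2) + enstrophy D (u s)))"
      by (intro mult_left_mono add_left_mono h1sq_le_enstrophy) simp
    finally show ?case .
  qed
  also have "\<dots> = ennreal c * (emeasure (lebesgue_on {a..b}) {a..b} + (\<integral>\<^sup>+s. ennreal ((norm (u s))\<^sup>2) + enstrophy D (u s) \<partial>lebesgue_on {a..b}))"
    by (simp add: nn_integral_cmult nn_integral_add space_restrict_space)
  also have "\<dots> < \<infinity>"
    using fin unfolding fin_energy_def
    by (simp add: ennreal_mult_less_top emeasure_restrict_space emeasure_lborel_Icc_eq less_top)
  finally have "integrable (lebesgue_on {a..b}) g" by (intro integrableI_bounded g)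
  then show ?thesis by (simp add: integrable_restrict_space set_integrable_def)
qed

text \<open>Twice the power balance, so that its integral bounds the increment of
  \<open>|u|^2\<close> itself, the argument of \<psi>.\<close>

definition energy_rate :: "(real \<Rightarrow> l2_field) \<Rightarrow> real \<Rightarrow> real" where
  "energy_rate u s = 2 * (F s \<bullet> u s) - 2 * \<nu> * h1sq (u s)"

lemma F_inner_bound: "\<bar>F s \<bullet> x\<bar> \<le> Cf * (1 + (norm x)\<^sup>2)"
proof -
  have "norm x \<le> 1 + (norm x)\<^sup>2" using sum_squares_bound[of "norm x" 1] zero_le_power2[of "norm x"] by (simp, linarith)
  then have "norm (F s) * norm x \<le> Cf * (1 + (norm x)\<^sup>2)" using F_bd Cf_nonneg by (intro mult_mono) auto
  with Cauchy_Schwarz_ineq2[of "F s" x] show ?thesis by linarith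
qed

lemma energy_parts_integrable:
  assumes u: "u \<in> path_space D I" and ab: "{a..b} \<subseteq> I" and fin: "fin_energy u a b"
  shows "set_integrable lebesgue {a..b} (\<lambda>s. F s \<bullet> u s)" "set_integrable lebesgue {a..b} (\<lambda>s. h1sq (u s))"
    "set_integrable lebesgue {a..b} (energy_rate u)"
proof -
  note m = path_measurable[OF u ab]
  show 1: "set_integrable lebesgue {a..b} (\<lambda>s. F s \<bullet> u s)"
  proof (rule set_integrable_dominated[OF u ab fin H_inner_measurable[OF F_measurable[OF ab] m(1)] Cf_nonneg])
    show "AE s in lebesgue_on {a..b}. \<bar>F s \<bullet> u s\<bar> \<le> Cf * (1 + (norm (u s))\<^sup>2 + h1sq (u s))"
    proof (intro AE_I2)
      fix s
      have "Cf * (1 + (norm (u s))\<^sup>2) \<le> Cf * (1 + (norm (u s))\<^sup>2 + h1sq (u s))"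
        by (rule mult_left_mono[OF _ Cf_nonneg]) (simp add: h1sq_nonneg)
      with F_inner_bound[of s "u s"] show "\<bar>F s \<bullet> u s\<bar> \<le> Cf * (1 + (norm (u s))\<^sup>2 + h1sq (u s))" by linarith
    qed
  qed
  show 2: "set_integrable lebesgue {a..b} (\<lambda>s. h1sq (u s))"
    by (rule set_integrable_dominated[OF u ab fin m(3), of 1]) (auto simp: h1sq_nonneg)
  show "set_integrable lebesgue {a..b} (energy_rate u)"
    unfolding energy_rate_def[abs_def] using 1 2 by (intro set_integral_diff set_integrable_mult_right) auto
qed

lemma US_energy_interior:
  assumes u: "u \<in> US"
  shows "AE t' in lebesgue_on (interior I). \<forall>t\<in>interior I. t' < t \<longrightarrow>
    (norm (u t))\<^sup>2 - (norm (u t'))\<^sup>2 \<le> (LINT s:{t'..t}|lebesgue. energy_rate u s)"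
proof -
  have "AE t' in lebesgue_on (interior I). \<forall>t\<in>interior I. t' < t \<longrightarrow>
        1/2 * (norm (u t))\<^sup>2 + \<nu> * (LINT s:{t'..t}|lebesgue. (H1_norm D (u s))\<^sup>2)
        \<le> 1/2 * (norm (u t'))\<^sup>2 + (LINT s:{t'..t}|lebesgue. f s \<bullet> u s)"
    using US_D(2)[OF u] by (simp add: weak_solution_def)
  then show ?thesis unfolding AE_lebesgue_on[OF interior_I(4)]
  proof eventually_elim
    case (elim t')
    show ?case
    proof (intro impI ballI)
      fix t assume t: "t' \<in> interior I" "t \<in> interior I" "t' < t"
      have sub: "{t'..t} \<subseteq> interior I" using t mem_is_interval_1_I[OF interior_I(3) t(1,2)] by auto
      then have subI: "{t'..t} \<subseteq> I" using interior_I(1) by blast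
      note parts = energy_parts_integrable[OF US_D(1)[OF u] subI US_AE_V_interior(2)[OF u sub]]
      have e1: "(LINT s:{t'..t}|lebesgue. (H1_norm D (u s))\<^sup>2) = (LINT s:{t'..t}|lebesgue. h1sq (u s))"
      proof (rule set_lebesgue_integral_cong_AE_lebesgue)
        have "AE s in lebesgue_on {t'..t}. u s \<in> V_space D"
          by (rule AE_lebesgue_on_mono[OF US_AE_V[OF u] subI I_lebesgue]) simp
        then show "AE s in lebesgue_on {t'..t}. (H1_norm D (u s))\<^sup>2 = h1sq (u s)" by eventually_elim (simp add: h1sq_def)
        show "(\<lambda>s. indicator {t'..t} s *\<^sub>R h1sq (u s)) \<in> borel_measurable lebesgue"
          using parts(2) unfolding set_integrable_def by (rule borel_measurable_integrable)
      qed simp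
      have e2: "(LINT s:{t'..t}|lebesgue. f s \<bullet> u s) = (LINT s:{t'..t}|lebesgue. F s \<bullet> u s)"
      proof (rule set_lebesgue_integral_cong_AE_lebesgue)
        have "AE s in lebesgue_on {t'..t}. f s = F s"
          by (rule AE_lebesgue_on_mono[OF f_F subI I_lebesgue]) simp
        then show "AE s in lebesgue_on {t'..t}. f s \<bullet> u s = F s \<bullet> u s" by eventually_elim simp
        show "(\<lambda>s. indicator {t'..t} s *\<^sub>R (F s \<bullet> u s)) \<in> borel_measurable lebesgue"
          using parts(1) unfolding set_integrable_def by (rule borel_measurable_integrable)
      qed simp
      have "(LINT s:{t'..t}|lebesgue. energy_rate u s) = 2 * (LINT s:{t'..t}|lebesgue. F s \<bullet> u s) - 2 * \<nu> * (LINT s:{t'..t}|lebesgue. h1sq (u s))"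
        unfolding energy_rate_def using parts(1,2) by (subst set_integral_diff) (auto intro!: set_integrable_mult_right)
      moreover have "1/2 * (norm (u t))\<^sup>2 + \<nu> * (LINT s:{t'..t}|lebesgue. h1sq (u s))
        \<le> 1/2 * (norm (u t'))\<^sup>2 + (LINT s:{t'..t}|lebesgue. F s \<bullet> u s)"
        using elim t unfolding e1[symmetric] e2[symmetric] by blast
      ultimately show "(norm (u t))\<^sup>2 - (norm (u t'))\<^sup>2 \<le> (LINT s:{t'..t}|lebesgue. energy_rate u s)" by linarith
    qed
  qed
qed

text \<open>Expanding \<open>|u (x n) - u t|^2 \<ge> 0\<close> bounds an expression linear in
  \<open>u (x n)\<close>, which converges by weak continuity, by the squared norm.\<close>

lemma weak_lsc_norm:
  assumes u: "u \<in> path_space D I" and t: "t \<in> I" and x: "\<And>n. x n \<in> I" "x \<longlonglongrightarrow> t"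
    and le: "\<And>n. (norm (u (x n)))\<^sup>2 \<le> c n" "c \<longlonglongrightarrow> L"
  shows "(norm (u t))\<^sup>2 \<le> L"
proof -
  have H: "u t \<in> H_space D" by (rule path_spaceD(1)[OF u t])
  have "(\<lambda>n. u (x n) \<bullet> u t) \<longlonglongrightarrow> u t \<bullet> u t"
    by (rule continuous_on_tendsto_compose[OF path_spaceD(2)[OF u H] x(2) t]) (simp add: x(1))
  from tendsto_diff[OF tendsto_mult[OF tendsto_const[of 2] this] tendsto_const]
  have "(\<lambda>n. 2 * (u (x n) \<bullet> u t) - (norm (u t))\<^sup>2) \<longlonglongrightarrow> 2 * (u t \<bullet> u t) - (norm (u t))\<^sup>2" .
  moreover have "2 * (u (x n) \<bullet> u t) - (norm (u t))\<^sup>2 \<le> c n" for n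
    using le(1)[of n] inner_ge_zero[of "u (x n) - u t"]
    by (simp add: power2_norm_eq_inner inner_diff_left inner_diff_right inner_commute)
  ultimately have "2 * (u t \<bullet> u t) - (norm (u t))\<^sup>2 \<le> L" using le(2) by (intro LIMSEQ_le) auto
  then show ?thesis by (simp add: power2_norm_eq_inner)
qed

text \<open>End times in \<open>B\<close> approach \<open>t\<close> from the left, where the
  integral is continuous in its upper limit. This serves both the passage from rational end times to
  all of them and the passage from the interior to a right end point of \<open>I\<close>.\<close>

lemma energy_extend:
  assumes u: "u \<in> path_space D I" and t': "t' \<in> I" and t: "t \<in> I" "t' < t" and fin: "fin_energy u t' t"
    and B: "\<And>a b. a < b \<Longrightarrow> \<exists>x\<in>B. a < x \<and> x < b"
    and en: "\<And>b. b \<in> B \<Longrightarrow> t' < b \<Longrightarrow> b < t \<Longrightarrow> (norm (u b))\<^sup>2 - (norm (u t'))\<^sup>2 \<le> (LINT s:{t'..b}|lebesgue. energy_rate u s)"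
  shows "(norm (u t))\<^sup>2 - (norm (u t'))\<^sup>2 \<le> (LINT s:{t'..t}|lebesgue. energy_rate u s)"
proof -
  have sub: "{t'..t} \<subseteq> I" using interval_mem[OF t' t(1)] by auto
  have int: "set_integrable lebesgue {t'..t} (energy_rate u)" by (rule energy_parts_integrable(3)[OF u sub fin])
  have "\<exists>x. x \<in> B \<and> t - (t - t') / real (Suc n) < x \<and> x < t" for n
    using B[of "t - (t - t') / real (Suc n)" t] t(2) by (simp del: of_nat_Suc) blast
  then obtain x where x: "\<And>n. x n \<in> B" "\<And>n. t - (t - t') / real (Suc n) < x n" "\<And>n. x n < t" by metis
  have xt': "t' < x n" for n
  proof -
    have "(t - t') / real (Suc n) \<le> (t - t') / 1" using t(2) by (intro divide_left_mono) auto
    then show ?thesis using x(2)[of n] by simp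
  qed
  have xI: "x n \<in> {t'..t}" for n using xt'[of n] x(3)[of n] by simp
  have r: "(\<lambda>n. (t - t') / real (Suc n)) \<longlonglongrightarrow> 0"
    using tendsto_mult[OF tendsto_const[of "t - t'"] LIMSEQ_Suc[OF lim_1_over_n]] by simp
  have "(\<lambda>n. t - x n) \<longlonglongrightarrow> 0"
  proof (rule Lim_null_comparison[OF always_eventually[OF allI] r])
    show "norm (t - x n) \<le> (t - t') / real (Suc n)" for n using x(2)[of n] x(3)[of n] by (simp del: of_nat_Suc)
  qed
  from tendsto_diff[OF tendsto_const[of t] this] have "(\<lambda>n. t - (t - x n)) \<longlonglongrightarrow> t - 0" .
  then have lim: "x \<longlonglongrightarrow> t" by simp
  have LI: "(LINT s:{t'..y}|lebesgue. energy_rate u s) = integral {t'..y} (energy_rate u)" if "y \<in> {t'..t}" for y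
    by (rule set_lebesgue_integral_eq_integral(2)[OF set_integrable_subset[OF int]]) (use that in auto)
  have cont: "continuous_on {t'..t} (\<lambda>y. integral {t'..y} (energy_rate u))"
    by (rule indefinite_integral_continuous_1[OF set_lebesgue_integral_eq_integral(1)[OF int]])
  have "(norm (u t))\<^sup>2 \<le> (norm (u t'))\<^sup>2 + integral {t'..t} (energy_rate u)"
  proof (rule weak_lsc_norm[OF u t(1) _ lim])
    show "x n \<in> I" for n using xI sub by blast
    show "(norm (u (x n)))\<^sup>2 \<le> (norm (u t'))\<^sup>2 + integral {t'..x n} (energy_rate u)" for n
      using en[OF x(1) xt' x(3), of n] LI[OF xI[of n]] by linarith
    show "(\<lambda>n. (norm (u t'))\<^sup>2 + integral {t'..x n} (energy_rate u)) \<longlonglongrightarrow> (norm (u t'))\<^sup>2 + integral {t'..t} (energy_rate u)"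
      by (intro tendsto_intros continuous_on_tendsto_compose[OF cont lim]) (use t xI in auto)
  qed
  then show ?thesis using LI[of t] t by simp
qed

section \<open>The weak equation tested with an element of V\<close>

definition ns_rate :: "l2_field \<Rightarrow> real \<Rightarrow> l2_field \<Rightarrow> real" where
  "ns_rate v s x = indicator (V_space D) x * NS_rhs D \<nu> F s x v"

lemma ns_rate_bound:
  assumes v: "v \<in> V_space D"
  obtains C where "0 \<le> C" "\<And>s x. \<bar>ns_rate v s x\<bar> \<le> C * (1 + (norm x)\<^sup>2 + h1sq x)"
proof -
  obtain C where C: "0 \<le> C" "\<And>f s u. u \<in> V_space D \<Longrightarrow>
    \<bar>NS_rhs D \<nu> f s u v\<bar> \<le> norm (f s) * norm v + C * (1 + (norm u)\<^sup>2 + (H1_norm D u)\<^sup>2)"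
    using NS_rhs_bound[OF v, of \<nu>] by blast
  have "\<bar>ns_rate v s x\<bar> \<le> (Cf * norm v + C) * (1 + (norm x)\<^sup>2 + h1sq x)" for s x
  proof (cases "x \<in> V_space D")
    case True
    have "norm (F s) * norm v \<le> Cf * norm v" by (intro mult_right_mono F_bd) simp
    also have "\<dots> \<le> (Cf * norm v) * (1 + (norm x)\<^sup>2 + h1sq x)"
      using Cf_nonneg h1sq_nonneg[of x] mult_left_mono[of 1 "1 + (norm x)\<^sup>2 + h1sq x" "Cf * norm v"] by simp
    finally show ?thesis using C(2)[OF True, of F s] True by (simp add: ns_rate_def h1sq_def distrib_right)
  next
    case False
    have "0 \<le> (Cf * norm v + C) * (1 + (norm x)\<^sup>2 + h1sq x)"
      using Cf_nonneg C(1) h1sq_nonneg[of x] by (intro mult_nonneg_nonneg add_nonneg_nonneg) auto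
    with False show ?thesis by (simp add: ns_rate_def)
  qed
  moreover have "0 \<le> Cf * norm v + C" using Cf_nonneg C(1) by simp
  ultimately show ?thesis using that by blast
qed

text \<open>The time and the state are measurable functions on an arbitrary space, so one statement
  serves integrals along a path and integrals over the product of time and \<open>H\<close>.\<close>

lemma ns_rate_joint:
  assumes v: "v \<in> V_space D" and s: "\<sigma> \<in> M \<rightarrow>\<^sub>M lebesgue_on I" and x: "\<xi> \<in> M \<rightarrow>\<^sub>M H_borel D"
  shows "(\<lambda>z. ns_rate v (\<sigma> z) (\<xi> z)) \<in> borel_measurable M"
proof -
  have 1: "(\<lambda>z. F (\<sigma> z) \<bullet> v) \<in> borel_measurable M"
    by (rule measurable_compose[OF measurable_compose[OF s F_meas] H_borel_inner])
  have "(\<lambda>u. indicator (V_space D) u * (\<nu> * H1_inner D u v + trilinear D u u v)) \<in> borel_measurable (H_borel D)"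
    by (rule V_supported_measurable) (intro borel_measurable_add borel_measurable_times borel_measurable_const H1_inner_measurable trilinear_measurable v)
  note 2 = measurable_compose[OF x this]
  have 3: "(\<lambda>z. indicator (V_space D) (\<xi> z) :: real) \<in> borel_measurable M"
    by (rule measurable_compose[OF x borel_measurable_indicator[OF V_space_H_borel]])
  have "(\<lambda>z. indicator (V_space D) (\<xi> z) * (F (\<sigma> z) \<bullet> v) - indicator (V_space D) (\<xi> z) * (\<nu> * H1_inner D (\<xi> z) v + trilinear D (\<xi> z) (\<xi> z) v)) \<in> borel_measurable M"
    by (intro borel_measurable_diff borel_measurable_times 1 2 3)
  also have "(\<lambda>z. indicator (V_space D) (\<xi> z) * (F (\<sigma> z) \<bullet> v) - indicator (V_space D) (\<xi> z) * (\<nu> * H1_inner D (\<xi> z) v + trilinear D (\<xi> z) (\<xi> z) v)) = (\<lambda>z. ns_rate v (\<sigma> z) (\<xi> z))"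
    by (simp add: ns_rate_def NS_rhs_V[OF v] algebra_simps fun_eq_iff)
  finally show ?thesis .
qed

lemma id_lebesgue_on: "S \<subseteq> I \<Longrightarrow> (\<lambda>s. s) \<in> lebesgue_on S \<rightarrow>\<^sub>M lebesgue_on I"
  by (rule measurable_restrict_mono[of "\<lambda>s. s" lebesgue I "lebesgue_on I" S]) simp_all

lemma ns_rate_integrable:
  assumes v: "v \<in> V_space D" and u: "u \<in> path_space D I" and ab: "{a..b} \<subseteq> I" and fin: "fin_energy u a b"
  shows "set_integrable lebesgue {a..b} (\<lambda>s. ns_rate v s (u s))"
proof -
  obtain C where C: "0 \<le> C" "\<And>s x. \<bar>ns_rate v s x\<bar> \<le> C * (1 + (norm x)\<^sup>2 + h1sq x)" using ns_rate_bound[OF v] by blast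
  show ?thesis
    by (rule set_integrable_dominated[OF u ab fin ns_rate_joint[OF v id_lebesgue_on[OF ab] path_measurable(1)[OF u ab]] C(1)])
      (simp add: C(2))
qed

lemma US_weak_identity_interior:
  assumes v: "v \<in> V_space D" and u: "u \<in> US" and st: "s \<in> interior I" "t \<in> interior I" "s < t"
  shows "u t \<bullet> v - u s \<bullet> v = (LINT x:{s..t}|lebesgue. ns_rate v x (u x))"
proof (rule du_Bois_Reymond[OF interior_I(2,3) st])
  let ?J = "interior I"
  have vH: "v \<in> H_space D" using v V_subset_H by blast
  show "continuous_on ?J (\<lambda>t. u t \<bullet> v)"
    by (rule continuous_on_subset[OF path_spaceD(2)[OF US_D(1)[OF u] vH] interior_I(1)])
  show "set_integrable lebesgue {a..b} (\<lambda>x. ns_rate v x (u x))" if "{a..b} \<subseteq> ?J" for a b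
    by (rule ns_rate_integrable[OF v US_D(1)[OF u] _ US_AE_V_interior(2)[OF u that]]) (use that interior_I(1) in blast)
  fix \<theta> :: "real \<Rightarrow> real" assume \<theta>: "\<theta> \<in> test_functions ?J"
  have "- (LINT t:?J|lebesgue. deriv \<theta> t * (u t \<bullet> v)) = (LINT t:?J|lebesgue. \<theta> t * NS_rhs D \<nu> f t (u t) v)"
    using US_D(2)[OF u] \<theta> v by (auto simp: weak_solution_def has_distr_deriv_def)
  also have "\<dots> = (LINT t:?J|lebesgue. \<theta> t * ns_rate v t (u t))"
  proof (rule set_lebesgue_integral_cong_AE_lebesgue[OF _ interior_I(4)])
    have "AE t in lebesgue_on ?J. f t = F t" by (rule AE_lebesgue_on_mono[OF f_F interior_I(1) I_lebesgue interior_I(4)])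
    with US_AE_V_interior(1)[OF u] show "AE t in lebesgue_on ?J. \<theta> t * NS_rhs D \<nu> f t (u t) v = \<theta> t * ns_rate v t (u t)"
      by eventually_elim (simp add: ns_rate_def NS_rhs_V[OF v])
    have "(\<lambda>t. ns_rate v t (u t)) \<in> borel_measurable (lebesgue_on ?J)"
      by (rule ns_rate_joint[OF v id_lebesgue_on path_measurable(1)[OF US_D(1)[OF u]]]; rule interior_I)
    then have "(\<lambda>t. indicator ?J t *\<^sub>R ns_rate v t (u t)) \<in> borel_measurable lebesgue"
      using borel_measurable_restrict_space_iff[of ?J lebesgue "\<lambda>t. ns_rate v t (u t)"] interior_I(4) by simp
    then have "(\<lambda>t. \<theta> t * (indicator ?J t *\<^sub>R ns_rate v t (u t))) \<in> borel_measurable lebesgue"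
      using \<theta> borel_measurable_times[OF continuous_lebesgue_measurable[OF smooth_continuous[of \<theta>]]] by (simp add: test_functions_def)
    then show "(\<lambda>t. indicator ?J t *\<^sub>R (\<theta> t * ns_rate v t (u t))) \<in> borel_measurable lebesgue"
      by (simp add: mult.left_commute)
  qed
  finally show "- (LINT x:?J|lebesgue. deriv \<theta> x * (u x \<bullet> v)) = (LINT x:?J|lebesgue. \<theta> x * ns_rate v x (u x))" .
qed

text \<open>The difference \<Delta> is constant on the open interval, by du Bois-Reymond, and
  continuous on the closed one, because \<open>u\<close> is weakly continuous up to the end points
  of \<open>I\<close> and \<open>fin_energy\<close> makes the rate integrable there.\<close>

lemma US_weak_identity:
  assumes v: "v \<in> V_space D" and u: "u \<in> US" and ab: "a \<in> I" "b \<in> I" "a \<le> b" and fin: "fin_energy u a b"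
  shows "u b \<bullet> v - u a \<bullet> v = (LINT x:{a..b}|lebesgue. ns_rate v x (u x))"
proof (cases "a = b")
  case True
  have "(LINT x:{b..b}|lebesgue. ns_rate v x (u x)) = (LINT x:{b..b}|lebesgue. 0)"
  proof (rule set_lebesgue_integral_cong_AE_lebesgue)
    have "AE x in lebesgue. x \<noteq> b" by (rule AE_completion[OF AE_lborel_singleton])
    then show "AE s in lebesgue_on {b..b}. ns_rate v s (u s) = 0"
      unfolding AE_lebesgue_on[OF Icc_sets] by eventually_elim simp
  qed simp_all
  with True show ?thesis by (simp add: set_lebesgue_integral_def)
next
  case False
  then have lt: "a < b" using ab by simp
  have sub: "{a..b} \<subseteq> I" using interval_mem[OF ab(1,2)] by auto
  have vH: "v \<in> H_space D" using v V_subset_H by blast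
  define g where "g x = ns_rate v x (u x)" for x
  have int: "set_integrable lebesgue {a..b} g" unfolding g_def by (rule ns_rate_integrable[OF v US_D(1)[OF u] sub fin])
  have hk: "g integrable_on {a..b}" by (rule set_lebesgue_integral_eq_integral(1)[OF int])
  have LI: "(LINT x:{y..z}|lebesgue. g x) = integral {y..z} g" if "a \<le> y" "z \<le> b" for y z
    by (rule set_lebesgue_integral_eq_integral(2)[OF set_integrable_subset[OF int]]) (use that in auto)
  define \<Delta> where "\<Delta> x = u x \<bullet> v - integral {a..x} g" for x
  have cont: "continuous_on {a..b} \<Delta>"
    unfolding \<Delta>_def by (rule continuous_on_diff[OF continuous_on_subset[OF path_spaceD(2)[OF US_D(1)[OF u] vH] sub] indefinite_integral_continuous_1[OF hk]])
  have const: "\<Delta> x = \<Delta> y" if "x \<in> {a<..<b}" "y \<in> {a<..<b}" "x < y" for x y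
  proof -
    have J: "x \<in> interior I" "y \<in> interior I" using interior_between[OF ab(1,2)] that by auto
    have "u y \<bullet> v - u x \<bullet> v = integral {x..y} g"
      using US_weak_identity_interior[OF v u J that(3)] LI[of x y] that by (simp add: g_def)
    moreover have "integral {a..x} g + integral {x..y} g = integral {a..y} g"
      using that by (intro Henstock_Kurzweil_Integration.integral_combine integrable_on_subinterval[OF hk]) auto
    ultimately show ?thesis by (simp add: \<Delta>_def)
  qed
  define m where "m = (a + b) / 2"
  have m: "m \<in> {a<..<b}" using lt by (simp add: m_def)
  have mid: "\<Delta> x = \<Delta> m" if x: "x \<in> {a<..<b}" for x
  proof (cases x m rule: linorder_cases)
    case less then show ?thesis by (rule const[OF x m])
  next
    case greater then show ?thesis by (rule const[OF m x, symmetric])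
  qed simp
  have cl: "closure {a<..<b} = {a..b}" using lt by simp
  have "\<Delta> x = \<Delta> m" if "x \<in> {a..b}" for x
  proof (rule continuous_constant_on_closure[of "{a<..<b}" \<Delta>])
    show "continuous_on (closure {a<..<b}) \<Delta>" unfolding cl by (rule cont)
    show "x \<in> closure {a<..<b}" unfolding cl by (rule that)
  qed (rule mid)
  then have "\<Delta> b = \<Delta> a" using lt by (metis atLeastAtMost_iff less_imp_le order_refl)
  then show ?thesis using LI[of a b] by (simp add: \<Delta>_def g_def)
qed

section \<open>Averaged estimates\<close>

lemma time_path_sigma_finite: "S \<in> sets lebesgue \<Longrightarrow> pair_sigma_finite (lebesgue_on S) \<rho>" for S :: "real set"
  using sigma_finite_lebesgue_on rho.sigma_finite_measure_axioms by (simp add: pair_sigma_finite_def)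

lemma eval_pair_measurable: "S \<subseteq> I \<Longrightarrow> (\<lambda>z. snd z (fst z)) \<in> (lebesgue_on S \<Otimes>\<^sub>M \<rho>) \<rightarrow>\<^sub>M H_borel D"
  using eval_joint_measurable by (simp add: case_prod_beta')

lemma nn_integral_time_path_swap:
  assumes S: "S \<subseteq> I" "S \<in> sets lebesgue" and g: "g \<in> borel_measurable (H_borel D)"
  shows "(\<integral>\<^sup>+u. (\<integral>\<^sup>+s. (g (u s) :: ennreal) \<partial>lebesgue_on S) \<partial>\<rho>) = (\<integral>\<^sup>+s. (\<integral>\<^sup>+u. g (u s) \<partial>\<rho>) \<partial>lebesgue_on S)"
    and "(\<lambda>s. \<integral>\<^sup>+u. g (u s) \<partial>\<rho>) \<in> borel_measurable (lebesgue_on S)"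
    and "(\<lambda>u. \<integral>\<^sup>+s. g (u s) \<partial>lebesgue_on S) \<in> borel_measurable \<rho>"
proof -
  interpret P: pair_sigma_finite "lebesgue_on S" \<rho> by (rule time_path_sigma_finite[OF S(2)])
  have m: "case_prod (\<lambda>s u. g (u s)) \<in> borel_measurable (lebesgue_on S \<Otimes>\<^sub>M \<rho>)"
    using measurable_compose[OF eval_pair_measurable[OF S(1)] g] by (simp add: case_prod_beta')
  show "(\<integral>\<^sup>+u. (\<integral>\<^sup>+s. g (u s) \<partial>lebesgue_on S) \<partial>\<rho>) = (\<integral>\<^sup>+s. (\<integral>\<^sup>+u. g (u s) \<partial>\<rho>) \<partial>lebesgue_on S)"
    by (rule P.Fubini'[OF m])
  show "(\<lambda>s. \<integral>\<^sup>+u. g (u s) \<partial>\<rho>) \<in> borel_measurable (lebesgue_on S)"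
    by (rule rho.borel_measurable_nn_integral[OF m])
  have "case_prod (\<lambda>u s. g (u s)) \<in> borel_measurable (\<rho> \<Otimes>\<^sub>M lebesgue_on S)"
    using measurable_pair_swap[OF m] by (simp add: case_prod_beta')
  then show "(\<lambda>u. \<integral>\<^sup>+s. g (u s) \<partial>lebesgue_on S) \<in> borel_measurable \<rho>"
    by (rule P.M1.borel_measurable_nn_integral)
qed

section \<open>Mean energy and mean enstrophy\<close>

definition mean_energy :: "real \<Rightarrow> ennreal" where
  "mean_energy s = (\<integral>\<^sup>+u. ennreal ((norm (u s))\<^sup>2) \<partial>\<rho>)"

definition mean_enstrophy :: "real \<Rightarrow> ennreal" where
  "mean_enstrophy s = (\<integral>\<^sup>+u. enstrophy D (u s) \<partial>\<rho>)"

lemma norm_sq_H_borel: "(\<lambda>x. ennreal ((norm x)\<^sup>2)) \<in> borel_measurable (H_borel D)"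
  by measurable

lemma drop_US: "(\<integral>\<^sup>+u\<in>US. G u \<partial>\<rho>) = (\<integral>\<^sup>+u. G u \<partial>\<rho>)"
  by (rule nn_integral_cong_AE) (use carried in eventually_elim, simp)

lemma mean_energy_L_inf: "in_L_inf_loc I mean_energy"
  using mean_bounded unfolding drop_US mean_energy_def[abs_def] .

lemma mean_energy_bound: "{a..b} \<subseteq> I \<Longrightarrow> \<exists>C::real. AE t in lebesgue_on {a..b}. mean_energy t \<le> ennreal C"
  using mean_energy_L_inf unfolding in_L_inf_loc_def by blast

lemma mean_measurable:
  assumes S: "S \<subseteq> I" "S \<in> sets lebesgue"
  shows "mean_energy \<in> borel_measurable (lebesgue_on S)" "mean_enstrophy \<in> borel_measurable (lebesgue_on S)"
  using nn_integral_time_path_swap(2)[OF S norm_sq_H_borel] nn_integral_time_path_swap(2)[OF S enstrophy_H_borel]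
  by (simp_all add: mean_energy_def[abs_def] mean_enstrophy_def[abs_def])

text \<open>Countably many compact intervals starting at \<open>t\<^sub>0\<close> cover
  \<open>I\<close>, so that local bounds and local almost sure statements combine into global ones
  without uncountable unions of null sets.\<close>

lemma exhaustion:
  obtains \<beta> :: "nat \<Rightarrow> real" where "\<And>n. \<beta> n \<in> I" "\<And>x. x \<in> I \<Longrightarrow> \<exists>n. x \<le> \<beta> n"
proof (rule I_cases)
  assume I: "I = {t\<^sub>0..}"
  show ?thesis
  proof (rule that[of "\<lambda>n. t\<^sub>0 + real n"])
    fix x obtain n where "x - t\<^sub>0 \<le> real n" using real_arch_simple by blast
    then show "\<exists>n. x \<le> t\<^sub>0 + real n" by (intro exI[of _ n]) linarith
  qed (simp add: I)
next
  fix T assume "t\<^sub>0 \<le> T" and I: "I = {t\<^sub>0..T}"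
  then show ?thesis by (intro that[of "\<lambda>n. T"]) auto
next
  fix T assume T: "t\<^sub>0 < T" and I: "I = {t\<^sub>0..<T}"
  show ?thesis
  proof (rule that[of "\<lambda>n. T - (T - t\<^sub>0) / real (Suc n)"])
    show "T - (T - t\<^sub>0) / real (Suc n) \<in> I" for n
      using T divide_left_mono[of 1 "real (Suc n)" "T - t\<^sub>0"] by (simp add: I del: of_nat_Suc)
    fix x assume "x \<in> I"
    then have x: "0 < T - x" by (simp add: I)
    obtain n where n: "(T - t\<^sub>0) / (T - x) \<le> real n" using real_arch_simple by blast
    then have "T - t\<^sub>0 \<le> real n * (T - x)" using x by (simp add: pos_divide_le_eq)
    also have "\<dots> \<le> real (Suc n) * (T - x)" using x by (intro mult_right_mono) auto
    finally have "(T - t\<^sub>0) / real (Suc n) \<le> T - x" by (simp add: pos_divide_le_eq mult.commute del: of_nat_Suc)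
    then show "\<exists>n. x \<le> T - (T - t\<^sub>0) / real (Suc n)" by (intro exI[of _ n]) linarith
  qed
qed

lemma mean_energy_finite: "AE t in lebesgue_on I. mean_energy t < \<infinity>"
proof -
  obtain \<beta> :: "nat \<Rightarrow> real" where \<beta>: "\<And>n. \<beta> n \<in> I" "\<And>x. x \<in> I \<Longrightarrow> \<exists>n. x \<le> \<beta> n" using exhaustion by blast
  have sub: "{t\<^sub>0..\<beta> n} \<subseteq> I" for n using interval_mem[OF t0_in \<beta>(1)] by auto
  have "AE t in lebesgue. t \<in> {t\<^sub>0..\<beta> n} \<longrightarrow> mean_energy t < \<infinity>" for n
  proof -
    obtain C :: real where "AE t in lebesgue_on {t\<^sub>0..\<beta> n}. mean_energy t \<le> ennreal C" using mean_energy_bound[OF sub] by blast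
    then show ?thesis unfolding AE_lebesgue_on[OF Icc_sets]
      by eventually_elim (auto intro: le_less_trans[OF _ ennreal_less_top])
  qed
  then have "AE t in lebesgue. \<forall>n. t \<in> {t\<^sub>0..\<beta> n} \<longrightarrow> mean_energy t < \<infinity>" by (subst AE_all_countable) blast
  then show ?thesis unfolding AE_lebesgue_on[OF I_lebesgue]
  proof eventually_elim
    case (elim t)
    show ?case
    proof
      assume t: "t \<in> I"
      then obtain n where "t \<le> \<beta> n" using \<beta>(2) by blast
      with elim t0_le[OF t] show "mean_energy t < \<infinity>" by auto
    qed
  qed
qed

text \<open>The final energy is discarded and the work of the forcing estimated by
  \<open>Cf * (1 + |u|^2)\<close>. The result is phrased in \<open>ennreal\<close> so that it can be
  averaged over paths before any mean is known to be finite.\<close>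

lemma path_dissipation:
  assumes u: "u \<in> US" and ab: "a \<le> b" "{a..b} \<subseteq> I" and fin: "fin_energy u a b"
    and en: "(norm (u b))\<^sup>2 - (norm (u a))\<^sup>2 \<le> (LINT s:{a..b}|lebesgue. energy_rate u s)"
  shows "ennreal (2 * \<nu>) * (\<integral>\<^sup>+s. enstrophy D (u s) \<partial>lebesgue_on {a..b}) \<le>
    ennreal ((norm (u a))\<^sup>2) + ennreal (2 * Cf) * (\<integral>\<^sup>+s. ennreal (1 + (norm (u s))\<^sup>2) \<partial>lebesgue_on {a..b})"
proof -
  let ?L = "lebesgue_on {a..b}"
  note p = US_D(1)[OF u]
  note m = path_measurable[OF p ab(2)]
  have F: "integrable ?L (\<lambda>s. F s \<bullet> u s)" and h: "integrable ?L (\<lambda>s. h1sq (u s))"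
    using energy_parts_integrable(1,2)[OF p ab(2) fin] unfolding set_integral_lebesgue_on(2) .
  have "set_integrable lebesgue {a..b} (\<lambda>s. 1 + (norm (u s))\<^sup>2)"
  proof (rule set_integrable_dominated[OF p ab(2) fin _ zero_le_one])
    show "(\<lambda>s. 1 + (norm (u s))\<^sup>2) \<in> borel_measurable ?L"
      by (intro borel_measurable_add borel_measurable_const borel_measurable_power m)
  qed (simp add: h1sq_nonneg)
  then have n: "integrable ?L (\<lambda>s. 1 + (norm (u s))\<^sup>2)" unfolding set_integral_lebesgue_on(2) .
  have "(\<integral>\<^sup>+s. enstrophy D (u s) \<partial>?L) = (\<integral>\<^sup>+s. ennreal (h1sq (u s)) \<partial>?L)"
  proof (rule nn_integral_cong_AE)
    have "AE s in ?L. u s \<in> V_space D" by (rule AE_lebesgue_on_mono[OF US_AE_V[OF u] ab(2) I_lebesgue]) simp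
    then show "AE s in ?L. enstrophy D (u s) = ennreal (h1sq (u s))" by eventually_elim (rule enstrophy_h1sq)
  qed
  also have "\<dots> = ennreal (\<integral>s. h1sq (u s) \<partial>?L)" by (rule nn_integral_eq_integral[OF h]) (simp add: h1sq_nonneg)
  finally have 1: "(\<integral>\<^sup>+s. enstrophy D (u s) \<partial>?L) = ennreal (\<integral>s. h1sq (u s) \<partial>?L)" .
  have 2: "(\<integral>\<^sup>+s. ennreal (1 + (norm (u s))\<^sup>2) \<partial>?L) = ennreal (\<integral>s. 1 + (norm (u s))\<^sup>2 \<partial>?L)"
    by (rule nn_integral_eq_integral[OF n]) simp
  have "(\<integral>s. energy_rate u s \<partial>?L) = 2 * (\<integral>s. F s \<bullet> u s \<partial>?L) - 2 * \<nu> * (\<integral>s. h1sq (u s) \<partial>?L)"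
    unfolding energy_rate_def using F h by simp
  moreover have "(\<integral>s. F s \<bullet> u s \<partial>?L) \<le> (\<integral>s. Cf * (1 + (norm (u s))\<^sup>2) \<partial>?L)"
    by (rule integral_mono[OF F integrable_mult_right[OF n]]) (use F_inner_bound abs_le_D1 in blast)
  moreover have "(\<integral>s. Cf * (1 + (norm (u s))\<^sup>2) \<partial>?L) = Cf * (\<integral>s. 1 + (norm (u s))\<^sup>2 \<partial>?L)" by simp
  moreover have "0 \<le> (norm (u b))\<^sup>2" by simp
  ultimately have "2 * \<nu> * (\<integral>s. h1sq (u s) \<partial>?L) \<le> (norm (u a))\<^sup>2 + 2 * Cf * (\<integral>s. 1 + (norm (u s))\<^sup>2 \<partial>?L)"
    using en unfolding set_integral_lebesgue_on(1) by linarith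
  then have "ennreal (2 * \<nu> * (\<integral>s. h1sq (u s) \<partial>?L)) \<le> ennreal ((norm (u a))\<^sup>2 + 2 * Cf * (\<integral>s. 1 + (norm (u s))\<^sup>2 \<partial>?L))"
    by (rule ennreal_leI)
  also have "\<dots> = ennreal ((norm (u a))\<^sup>2) + ennreal (2 * Cf) * ennreal (\<integral>s. 1 + (norm (u s))\<^sup>2 \<partial>?L)"
    using Cf_nonneg by (subst ennreal_plus) (auto simp: ennreal_mult' intro!: mult_nonneg_nonneg integral_nonneg)
  finally show ?thesis unfolding 1 2 using nu by (simp add: ennreal_mult')
qed

definition energy_step :: "(real \<Rightarrow> l2_field) \<Rightarrow> real \<Rightarrow> real \<Rightarrow> bool" where
  "energy_step u a b \<longleftrightarrow> (norm (u b))\<^sup>2 - (norm (u a))\<^sup>2 \<le> (LINT s:{a..b}|lebesgue. energy_rate u s)"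

text \<open>Needed to exchange almost-everywhere quantifiers over time and paths. The interval of
  integration depends on the starting time, so the integral is rewritten over the fixed set
  \<open>J\<close> with a jointly measurable cut-off; the end time \<open>b\<close> is fixed, so
  that afterwards countably many such conditions can be intersected.\<close>

lemma energy_step_measurable:
  assumes J: "J \<subseteq> I" "J \<in> sets lebesgue" "is_interval J" and b: "b \<in> J"
  shows "{z \<in> space (lebesgue_on J \<Otimes>\<^sub>M \<rho>). fst z < b \<longrightarrow> energy_step (snd z) (fst z) b} \<in> sets (lebesgue_on J \<Otimes>\<^sub>M \<rho>)"
proof -
  let ?M = "lebesgue_on J \<Otimes>\<^sub>M \<rho>"
  interpret L: sigma_finite_measure "lebesgue_on J" by (rule sigma_finite_lebesgue_on[OF J(2)])
  have fst_m: "(\<lambda>z. fst z) \<in> borel_measurable ?M"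
  proof (rule measurable_compose[OF measurable_fst])
    show "(\<lambda>x. x) \<in> borel_measurable (lebesgue_on J)" by (rule measurable_restrict_space1[OF borel_measurable_ident_lebesgue])
  qed
  have end_m: "(\<lambda>z. norm (snd z b)) \<in> borel_measurable ?M"
    by (rule measurable_compose[OF measurable_compose[OF measurable_snd eval_measurable] H_borel_norm]) (use b J in auto)
  have start_m: "(\<lambda>z. norm (snd z (fst z))) \<in> borel_measurable ?M"
    by (rule measurable_compose[OF eval_pair_measurable[OF J(1)] H_borel_norm])
  let ?N = "?M \<Otimes>\<^sub>M lebesgue_on J"
  have s_m: "(\<lambda>w. snd w) \<in> ?N \<rightarrow>\<^sub>M lebesgue_on J" by (rule measurable_snd)
  have sr: "(\<lambda>w. snd w) \<in> borel_measurable ?N"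
  proof (rule measurable_compose[OF measurable_snd])
    show "(\<lambda>x. x) \<in> borel_measurable (lebesgue_on J)" by (rule measurable_restrict_space1[OF borel_measurable_ident_lebesgue])
  qed
  have tr: "(\<lambda>w. fst (fst w)) \<in> borel_measurable ?N" by (rule measurable_compose[OF measurable_fst fst_m])
  have "(\<lambda>w. (snd w, snd (fst w))) \<in> ?N \<rightarrow>\<^sub>M (lebesgue_on J \<Otimes>\<^sub>M \<rho>)"
    by (intro measurable_Pair measurable_snd measurable_compose[OF measurable_fst measurable_snd])
  from measurable_compose[OF this eval_pair_measurable[OF J(1)]]
  have x_m: "(\<lambda>w. snd (fst w) (snd w)) \<in> ?N \<rightarrow>\<^sub>M H_borel D" by simp
  have F_m: "(\<lambda>w. F (snd w)) \<in> ?N \<rightarrow>\<^sub>M H_borel D" by (rule measurable_compose[OF s_m F_measurable[OF J(1)]])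
  note [measurable] = H_inner_measurable[OF F_m x_m] measurable_compose[OF x_m h1sq_measurable] sr tr
  have "(\<lambda>w. if fst (fst w) \<le> snd w \<and> snd w \<le> b then 2 * (F (snd w) \<bullet> snd (fst w) (snd w)) - 2 * \<nu> * h1sq (snd (fst w) (snd w)) else 0)
     \<in> borel_measurable ?N" by measurable
  then have "(\<lambda>w. (if fst (fst w) \<le> snd w \<and> snd w \<le> b then energy_rate (snd (fst w)) (snd w) else 0)) \<in> borel_measurable ?N"
    unfolding energy_rate_def .
  then have "case_prod (\<lambda>z s. if fst z \<le> s \<and> s \<le> b then energy_rate (snd z) s else 0) \<in> borel_measurable ?N"
    by (simp add: case_prod_beta')
  from L.borel_measurable_lebesgue_integral[OF this]
  have [measurable]: "(\<lambda>z. \<integral>s. (if fst z \<le> s \<and> s \<le> b then energy_rate (snd z) s else 0) \<partial>lebesgue_on J) \<in> borel_measurable ?M" .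
  note [measurable] = fst_m end_m start_m
  have "{z \<in> space ?M. fst z < b \<longrightarrow> (norm (snd z b))\<^sup>2 - (norm (snd z (fst z)))\<^sup>2 \<le>
     (\<integral>s. (if fst z \<le> s \<and> s \<le> b then energy_rate (snd z) s else 0) \<partial>lebesgue_on J)} \<in> sets ?M" by measurable
  also have "{z \<in> space ?M. fst z < b \<longrightarrow> (norm (snd z b))\<^sup>2 - (norm (snd z (fst z)))\<^sup>2 \<le>
     (\<integral>s. (if fst z \<le> s \<and> s \<le> b then energy_rate (snd z) s else 0) \<partial>lebesgue_on J)} =
     {z \<in> space ?M. fst z < b \<longrightarrow> energy_step (snd z) (fst z) b}"
  proof -
    have "(\<integral>s. (if a \<le> s \<and> s \<le> b then energy_rate u s else 0) \<partial>lebesgue_on J) = (LINT s:{a..b}|lebesgue. energy_rate u s)"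
      if a: "a \<in> J" for a u
    proof -
      have "{a..b} \<subseteq> J" using mem_is_interval_1_I[OF J(3) a b] by auto
      then have "indicator J s * (if a \<le> s \<and> s \<le> b then energy_rate u s else 0) = indicator {a..b} s * energy_rate u s" for s
        by (auto simp: indicator_def)
      then show ?thesis using J(2) by (simp add: integral_restrict_space set_lebesgue_integral_def)
    qed
    then show ?thesis unfolding energy_step_def by (auto simp: space_pair_measure space_restrict_space)
  qed
  finally show ?thesis .
qed

lemma AE_energy_step:
  "AE a in lebesgue_on (interior I). AE u in \<rho>. u \<in> US \<and> (\<forall>b\<in>\<rat> \<inter> interior I. a < b \<longrightarrow> energy_step u a b)"
proof -
  let ?J = "interior I"
  interpret P: pair_sigma_finite "lebesgue_on ?J" \<rho> by (rule time_path_sigma_finite[OF interior_I(4)])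
  have meas: "{z \<in> space (lebesgue_on ?J \<Otimes>\<^sub>M \<rho>). \<forall>b\<in>\<rat> \<inter> ?J. fst z < b \<longrightarrow> energy_step (snd z) (fst z) b} \<in> sets (lebesgue_on ?J \<Otimes>\<^sub>M \<rho>)"
    by (rule sets.sets_Collect_countable_All'[OF energy_step_measurable[OF interior_I(1,4,3)]]) (auto intro: countable_rat countable_Int1)
  have "AE u in \<rho>. AE a in lebesgue_on ?J. \<forall>b\<in>\<rat> \<inter> ?J. a < b \<longrightarrow> energy_step u a b"
    using carried
  proof eventually_elim
    case (elim u)
    from US_energy_interior[OF elim] show ?case by eventually_elim (auto simp: energy_step_def)
  qed
  then have "AE a in lebesgue_on ?J. AE u in \<rho>. \<forall>b\<in>\<rat> \<inter> ?J. a < b \<longrightarrow> energy_step u a b"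
    using P.AE_commute[OF meas] by blast
  then show ?thesis using carried by simp
qed

lemma mean_dissipation:
  assumes ab: "a < b" "{a..b} \<subseteq> interior I" and en: "AE u in \<rho>. u \<in> US \<and> energy_step u a b"
  shows "ennreal (2 * \<nu>) * (\<integral>\<^sup>+s. mean_enstrophy s \<partial>lebesgue_on {a..b}) \<le>
    mean_energy a + ennreal (2 * Cf) * (\<integral>\<^sup>+s. 1 + mean_energy s \<partial>lebesgue_on {a..b})"
proof -
  let ?L = "lebesgue_on {a..b}"
  have sub: "{a..b} \<subseteq> I" using ab(2) interior_I(1) by blast
  have a: "a \<in> I" using sub ab(1) by auto
  have m1: "(\<lambda>x. ennreal (1 + (norm x)\<^sup>2)) \<in> borel_measurable (H_borel D)" by measurable
  have "ennreal (2 * \<nu>) * (\<integral>\<^sup>+s. mean_enstrophy s \<partial>?L) = (\<integral>\<^sup>+u. ennreal (2 * \<nu>) * (\<integral>\<^sup>+s. enstrophy D (u s) \<partial>?L) \<partial>\<rho>)"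
    unfolding mean_enstrophy_def nn_integral_time_path_swap(1)[OF sub Icc_sets enstrophy_H_borel, symmetric]
    by (rule nn_integral_cmult[symmetric, OF nn_integral_time_path_swap(3)[OF sub Icc_sets enstrophy_H_borel]])
  also have "\<dots> \<le> (\<integral>\<^sup>+u. ennreal ((norm (u a))\<^sup>2) + ennreal (2 * Cf) * (\<integral>\<^sup>+s. ennreal (1 + (norm (u s))\<^sup>2) \<partial>?L) \<partial>\<rho>)"
  proof (rule nn_integral_mono_AE, use en in eventually_elim)
    case (elim u)
    then show ?case using path_dissipation[of u a b] US_AE_V_interior(2)[of u a b] ab sub by (auto simp: energy_step_def)
  qed
  also have "\<dots> = mean_energy a + (\<integral>\<^sup>+u. ennreal (2 * Cf) * (\<integral>\<^sup>+s. ennreal (1 + (norm (u s))\<^sup>2) \<partial>?L) \<partial>\<rho>)"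
    unfolding mean_energy_def
    by (rule nn_integral_add[OF measurable_compose[OF eval_measurable[OF a] norm_sq_H_borel] borel_measurable_times_ennreal[OF borel_measurable_const nn_integral_time_path_swap(3)[OF sub Icc_sets m1]]])
  also have "(\<integral>\<^sup>+u. ennreal (2 * Cf) * (\<integral>\<^sup>+s. ennreal (1 + (norm (u s))\<^sup>2) \<partial>?L) \<partial>\<rho>)
     = ennreal (2 * Cf) * (\<integral>\<^sup>+s. (\<integral>\<^sup>+u. ennreal (1 + (norm (u s))\<^sup>2) \<partial>\<rho>) \<partial>?L)"
    unfolding nn_integral_time_path_swap(1)[OF sub Icc_sets m1, symmetric] by (rule nn_integral_cmult[OF nn_integral_time_path_swap(3)[OF sub Icc_sets m1]])
  also have "(\<integral>\<^sup>+s. (\<integral>\<^sup>+u. ennreal (1 + (norm (u s))\<^sup>2) \<partial>\<rho>) \<partial>?L) = (\<integral>\<^sup>+s. 1 + mean_energy s \<partial>?L)"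
  proof (rule nn_integral_cong)
    fix s assume "s \<in> space ?L"
    then have s: "s \<in> I" using sub by (auto simp: space_restrict_space)
    have "(\<integral>\<^sup>+u. ennreal (1 + (norm (u s))\<^sup>2) \<partial>\<rho>) = (\<integral>\<^sup>+u. 1 + ennreal ((norm (u s))\<^sup>2) \<partial>\<rho>)" by (intro nn_integral_cong) simp
    also have "\<dots> = 1 + mean_energy s"
      unfolding mean_energy_def using nn_integral_add[OF borel_measurable_const[of 1] measurable_compose[OF eval_measurable[OF s] norm_sq_H_borel]]
      by (simp add: rho.emeasure_space_1)
    finally show "(\<integral>\<^sup>+u. ennreal (1 + (norm (u s))\<^sup>2) \<partial>\<rho>) = 1 + mean_energy s" .
  qed
  finally show ?thesis .
qed

lemma mean_energy_integral:
  assumes ab: "{a..b} \<subseteq> I"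
  shows "(\<integral>\<^sup>+s. 1 + mean_energy s \<partial>lebesgue_on {a..b}) < \<infinity>"
proof -
  obtain C :: real where C: "AE t in lebesgue_on {a..b}. mean_energy t \<le> ennreal C" using mean_energy_bound[OF ab] by blast
  have "(\<integral>\<^sup>+s. 1 + mean_energy s \<partial>lebesgue_on {a..b}) \<le> (\<integral>\<^sup>+s. 1 + ennreal C \<partial>lebesgue_on {a..b})"
    by (rule nn_integral_mono_AE) (use C in eventually_elim, auto intro: add_left_mono)
  also have "\<dots> < \<infinity>" by (simp add: emeasure_restrict_space ennreal_mult_less_top emeasure_lborel_Icc_eq less_top)
  finally show ?thesis .
qed

text \<open>The starting time has to be good for almost every path and to have mean energy below the
  essential bound \<open>C\<close>; almost every time qualifies. The resulting bound
  \<open>K\<close> is then independent of how close the starting time is to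
  \<open>t\<^sub>0\<close>.\<close>

lemma mean_enstrophy_integral:
  assumes b: "b \<in> I"
  shows "(\<integral>\<^sup>+s. mean_enstrophy s \<partial>lebesgue_on {t\<^sub>0..b}) < \<infinity>"
proof -
  have sub: "{t\<^sub>0..b} \<subseteq> I" using interval_mem[OF t0_in b] by auto
  obtain C :: real where C: "AE t in lebesgue_on {t\<^sub>0..b}. mean_energy t \<le> ennreal C" using mean_energy_bound[OF sub] by blast
  define K where "K = ennreal C + ennreal (2 * Cf) * (\<integral>\<^sup>+s. 1 + mean_energy s \<partial>lebesgue_on {t\<^sub>0..b})"
  have K: "K < \<infinity>" unfolding K_def using mean_energy_integral[OF sub] by (simp add: ennreal_mult_less_top)
  have le: "ennreal (2 * \<nu>) * (\<integral>\<^sup>+s. mean_enstrophy s \<partial>lebesgue_on {t\<^sub>0 + e..b - e}) \<le> K" if e: "0 < e" "t\<^sub>0 + e \<le> b - e" for e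
  proof -
    define P where "P t \<longleftrightarrow> (t \<in> interior I \<longrightarrow> (AE u in \<rho>. u \<in> US \<and> (\<forall>b\<in>\<rat> \<inter> interior I. t < b \<longrightarrow> energy_step u t b))) \<and>
      (t \<in> {t\<^sub>0..b} \<longrightarrow> mean_energy t \<le> ennreal C)" for t
    have "AE t in lebesgue. t \<in> {t\<^sub>0..b} \<longrightarrow> P t"
      using AE_energy_step C unfolding AE_lebesgue_on[OF interior_I(4)] AE_lebesgue_on[OF Icc_sets]
      by eventually_elim (simp add: P_def)
    from AE_dense[OF this, of t\<^sub>0 "t\<^sub>0 + e"] e obtain a where a: "P a" "t\<^sub>0 < a" "a < t\<^sub>0 + e" by auto
    \<comment> \<open>The end time is rational because \<open>AE_energy_step\<close> covers only
      such end times.\<close>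
    obtain c where c: "c \<in> \<rat>" "b - e < c" "c < b" using Rats_dense_in_real[of "b - e" b] e(1) by auto
    have int: "x \<in> interior I" if "a \<le> x" "x \<le> c" for x
      using interior_between[OF t0_in b, of x] that a c by simp
    have ac: "a < c" using a c e by linarith
    have "AE u in \<rho>. u \<in> US \<and> (\<forall>b\<in>\<rat> \<inter> interior I. a < b \<longrightarrow> energy_step u a b)"
      using a(1) int[of a] ac by (simp add: P_def)
    then have en: "AE u in \<rho>. u \<in> US \<and> energy_step u a c"
      by eventually_elim (use int[of c] c(1) ac in auto)
    have "{a..c} \<subseteq> interior I" using int by auto
    from mean_dissipation[OF ac this en]
    have "ennreal (2 * \<nu>) * (\<integral>\<^sup>+s. mean_enstrophy s \<partial>lebesgue_on {a..c}) \<le>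
      mean_energy a + ennreal (2 * Cf) * (\<integral>\<^sup>+s. 1 + mean_energy s \<partial>lebesgue_on {a..c})" .
    also have "\<dots> \<le> K" unfolding K_def
      by (intro add_mono mult_left_mono nn_integral_Icc_mono) (use a c e in \<open>auto simp: P_def\<close>)
    finally have 1: "ennreal (2 * \<nu>) * (\<integral>\<^sup>+s. mean_enstrophy s \<partial>lebesgue_on {a..c}) \<le> K" .
    have "(\<integral>\<^sup>+s. mean_enstrophy s \<partial>lebesgue_on {t\<^sub>0 + e..b - e}) \<le> (\<integral>\<^sup>+s. mean_enstrophy s \<partial>lebesgue_on {a..c})"
      by (rule nn_integral_Icc_mono) (use a c in auto)
    from order_trans[OF mult_left_mono[OF this] 1] show ?thesis by simp
  qed
  have le': "(\<integral>\<^sup>+s. mean_enstrophy s \<partial>lebesgue_on {t\<^sub>0 + e..b - e}) \<le> ennreal (1 / (2 * \<nu>)) * K" if e: "0 < e" "t\<^sub>0 + e \<le> b - e" for e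
  proof -
    have "ennreal (1 / (2 * \<nu>)) * (ennreal (2 * \<nu>) * X) = X" for X
      using nu by (simp add: mult.assoc[symmetric] ennreal_mult'[symmetric])
    with mult_left_mono[OF le[OF e], of "ennreal (1 / (2 * \<nu>))"] show ?thesis by simp
  qed
  have "(\<integral>\<^sup>+s. mean_enstrophy s \<partial>lebesgue_on {t\<^sub>0..b}) \<le> ennreal (1 / (2 * \<nu>)) * K"
    by (rule nn_integral_Icc_exhaust[OF mean_measurable(2)[OF sub Icc_sets] le'])
  also have "\<dots> < \<infinity>" using K by (simp add: ennreal_mult_less_top)
  finally show ?thesis .
qed

lemma mean_enstrophy_integral_Icc:
  assumes "{a..b} \<subseteq> I"
  shows "(\<integral>\<^sup>+s. mean_enstrophy s \<partial>lebesgue_on {a..b}) < \<infinity>"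
proof (cases "a \<le> b")
  case True
  then have ab: "a \<in> I" "b \<in> I" using assms by auto
  have "(\<integral>\<^sup>+s. mean_enstrophy s \<partial>lebesgue_on {a..b}) \<le> (\<integral>\<^sup>+s. mean_enstrophy s \<partial>lebesgue_on {t\<^sub>0..b})"
    by (rule nn_integral_Icc_mono) (use t0_le[OF ab(1)] in auto)
  with mean_enstrophy_integral[OF ab(2)] show ?thesis by (rule order.strict_trans1[rotated])
qed (simp add: nn_integral_restrict_space)

section \<open>Paths of finite energy and admissible starting times\<close>

definition good_path :: "(real \<Rightarrow> l2_field) \<Rightarrow> bool" where
  "good_path u \<longleftrightarrow> u \<in> US \<and> (\<forall>a b. {a..b} \<subseteq> I \<longrightarrow> fin_energy u a b)"

text \<open>A finite mean leaves only a null set of paths with infinite energy, for each of the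
  countably many intervals of the exhaustion; every compact interval in \<open>I\<close> lies in one
  of them.\<close>

lemma AE_good_path: "AE u in \<rho>. good_path u"
proof -
  obtain \<beta> :: "nat \<Rightarrow> real" where \<beta>: "\<And>n. \<beta> n \<in> I" "\<And>x. x \<in> I \<Longrightarrow> \<exists>n. x \<le> \<beta> n" using exhaustion by blast
  have sub: "{t\<^sub>0..\<beta> n} \<subseteq> I" for n using interval_mem[OF t0_in \<beta>(1)] by auto
  have gm: "(\<lambda>x. ennreal ((norm x)\<^sup>2) + enstrophy D x) \<in> borel_measurable (H_borel D)"
    by (intro borel_measurable_add norm_sq_H_borel enstrophy_H_borel)
  have "AE u in \<rho>. fin_energy u t\<^sub>0 (\<beta> n)" for n
  proof -
    let ?L = "lebesgue_on {t\<^sub>0..\<beta> n}"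
    have "(\<integral>\<^sup>+u. (\<integral>\<^sup>+s. ennreal ((norm (u s))\<^sup>2) + enstrophy D (u s) \<partial>?L) \<partial>\<rho>) =
      (\<integral>\<^sup>+s. (\<integral>\<^sup>+u. ennreal ((norm (u s))\<^sup>2) + enstrophy D (u s) \<partial>\<rho>) \<partial>?L)"
      by (rule nn_integral_time_path_swap(1)[OF sub Icc_sets gm])
    also have "\<dots> = (\<integral>\<^sup>+s. mean_energy s + mean_enstrophy s \<partial>?L)"
    proof (rule nn_integral_cong)
      fix s assume "s \<in> space ?L"
      then have s: "s \<in> I" using sub[of n] by (auto simp: space_restrict_space)
      show "(\<integral>\<^sup>+u. ennreal ((norm (u s))\<^sup>2) + enstrophy D (u s) \<partial>\<rho>) = mean_energy s + mean_enstrophy s"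
        unfolding mean_energy_def mean_enstrophy_def
        by (rule nn_integral_add[OF measurable_compose[OF eval_measurable[OF s] norm_sq_H_borel] measurable_compose[OF eval_measurable[OF s] enstrophy_H_borel]])
    qed
    also have "\<dots> = (\<integral>\<^sup>+s. mean_energy s \<partial>?L) + (\<integral>\<^sup>+s. mean_enstrophy s \<partial>?L)"
      by (rule nn_integral_add[OF mean_measurable[OF sub Icc_sets]])
    also have "\<dots> < \<infinity>"
    proof -
      have "(\<integral>\<^sup>+s. mean_energy s \<partial>?L) \<le> (\<integral>\<^sup>+s. 1 + mean_energy s \<partial>?L)" by (intro nn_integral_mono) simp
      from order.strict_trans1[OF this mean_energy_integral[OF sub]] mean_enstrophy_integral_Icc[OF sub]
      show ?thesis by simp
    qed
    finally have "(\<integral>\<^sup>+u. (\<integral>\<^sup>+s. ennreal ((norm (u s))\<^sup>2) + enstrophy D (u s) \<partial>?L) \<partial>\<rho>) \<noteq> \<infinity>" by simp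
    from nn_integral_noteq_infinite[OF nn_integral_time_path_swap(3)[OF sub Icc_sets gm] this]
    show ?thesis by eventually_elim (simp add: fin_energy_def less_top)
  qed
  then have "AE u in \<rho>. \<forall>n. fin_energy u t\<^sub>0 (\<beta> n)" by (simp add: AE_all_countable)
  with carried show ?thesis
  proof eventually_elim
    case (elim u)
    have "fin_energy u a b" if ab: "{a..b} \<subseteq> I" for a b
    proof (cases "a \<le> b")
      case True
      then have "a \<in> I" "b \<in> I" using ab by auto
      then obtain n where n: "t\<^sub>0 \<le> a" "b \<le> \<beta> n" using \<beta>(2) t0_le by blast
      have "(\<integral>\<^sup>+s. ennreal ((norm (u s))\<^sup>2) + enstrophy D (u s) \<partial>lebesgue_on {a..b}) \<le> (\<integral>\<^sup>+s. ennreal ((norm (u s))\<^sup>2) + enstrophy D (u s) \<partial>lebesgue_on {t\<^sub>0..\<beta> n})"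
        by (rule nn_integral_Icc_mono) (use n in auto)
      with elim show ?thesis unfolding fin_energy_def by (meson order.strict_trans1)
    qed (simp add: fin_energy_def nn_integral_restrict_space)
    with elim show ?case by (simp add: good_path_def)
  qed
qed

definition energy_start :: "(real \<Rightarrow> l2_field) \<Rightarrow> real \<Rightarrow> bool" where
  "energy_start u a \<longleftrightarrow> (\<forall>b\<in>I. a < b \<longrightarrow> energy_step u a b)"

text \<open>Used with \<open>B\<close> the whole line for a single path and with \<open>B\<close>
  the rationals under the measure; in both cases the end times grow from the interior to all of
  \<open>I\<close>, including a right end point.\<close>

lemma energy_start_extend:
  assumes u: "good_path u" and a: "a \<in> I" and B: "\<And>x y. x < y \<Longrightarrow> \<exists>z\<in>B. x < z \<and> z < y"
    and en: "\<And>b. b \<in> B \<inter> interior I \<Longrightarrow> a < b \<Longrightarrow> energy_step u a b"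
  shows "energy_start u a"
  unfolding energy_start_def
proof (intro ballI impI)
  fix b assume b: "b \<in> I" "a < b"
  have sub: "{a..b} \<subseteq> I" using interval_mem[OF a b(1)] by auto
  have "(norm (u b))\<^sup>2 - (norm (u a))\<^sup>2 \<le> (LINT s:{a..b}|lebesgue. energy_rate u s)"
  proof (rule energy_extend[OF US_D(1) a b _ B])
    show "u \<in> US" "fin_energy u a b" using u sub by (auto simp: good_path_def)
    fix c assume "c \<in> B" "a < c" "c < b"
    then show "(norm (u c))\<^sup>2 - (norm (u a))\<^sup>2 \<le> (LINT s:{a..c}|lebesgue. energy_rate u s)"
      using en[of c] interior_between[OF a b(1), of c] by (auto simp: energy_step_def)
  qed
  then show "energy_step u a b" by (simp add: energy_step_def)
qed

text \<open>The exceptional times here depend on the path. That is enough for the nodes of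
  partitions along this path, whereas the starting time in the mean inequality needs the
  path-independent set \<open>good_times\<close>.\<close>

lemma good_path_AE_energy_start:
  assumes u: "good_path u"
  shows "AE a in lebesgue_on I. energy_start u a"
  unfolding AE_interior_iff
proof -
  have US: "u \<in> US" using u by (simp add: good_path_def)
  have sp: "AE a in lebesgue_on (interior I). a \<in> interior I" unfolding AE_lebesgue_on[OF interior_I(4)] by simp
  from US_energy_interior[OF US] sp show "AE a in lebesgue_on (interior I). energy_start u a"
  proof eventually_elim
    case (elim a)
    show ?case
      by (rule energy_start_extend[OF u, of _ UNIV]) (use elim interior_I(1) dense in \<open>auto simp: energy_step_def\<close>)
  qed
qed

text \<open>Chosen before \<psi>, so one set serves every energy function. The finite mean energy
  makes \<psi> of the squared norm integrable at the starting time, as \<psi> grows at most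
  linearly.\<close>

definition good_times :: "real set" where
  "good_times = {a \<in> I. (AE u in \<rho>. energy_start u a) \<and> mean_energy a < \<infinity>}"

lemma good_times_full: "I - good_times \<in> null_sets lebesgue"
proof -
  have "AE a in lebesgue_on I. AE u in \<rho>. energy_start u a"
    unfolding AE_interior_iff
  proof -
    have sp: "AE a in lebesgue_on (interior I). a \<in> interior I" unfolding AE_lebesgue_on[OF interior_I(4)] by simp
    from AE_energy_step sp show "AE a in lebesgue_on (interior I). AE u in \<rho>. energy_start u a"
    proof eventually_elim
      case (elim a)
      from elim(1) AE_good_path show ?case
      proof eventually_elim
        case (elim u)
        show ?case
          by (rule energy_start_extend[OF elim(2), of _ \<rat>]) (use elim(1) \<open>a \<in> interior I\<close> interior_I(1) Rats_dense_in_real in auto)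
      qed
    qed
  qed
  with mean_energy_finite have "AE a in lebesgue. a \<notin> I - good_times"
    unfolding AE_lebesgue_on[OF I_lebesgue] by eventually_elim (auto simp: good_times_def)
  then show ?thesis unfolding completion.null_sets_iff_AE by simp
qed

section \<open>The statistical solution\<close>

abbreviation \<mu> :: "real \<Rightarrow> l2_field measure" where "\<mu> \<equiv> time_projection D \<rho>"

lemma projection_sets: "sets (\<mu> t) = sets (H_borel D)"
  by (simp add: time_projection_def)

lemma projection_prob: "t \<in> I \<Longrightarrow> prob_space (\<mu> t)"
  unfolding time_projection_def by (rule rho.prob_space_distr[OF eval_measurable])

lemma projection_integral:
  fixes g :: "l2_field \<Rightarrow> real"
  assumes "t \<in> I" "g \<in> borel_measurable (H_borel D)"
  shows "(\<integral>u. g u \<partial>\<mu> t) = (\<integral>u. g (u t) \<partial>\<rho>)" "integrable (\<mu> t) g \<longleftrightarrow> integrable \<rho> (\<lambda>u. g (u t))"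
  unfolding time_projection_def using integral_distr[OF eval_measurable] integrable_distr_eq[OF eval_measurable] assms by blast+

lemma projection_nn_integral:
  assumes "t \<in> I" "g \<in> borel_measurable (H_borel D)"
  shows "(\<integral>\<^sup>+u. g u \<partial>\<mu> t) = (\<integral>\<^sup>+u. g (u t) \<partial>\<rho>)"
  unfolding time_projection_def by (rule nn_integral_distr) (simp_all add: eval_measurable assms)

lemma projection_expectation_measurable:
  fixes \<Phi> :: "l2_field \<Rightarrow> real"
  assumes \<Phi>: "continuous_on (H_space D) \<Phi>"
  shows "(\<lambda>t. \<integral>u. \<Phi> u \<partial>\<mu> t) \<in> borel_measurable (lebesgue_on I)"
proof -
  note m = H_borel_continuous_measurable[OF \<Phi>]
  have "case_prod (\<lambda>t u. \<Phi> (u t)) \<in> borel_measurable (lebesgue_on I \<Otimes>\<^sub>M \<rho>)"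
    using measurable_compose[OF eval_pair_measurable[OF order_refl] m] by (simp add: case_prod_beta')
  then have "(\<lambda>t. \<integral>u. \<Phi> (u t) \<partial>\<rho>) \<in> borel_measurable (lebesgue_on I)" by (rule rho.borel_measurable_lebesgue_integral)
  also have "?this \<longleftrightarrow> ?thesis"
    by (rule measurable_cong) (simp add: space_restrict_space projection_integral(1)[OF _ m])
  finally show ?thesis .
qed

lemma projection_energy: "in_L_inf_loc I (\<lambda>t. \<integral>\<^sup>+u. ennreal ((norm u)\<^sup>2) \<partial>\<mu> t)"
proof -
  have eq: "(\<integral>\<^sup>+u. ennreal ((norm u)\<^sup>2) \<partial>\<mu> t) = mean_energy t" if "t \<in> I" for t
    unfolding mean_energy_def by (rule projection_nn_integral[OF that norm_sq_H_borel])
  show ?thesis unfolding in_L_inf_loc_def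
  proof (intro conjI allI impI)
    have "mean_energy \<in> borel_measurable (lebesgue_on I)" by (rule mean_measurable) simp_all
    also have "?this \<longleftrightarrow> (\<lambda>t. \<integral>\<^sup>+u. ennreal ((norm u)\<^sup>2) \<partial>\<mu> t) \<in> borel_measurable (lebesgue_on I)"
      by (rule measurable_cong) (simp add: space_restrict_space eq)
    finally show "(\<lambda>t. \<integral>\<^sup>+u. ennreal ((norm u)\<^sup>2) \<partial>\<mu> t) \<in> borel_measurable (lebesgue_on I)" .
    fix a b assume sub: "{a..b} \<subseteq> I"
    obtain C :: real where "AE t in lebesgue_on {a..b}. mean_energy t \<le> ennreal C" using mean_energy_bound[OF sub] by blast
    then have "AE t in lebesgue_on {a..b}. (\<integral>\<^sup>+u. ennreal ((norm u)\<^sup>2) \<partial>\<mu> t) \<le> ennreal C"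
      unfolding AE_lebesgue_on[OF Icc_sets] by eventually_elim (use sub eq in auto)
    then show "\<exists>C::real. AE t in lebesgue_on {a..b}. (\<integral>\<^sup>+u. ennreal ((norm u)\<^sup>2) \<partial>\<mu> t) \<le> ennreal C" by blast
  qed
qed

lemma projection_enstrophy: "in_L1_loc I (\<lambda>t. \<integral>\<^sup>+u. enstrophy D u \<partial>\<mu> t)"
proof -
  have eq: "(\<integral>\<^sup>+u. enstrophy D u \<partial>\<mu> t) = mean_enstrophy t" if "t \<in> I" for t
    unfolding mean_enstrophy_def by (rule projection_nn_integral[OF that enstrophy_H_borel])
  show ?thesis unfolding in_L1_loc_def
  proof (intro conjI allI impI)
    have "mean_enstrophy \<in> borel_measurable (lebesgue_on I)" by (rule mean_measurable) simp_all
    also have "?this \<longleftrightarrow> (\<lambda>t. \<integral>\<^sup>+u. enstrophy D u \<partial>\<mu> t) \<in> borel_measurable (lebesgue_on I)"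
      by (rule measurable_cong) (simp add: space_restrict_space eq)
    finally show "(\<lambda>t. \<integral>\<^sup>+u. enstrophy D u \<partial>\<mu> t) \<in> borel_measurable (lebesgue_on I)" .
    fix a b assume sub: "{a..b} \<subseteq> I"
    have "(\<integral>\<^sup>+t\<in>{a..b}. (\<integral>\<^sup>+u. enstrophy D u \<partial>\<mu> t) \<partial>lebesgue) = (\<integral>\<^sup>+t. (\<integral>\<^sup>+u. enstrophy D u \<partial>\<mu> t) \<partial>lebesgue_on {a..b})"
      by (rule nn_integral_restrict_space[symmetric]) simp
    also have "\<dots> = (\<integral>\<^sup>+t. mean_enstrophy t \<partial>lebesgue_on {a..b})"
      by (rule nn_integral_cong) (use eq sub in \<open>auto simp: space_restrict_space\<close>)
    also have "\<dots> < \<infinity>" by (rule mean_enstrophy_integral_Icc[OF sub])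
    finally show "(\<integral>\<^sup>+t\<in>{a..b}. (\<integral>\<^sup>+u. enstrophy D u \<partial>\<mu> t) \<partial>lebesgue) < \<infinity>" .
  qed
qed

section \<open>Exchange of time integrals and path averages\<close>

lemma mean_growth:
  assumes sub: "{a..b} \<subseteq> I"
  shows "(\<integral>\<^sup>+s. (\<integral>\<^sup>+u. ennreal (1 + (norm (u s))\<^sup>2 + h1sq (u s)) \<partial>\<rho>) \<partial>lebesgue_on {a..b}) < \<infinity>"
proof -
  have "(\<integral>\<^sup>+s. (\<integral>\<^sup>+u. ennreal (1 + (norm (u s))\<^sup>2 + h1sq (u s)) \<partial>\<rho>) \<partial>lebesgue_on {a..b}) \<le>
    (\<integral>\<^sup>+s. (1 + mean_energy s) + mean_enstrophy s \<partial>lebesgue_on {a..b})"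
  proof (rule nn_integral_mono)
    fix s assume "s \<in> space (lebesgue_on {a..b})"
    then have s: "s \<in> I" using sub by (auto simp: space_restrict_space)
    note m = measurable_compose[OF eval_measurable[OF s] norm_sq_H_borel] measurable_compose[OF eval_measurable[OF s] enstrophy_H_borel]
    have "(\<integral>\<^sup>+u. ennreal (1 + (norm (u s))\<^sup>2 + h1sq (u s)) \<partial>\<rho>) \<le> (\<integral>\<^sup>+u. (1 + ennreal ((norm (u s))\<^sup>2)) + enstrophy D (u s) \<partial>\<rho>)"
    proof (rule nn_integral_mono)
      fix u
      have "ennreal (1 + (norm (u s))\<^sup>2 + h1sq (u s)) = (1 + ennreal ((norm (u s))\<^sup>2)) + ennreal (h1sq (u s))"
        using h1sq_nonneg[of "u s"] by simp
      also have "\<dots> \<le> (1 + ennreal ((norm (u s))\<^sup>2)) + enstrophy D (u s)" by (intro add_left_mono h1sq_le_enstrophy)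
      finally show "ennreal (1 + (norm (u s))\<^sup>2 + h1sq (u s)) \<le> (1 + ennreal ((norm (u s))\<^sup>2)) + enstrophy D (u s)" .
    qed
    also have "\<dots> = (\<integral>\<^sup>+u. 1 + ennreal ((norm (u s))\<^sup>2) \<partial>\<rho>) + mean_enstrophy s"
      unfolding mean_enstrophy_def by (rule nn_integral_add[OF borel_measurable_add[OF borel_measurable_const m(1)] m(2)])
    also have "(\<integral>\<^sup>+u. 1 + ennreal ((norm (u s))\<^sup>2) \<partial>\<rho>) = 1 + mean_energy s"
      unfolding mean_energy_def using nn_integral_add[OF borel_measurable_const[of 1] m(1)] by (simp add: rho.emeasure_space_1)
    finally show "(\<integral>\<^sup>+u. ennreal (1 + (norm (u s))\<^sup>2 + h1sq (u s)) \<partial>\<rho>) \<le> (1 + mean_energy s) + mean_enstrophy s" .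
  qed
  also have "\<dots> = (\<integral>\<^sup>+s. 1 + mean_energy s \<partial>lebesgue_on {a..b}) + (\<integral>\<^sup>+s. mean_enstrophy s \<partial>lebesgue_on {a..b})"
    by (rule nn_integral_add[OF borel_measurable_add[OF borel_measurable_const mean_measurable(1)[OF sub Icc_sets]] mean_measurable(2)[OF sub Icc_sets]])
  also have "\<dots> < \<infinity>" using mean_energy_integral[OF sub] mean_enstrophy_integral_Icc[OF sub] by simp
  finally show ?thesis .
qed

text \<open>\<open>g\<close> is the integrand as the definition of a statistical solution writes it,
  \<open>G\<close> a jointly measurable version agreeing with it on all of \<open>H\<close> at
  almost every time. Both orientations are recorded, since the cylindrical identity is demanded for
  times in either order.\<close>

lemma time_fubini:
  fixes G g :: "real \<Rightarrow> l2_field \<Rightarrow> real"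
  assumes ab: "a \<le> b" "{a..b} \<subseteq> I"
    and G: "case_prod G \<in> borel_measurable (lebesgue_on I \<Otimes>\<^sub>M H_borel D)"
    and c: "0 \<le> c" "\<And>s x. \<bar>G s x\<bar> \<le> c * (1 + (norm x)\<^sup>2 + h1sq x)"
    and g: "AE s in lebesgue_on I. \<forall>x\<in>H_space D. g s x = G s x"
  shows "integrable \<rho> (\<lambda>u. LINT s:{a..b}|lebesgue. G s (u s))"
    and "iterated_integrable \<mu> a b g" "iterated_integrable \<mu> b a g"
    and "iterated_integral \<mu> a b g = (\<integral>u. (LINT s:{a..b}|lebesgue. G s (u s)) \<partial>\<rho>)"
    and "iterated_integral \<mu> b a g = - (\<integral>u. (LINT s:{a..b}|lebesgue. G s (u s)) \<partial>\<rho>)"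
proof -
  let ?L = "lebesgue_on {a..b}"
  interpret P: pair_sigma_finite ?L \<rho> by (rule time_path_sigma_finite[OF Icc_sets])
  have "(\<lambda>z. (fst z, snd z (fst z))) \<in> ?L \<Otimes>\<^sub>M \<rho> \<rightarrow>\<^sub>M lebesgue_on I \<Otimes>\<^sub>M H_borel D"
    by (intro measurable_Pair measurable_compose[OF measurable_fst id_lebesgue_on[OF ab(2)]] eval_pair_measurable[OF ab(2)])
  from measurable_compose[OF this G]
  have jm: "case_prod (\<lambda>s u. G s (u s)) \<in> borel_measurable (?L \<Otimes>\<^sub>M \<rho>)" by (simp add: case_prod_beta')
  have hm: "(\<lambda>x. ennreal (1 + (norm x)\<^sup>2 + h1sq x)) \<in> borel_measurable (H_borel D)" by measurable
  have "(\<integral>\<^sup>+z. ennreal (norm (case_prod (\<lambda>s u. G s (u s)) z)) \<partial>(?L \<Otimes>\<^sub>M \<rho>)) = (\<integral>\<^sup>+s. (\<integral>\<^sup>+u. ennreal \<bar>G s (u s)\<bar> \<partial>\<rho>) \<partial>?L)"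
    using rho.nn_integral_fst[OF measurable_compose[OF measurable_compose[OF jm borel_measurable_norm] measurable_ennreal], symmetric] by simp
  also have "\<dots> \<le> (\<integral>\<^sup>+s. ennreal c * (\<integral>\<^sup>+u. ennreal (1 + (norm (u s))\<^sup>2 + h1sq (u s)) \<partial>\<rho>) \<partial>?L)"
  proof (rule nn_integral_mono)
    fix s assume "s \<in> space ?L"
    then have s: "s \<in> I" using ab(2) by (auto simp: space_restrict_space)
    have "(\<integral>\<^sup>+u. ennreal \<bar>G s (u s)\<bar> \<partial>\<rho>) \<le> (\<integral>\<^sup>+u. ennreal c * ennreal (1 + (norm (u s))\<^sup>2 + h1sq (u s)) \<partial>\<rho>)"
      by (rule nn_integral_mono) (use c in \<open>simp add: ennreal_mult'[symmetric] ennreal_leI\<close>)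
    also have "\<dots> = ennreal c * (\<integral>\<^sup>+u. ennreal (1 + (norm (u s))\<^sup>2 + h1sq (u s)) \<partial>\<rho>)"
      by (rule nn_integral_cmult[OF measurable_compose[OF eval_measurable[OF s] hm]])
    finally show "(\<integral>\<^sup>+u. ennreal \<bar>G s (u s)\<bar> \<partial>\<rho>) \<le> ennreal c * (\<integral>\<^sup>+u. ennreal (1 + (norm (u s))\<^sup>2 + h1sq (u s)) \<partial>\<rho>)" .
  qed
  also have "\<dots> = ennreal c * (\<integral>\<^sup>+s. (\<integral>\<^sup>+u. ennreal (1 + (norm (u s))\<^sup>2 + h1sq (u s)) \<partial>\<rho>) \<partial>?L)"
    by (rule nn_integral_cmult[OF nn_integral_time_path_swap(2)[OF ab(2) Icc_sets hm]])
  also have "\<dots> < \<infinity>" using mean_growth[OF ab(2)] by (simp add: ennreal_mult_less_top)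
  finally have int: "integrable (?L \<Otimes>\<^sub>M \<rho>) (case_prod (\<lambda>s u. G s (u s)))" by (intro integrableI_bounded jm)
  have LI: "(LINT s:{a..b}|lebesgue. G s (u s)) = (\<integral>s. G s (u s) \<partial>?L)" for u by (rule set_integral_lebesgue_on(1))
  show "integrable \<rho> (\<lambda>u. LINT s:{a..b}|lebesgue. G s (u s))" unfolding LI by (rule P.integrable_snd[OF int])
  have Gm: "G s \<in> borel_measurable (H_borel D)" if "s \<in> I" for s
    using measurable_Pair2[OF G, of s] that by (simp add: space_restrict_space)
  have eq: "(\<integral>x. g s x \<partial>\<mu> s) = (\<integral>u. G s (u s) \<partial>\<rho>)" "integrable (\<mu> s) (g s) \<longleftrightarrow> integrable \<rho> (\<lambda>u. G s (u s))"
    if s: "s \<in> I" "\<forall>x\<in>H_space D. g s x = G s x" for s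
  proof -
    have sp: "space (\<mu> s) = H_space D" using sets_eq_imp_space_eq[OF projection_sets[of s]] by (simp add: space_H_borel)
    have "(\<integral>x. g s x \<partial>\<mu> s) = (\<integral>x. G s x \<partial>\<mu> s)" by (rule Bochner_Integration.integral_cong) (use s sp in auto)
    then show "(\<integral>x. g s x \<partial>\<mu> s) = (\<integral>u. G s (u s) \<partial>\<rho>)" by (simp add: projection_integral(1)[OF s(1) Gm[OF s(1)]])
    have "integrable (\<mu> s) (g s) \<longleftrightarrow> integrable (\<mu> s) (G s)" by (rule Bochner_Integration.integrable_cong) (use s sp in auto)
    then show "integrable (\<mu> s) (g s) \<longleftrightarrow> integrable \<rho> (\<lambda>u. G s (u s))" by (simp add: projection_integral(2)[OF s(1) Gm[OF s(1)]])
  qed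
  define k where "k s = (\<integral>x. g s x \<partial>\<mu> s)" for s
  define k' where "k' s = (\<integral>u. G s (u s) \<partial>\<rho>)" for s
  have gL: "AE s in ?L. s \<in> I \<and> (\<forall>x\<in>H_space D. g s x = G s x)"
  proof -
    have "AE s in ?L. s \<in> I" unfolding AE_lebesgue_on[OF Icc_sets] using ab(2) by (intro AE_I2) blast
    with AE_lebesgue_on_mono[OF g ab(2) I_lebesgue Icc_sets] show ?thesis by eventually_elim simp
  qed
  have AE_int: "AE s in ?L. integrable (\<mu> s) (g s)"
    using gL P.AE_integrable_fst[OF int] by eventually_elim (simp add: eq(2))
  have k'int: "integrable ?L k'" unfolding k'_def[abs_def] by (rule P.integrable_fst[OF int])
  have kk': "AE s in ?L. k s = k' s" using gL by eventually_elim (simp add: k_def k'_def eq(1))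
  have k'm: "(\<lambda>s. indicator {a..b} s *\<^sub>R k' s) \<in> borel_measurable lebesgue"
    using k'int unfolding set_integral_lebesgue_on(2)[symmetric] set_integrable_def by (rule borel_measurable_integrable)
  have ae: "AE s in lebesgue. indicator {a..b} s *\<^sub>R k' s = indicator {a..b} s *\<^sub>R k s"
    using kk' unfolding AE_lebesgue_on[OF Icc_sets] by eventually_elim (auto simp: indicator_def)
  have km: "(\<lambda>s. indicator {a..b} s *\<^sub>R k s) \<in> borel_measurable lebesgue" by (rule borel_measurable_AE[OF k'm ae])
  have kint: "integrable ?L k"
    unfolding set_integral_lebesgue_on(2)[symmetric] set_integrable_def
    by (rule integrable_cong_AE_imp[OF _ km ae])
      (use k'int in \<open>simp add: set_integral_lebesgue_on(2)[symmetric] set_integrable_def\<close>)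
  have seg: "closed_segment a b = {a..b}" "closed_segment b a = {a..b}"
    using ab(1) by (simp_all add: closed_segment_eq_real_ivl)
  show "iterated_integrable \<mu> a b g" "iterated_integrable \<mu> b a g"
    unfolding iterated_integrable_def seg using AE_int kint by (auto simp: k_def[abs_def])
  \<comment> \<open>The oriented integral is taken over the open interval, the path integrals over
    the closed one; the end points form a null set.\<close>
  have "(LINT s:{a<..<b}|lebesgue. k s) = (LINT s:{a..b}|lebesgue. k s)"
    unfolding set_lebesgue_integral_def
  proof (rule integral_cong_AE)
    have "AE s in lebesgue. s \<noteq> a" "AE s in lebesgue. s \<noteq> b" by (rule AE_completion[OF AE_lborel_singleton])+
    then show "AE s in lebesgue. indicator {a<..<b} s *\<^sub>R k s = indicator {a..b} s *\<^sub>R k s"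
      by eventually_elim (auto simp: indicator_def)
    have "(\<lambda>s. indicator {a<..<b} s * (indicator {a..b} s *\<^sub>R k s)) \<in> borel_measurable lebesgue"
      by (intro borel_measurable_times km borel_measurable_indicator) simp
    also have "(\<lambda>s. indicator {a<..<b} s * (indicator {a..b} s *\<^sub>R k s)) = (\<lambda>s. indicator {a<..<b} s *\<^sub>R k s)"
      by (auto simp: indicator_def fun_eq_iff)
    finally show "(\<lambda>s. indicator {a<..<b} s *\<^sub>R k s) \<in> borel_measurable lebesgue" .
  qed (rule km)
  also have "\<dots> = (LINT s:{a..b}|lebesgue. k' s)" by (rule set_lebesgue_integral_cong_AE_lebesgue[OF kk' Icc_sets k'm])
  also have "\<dots> = (\<integral>s. k' s \<partial>?L)" by (rule set_integral_lebesgue_on(1))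
  also have "\<dots> = (\<integral>u. (\<integral>s. G s (u s) \<partial>?L) \<partial>\<rho>)"
    unfolding k'_def using P.integral_fst[OF int] P.integral_snd[OF int] by simp
  finally have val: "(LINT s:{a<..<b}|lebesgue. k s) = (\<integral>u. (LINT s:{a..b}|lebesgue. G s (u s)) \<partial>\<rho>)" unfolding LI .
  show "iterated_integral \<mu> a b g = (\<integral>u. (LINT s:{a..b}|lebesgue. G s (u s)) \<partial>\<rho>)"
    unfolding iterated_integral_def k_def[symmetric] using ab(1) val by (simp add: interval_lebesgue_integral_le_eq)
  show "iterated_integral \<mu> b a g = - (\<integral>u. (LINT s:{a..b}|lebesgue. G s (u s)) \<partial>\<rho>)"
  \<comment> \<open>For equal end points the integral counts as forward oriented and is zero, so the
    sign is immaterial.\<close>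
  proof (cases "a = b")
    case True
    then show ?thesis unfolding iterated_integral_def k_def[symmetric] val[symmetric]
      by (simp add: interval_lebesgue_integral_le_eq set_lebesgue_integral_def)
  next
    case False
    then show ?thesis unfolding iterated_integral_def k_def[symmetric] val[symmetric] using ab(1)
      by (simp add: interval_lebesgue_integral_def)
  qed
qed

text \<open>Compact support bounds \<phi> and its partial derivatives, so the chain rule along a
  path has an integrand of quadratic growth and may be averaged. Backward times follow from the
  forward identity with the roles exchanged.\<close>

lemma projection_cylindrical:
  assumes cyl: "cylindrical D \<Phi> d\<Phi>" and t: "t' \<in> I" "t \<in> I"
  defines "g \<equiv> \<lambda>s u. indicator (V_space D) u * NS_rhs D \<nu> f s u (d\<Phi> u)"
  shows "iterated_integrable \<mu> t' t g \<and> (\<integral>u. \<Phi> u \<partial>\<mu> t) = (\<integral>u. \<Phi> u \<partial>\<mu> t') + iterated_integral \<mu> t' t g"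
proof -
  obtain k \<phi> d\<phi> v where \<phi>: "C1_compact_support k \<phi> d\<phi>" and v: "\<And>j. j < k \<Longrightarrow> v j \<in> V_space D"
    and \<Phi>: "\<Phi> = (\<lambda>u. \<phi> (\<lambda>j. if j < k then u \<bullet> v j else 0))"
    and d\<Phi>: "d\<Phi> = (\<lambda>u. \<Sum>j<k. d\<phi> j (\<lambda>j. if j < k then u \<bullet> v j else 0) *\<^sub>R v j)"
    using cyl unfolding cylindrical_def Let_def by blast
  define X where "X u = (\<lambda>j. if j < k then u \<bullet> v j else 0)" for u :: l2_field
  have X: "X u \<in> topspace (Euclidean_space k)" for u by (simp add: X_def topspace_Euclidean_space)
  have \<phi>c: "continuous_map (Euclidean_space k) euclideanreal \<phi>" and d\<phi>c: "\<And>j. j < k \<Longrightarrow> continuous_map (Euclidean_space k) euclideanreal (d\<phi> j)"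
    using \<phi> by (auto simp: C1_compact_support_def)
  have meas: "(\<lambda>u. h (X u)) \<in> borel_measurable (H_borel D)" if h: "continuous_map (Euclidean_space k) euclideanreal h" for h
  proof (rule H_borel_continuous_measurable)
    have "(\<lambda>n. h (X (x n))) \<longlonglongrightarrow> h (X a)" if "x \<longlonglongrightarrow> a" for x a
    proof (rule Euclidean_space_limit[OF h X X])
      show "(\<lambda>n. X (x n) i) \<longlonglongrightarrow> X a i" for i
        unfolding X_def using tendsto_inner[OF that tendsto_const] by (cases "i < k") auto
    qed
    then show "continuous_on (H_space D) (\<lambda>u. h (X u))" unfolding continuous_on_sequentially by (auto simp: o_def)
  qed
  obtain B where B: "0 \<le> B" "\<And>x. x \<in> topspace (Euclidean_space k) \<Longrightarrow> \<bar>\<phi> x\<bar> \<le> B"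
    using C1_compact_support_bounded(1)[OF \<phi>] by blast
  have "\<exists>c\<ge>0. \<forall>s x. \<bar>d\<phi> j (X x) * ns_rate (v j) s x\<bar> \<le> c * (1 + (norm x)\<^sup>2 + h1sq x)" if j: "j < k" for j
  proof -
    obtain B where B: "0 \<le> B" "\<And>x. x \<in> topspace (Euclidean_space k) \<Longrightarrow> \<bar>d\<phi> j x\<bar> \<le> B"
      using C1_compact_support_bounded(2)[OF \<phi> j] by blast
    obtain C where C: "0 \<le> C" "\<And>s x. \<bar>ns_rate (v j) s x\<bar> \<le> C * (1 + (norm x)\<^sup>2 + h1sq x)"
      using ns_rate_bound[OF v[OF j]] by blast
    have "\<bar>d\<phi> j (X x) * ns_rate (v j) s x\<bar> \<le> (B * C) * (1 + (norm x)\<^sup>2 + h1sq x)" for s x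
      unfolding abs_mult mult.assoc by (rule mult_mono[OF B(2)[OF X] C(2) B(1)]) simp
    with mult_nonneg_nonneg[OF B(1) C(1)] show ?thesis by blast
  qed
  then obtain c where c: "\<And>j. j < k \<Longrightarrow> 0 \<le> c j" "\<And>j s x. j < k \<Longrightarrow> \<bar>d\<phi> j (X x) * ns_rate (v j) s x\<bar> \<le> c j * (1 + (norm x)\<^sup>2 + h1sq x)"
    by metis
  \<comment> \<open>The right-hand side applied to the derivative of \<Phi>, expanded by linearity
    in the test direction so that each factor is separately measurable; \<open>NS_rhs_sum\<close>
    undoes the expansion.\<close>
  define G where "G s x = (\<Sum>j<k. d\<phi> j (X x) * ns_rate (v j) s x)" for s x
  have Gm: "case_prod G \<in> borel_measurable (lebesgue_on I \<Otimes>\<^sub>M H_borel D)"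
  proof -
    have "(\<lambda>z. d\<phi> j (X (snd z)) * ns_rate (v j) (fst z) (snd z)) \<in> borel_measurable (lebesgue_on I \<Otimes>\<^sub>M H_borel D)" if "j < k" for j
      by (intro borel_measurable_times measurable_compose[OF measurable_snd meas[OF d\<phi>c[OF that]]] ns_rate_joint[OF v[OF that]] measurable_fst measurable_snd)
    then have "(\<lambda>z. \<Sum>j<k. d\<phi> j (X (snd z)) * ns_rate (v j) (fst z) (snd z)) \<in> borel_measurable (lebesgue_on I \<Otimes>\<^sub>M H_borel D)"
      by (intro borel_measurable_sum) simp
    then show ?thesis by (simp add: G_def case_prod_beta')
  qed
  have Gb: "\<bar>G s x\<bar> \<le> (\<Sum>j<k. c j) * (1 + (norm x)\<^sup>2 + h1sq x)" for s x
  proof -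
    have "\<bar>G s x\<bar> \<le> (\<Sum>j<k. \<bar>d\<phi> j (X x) * ns_rate (v j) s x\<bar>)" unfolding G_def by (rule sum_abs)
    also have "\<dots> \<le> (\<Sum>j<k. c j * (1 + (norm x)\<^sup>2 + h1sq x))" by (intro sum_mono c(2)) simp
    finally show ?thesis by (simp add: sum_distrib_right)
  qed
  have c0: "0 \<le> (\<Sum>j<k. c j)" by (intro sum_nonneg c(1)) simp
  have gG: "AE s in lebesgue_on I. \<forall>x\<in>H_space D. g s x = G s x"
    using f_F
  proof eventually_elim
    case (elim s)
    show ?case
    proof
      fix x
      show "g s x = G s x"
      proof (cases "x \<in> V_space D")
        case True
        have "NS_rhs D \<nu> f s x (\<Sum>j<k. d\<phi> j (X x) *\<^sub>R v j) = (\<Sum>j<k. d\<phi> j (X x) * NS_rhs D \<nu> f s x (v j))"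
          by (rule NS_rhs_sum[OF True]) (simp_all add: v)
        also have "\<dots> = G s x" unfolding G_def
          by (rule sum.cong) (use True elim in \<open>simp_all add: ns_rate_def NS_rhs_def\<close>)
        finally show ?thesis using True by (simp add: g_def d\<Phi> X_def)
      qed (simp add: g_def G_def ns_rate_def)
    qed
  qed
  have \<Phi>m: "\<Phi> \<in> borel_measurable (H_borel D)" using meas[OF \<phi>c] by (simp add: \<Phi> X_def)
  have \<Phi>i: "integrable \<rho> (\<lambda>u. \<Phi> (u s))" if "s \<in> I" for s
  proof (rule rho.integrable_const_bound[of _ B])
    show "AE u in \<rho>. norm (\<Phi> (u s)) \<le> B" using B(2)[OF X] by (intro AE_I2) (simp add: \<Phi> X_def)
    show "(\<lambda>u. \<Phi> (u s)) \<in> borel_measurable \<rho>" by (rule measurable_compose[OF eval_measurable[OF that] \<Phi>m])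
  qed
  have path: "\<Phi> (u q) - \<Phi> (u p) = (LINT s:{p..q}|lebesgue. G s (u s))" if u: "good_path u" and pq: "p \<in> I" "q \<in> I" "p \<le> q" for u p q
  proof (cases "p = q")
    case True show ?thesis unfolding True set_integral_singleton by simp
  next
    case False
    then have lt: "p < q" using pq by simp
    have sub: "{x..y} \<subseteq> I" if "p \<le> x" "y \<le> q" for x y using interval_mem[OF pq(1,2)] that by auto
    have US: "u \<in> US" and fin: "\<And>x y. {x..y} \<subseteq> I \<Longrightarrow> fin_energy u x y" using u by (auto simp: good_path_def)
    have int: "set_integrable lebesgue {p..q} (\<lambda>s. ns_rate (v j) s (u s))" if "j < k" for j
      by (rule ns_rate_integrable[OF v[OF that] US_D(1)[OF US] sub fin]) (simp_all add: sub)
    have inc: "u b \<bullet> v j - u a \<bullet> v j = (LINT s:{a..b}|lebesgue. ns_rate (v j) s (u s))" if "j < k" "p \<le> a" "a \<le> b" "b \<le> q" for j a b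
      using that interval_mem[OF pq(1,2), of a] interval_mem[OF pq(1,2), of b]
      by (intro US_weak_identity[OF v US _ _ _ fin] sub) auto
    note chain = cylinder_chain[where x = "\<lambda>j s. u s \<bullet> v j" and g = "\<lambda>j s. ns_rate (v j) s (u s)", OF \<phi> lt int inc]
    have "\<Phi> (u q) - \<Phi> (u p) = (\<Sum>j<k. LINT s:{p..q}|lebesgue. d\<phi> j (X (u s)) * ns_rate (v j) s (u s))"
      using chain(1) by (simp add: \<Phi> X_def)
    also have "\<dots> = (LINT s:{p..q}|lebesgue. G s (u s))"
    proof -
      have "integrable lebesgue (\<lambda>s. indicator {p..q} s *\<^sub>R (d\<phi> j (X (u s)) * ns_rate (v j) s (u s)))" if "j < k" for j
        using chain(2)[OF _ _ _ _ _ that] that unfolding set_integrable_def X_def by simp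
      then show ?thesis unfolding set_lebesgue_integral_def G_def
        by (subst Bochner_Integration.integral_sum[symmetric]) (auto simp: sum_distrib_left)
    qed
    finally show ?thesis .
  qed
  have main: "(\<integral>u. \<Phi> u \<partial>\<mu> q) - (\<integral>u. \<Phi> u \<partial>\<mu> p) = (\<integral>u. (LINT s:{p..q}|lebesgue. G s (u s)) \<partial>\<rho>)" if pq: "p \<in> I" "q \<in> I" "p \<le> q" for p q
  proof -
    have sub: "{p..q} \<subseteq> I" using interval_mem[OF pq(1,2)] by auto
    note fub = time_fubini[OF pq(3) sub Gm c0 Gb gG]
    have "(\<integral>u. \<Phi> u \<partial>\<mu> q) - (\<integral>u. \<Phi> u \<partial>\<mu> p) = (\<integral>u. \<Phi> (u q) - \<Phi> (u p) \<partial>\<rho>)"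
      using pq \<Phi>i by (simp add: projection_integral(1)[OF _ \<Phi>m])
    also have "\<dots> = (\<integral>u. (LINT s:{p..q}|lebesgue. G s (u s)) \<partial>\<rho>)"
    proof (rule integral_cong_AE)
      show "AE u in \<rho>. \<Phi> (u q) - \<Phi> (u p) = (LINT s:{p..q}|lebesgue. G s (u s))"
        using AE_good_path by eventually_elim (rule path[OF _ pq])
    qed (use \<Phi>i pq fub(1) borel_measurable_integrable in auto)
    finally show ?thesis .
  qed
  show ?thesis
  proof (cases "t' \<le> t")
    case True
    have sub: "{t'..t} \<subseteq> I" using interval_mem[OF t] by auto
    note fub = time_fubini[OF True sub Gm c0 Gb gG]
    show ?thesis using fub(2,4) main[OF t True] by simp
  next
    case False
    then have le: "t \<le> t'" by simp
    have sub: "{t..t'} \<subseteq> I" using interval_mem[OF t(2,1)] by auto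
    note fub = time_fubini[OF le sub Gm c0 Gb gG]
    show ?thesis using fub(3,5) main[OF t(2,1) le] by simp
  qed
qed

section \<open>The mean energy inequality\<close>

lemma energy_function_measurable:
  assumes \<psi>: "energy_function \<psi> \<psi>'"
  shows "(\<lambda>u. \<psi> ((norm u)\<^sup>2)) \<in> borel_measurable (H_borel D)"
proof (rule H_borel_continuous_measurable)
  have "continuous_on {0..} \<psi>" by (rule DERIV_continuous_on) (use \<psi> in \<open>auto simp: energy_function_def\<close>)
  moreover have "continuous_on (H_space D) (\<lambda>u. (norm u)\<^sup>2)" by (intro continuous_intros)
  ultimately show "continuous_on (H_space D) (\<lambda>u. \<psi> ((norm u)\<^sup>2))"
    by (rule continuous_on_compose2) (simp add: image_subset_iff)
qed

text \<open>The chain rule is applied on each path from the common starting time \<open>t'\<close>,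
  with nodes from the path's own starting times. Mean energy is known to be finite at
  \<open>t'\<close> but not at an individual \<open>t\<close>, so integrability at \<open>t\<close>
  is obtained from the path inequality itself.\<close>

lemma projection_energy_inequality:
  assumes \<psi>: "energy_function \<psi> \<psi>'" and t': "t' \<in> good_times" and t: "t \<in> I" "t' \<le> t"
  defines "e \<equiv> \<lambda>u :: l2_field. \<psi> ((norm u)\<^sup>2)"
    and "g \<equiv> \<lambda>(s :: real) u. indicator (V_space D) u * (\<psi>' ((norm u)\<^sup>2) * (H1_norm D u)\<^sup>2)"
    and "h \<equiv> \<lambda>s u. \<psi>' ((norm u)\<^sup>2) * (f s \<bullet> u)"
  shows "integrable (\<mu> t) e \<and> integrable (\<mu> t') e \<and> iterated_integrable \<mu> t' t g \<and> iterated_integrable \<mu> t' t h \<and>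
    1/2 * (\<integral>u. e u \<partial>\<mu> t) + \<nu> * iterated_integral \<mu> t' t g \<le> 1/2 * (\<integral>u. e u \<partial>\<mu> t') + iterated_integral \<mu> t' t h"
proof -
  have t'I: "t' \<in> I" and st: "AE u in \<rho>. energy_start u t'" and fin: "mean_energy t' < \<infinity>"
    using t' by (auto simp: good_times_def)
  have sub: "{t'..t} \<subseteq> I" using interval_mem[OF t'I t(1)] by auto
  obtain B where B: "0 \<le> B" "\<And>r. 0 \<le> r \<Longrightarrow> \<bar>\<psi>' r\<bar> \<le> B" using energy_function_props(3)[OF \<psi>] by blast
  have \<psi>0: "0 \<le> \<psi> r" if "0 \<le> r" for r using \<psi> that by (auto simp: energy_function_def)
  \<comment> \<open>Linear growth, from the bound \<open>B\<close> on the derivative; it reduces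
    integrability at \<open>t'\<close> to finite mean energy.\<close>
  have \<psi>le: "\<psi> r \<le> \<psi> 0 + B * r" if r: "0 \<le> r" for r
  proof -
    obtain \<xi> where \<xi>: "min 0 r \<le> \<xi>" "\<psi> r - \<psi> 0 = \<psi>' \<xi> * (r - 0)" using energy_function_props(2)[OF \<psi>, of 0 r] r by blast
    have "\<psi>' \<xi> * r \<le> B * r" using B(2)[of \<xi>] \<xi>(1) r by (intro mult_right_mono) (auto simp: min_def)
    with \<xi>(2) show ?thesis by simp
  qed
  have sq: "continuous_on (H_space D) (\<lambda>u. (norm u)\<^sup>2)" by (intro continuous_intros)
  have em: "e \<in> borel_measurable (H_borel D)" unfolding e_def by (rule energy_function_measurable[OF \<psi>])
  have "continuous_on {0..} \<psi>'" using \<psi> by (simp add: energy_function_def)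
  from continuous_on_compose2[OF this sq] have dm: "(\<lambda>u. \<psi>' ((norm u)\<^sup>2)) \<in> borel_measurable (H_borel D)"
    by (intro H_borel_continuous_measurable) (simp add: image_subset_iff)
  define G where "G s x = \<psi>' ((norm x)\<^sup>2) * h1sq x" for s :: real and x
  define K where "K s x = \<psi>' ((norm x)\<^sup>2) * (F s \<bullet> x)" for s x
  have Gm: "case_prod G \<in> borel_measurable (lebesgue_on I \<Otimes>\<^sub>M H_borel D)"
    using borel_measurable_times[OF measurable_compose[OF measurable_snd dm] measurable_compose[OF measurable_snd h1sq_measurable], of "lebesgue_on I"]
    by (simp add: G_def case_prod_beta')
  have Km: "case_prod K \<in> borel_measurable (lebesgue_on I \<Otimes>\<^sub>M H_borel D)"
    using borel_measurable_times[OF measurable_compose[OF measurable_snd dm] H_inner_measurable[OF measurable_compose[OF measurable_fst F_meas] measurable_snd]]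
    by (simp add: K_def case_prod_beta')
  have Gb: "\<bar>G s x\<bar> \<le> B * (1 + (norm x)\<^sup>2 + h1sq x)" for s x
    unfolding G_def abs_mult by (rule mult_mono[OF B(2) _ B(1)]) (simp_all add: h1sq_nonneg)
  have Kb: "\<bar>K s x\<bar> \<le> (B * Cf) * (1 + (norm x)\<^sup>2 + h1sq x)" for s x
  proof -
    have "Cf * (1 + (norm x)\<^sup>2) \<le> Cf * (1 + (norm x)\<^sup>2 + h1sq x)"
      by (rule mult_left_mono[OF _ Cf_nonneg]) (simp add: h1sq_nonneg)
    with F_inner_bound[of s x] have "\<bar>F s \<bullet> x\<bar> \<le> Cf * (1 + (norm x)\<^sup>2 + h1sq x)" by linarith
    then show ?thesis unfolding K_def abs_mult mult.assoc by (intro mult_mono B) simp_all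
  qed
  have gG: "AE s in lebesgue_on I. \<forall>x\<in>H_space D. g s x = G s x"
    by (intro AE_I2) (simp add: g_def G_def h1sq_def)
  have hK: "AE s in lebesgue_on I. \<forall>x\<in>H_space D. h s x = K s x"
    using f_F by eventually_elim (simp add: h_def K_def)
  note fubG = time_fubini[OF t(2) sub Gm B(1) Gb gG]
  note fubK = time_fubini[OF t(2) sub Km mult_nonneg_nonneg[OF B(1) Cf_nonneg] Kb hK]
  have path: "\<psi> ((norm (u t))\<^sup>2) - \<psi> ((norm (u t'))\<^sup>2) \<le> 2 * (LINT s:{t'..t}|lebesgue. K s (u s)) - 2 * \<nu> * (LINT s:{t'..t}|lebesgue. G s (u s))"
    if u: "good_path u" and stu: "energy_start u t'" for u
  proof (cases "t' = t")
    case True show ?thesis unfolding True set_integral_singleton by simp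
  next
    case False
    then have lt: "t' < t" using t by simp
    have US: "u \<in> US" and fin: "fin_energy u t' t" using u sub by (auto simp: good_path_def)
    note p = US_D(1)[OF US]
    \<comment> \<open>\<open>t'\<close> belongs to this set by \<open>stu\<close>, which holds for
      almost every path because \<open>t'\<close> was taken from \<open>good_times\<close>; of the
      remaining times only almost all are known to belong.\<close>
    define \<G> where "\<G> = {s \<in> {t'..<t}. energy_start u s}"
    have nm: "(\<lambda>s. (norm (u s))\<^sup>2) \<in> borel_measurable (lebesgue_on {t'..t})"
      by (intro borel_measurable_power path_measurable(2)[OF p sub])
    have "\<psi> ((norm (u t))\<^sup>2) - \<psi> ((norm (u t'))\<^sup>2) \<le> (LINT s:{t'..t}|lebesgue. \<psi>' ((norm (u s))\<^sup>2) * energy_rate u s)"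
    proof (rule energy_chain(1)[OF \<psi> lt energy_parts_integrable(3)[OF p sub fin], where y = "\<lambda>s. (norm (u s))\<^sup>2" and G = \<G>])
      show "(\<lambda>s. indicator {t'..t} s * (norm (u s))\<^sup>2) \<in> borel_measurable lebesgue"
        using nm borel_measurable_restrict_space_iff[of "{t'..t}" lebesgue "\<lambda>s. (norm (u s))\<^sup>2"] by simp
      show "\<G> \<subseteq> {t'..<t}" "t' \<in> \<G>" using stu lt by (auto simp: \<G>_def)
      have "AE s in lebesgue. s \<noteq> t" by (rule AE_completion[OF AE_lborel_singleton])
      with good_path_AE_energy_start[OF u] show "AE s in lebesgue. s \<in> {t'..t} \<longrightarrow> s \<in> \<G>"
        unfolding AE_lebesgue_on[OF I_lebesgue] by eventually_elim (use sub in \<open>auto simp: \<G>_def\<close>)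
      fix a b assume "a \<in> \<G>" "a < b" "b \<le> t"
      moreover from this have "b \<in> I" using sub by (auto simp: \<G>_def)
      ultimately show "(norm (u b))\<^sup>2 - (norm (u a))\<^sup>2 \<le> (LINT s:{a..b}|lebesgue. energy_rate u s)"
        by (auto simp: \<G>_def energy_start_def energy_step_def)
    qed simp
    also have "\<dots> = (LINT s:{t'..t}|lebesgue. 2 * K s (u s) - 2 * \<nu> * G s (u s))"
      by (simp add: energy_rate_def K_def G_def algebra_simps)
    also have "\<dots> = 2 * (LINT s:{t'..t}|lebesgue. K s (u s)) - 2 * \<nu> * (LINT s:{t'..t}|lebesgue. G s (u s))"
    proof -
      have um: "(\<lambda>s. (s, u s)) \<in> lebesgue_on {t'..t} \<rightarrow>\<^sub>M lebesgue_on I \<Otimes>\<^sub>M H_borel D"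
        by (intro measurable_Pair id_lebesgue_on sub path_measurable(1)[OF p sub])
      have Gi: "set_integrable lebesgue {t'..t} (\<lambda>s. G s (u s))"
        by (rule set_integrable_dominated[OF p sub fin _ B(1)]) (use measurable_compose[OF um Gm] Gb in auto)
      have Ki: "set_integrable lebesgue {t'..t} (\<lambda>s. K s (u s))"
        by (rule set_integrable_dominated[OF p sub fin _ mult_nonneg_nonneg[OF B(1) Cf_nonneg]]) (use measurable_compose[OF um Km] Kb in auto)
      show ?thesis using Gi Ki by (subst set_integral_diff) (auto intro!: set_integrable_mult_right)
    qed
    finally show ?thesis .
  qed
  have AEpath: "AE u in \<rho>. e (u t) \<le> e (u t') + 2 * (LINT s:{t'..t}|lebesgue. K s (u s)) - 2 * \<nu> * (LINT s:{t'..t}|lebesgue. G s (u s))"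
    using AE_good_path st
  proof eventually_elim
    case (elim u)
    from path[OF elim] show ?case unfolding e_def by linarith
  qed
  have m: "(\<lambda>u. e (u s)) \<in> borel_measurable \<rho>" if "s \<in> I" for s by (rule measurable_compose[OF eval_measurable[OF that] em])
  have nm: "integrable \<rho> (\<lambda>u. (norm (u t'))\<^sup>2)"
  proof (rule integrableI_bounded)
    show "(\<lambda>u. (norm (u t'))\<^sup>2) \<in> borel_measurable \<rho>"
      by (intro borel_measurable_power measurable_compose[OF eval_measurable[OF t'I] H_borel_norm])
  qed (use fin in \<open>simp add: mean_energy_def\<close>)
  have e': "integrable \<rho> (\<lambda>u. e (u t'))"
  proof (rule Bochner_Integration.integrable_bound[OF _ m[OF t'I]])
    show "integrable \<rho> (\<lambda>u. \<psi> 0 + B * (norm (u t'))\<^sup>2)" using nm by simp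
    show "AE u in \<rho>. norm (e (u t')) \<le> norm (\<psi> 0 + B * (norm (u t'))\<^sup>2)"
    proof (intro AE_I2)
      fix u
      have "0 \<le> e (u t')" "e (u t') \<le> \<psi> 0 + B * (norm (u t'))\<^sup>2" using \<psi>0 \<psi>le by (simp_all add: e_def)
      then show "norm (e (u t')) \<le> norm (\<psi> 0 + B * (norm (u t'))\<^sup>2)" by simp
    qed
  qed
  have r: "integrable \<rho> (\<lambda>u. e (u t') + 2 * (LINT s:{t'..t}|lebesgue. K s (u s)) - 2 * \<nu> * (LINT s:{t'..t}|lebesgue. G s (u s)))"
    by (intro Bochner_Integration.integrable_diff Bochner_Integration.integrable_add integrable_mult_right e' fubG(1) fubK(1))
  \<comment> \<open>Nonnegativity of \<psi> makes the right-hand side of the path inequality an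
    integrable bound for the modulus.\<close>
  have et: "integrable \<rho> (\<lambda>u. e (u t))"
  proof (rule Bochner_Integration.integrable_bound[OF r m[OF t(1)]])
    show "AE u in \<rho>. norm (e (u t)) \<le> norm (e (u t') + 2 * (LINT s:{t'..t}|lebesgue. K s (u s)) - 2 * \<nu> * (LINT s:{t'..t}|lebesgue. G s (u s)))"
      using AEpath
    proof eventually_elim
      case (elim u)
      have "0 \<le> e (u t)" using \<psi>0 by (simp add: e_def)
      with elim show ?case by simp
    qed
  qed
  have "(\<integral>u. e (u t) \<partial>\<rho>) \<le> (\<integral>u. e (u t') + 2 * (LINT s:{t'..t}|lebesgue. K s (u s)) - 2 * \<nu> * (LINT s:{t'..t}|lebesgue. G s (u s)) \<partial>\<rho>)"
    by (rule integral_mono_AE[OF et r AEpath])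
  also have "\<dots> = (\<integral>u. e (u t') \<partial>\<rho>) + 2 * iterated_integral \<mu> t' t h - 2 * \<nu> * iterated_integral \<mu> t' t g"
    unfolding fubG(4) fubK(4) using e' fubG(1) fubK(1) by simp
  finally show ?thesis
    using et e' fubG(2) fubK(2) t(1) t'I by (simp add: projection_integral[OF _ em])
qed

end

theorem theorem3p3:
  fixes D :: flow_domain and \<nu> t\<^sub>0 :: real and I :: "real set"
    and f :: "real \<Rightarrow> l2_field" and \<rho> :: "(real \<Rightarrow> l2_field) measure"
  assumes "admissible D" and "0 < \<nu>"
    and "is_interval I" and "left_endpoint I t\<^sub>0"
    and "f \<in> L_inf I (H_borel D) norm"
    and "vishik_fursikov_measure D \<nu> f I \<rho>"
  shows "statistical_solution_with_data D \<nu> f I t\<^sub>0 (time_projection D \<rho> t\<^sub>0)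
    (\<lambda>t. time_projection D \<rho> t)"
proof -
  interpret flow_setting D by (rule flow_setting.intro[OF assms(1)])
  have vf: "prob_space \<rho>" "sets \<rho> = sets (borel_of (path_topology D I))" "AE u in \<rho>. u \<in> U_sharp D \<nu> f I"
    "in_L_inf_loc I (\<lambda>t. \<integral>\<^sup>+u\<in>U_sharp D \<nu> f I. ennreal ((norm (u t))\<^sup>2) \<partial>\<rho>)"
    and init: "\<And>t\<^sub>0 \<psi> \<psi>'. left_endpoint I t\<^sub>0 \<Longrightarrow> energy_function \<psi> \<psi>' \<Longrightarrow>
        ((\<lambda>t. \<integral>\<^sup>+u\<in>U_sharp D \<nu> f I. ennreal (\<psi> ((norm (u t))\<^sup>2)) \<partial>\<rho>) \<longlongrightarrow>
           (\<integral>\<^sup>+u\<in>U_sharp D \<nu> f I. ennreal (\<psi> ((norm (u t\<^sub>0))\<^sup>2)) \<partial>\<rho>)) (at t\<^sub>0 within I) \<and>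
        (\<integral>\<^sup>+u\<in>U_sharp D \<nu> f I. ennreal (\<psi> ((norm (u t\<^sub>0))\<^sup>2)) \<partial>\<rho>) < \<infinity>"
    using assms(6) unfolding vishik_fursikov_measure_def by blast+
  interpret path_setting D I t\<^sub>0 \<rho>
    by (rule path_setting.intro[OF flow_setting_axioms path_setting_axioms.intro[OF assms(3,4) vf(2,1)]])
  obtain v C where v: "v \<in> lebesgue_on I \<rightarrow>\<^sub>M H_borel D" "AE t in lebesgue_on I. f t = v t" "AE t in lebesgue_on I. norm (v t) \<le> C"
    using assms(5) unfolding L_inf_def by blast
  \<comment> \<open>The maximum with 0 keeps the default value 0 of \<open>F\<close> within the
    bound even when \<open>I\<close> is a null set and \<open>C\<close> is negative.\<close>
  define Cf where "Cf = max C 0"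
  \<comment> \<open>The truncation alters \<open>v\<close> only on a null set of times in
    \<open>I\<close> and makes the bound hold at every real time, also outside
    \<open>I\<close>.\<close>
  define F where "F t = (if norm (v t) \<le> Cf \<and> t \<in> I then v t else 0)" for t
  have F_meas: "F \<in> lebesgue_on I \<rightarrow>\<^sub>M H_borel D"
  proof -
    have "(\<lambda>t. if norm (v t) \<le> Cf then v t else 0) \<in> lebesgue_on I \<rightarrow>\<^sub>M H_borel D"
    proof (rule measurable_If[OF v(1) measurable_const])
      show "0 \<in> space (H_borel D)" using zero_in_H by (simp add: space_H_borel)
      have [measurable]: "(\<lambda>t. norm (v t)) \<in> borel_measurable (lebesgue_on I)" by (rule measurable_compose[OF v(1) H_borel_norm])
      show "{t \<in> space (lebesgue_on I). norm (v t) \<le> Cf} \<in> sets (lebesgue_on I)" by measurable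
    qed
    also have "?this \<longleftrightarrow> F \<in> lebesgue_on I \<rightarrow>\<^sub>M H_borel D"
      by (rule measurable_cong) (simp add: F_def space_restrict_space)
    finally show ?thesis .
  qed
  have f_F: "AE t in lebesgue_on I. f t = F t"
  proof -
    have "AE t in lebesgue_on I. t \<in> I" using I_lebesgue by (simp add: AE_restrict_space_iff)
    with v(2,3) show ?thesis by eventually_elim (simp add: F_def Cf_def le_max_iff_disj)
  qed
  have F_bd: "norm (F t) \<le> Cf" for t by (simp add: F_def Cf_def)
  interpret ns_setting D I t\<^sub>0 \<rho> \<nu> f F Cf
    by (rule ns_setting.intro[OF path_setting_axioms ns_setting_axioms.intro[OF assms(2) F_meas f_F F_bd vf(3,4)]])
  have init': "((\<lambda>t. \<integral>\<^sup>+u. ennreal (\<psi> ((norm u)\<^sup>2)) \<partial>\<mu> t) \<longlongrightarrow> (\<integral>\<^sup>+u. ennreal (\<psi> ((norm u)\<^sup>2)) \<partial>\<mu> s)) (at s within I) \<and>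
        (\<integral>\<^sup>+u. ennreal (\<psi> ((norm u)\<^sup>2)) \<partial>\<mu> s) < \<infinity>"
    if s: "left_endpoint I s" and \<psi>: "energy_function \<psi> \<psi>'" for s \<psi> \<psi>'
  proof -
    have eq: "(\<integral>\<^sup>+u. ennreal (\<psi> ((norm u)\<^sup>2)) \<partial>\<mu> t) = (\<integral>\<^sup>+u. ennreal (\<psi> ((norm (u t))\<^sup>2)) \<partial>\<rho>)" if "t \<in> I" for t
      by (rule projection_nn_integral[OF that measurable_compose[OF energy_function_measurable[OF \<psi>] measurable_ennreal]])
    have sI: "s \<in> I" using s by (simp add: left_endpoint_def)
    have "((\<lambda>t. \<integral>\<^sup>+u. ennreal (\<psi> ((norm (u t))\<^sup>2)) \<partial>\<rho>) \<longlongrightarrow> (\<integral>\<^sup>+u. ennreal (\<psi> ((norm u)\<^sup>2)) \<partial>\<mu> s)) (at s within I)"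
      using init[OF s \<psi>] unfolding drop_US eq[OF sI] by blast
    then have "((\<lambda>t. \<integral>\<^sup>+u. ennreal (\<psi> ((norm u)\<^sup>2)) \<partial>\<mu> t) \<longlongrightarrow> (\<integral>\<^sup>+u. ennreal (\<psi> ((norm u)\<^sup>2)) \<partial>\<mu> s)) (at s within I)"
      by (rule Lim_transform_within[OF _ zero_less_one]) (simp add: eq)
    then show ?thesis using init[OF s \<psi>] unfolding drop_US eq[OF sI] by blast
  qed
  have "statistical_solution D \<nu> f I \<mu>"
    unfolding statistical_solution_def Let_def
  proof (intro conjI)
    show "\<forall>t\<in>I. prob_space (\<mu> t) \<and> sets (\<mu> t) = sets (H_borel D)" using projection_prob projection_sets by blast
    show "\<forall>\<Phi>::l2_field \<Rightarrow> real. continuous_on (H_space D) \<Phi> \<and> bounded (\<Phi> ` H_space D) \<longrightarrow>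
        (\<lambda>t. \<integral>u. \<Phi> u \<partial>\<mu> t) \<in> borel_measurable (lebesgue_on I)" using projection_expectation_measurable by blast
    show "in_L_inf_loc I (\<lambda>t. \<integral>\<^sup>+u. ennreal ((norm u)\<^sup>2) \<partial>\<mu> t)" by (rule projection_energy)
    show "in_L1_loc I (\<lambda>t. \<integral>\<^sup>+u. enstrophy D u \<partial>\<mu> t)" by (rule projection_enstrophy)
    show "\<forall>\<Phi> d\<Phi>. cylindrical D \<Phi> d\<Phi> \<longrightarrow> (\<forall>t'\<in>I. \<forall>t\<in>I.
        iterated_integrable \<mu> t' t (\<lambda>s u. indicator (V_space D) u * NS_rhs D \<nu> f s u (d\<Phi> u)) \<and>
        (\<integral>u. \<Phi> u \<partial>\<mu> t) = (\<integral>u. \<Phi> u \<partial>\<mu> t') +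
          iterated_integral \<mu> t' t (\<lambda>s u. indicator (V_space D) u * NS_rhs D \<nu> f s u (d\<Phi> u)))"
      using projection_cylindrical by blast
    show "\<exists>I'\<subseteq>I. I - I' \<in> null_sets lebesgue \<and>
        (\<forall>\<psi> \<psi>'. energy_function \<psi> \<psi>' \<longrightarrow> (\<forall>t'\<in>I'. \<forall>t\<in>I. t' \<le> t \<longrightarrow>
            integrable (\<mu> t) (\<lambda>u. \<psi> ((norm u)\<^sup>2)) \<and> integrable (\<mu> t') (\<lambda>u. \<psi> ((norm u)\<^sup>2)) \<and>
            iterated_integrable \<mu> t' t (\<lambda>s u. indicator (V_space D) u * (\<psi>' ((norm u)\<^sup>2) * (H1_norm D u)\<^sup>2)) \<and>
            iterated_integrable \<mu> t' t (\<lambda>s u. \<psi>' ((norm u)\<^sup>2) * (f s \<bullet> u)) \<and>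
            1/2 * (\<integral>u. \<psi> ((norm u)\<^sup>2) \<partial>\<mu> t) +
              \<nu> * iterated_integral \<mu> t' t (\<lambda>s u. indicator (V_space D) u * (\<psi>' ((norm u)\<^sup>2) * (H1_norm D u)\<^sup>2))
            \<le> 1/2 * (\<integral>u. \<psi> ((norm u)\<^sup>2) \<partial>\<mu> t') + iterated_integral \<mu> t' t (\<lambda>s u. \<psi>' ((norm u)\<^sup>2) * (f s \<bullet> u))))"
    proof (intro exI[of _ good_times] conjI allI impI ballI)
      show "good_times \<subseteq> I" by (auto simp: good_times_def)
    qed (use good_times_full projection_energy_inequality in blast)+
    show "\<forall>s. left_endpoint I s \<longrightarrow> (\<forall>\<psi> \<psi>'. energy_function \<psi> \<psi>' \<longrightarrow>
        ((\<lambda>t. \<integral>\<^sup>+u. ennreal (\<psi> ((norm u)\<^sup>2)) \<partial>\<mu> t) \<longlongrightarrow> (\<integral>\<^sup>+u. ennreal (\<psi> ((norm u)\<^sup>2)) \<partial>\<mu> s)) (at s within I) \<and>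
        (\<integral>\<^sup>+u. ennreal (\<psi> ((norm u)\<^sup>2)) \<partial>\<mu> s) < \<infinity>)"
      using init' by blast
  qed
  then show ?thesis by (simp add: statistical_solution_with_data_def)
qed

end
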